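(* Let $G_1,G_2$ be finitely presented groups, let $N_1\lhd G_1$ and $N_2\lhd G_2$ be normal subgroups with $G_1'\leq N_1$ and $G_2'\leq N_2$, and let $\mu:G_1/N_1\to G_2/N_2$ be an isomorphism. Then the fibre product $H_\mu\leq G_1\times G_2$ is finitely presented if and only if $$[\mu^*(\Sigma^1(G_2)^c\cap S(G_2,N_2))]\subseteq -\Sigma^1(G_1)\cap S(G_1,N_1).$$
   Context: $G'$ denotes the commutator subgroup of $G$. For an isomorphism $\mu:G_1/N_1\to G_2/N_2$, the fibre product is $H_\mu=\{(g_1,g_2)\in G_1\times G_2\mid \mu(g_1N_1)=g_2N_2\}$. A character of a group $G$ is a homomorphism $\chi:G\to\mathbb{R}$ to the additive group of reals. For a nonzero character $\chi$ put $[\chi]=\{t\chi\mid 0<t\in\mathbb{R}\}$, and let $S(G)=\{[\chi]\mid 0\neq\chi:G\to\mathbb{R}\}$ be the character sphere. For $N\leq G$, $S(G,N)=\{[\chi]\in S(G)\mid \chi|_N=0\}$. For a finitely generated group $G$, the Bieri-Neumann-Strebel invariant is $\Sigma^1(G)=\{[\chi]\in S(G)\mid G_\chi \text{ is of type } \mathrm{FP}_1\}$, where $G_\chi$ is the monoid $\{g\in G\mid\chi(g)\geq 0\}$ and type $\mathrm{FP}_1$ means that the trivial $\mathbb{Z}G_\chi$-module $\mathbb{Z}$ has a resolution by projective $\mathbb{Z}G_\chi$-modules which are finitely generated in degrees $0$ and $1$. For $\Sigma\subseteq S(G)$, $\Sigma^c=S(G)\setminus\Sigma$ and $-\Sigma=\{[-\chi]\mid[\chi]\in\Sigma\}$.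 The map $\mu^*:\operatorname{Hom}(G_2/N_2,\mathbb{R})\to\operatorname{Hom}(G_1/N_1,\mathbb{R})$, $\mu^*(\chi)=\chi\circ\mu$, is the dual of $\mu$. Characters of $G_i$ vanishing on $N_i$ are identified with characters of $G_i/N_i$, and for $\Omega\subseteq S(G_2,N_2)$, $[\mu^*(\Omega)]=\{[\mu^*(\chi)]\mid[\chi]\in\Omega\}\subseteq S(G_1,N_1)$. *)

theory Defs
  imports Complex_Main "HOL-Algebra.Generated_Groups" "HOL-Algebra.Module" "HOL-Library.Poly_Mapping"
begin

section \<open>Free groups and finite presentability\<close>

text \<open>Letters are pairs \<open>(x, b)\<close>, where \<open>(x, False)\<close> is the formal inverse of \<open>(x, True)\<close>.\<close>

inductive_set free_equiv :: "'x set \<Rightarrow> (('x \<times> bool) list \<times> ('x \<times> bool) list) set"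
  for X :: "'x set" where
  refl: "w \<in> lists (X \<times> UNIV) \<Longrightarrow> (w, w) \<in> free_equiv X"
| cancel: "\<lbrakk>u \<in> lists (X \<times> UNIV); v \<in> lists (X \<times> UNIV); x \<in> X\<rbrakk>
    \<Longrightarrow> (u @ [(x, b), (x, \<not> b)] @ v, u @ v) \<in> free_equiv X"
| sym: "(v, w) \<in> free_equiv X \<Longrightarrow> (w, v) \<in> free_equiv X"
| trans: "\<lbrakk>(u, v) \<in> free_equiv X; (v, w) \<in> free_equiv X\<rbrakk> \<Longrightarrow> (u, w) \<in> free_equiv X"

definition free_group :: "'x set \<Rightarrow> ('x \<times> bool) list set monoid" where
  "free_group X =
    \<lparr>carrier = lists (X \<times> UNIV) // free_equiv X,
     mult = (\<lambda>A B. \<Union>a\<in>A. \<Union>b\<in>B. free_equiv X `` {a @ b}),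
     one = free_equiv X `` {[]}\<rparr>"

definition normal_closure :: "('a, 'm) monoid_scheme \<Rightarrow> 'a set \<Rightarrow> 'a set" where
  "normal_closure G S = \<Inter> {N. N \<lhd> G \<and> S \<subseteq> N}"

definition finitely_presented :: "('a, 'm) monoid_scheme \<Rightarrow> bool" where
  "finitely_presented G \<longleftrightarrow>
    (\<exists>(X :: nat set) R. finite X \<and> finite R \<and> R \<subseteq> carrier (free_group X) \<and>
      G \<cong> free_group X Mod normal_closure (free_group X) R)"

lemma equiv_free_equiv: "equiv (lists (X \<times> UNIV)) (free_equiv X)"
proof (rule equivI)
  have *: "u \<in> lists (X \<times> UNIV) \<and> v \<in> lists (X \<times> UNIV)" if "(u, v) \<in> free_equiv X" for u v
    using that by induction auto
  show "free_equiv X \<subseteq> lists (X \<times> UNIV) \<times> lists (X \<times> UNIV)"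
    by (intro subrelI SigmaI) (use * in blast)+
  show "refl_on (lists (X \<times> UNIV)) (free_equiv X)"
    by (rule refl_onI) (rule free_equiv.refl)
  show "sym (free_equiv X)"
    by (rule symI) (rule free_equiv.sym)
  show "trans (free_equiv X)"
    by (rule transI) (rule free_equiv.trans)
qed

lemma free_equiv_append_left:
  assumes "(u, v) \<in> free_equiv X" "w \<in> lists (X \<times> UNIV)"
  shows "(w @ u, w @ v) \<in> free_equiv X"
  using assms
proof induction
  case (cancel u v x b)
  then show ?case
    using free_equiv.cancel[of "w @ u" X v x b] by auto
next
  case (refl u)
  then show ?case
    by (intro free_equiv.refl) auto
qed (blast intro: free_equiv.sym free_equiv.trans)+

lemma free_equiv_append_right:
  assumes "(u, v) \<in> free_equiv X" "w \<in> lists (X \<times> UNIV)"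
  shows "(u @ w, v @ w) \<in> free_equiv X"
  using assms
proof induction
  case (cancel u v x b)
  then show ?case
    using free_equiv.cancel[of u X "v @ w" x b] by auto
next
  case (refl u)
  then show ?case
    by (intro free_equiv.refl) auto
qed (blast intro: free_equiv.sym free_equiv.trans)+

lemma free_group_mult:
  assumes "u \<in> lists (X \<times> UNIV)" "v \<in> lists (X \<times> UNIV)"
  shows "free_equiv X `` {u} \<otimes>\<^bsub>free_group X\<^esub> free_equiv X `` {v} = free_equiv X `` {u @ v}"
proof -
  have "congruent2 (free_equiv X) (free_equiv X) (\<lambda>a b. free_equiv X `` {a @ b})"
  proof (rule congruent2I[OF equiv_free_equiv equiv_free_equiv])
    fix y z w :: "('a \<times> bool) list" assume "(y, z) \<in> free_equiv X" "w \<in> lists (X \<times> UNIV)"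
    then show "free_equiv X `` {y @ w} = free_equiv X `` {z @ w}"
      by (intro equiv_class_eq[OF equiv_free_equiv] free_equiv_append_right)
  next
    fix y z w :: "('a \<times> bool) list" assume "(y, z) \<in> free_equiv X" "w \<in> lists (X \<times> UNIV)"
    then show "free_equiv X `` {w @ y} = free_equiv X `` {w @ z}"
      by (intro equiv_class_eq[OF equiv_free_equiv] free_equiv_append_left)
  qed
  from UN_equiv_class2[OF equiv_free_equiv equiv_free_equiv this] assms show ?thesis
    by (simp add: free_group_def)
qed

lemma free_equiv_inverse:
  assumes "w \<in> lists (X \<times> UNIV)"
  shows "(rev (map (apsnd Not) w) @ w, []) \<in> free_equiv X"
  using assms
proof (induction w)
  case Nil
  then show ?case by (auto intro: free_equiv.refl)
next
  case (Cons a w)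
  obtain x b where a: "a = (x, b)" by (cases a)
  have r: "rev (map (apsnd Not) w) \<in> lists (X \<times> UNIV)"
    using Cons by (auto simp: in_lists_conv_set)
  have "(rev (map (apsnd Not) w) @ [(x, \<not> b), (x, \<not> \<not> b)] @ w, rev (map (apsnd Not) w) @ w) \<in> free_equiv X"
    using Cons a r by (intro free_equiv.cancel) auto
  then show ?case
    using Cons a by (auto intro: free_equiv.trans)
qed

lemma group_free_group: "group (free_group X)"
proof (rule groupI)
  note q = quotientE[where A = "lists (X \<times> UNIV)" and r = "free_equiv X"]
  have car: "carrier (free_group X) = lists (X \<times> UNIV) // free_equiv X"
    and one: "\<one>\<^bsub>free_group X\<^esub> = free_equiv X `` {[]}"
    by (auto simp: free_group_def)
  show "\<one>\<^bsub>free_group X\<^esub> \<in> carrier (free_group X)"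
    by (auto simp: car one intro: quotientI)
  fix A assume "A \<in> carrier (free_group X)"
  then obtain u where u: "u \<in> lists (X \<times> UNIV)" "A = free_equiv X `` {u}"
    unfolding car by (elim q)
  show "\<one>\<^bsub>free_group X\<^esub> \<otimes>\<^bsub>free_group X\<^esub> A = A"
    using u free_group_mult[of "[]" X u] by (simp add: one)
  let ?v = "rev (map (apsnd Not) u)"
  have v: "?v \<in> lists (X \<times> UNIV)"
    using u by (auto simp: in_lists_conv_set)
  have "free_equiv X `` {?v} \<otimes>\<^bsub>free_group X\<^esub> A = \<one>\<^bsub>free_group X\<^esub>"
    using free_group_mult[OF v u(1)] equiv_class_eq[OF equiv_free_equiv free_equiv_inverse[OF u(1)]]
    by (simp add: one u)
  then show "\<exists>B\<in>carrier (free_group X). B \<otimes>\<^bsub>free_group X\<^esub> A = \<one>\<^bsub>free_group X\<^esub>"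
    using v quotientI[OF v, of "free_equiv X"] by (auto simp: car)
  fix B assume "B \<in> carrier (free_group X)"
  then obtain v where v: "v \<in> lists (X \<times> UNIV)" "B = free_equiv X `` {v}"
    unfolding car by (elim q)
  show "A \<otimes>\<^bsub>free_group X\<^esub> B \<in> carrier (free_group X)"
    using u v by (auto simp: free_group_mult car intro!: quotientI)
  fix C assume "C \<in> carrier (free_group X)"
  then obtain w where w: "w \<in> lists (X \<times> UNIV)" "C = free_equiv X `` {w}"
    unfolding car by (elim q)
  have "u @ v \<in> lists (X \<times> UNIV)" "v @ w \<in> lists (X \<times> UNIV)"
    using u v w by auto
  then show "A \<otimes>\<^bsub>free_group X\<^esub> B \<otimes>\<^bsub>free_group X\<^esub> C = A \<otimes>\<^bsub>free_group X\<^esub> (B \<otimes>\<^bsub>free_group X\<^esub> C)"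
    using u v w by (simp add: free_group_mult)
qed


section \<open>Modules over a ring that need not be commutative\<close>

locale left_module = R?: ring R + M?: abelian_group M
  for R (structure) and M (structure) +
  assumes smult_closed [simp, intro]:
      "\<lbrakk>a \<in> carrier R; x \<in> carrier M\<rbrakk> \<Longrightarrow> a \<odot>\<^bsub>M\<^esub> x \<in> carrier M"
    and smult_l_distr:
      "\<lbrakk>a \<in> carrier R; b \<in> carrier R; x \<in> carrier M\<rbrakk> \<Longrightarrow>
      (a \<oplus> b) \<odot>\<^bsub>M\<^esub> x = a \<odot>\<^bsub>M\<^esub> x \<oplus>\<^bsub>M\<^esub> b \<odot>\<^bsub>M\<^esub> x"
    and smult_r_distr:
      "\<lbrakk>a \<in> carrier R; x \<in> carrier M; y \<in> carrier M\<rbrakk> \<Longrightarrow>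
      a \<odot>\<^bsub>M\<^esub> (x \<oplus>\<^bsub>M\<^esub> y) = a \<odot>\<^bsub>M\<^esub> x \<oplus>\<^bsub>M\<^esub> a \<odot>\<^bsub>M\<^esub> y"
    and smult_assoc1:
      "\<lbrakk>a \<in> carrier R; b \<in> carrier R; x \<in> carrier M\<rbrakk> \<Longrightarrow>
      (a \<otimes> b) \<odot>\<^bsub>M\<^esub> x = a \<odot>\<^bsub>M\<^esub> (b \<odot>\<^bsub>M\<^esub> x)"
    and smult_one [simp]:
      "x \<in> carrier M \<Longrightarrow> \<one> \<odot>\<^bsub>M\<^esub> x = x"

definition left_module_hom ::
  "('r, 'k) ring_scheme \<Rightarrow> ('r, 'a, 'm) module_scheme \<Rightarrow> ('r, 'b, 'n) module_scheme \<Rightarrow> ('a \<Rightarrow> 'b) set" where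
  "left_module_hom R M N = {f. f \<in> carrier M \<rightarrow> carrier N \<and>
    (\<forall>x\<in>carrier M. \<forall>y\<in>carrier M. f (x \<oplus>\<^bsub>M\<^esub> y) = f x \<oplus>\<^bsub>N\<^esub> f y) \<and>
    (\<forall>a\<in>carrier R. \<forall>x\<in>carrier M. f (a \<odot>\<^bsub>M\<^esub> x) = a \<odot>\<^bsub>N\<^esub> f x)}"

definition module_kernel ::
  "('r, 'a, 'm) module_scheme \<Rightarrow> ('r, 'b, 'n) module_scheme \<Rightarrow> ('a \<Rightarrow> 'b) \<Rightarrow> 'a set" where
  "module_kernel M N f = {x \<in> carrier M. f x = \<zero>\<^bsub>N\<^esub>}"

definition finitely_generated_module ::
  "('r, 'k) ring_scheme \<Rightarrow> ('r, 'a, 'm) module_scheme \<Rightarrow> bool" where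
  "finitely_generated_module R M \<longleftrightarrow>
    (\<exists>S \<subseteq> carrier M. finite S \<and>
      (\<forall>x\<in>carrier M. \<exists>c \<in> S \<rightarrow> carrier R. x = (\<Oplus>\<^bsub>M\<^esub>s\<in>S. c s \<odot>\<^bsub>M\<^esub> s)))"

text \<open>
  The lifting property.  A definition cannot quantify over types, so the test modules
  \<open>M \<rightarrow> N\<close> live on fixed types.  These are large enough: the free module on the elements
  of \<open>P\<close> lives on \<open>'p \<Rightarrow> 'r\<close>, and lemma \<open>projective_module_lift\<close> below derives the lifting
  property for test modules on arbitrary types.
\<close>

definition projective_module :: "('r, 'k) ring_scheme \<Rightarrow> ('r, 'p, 'm) module_scheme \<Rightarrow> bool" where
  "projective_module R P \<longleftrightarrow> left_module R P \<and>
    (\<forall>(M :: ('r, 'p \<Rightarrow> 'r) module) (N :: ('r, 'p) module) f g.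
      left_module R M \<and> left_module R N \<and>
      f \<in> left_module_hom R M N \<and> f ` carrier M = carrier N \<and> g \<in> left_module_hom R P N \<longrightarrow>
      (\<exists>h \<in> left_module_hom R P M. \<forall>x\<in>carrier P. f (h x) = g x))"

context left_module
begin

lemma smult_r_null [simp]: "a \<in> carrier R \<Longrightarrow> a \<odot>\<^bsub>M\<^esub> \<zero>\<^bsub>M\<^esub> = \<zero>\<^bsub>M\<^esub>"
  using smult_r_distr[of a "\<zero>\<^bsub>M\<^esub>" "\<zero>\<^bsub>M\<^esub>"] by simp

lemma smult_l_null [simp]: "x \<in> carrier M \<Longrightarrow> \<zero> \<odot>\<^bsub>M\<^esub> x = \<zero>\<^bsub>M\<^esub>"
  using smult_l_distr[of \<zero> \<zero> x] by simp

lemma smult_finsum: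
  assumes "a \<in> carrier R" "f \<in> A \<rightarrow> carrier M"
  shows "a \<odot>\<^bsub>M\<^esub> (\<Oplus>\<^bsub>M\<^esub>x\<in>A. f x) = (\<Oplus>\<^bsub>M\<^esub>x\<in>A. a \<odot>\<^bsub>M\<^esub> f x)"
  using assms(2)
proof (induction A rule: infinite_finite_induct)
  case (insert x A)
  then have "f \<in> A \<rightarrow> carrier M" "f x \<in> carrier M"
    by auto
  moreover from this have "(\<lambda>x. a \<odot>\<^bsub>M\<^esub> f x) \<in> A \<rightarrow> carrier M"
    using assms(1) by auto
  ultimately show ?case
    using insert assms(1) by (simp add: smult_r_distr)
qed (use assms(1) in simp_all)

end

definition free_module :: "('r, 'k) ring_scheme \<Rightarrow> 'x set \<Rightarrow> ('r, 'x \<Rightarrow> 'r) module" where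
  "free_module R S =
    \<lparr>carrier = {c. (\<forall>x. c x \<in> carrier R) \<and> finite {x. c x \<noteq> \<zero>\<^bsub>R\<^esub>} \<and> {x. c x \<noteq> \<zero>\<^bsub>R\<^esub>} \<subseteq> S},
     mult = (\<lambda>c d x. \<zero>\<^bsub>R\<^esub>), one = (\<lambda>x. \<zero>\<^bsub>R\<^esub>),
     zero = (\<lambda>x. \<zero>\<^bsub>R\<^esub>), add = (\<lambda>c d x. c x \<oplus>\<^bsub>R\<^esub> d x), smult = (\<lambda>a c x. a \<otimes>\<^bsub>R\<^esub> c x)\<rparr>"

lemma left_module_free_module:
  assumes "ring R"
  shows "left_module R (free_module R S)"
proof -
  interpret R: ring R by fact
  show ?thesis
  proof (intro left_module.intro left_module_axioms.intro abelian_groupI \<open>ring R\<close>)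
    fix c d assume c: "c \<in> carrier (free_module R S)" and d: "d \<in> carrier (free_module R S)"
    have "{x. c x \<oplus>\<^bsub>R\<^esub> d x \<noteq> \<zero>\<^bsub>R\<^esub>} \<subseteq> {x. c x \<noteq> \<zero>\<^bsub>R\<^esub>} \<union> {x. d x \<noteq> \<zero>\<^bsub>R\<^esub>}"
      by auto
    then show "c \<oplus>\<^bsub>free_module R S\<^esub> d \<in> carrier (free_module R S)"
      using c d finite_subset[of "{x. c x \<oplus>\<^bsub>R\<^esub> d x \<noteq> \<zero>\<^bsub>R\<^esub>}" "{x. c x \<noteq> \<zero>\<^bsub>R\<^esub>} \<union> {x. d x \<noteq> \<zero>\<^bsub>R\<^esub>}"]
      by (auto simp: free_module_def)
  next
    fix c assume c: "c \<in> carrier (free_module R S)"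
    have "{x. \<ominus>\<^bsub>R\<^esub> c x \<noteq> \<zero>\<^bsub>R\<^esub>} \<subseteq> {x. c x \<noteq> \<zero>\<^bsub>R\<^esub>}"
      by auto
    then show "\<exists>d\<in>carrier (free_module R S). d \<oplus>\<^bsub>free_module R S\<^esub> c = \<zero>\<^bsub>free_module R S\<^esub>"
      using c finite_subset[of "{x. \<ominus>\<^bsub>R\<^esub> c x \<noteq> \<zero>\<^bsub>R\<^esub>}" "{x. c x \<noteq> \<zero>\<^bsub>R\<^esub>}"]
      by (intro bexI[of _ "\<lambda>x. \<ominus>\<^bsub>R\<^esub> c x"]) (auto simp: free_module_def R.l_neg)
  next
    fix a c assume a: "a \<in> carrier R" and c: "c \<in> carrier (free_module R S)"
    have "{x. a \<otimes>\<^bsub>R\<^esub> c x \<noteq> \<zero>\<^bsub>R\<^esub>} \<subseteq> {x. c x \<noteq> \<zero>\<^bsub>R\<^esub>}"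
      using a by auto
    then show "a \<odot>\<^bsub>free_module R S\<^esub> c \<in> carrier (free_module R S)"
      using a c finite_subset[of "{x. a \<otimes>\<^bsub>R\<^esub> c x \<noteq> \<zero>\<^bsub>R\<^esub>}" "{x. c x \<noteq> \<zero>\<^bsub>R\<^esub>}"]
      by (auto simp: free_module_def)
  qed (auto simp: free_module_def R.l_distr R.r_distr R.m_assoc R.a_assoc intro: R.a_comm)
qed

definition linear_combination ::
  "('r, 'k) ring_scheme \<Rightarrow> ('r, 'a, 'm) module_scheme \<Rightarrow> ('x \<Rightarrow> 'a) \<Rightarrow> ('x \<Rightarrow> 'r) \<Rightarrow> 'a" where
  "linear_combination R M m c = (\<Oplus>\<^bsub>M\<^esub>x\<in>{x. c x \<noteq> \<zero>\<^bsub>R\<^esub>}. c x \<odot>\<^bsub>M\<^esub> m x)"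

lemma (in left_module) linear_combination_superset:
  assumes "c \<in> carrier (free_module R S)" "m \<in> S \<rightarrow> carrier M"
    and "finite A" "{x. c x \<noteq> \<zero>} \<subseteq> A" "A \<subseteq> S"
  shows "linear_combination R M m c = (\<Oplus>\<^bsub>M\<^esub>x\<in>A. c x \<odot>\<^bsub>M\<^esub> m x)"
  unfolding linear_combination_def
proof (rule M.add.finprod_mono_neutral_cong_left)
  show "c x \<odot>\<^bsub>M\<^esub> m x = \<zero>\<^bsub>M\<^esub>" if "x \<in> A - {x. c x \<noteq> \<zero>}" for x
  proof -
    have "c x = \<zero>" "m x \<in> carrier M"
      using that assms by auto
    then show ?thesis
      by simp
  qed
  show "(\<lambda>x. c x \<odot>\<^bsub>M\<^esub> m x) \<in> A \<rightarrow> carrier M"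
    using assms by (auto simp: free_module_def Pi_iff subset_iff)
qed (use assms in auto)

lemma (in left_module) linear_combination_hom:
  assumes m: "m \<in> S \<rightarrow> carrier M"
  shows "linear_combination R M m \<in> left_module_hom R (free_module R S) M"
proof -
  interpret F: left_module R "free_module R S"
    by (rule left_module_free_module) (rule R.ring_axioms)
  have in_M: "(\<lambda>x. c x \<odot>\<^bsub>M\<^esub> m x) \<in> A \<rightarrow> carrier M"
    if "c \<in> carrier (free_module R S)" "A \<subseteq> S" for c A
    using that m by (auto simp: free_module_def)
  note supset = linear_combination_superset[OF _ m]
  show ?thesis
    unfolding left_module_hom_def
  proof (intro CollectI conjI ballI funcsetI)
    fix c assume c: "c \<in> carrier (free_module R S)"
    then show "linear_combination R M m c \<in> carrier M"
      unfolding linear_combination_def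
      by (intro M.finsum_closed in_M) (auto simp: free_module_def)
    fix a assume a: "a \<in> carrier R"
    let ?A = "{x. c x \<noteq> \<zero>}"
    have A: "finite ?A" "?A \<subseteq> S"
      using c by (auto simp: free_module_def)
    have *: "linear_combination R M m (a \<odot>\<^bsub>free_module R S\<^esub> c) =
        (\<Oplus>\<^bsub>M\<^esub>x\<in>?A. (a \<odot>\<^bsub>free_module R S\<^esub> c) x \<odot>\<^bsub>M\<^esub> m x)"
      using F.smult_closed[OF a c] A a by (intro supset) (auto simp: free_module_def)
    also have "\<dots> = (\<Oplus>\<^bsub>M\<^esub>x\<in>?A. a \<odot>\<^bsub>M\<^esub> (c x \<odot>\<^bsub>M\<^esub> m x))"
      using a c A m by (intro M.finsum_cong') (auto simp: free_module_def smult_assoc1 Pi_iff)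
    also have "\<dots> = a \<odot>\<^bsub>M\<^esub> linear_combination R M m c"
      using smult_finsum[OF a in_M[OF c A(2)]] by (simp add: linear_combination_def)
    finally show "linear_combination R M m (a \<odot>\<^bsub>free_module R S\<^esub> c) = a \<odot>\<^bsub>M\<^esub> linear_combination R M m c" .
  next
    fix c d assume c: "c \<in> carrier (free_module R S)" and d: "d \<in> carrier (free_module R S)"
    let ?A = "{x. c x \<noteq> \<zero>} \<union> {x. d x \<noteq> \<zero>}"
    have A: "finite ?A" "?A \<subseteq> S"
      using c d by (auto simp: free_module_def)
    have "linear_combination R M m (c \<oplus>\<^bsub>free_module R S\<^esub> d) =
        (\<Oplus>\<^bsub>M\<^esub>x\<in>?A. (c \<oplus>\<^bsub>free_module R S\<^esub> d) x \<odot>\<^bsub>M\<^esub> m x)"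
    proof (rule supset[OF F.M.a_closed[OF c d] A(1) _ A(2)])
      show "{x. (c \<oplus>\<^bsub>free_module R S\<^esub> d) x \<noteq> \<zero>} \<subseteq> ?A"
        by (auto simp: free_module_def)
    qed
    also have "\<dots> = (\<Oplus>\<^bsub>M\<^esub>x\<in>?A. c x \<odot>\<^bsub>M\<^esub> m x \<oplus>\<^bsub>M\<^esub> d x \<odot>\<^bsub>M\<^esub> m x)"
      using c d A m
      by (intro M.finsum_cong') (auto simp: free_module_def smult_l_distr Pi_iff subset_iff)
    also have "\<dots> = (\<Oplus>\<^bsub>M\<^esub>x\<in>?A. c x \<odot>\<^bsub>M\<^esub> m x) \<oplus>\<^bsub>M\<^esub> (\<Oplus>\<^bsub>M\<^esub>x\<in>?A. d x \<odot>\<^bsub>M\<^esub> m x)"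
      using in_M[OF c A(2)] in_M[OF d A(2)] by (rule M.finsum_addf)
    also have "\<dots> = linear_combination R M m c \<oplus>\<^bsub>M\<^esub> linear_combination R M m d"
      using c d A by (simp add: supset[OF c A(1) _ A(2)] supset[OF d A(1) _ A(2)])
    finally show "linear_combination R M m (c \<oplus>\<^bsub>free_module R S\<^esub> d) =
      linear_combination R M m c \<oplus>\<^bsub>M\<^esub> linear_combination R M m d" .
  qed
qed

lemma left_module_hom_comp:
  "\<lbrakk>f \<in> left_module_hom R L M; g \<in> left_module_hom R M N\<rbrakk> \<Longrightarrow> g \<circ> f \<in> left_module_hom R L N"
  by (auto simp: left_module_hom_def Pi_iff)

lemma left_module_hom_finsum:
  assumes "left_module R M" "left_module R N" "f \<in> left_module_hom R M N" "h \<in> A \<rightarrow> carrier M"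
  shows "f (\<Oplus>\<^bsub>M\<^esub>x\<in>A. h x) = (\<Oplus>\<^bsub>N\<^esub>x\<in>A. f (h x))"
proof -
  interpret M: left_module R M by fact
  interpret N: left_module R N by fact
  have zero: "f \<zero>\<^bsub>M\<^esub> = \<zero>\<^bsub>N\<^esub>"
  proof -
    have "f (\<zero>\<^bsub>M\<^esub> \<oplus>\<^bsub>M\<^esub> \<zero>\<^bsub>M\<^esub>) = f \<zero>\<^bsub>M\<^esub> \<oplus>\<^bsub>N\<^esub> f \<zero>\<^bsub>M\<^esub>" "f \<zero>\<^bsub>M\<^esub> \<in> carrier N"
      using assms(3) by (auto simp: left_module_hom_def simp del: M.M.l_zero M.M.r_zero)
    then show ?thesis by simp
  qed
  from assms(4) show ?thesis
  proof (induction A rule: infinite_finite_induct)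
    case (insert x A)
    then have "h \<in> A \<rightarrow> carrier M" "h x \<in> carrier M"
      by auto
    moreover from this have "(\<lambda>x. f (h x)) \<in> A \<rightarrow> carrier N" "f (h x) \<in> carrier N"
      using assms(3) by (auto simp: left_module_hom_def)
    ultimately show ?case
      using insert assms(3) by (simp add: left_module_hom_def)
  qed (simp_all add: zero)
qed

lemma projective_module_lift:
  fixes P :: "('r, 'p) module" and R :: "('r, 'k) ring_scheme"
    and M :: "('r, 'm, 'q) module_scheme" and N :: "('r, 'n, 's) module_scheme"
  assumes proj: "projective_module R P" and M: "left_module R M" and N: "left_module R N"
    and f: "f \<in> left_module_hom R M N" "f ` carrier M = carrier N"
    and g: "g \<in> left_module_hom R P N"
  shows "\<exists>h \<in> left_module_hom R P M. \<forall>x\<in>carrier P. f (h x) = g x"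
proof -
  from proj have P: "left_module R P"
    by (simp add: projective_module_def)
  interpret P: left_module R P by fact
  interpret M: left_module R M by fact
  interpret N: left_module R N by fact
  let ?S = "carrier P"
  let ?F = "free_module R ?S"
  have F: "left_module R ?F"
    by (rule left_module_free_module) (rule P.R.ring_axioms)
  let ?p = "linear_combination R P id"
  have p: "?p \<in> left_module_hom R ?F P"
    by (rule P.linear_combination_hom) auto
  have "?p ` carrier ?F = carrier P"
  proof
    show "?p ` carrier ?F \<subseteq> carrier P"
      using p by (auto simp: left_module_hom_def)
    show "carrier P \<subseteq> ?p ` carrier ?F"
    proof
      fix x assume x: "x \<in> carrier P"
      let ?c = "\<lambda>y. if y = x then \<one>\<^bsub>R\<^esub> else \<zero>\<^bsub>R\<^esub>"
      have supp: "{y. ?c y \<noteq> \<zero>\<^bsub>R\<^esub>} \<subseteq> {x}"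
        by auto
      then have c: "?c \<in> carrier ?F"
        using x finite_subset[OF supp] by (auto simp: free_module_def)
      have "?p ?c = (\<Oplus>\<^bsub>P\<^esub>y\<in>{x}. ?c y \<odot>\<^bsub>P\<^esub> id y)"
        using c x by (intro P.linear_combination_superset) auto
      also have "\<dots> = x"
        using x by simp
      finally show "x \<in> ?p ` carrier ?F"
        using c by (metis imageI)
    qed
  qed
  moreover have "id \<in> left_module_hom R P P"
    by (auto simp: left_module_hom_def)
  ultimately obtain s where s: "s \<in> left_module_hom R P ?F" "\<And>x. x \<in> carrier P \<Longrightarrow> ?p (s x) = x"
    using proj F P p unfolding projective_module_def by (metis id_apply)
  have "\<forall>x\<in>carrier P. \<exists>y\<in>carrier M. f y = g x"
    using f(2) g by (auto simp: left_module_hom_def Pi_iff image_iff set_eq_iff) metis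
  then obtain m where m: "\<And>x. x \<in> carrier P \<Longrightarrow> m x \<in> carrier M \<and> f (m x) = g x"
    by metis
  let ?q = "linear_combination R M m"
  have q: "?q \<in> left_module_hom R ?F M"
    using m by (intro M.linear_combination_hom) auto
  have eq: "f (?q c) = g (?p c)" if c: "c \<in> carrier ?F" for c
  proof -
    let ?A = "{x. c x \<noteq> \<zero>\<^bsub>R\<^esub>}"
    have A: "?A \<subseteq> carrier P" "\<And>x. c x \<in> carrier R"
      using c by (auto simp: free_module_def)
    have "f (?q c) = (\<Oplus>\<^bsub>N\<^esub>x\<in>?A. f (c x \<odot>\<^bsub>M\<^esub> m x))"
      unfolding linear_combination_def using A m
      by (intro left_module_hom_finsum[OF M N f(1)]) auto
    also have "\<dots> = (\<Oplus>\<^bsub>N\<^esub>x\<in>?A. g (c x \<odot>\<^bsub>P\<^esub> id x))"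
      using A m f(1) g
      by (intro N.M.finsum_cong') (auto simp: left_module_hom_def Pi_iff subset_iff)
    also have "\<dots> = g (?p c)"
      unfolding linear_combination_def using A
      by (intro left_module_hom_finsum[OF P N g, symmetric]) auto
    finally show ?thesis .
  qed
  show ?thesis
  proof (intro bexI ballI)
    show "?q \<circ> s \<in> left_module_hom R P M"
      by (rule left_module_hom_comp[OF s(1) q])
    show "f ((?q \<circ> s) x) = g x" if "x \<in> carrier P" for x
      using that s eq[of "s x"] by (auto simp: left_module_hom_def Pi_iff)
  qed
qed

definition projective_resolution ::
  "('r, 'k) ring_scheme \<Rightarrow> ('r, 'a, 'm) module_scheme \<Rightarrow>
    (nat \<Rightarrow> ('r, 'p) module) \<Rightarrow> (nat \<Rightarrow> 'p \<Rightarrow> 'p) \<Rightarrow> ('p \<Rightarrow> 'a) \<Rightarrow> bool" where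
  "projective_resolution R A P d \<epsilon> \<longleftrightarrow>
    (\<forall>i. projective_module R (P i)) \<and>
    \<epsilon> \<in> left_module_hom R (P 0) A \<and>
    (\<forall>i. d i \<in> left_module_hom R (P (Suc i)) (P i)) \<and>
    \<epsilon> ` carrier (P 0) = carrier A \<and>
    d 0 ` carrier (P 1) = module_kernel (P 0) A \<epsilon> \<and>
    (\<forall>i. d (Suc i) ` carrier (P (Suc (Suc i))) = module_kernel (P (Suc i)) (P i) (d i))"

text \<open>
  The terms of the resolution live on the type \<open>nat \<Rightarrow> 'r\<close>.  This is no restriction for the
  existence of a resolution with \<open>P 0, \<dots>, P n\<close> finitely generated: up to isomorphism
  these are direct summands of free modules of finite rank, hence submodules of such,
  and the later terms can be chosen free on the elements of the preceding kernel,
  hence of cardinality at most that of \<open>nat \<Rightarrow> 'r\<close>.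
\<close>

definition FP_type ::
  "nat \<Rightarrow> ('r, 'k) ring_scheme \<Rightarrow> ('r, 'a, 'm) module_scheme \<Rightarrow> bool" where
  "FP_type n R A \<longleftrightarrow>
    (\<exists>(P :: nat \<Rightarrow> ('r, nat \<Rightarrow> 'r) module) d \<epsilon>.
      projective_resolution R A P d \<epsilon> \<and> (\<forall>i\<le>n. finitely_generated_module R (P i)))"


section \<open>Monoid rings and the trivial module\<close>

definition monoid_ring :: "('g, 'm) monoid_scheme \<Rightarrow> ('g \<Rightarrow>\<^sub>0 int) ring" where
  "monoid_ring M =
    \<lparr>carrier = {c. Poly_Mapping.keys c \<subseteq> carrier M},
     mult = (\<lambda>c d. frag_extend (\<lambda>a. frag_extend (\<lambda>b. frag_of (a \<otimes>\<^bsub>M\<^esub> b)) d) c),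
     one = frag_of \<one>\<^bsub>M\<^esub>,
     zero = 0,
     add = (+)\<rparr>"

lemma monoid_ring_mult_diff:
  "(c - d) \<otimes>\<^bsub>monoid_ring M\<^esub> e = c \<otimes>\<^bsub>monoid_ring M\<^esub> e - d \<otimes>\<^bsub>monoid_ring M\<^esub> e"
  "e \<otimes>\<^bsub>monoid_ring M\<^esub> (c - d) = e \<otimes>\<^bsub>monoid_ring M\<^esub> c - e \<otimes>\<^bsub>monoid_ring M\<^esub> d"
proof -
  have "frag_cmul k (a - b) = frag_cmul k a - frag_cmul k b" for k and a b :: "'a \<Rightarrow>\<^sub>0 int"
    by (metis (no_types) add_diff_cancel diff_add_cancel frag_cmul_distrib2)
  then show "e \<otimes>\<^bsub>monoid_ring M\<^esub> (c - d) = e \<otimes>\<^bsub>monoid_ring M\<^esub> c - e \<otimes>\<^bsub>monoid_ring M\<^esub> d"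
    by (simp add: monoid_ring_def frag_extend_diff frag_extend_def[of _ e] sum_subtractf)
qed (simp add: monoid_ring_def frag_extend_diff)

lemma monoid_ring_mult_of [simp]:
  "frag_of a \<otimes>\<^bsub>monoid_ring M\<^esub> frag_of b = frag_of (a \<otimes>\<^bsub>M\<^esub> b)"
  by (simp add: monoid_ring_def)

lemma monoid_ring_mult_zero [simp]:
  "0 \<otimes>\<^bsub>monoid_ring M\<^esub> c = 0" "c \<otimes>\<^bsub>monoid_ring M\<^esub> 0 = 0"
  using monoid_ring_mult_diff(1)[of M 0 0 c] monoid_ring_mult_diff(2)[of M c 0 0] by simp_all

lemma ring_monoid_ring:
  fixes M :: "('g, 'm) monoid_scheme" (structure)
  assumes "monoid M"
  shows "ring (monoid_ring M)"
proof -
  interpret monoid M by fact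
  let ?R = "monoid_ring M"
  have car: "carrier ?R = {c. Poly_Mapping.keys c \<subseteq> carrier M}"
    and add: "\<And>c d. c \<oplus>\<^bsub>?R\<^esub> d = c + d" and zero: "\<zero>\<^bsub>?R\<^esub> = 0"
    and one: "\<one>\<^bsub>?R\<^esub> = frag_of \<one>"
    by (simp_all add: monoid_ring_def)
  have mult_add:
    "(c + d) \<otimes>\<^bsub>?R\<^esub> e = c \<otimes>\<^bsub>?R\<^esub> e + d \<otimes>\<^bsub>?R\<^esub> e"
    "e \<otimes>\<^bsub>?R\<^esub> (c + d) = e \<otimes>\<^bsub>?R\<^esub> c + e \<otimes>\<^bsub>?R\<^esub> d" for c d e
    using monoid_ring_mult_diff(1)[of M "c + d" d e] monoid_ring_mult_diff(2)[of M e "c + d" d]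
    by simp_all
  show ?thesis
  proof (rule ringI)
    show "abelian_group ?R"
    proof (rule abelian_groupI)
      fix c d assume "c \<in> carrier ?R" "d \<in> carrier ?R"
      then show "c \<oplus>\<^bsub>?R\<^esub> d \<in> carrier ?R"
        using Poly_Mapping.keys_add[of c d] by (auto simp: car add)
    next
      fix c assume "c \<in> carrier ?R"
      then show "\<exists>d\<in>carrier ?R. d \<oplus>\<^bsub>?R\<^esub> c = \<zero>\<^bsub>?R\<^esub>"
        by (intro bexI[of _ "- c"]) (auto simp: car add zero)
    qed (auto simp: car add zero ac_simps)
    show "Group.monoid ?R"
    proof (rule monoidI)
      fix c d assume "c \<in> carrier ?R" "d \<in> carrier ?R"
      then show "c \<otimes>\<^bsub>?R\<^esub> d \<in> carrier ?R"
        using keys_frag_extend[of "\<lambda>a. frag_extend (\<lambda>b. frag_of (a \<otimes> b)) d" c]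
          keys_frag_extend[of "\<lambda>b. frag_of (_ \<otimes> b)" d]
        by (fastforce simp: monoid_ring_def subset_iff)
    next
      fix c d e assume "c \<in> carrier ?R" "d \<in> carrier ?R" "e \<in> carrier ?R"
      then have c: "Poly_Mapping.keys c \<subseteq> carrier M"
        and d: "Poly_Mapping.keys d \<subseteq> carrier M" and e: "Poly_Mapping.keys e \<subseteq> carrier M"
        by (auto simp: car)
      from c show "c \<otimes>\<^bsub>?R\<^esub> d \<otimes>\<^bsub>?R\<^esub> e = c \<otimes>\<^bsub>?R\<^esub> (d \<otimes>\<^bsub>?R\<^esub> e)"
      proof (induction c rule: frag_induction)
        case (one x)
        from d show ?case
        proof (induction d rule: frag_induction)
          case (one y)
          from e show ?case
            by (induction e rule: frag_induction)
              (use one \<open>x \<in> carrier M\<close> in \<open>simp_all add: monoid_ring_mult_diff m_assoc\<close>)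
        qed (simp_all add: monoid_ring_mult_diff)
      qed (simp_all add: monoid_ring_mult_diff)
    next
      fix c assume "c \<in> carrier ?R"
      then have c: "Poly_Mapping.keys c \<subseteq> carrier M"
        by (simp add: car)
      then show "\<one>\<^bsub>?R\<^esub> \<otimes>\<^bsub>?R\<^esub> c = c"
        by (induction c rule: frag_induction) (simp_all add: one monoid_ring_mult_diff)
      from c show "c \<otimes>\<^bsub>?R\<^esub> \<one>\<^bsub>?R\<^esub> = c"
        by (induction c rule: frag_induction) (simp_all add: one monoid_ring_mult_diff)
    qed (simp add: car one)
  qed (simp_all add: add mult_add)
qed

definition augmentation :: "('g \<Rightarrow>\<^sub>0 int) \<Rightarrow> int" where
  "augmentation c = (\<Sum>g\<in>Poly_Mapping.keys c. Poly_Mapping.lookup c g)"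

text \<open>The fields \<open>mult\<close> and \<open>one\<close> of a module record play no role.\<close>

definition trivial_module :: "('g \<Rightarrow>\<^sub>0 int, int) module" where
  "trivial_module =
    \<lparr>carrier = UNIV, mult = (*), one = 1, zero = 0, add = (+), smult = (\<lambda>c n. augmentation c * n)\<rparr>"

lemma augmentation_diff: "augmentation (c - d) = augmentation c - augmentation d"
proof -
  let ?A = "Poly_Mapping.keys c \<union> Poly_Mapping.keys d"
  have "augmentation e = (\<Sum>g\<in>?A. Poly_Mapping.lookup e g)" if "Poly_Mapping.keys e \<subseteq> ?A" for e
    unfolding augmentation_def using that
    by (intro sum.mono_neutral_left) (auto simp: in_keys_iff)
  moreover have "Poly_Mapping.keys (c - d) \<subseteq> ?A"
    by (rule keys_diff)
  ultimately show ?thesis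
    by (simp add: lookup_minus sum_subtractf)
qed

lemma augmentation_of [simp]: "augmentation (frag_of g) = 1"
  by (simp add: augmentation_def)

lemma augmentation_mult: "augmentation (c \<otimes>\<^bsub>monoid_ring M\<^esub> d) = augmentation c * augmentation d"
proof -
  have zero: "augmentation 0 = 0"
    by (simp add: augmentation_def)
  show ?thesis
  proof (induction c rule: frag_induction[OF subset_UNIV])
    case (2 x)
    show ?case
      by (induction d rule: frag_induction[OF subset_UNIV])
        (simp_all add: zero augmentation_diff monoid_ring_mult_diff)
  qed (simp_all add: zero augmentation_diff monoid_ring_mult_diff left_diff_distrib)
qed

lemma left_module_trivial_module:
  assumes "monoid M"
  shows "left_module (monoid_ring M) trivial_module"
proof -
  have "augmentation (c + d) = augmentation c + augmentation d" for c d :: "'a \<Rightarrow>\<^sub>0 int"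
    using augmentation_diff[of "c + d" d] by simp
  moreover have "abelian_group (trivial_module :: ('a \<Rightarrow>\<^sub>0 int, int) module)"
    by (rule abelian_groupI) (auto simp: trivial_module_def intro: exI[of _ "- _"])
  ultimately show ?thesis
    using augmentation_mult[where M = M]
    by (intro left_module.intro left_module_axioms.intro ring_monoid_ring[OF assms])
      (auto simp: trivial_module_def monoid_ring_def algebra_simps)
qed

definition FP_monoid :: "nat \<Rightarrow> ('g, 'm) monoid_scheme \<Rightarrow> bool" where
  "FP_monoid n M \<longleftrightarrow> FP_type n (monoid_ring M) (trivial_module :: ('g \<Rightarrow>\<^sub>0 int, int) module)"


section \<open>Characters and the invariant \<open>\<Sigma>\<^sup>1\<close>\<close>

definition real_group :: "real monoid" where
  "real_group = \<lparr>carrier = UNIV, mult = (+), one = 0\<rparr>"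

text \<open>Extensionality makes equality of characters equality on the carrier.\<close>

definition characters :: "('a, 'm) monoid_scheme \<Rightarrow> ('a \<Rightarrow> real) set" where
  "characters G = hom G real_group \<inter> extensional (carrier G)"

definition nonzero_characters :: "('a, 'm) monoid_scheme \<Rightarrow> ('a \<Rightarrow> real) set" where
  "nonzero_characters G = characters G - {\<lambda>g\<in>carrier G. 0}"

definition ray :: "('a, 'm) monoid_scheme \<Rightarrow> ('a \<Rightarrow> real) \<Rightarrow> ('a \<Rightarrow> real) set" where
  "ray G \<chi> = {\<lambda>g\<in>carrier G. t * \<chi> g | t. 0 < t}"

definition character_sphere :: "('a, 'm) monoid_scheme \<Rightarrow> ('a \<Rightarrow> real) set set" where
  "character_sphere G = {ray G \<chi> | \<chi>. \<chi> \<in> nonzero_characters G}"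

definition character_subsphere :: "('a, 'm) monoid_scheme \<Rightarrow> 'a set \<Rightarrow> ('a \<Rightarrow> real) set set" where
  "character_subsphere G N =
    {ray G \<chi> | \<chi>. \<chi> \<in> nonzero_characters G \<and> (\<forall>g\<in>N. \<chi> g = 0)}"

definition character_monoid :: "('a, 'm) monoid_scheme \<Rightarrow> ('a \<Rightarrow> real) \<Rightarrow> ('a, 'm) monoid_scheme" where
  "character_monoid G \<chi> = G\<lparr>carrier := {g \<in> carrier G. 0 \<le> \<chi> g}\<rparr>"

lemma (in group) monoid_character_monoid:
  assumes "\<chi> \<in> characters G"
  shows "monoid (character_monoid G \<chi>)"
proof -
  have hom: "\<chi> (x \<otimes> y) = \<chi> x + \<chi> y" if "x \<in> carrier G" "y \<in> carrier G" for x y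
    using assms that by (auto simp: characters_def real_group_def hom_def)
  have "\<chi> \<one> = 0"
    using hom[of \<one> \<one>] by simp
  then show ?thesis
    by (intro monoidI) (auto simp: character_monoid_def hom m_assoc)
qed

definition Sigma1 :: "('a, 'm) monoid_scheme \<Rightarrow> ('a \<Rightarrow> real) set set" where
  "Sigma1 G = {ray G \<chi> | \<chi>. \<chi> \<in> nonzero_characters G \<and> FP_monoid 1 (character_monoid G \<chi>)}"

definition antipodal :: "('a, 'm) monoid_scheme \<Rightarrow> ('a \<Rightarrow> real) set set \<Rightarrow> ('a \<Rightarrow> real) set set" where
  "antipodal G \<Omega> =
    {ray G (\<lambda>g\<in>carrier G. - \<chi> g) | \<chi>. \<chi> \<in> nonzero_characters G \<and> ray G \<chi> \<in> \<Omega>}"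


section \<open>Fibre products and the dual of an isomorphism of quotients\<close>

definition fibre_product_set ::
  "('a, 'm) monoid_scheme \<Rightarrow> 'a set \<Rightarrow> ('b, 'n) monoid_scheme \<Rightarrow> 'b set \<Rightarrow> ('a set \<Rightarrow> 'b set) \<Rightarrow> ('a \<times> 'b) set" where
  "fibre_product_set G1 N1 G2 N2 \<mu> =
    {(g1, g2) \<in> carrier G1 \<times> carrier G2. \<mu> (g1 <#\<^bsub>G1\<^esub> N1) = g2 <#\<^bsub>G2\<^esub> N2}"

definition fibre_product ::
  "('a, 'm) monoid_scheme \<Rightarrow> 'a set \<Rightarrow> ('b, 'n) monoid_scheme \<Rightarrow> 'b set \<Rightarrow> ('a set \<Rightarrow> 'b set) \<Rightarrow> ('a \<times> 'b) monoid" where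
  "fibre_product G1 N1 G2 N2 \<mu> = (G1 \<times>\<times> G2)\<lparr>carrier := fibre_product_set G1 N1 G2 N2 \<mu>\<rparr>"

lemma subgroup_fibre_product_set:
  assumes "N1 \<lhd> G1" "N2 \<lhd> G2" "\<mu> \<in> hom (G1 Mod N1) (G2 Mod N2)"
  shows "subgroup (fibre_product_set G1 N1 G2 N2 \<mu>) (G1 \<times>\<times> G2)"
proof -
  interpret N1: normal N1 G1 by fact
  interpret N2: normal N2 G2 by fact
  interpret Q1: group "G1 Mod N1" by (rule N1.factorgroup_is_group)
  interpret Q2: group "G2 Mod N2" by (rule N2.factorgroup_is_group)
  interpret \<mu>: group_hom "G1 Mod N1" "G2 Mod N2" \<mu>
    by unfold_locales fact
  interpret \<pi>1: group_hom G1 "G1 Mod N1" "\<lambda>g. N1 #>\<^bsub>G1\<^esub> g"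
    by unfold_locales (rule N1.r_coset_hom_Mod)
  interpret \<pi>2: group_hom G2 "G2 Mod N2" "\<lambda>g. N2 #>\<^bsub>G2\<^esub> g"
    by unfold_locales (rule N2.r_coset_hom_Mod)
  interpret \<mu>\<pi>: group_hom G1 "G2 Mod N2" "\<lambda>g. \<mu> (N1 #>\<^bsub>G1\<^esub> g)"
    using \<pi>1.homh \<mu>.homh by unfold_locales (auto simp: hom_def Pi_iff)
  interpret D: group "G1 \<times>\<times> G2"
    by (intro DirProd_group N1.is_group N2.is_group)
  have *: "fibre_product_set G1 N1 G2 N2 \<mu> =
      {(g1, g2) \<in> carrier G1 \<times> carrier G2. \<mu> (N1 #>\<^bsub>G1\<^esub> g1) = N2 #>\<^bsub>G2\<^esub> g2}"
    using N1.coset_eq N2.coset_eq by (auto simp: fibre_product_set_def)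
  show ?thesis
    unfolding *
  proof (rule D.subgroupI)
    have "(\<one>\<^bsub>G1\<^esub>, \<one>\<^bsub>G2\<^esub>) \<in> {(g1, g2) \<in> carrier G1 \<times> carrier G2. \<mu> (N1 #>\<^bsub>G1\<^esub> g1) = N2 #>\<^bsub>G2\<^esub> g2}"
      using \<mu>\<pi>.hom_one \<pi>2.hom_one by simp
    then show "{(g1, g2) \<in> carrier G1 \<times> carrier G2. \<mu> (N1 #>\<^bsub>G1\<^esub> g1) = N2 #>\<^bsub>G2\<^esub> g2} \<noteq> {}"
      by blast
  qed (auto simp: inv_DirProd N1.is_group N2.is_group
        simp del: \<mu>.hom_mult \<pi>1.hom_mult \<pi>1.hom_inv simp add: \<mu>\<pi>.hom_mult \<pi>2.hom_mult \<mu>\<pi>.hom_inv \<pi>2.hom_inv)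
qed

definition dual_map :: "('c, 'm) monoid_scheme \<Rightarrow> ('c \<Rightarrow> 'd) \<Rightarrow> ('d \<Rightarrow> real) \<Rightarrow> ('c \<Rightarrow> real)" where
  "dual_map Q \<mu> \<chi> = compose (carrier Q) \<chi> \<mu>"

text \<open>
  Mutually inverse identifications of the characters of \<open>G\<close> vanishing on \<open>N\<close> with the
  characters of \<open>G Mod N\<close>.
\<close>

definition descend_character :: "('a, 'm) monoid_scheme \<Rightarrow> 'a set \<Rightarrow> ('a \<Rightarrow> real) \<Rightarrow> ('a set \<Rightarrow> real)" where
  "descend_character G N \<chi> = (\<lambda>C\<in>carrier (G Mod N). the_elem (\<chi> ` C))"

definition inflate_character :: "('a, 'm) monoid_scheme \<Rightarrow> 'a set \<Rightarrow> ('a set \<Rightarrow> real) \<Rightarrow> ('a \<Rightarrow> real)" where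
  "inflate_character G N \<psi> = (\<lambda>g\<in>carrier G. \<psi> (g <#\<^bsub>G\<^esub> N))"

context normal
begin

lemma descend_character_apply:
  assumes "\<chi> \<in> characters G" "\<And>g. g \<in> H \<Longrightarrow> \<chi> g = 0" "g \<in> carrier G"
  shows "descend_character G H \<chi> (g <# H) = \<chi> g"
proof -
  have "\<chi> ` (g <# H) = {\<chi> g}"
  proof -
    have "\<chi> (g \<otimes> h) = \<chi> g" if "h \<in> H" for h
      using assms that subset by (auto simp: characters_def real_group_def hom_def)
    then show ?thesis
      using one_closed by (auto simp: l_coset_def image_iff intro!: exI[of _ \<one>])
  qed
  moreover have "g <# H \<in> carrier (G Mod H)"
    using assms(3) coset_eq by (auto simp: FactGroup_def RCOSETS_def)
  ultimately show ?thesis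
    by (simp add: descend_character_def)
qed

lemma inflate_descend_character:
  assumes "\<chi> \<in> characters G" "\<And>g. g \<in> H \<Longrightarrow> \<chi> g = 0"
  shows "inflate_character G H (descend_character G H \<chi>) = \<chi>"
proof
  fix g show "inflate_character G H (descend_character G H \<chi>) g = \<chi> g"
    using assms descend_character_apply[OF assms]
    by (cases "g \<in> carrier G")
      (auto simp: inflate_character_def characters_def extensional_def)
qed

lemma descend_character_in_characters:
  assumes "\<chi> \<in> characters G" "\<And>g. g \<in> H \<Longrightarrow> \<chi> g = 0"
  shows "descend_character G H \<chi> \<in> characters (G Mod H)"
proof -
  have coset: "\<exists>g\<in>carrier G. C = g <# H" if "C \<in> carrier (G Mod H)" for C
    using that coset_eq by (auto simp: FactGroup_def RCOSETS_def)
  have "descend_character G H \<chi> (C \<otimes>\<^bsub>G Mod H\<^esub> D) = descend_character G H \<chi> C + descend_character G H \<chi> D"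
    if CD: "C \<in> carrier (G Mod H)" "D \<in> carrier (G Mod H)" for C D
  proof -
    from CD obtain g h where g: "g \<in> carrier G" "C = g <# H" and h: "h \<in> carrier G" "D = h <# H"
      using coset by metis
    have "C \<otimes>\<^bsub>G Mod H\<^esub> D = (g \<otimes> h) <# H"
      using g h rcos_sum[of g h] coset_eq by (simp add: FactGroup_def)
    then show ?thesis
      using g h assms(1) descend_character_apply[OF assms]
      by (simp add: characters_def real_group_def hom_def)
  qed
  then show ?thesis
    by (auto simp: characters_def hom_def real_group_def descend_character_def)
qed

lemma descend_inflate_character:
  assumes "\<psi> \<in> characters (G Mod H)"
  shows "inflate_character G H \<psi> \<in> characters G"
    and "\<And>g. g \<in> H \<Longrightarrow> inflate_character G H \<psi> g = 0"
    and "descend_character G H (inflate_character G H \<psi>) = \<psi>"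
proof -
  have car: "g <# H \<in> carrier (G Mod H)" if "g \<in> carrier G" for g
    using that coset_eq by (auto simp: FactGroup_def RCOSETS_def)
  have mult: "(g <# H) \<otimes>\<^bsub>G Mod H\<^esub> (h <# H) = (g \<otimes> h) <# H" if "g \<in> carrier G" "h \<in> carrier G" for g h
    using that rcos_sum[of g h] coset_eq by (simp add: FactGroup_def)
  have hom: "\<psi> (C \<otimes>\<^bsub>G Mod H\<^esub> D) = \<psi> C + \<psi> D"
    if "C \<in> carrier (G Mod H)" "D \<in> carrier (G Mod H)" for C D
    using assms that by (simp add: characters_def real_group_def hom_def)
  show ch: "inflate_character G H \<psi> \<in> characters G"
    using hom[OF car car]
    by (auto simp: characters_def hom_def real_group_def inflate_character_def simp flip: mult)
  show zero: "inflate_character G H \<psi> g = 0" if "g \<in> H" for g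
  proof -
    have "g \<in> carrier G" "g <# H = H"
      using that subset coset_eq coset_join2[of g H] subgroup_axioms by auto
    moreover have "\<psi> H = 0"
    proof -
      interpret Q: group "G Mod H"
        by (rule factorgroup_is_group)
      have "\<psi> \<one>\<^bsub>G Mod H\<^esub> = 0"
        using hom[OF Q.one_closed Q.one_closed] unfolding Q.l_one[OF Q.one_closed] by linarith
      then show ?thesis
        by (simp add: FactGroup_def)
    qed
    ultimately show ?thesis
      by (simp add: inflate_character_def)
  qed
  show "descend_character G H (inflate_character G H \<psi>) = \<psi>"
  proof
    fix C show "descend_character G H (inflate_character G H \<psi>) C = \<psi> C"
    proof (cases "C \<in> carrier (G Mod H)")
      case True
      then obtain g where g: "g \<in> carrier G" "C = g <# H"
        using coset_eq by (auto simp: FactGroup_def RCOSETS_def)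
      have "descend_character G H (inflate_character G H \<psi>) (g <# H) = inflate_character G H \<psi> g"
        using ch zero g(1) by (rule descend_character_apply)
      also have "\<dots> = \<psi> (g <# H)"
        using g(1) by (simp add: inflate_character_def)
      finally show ?thesis
        by (simp add: g(2))
    next
      case False
      then show ?thesis
        using assms by (auto simp: descend_character_def characters_def extensional_def)
    qed
  qed
qed

end

definition dual_image ::
  "('a, 'm) monoid_scheme \<Rightarrow> 'a set \<Rightarrow> ('b, 'n) monoid_scheme \<Rightarrow> 'b set \<Rightarrow> ('a set \<Rightarrow> 'b set) \<Rightarrow>
    ('b \<Rightarrow> real) set set \<Rightarrow> ('a \<Rightarrow> real) set set" where
  "dual_image G1 N1 G2 N2 \<mu> \<Omega> =
    {ray G1 (inflate_character G1 N1 (dual_map (G1 Mod N1) \<mu> (descend_character G2 N2 \<chi>))) | \<chi>.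
      \<chi> \<in> nonzero_characters G2 \<and> ray G2 \<chi> \<in> \<Omega>}"

end

theory Submission
  imports Defs "HOL-Library.Nat_Bijection"
begin

text \<open>
  Finite presentability is used in the form that all words with trivial value, over a finite
  generating set, contract along the Cayley graph by deleting trivial subwords of bounded length;
  type \<open>FP\<^sub>1\<close> of a monoid means that a Cayley graph of it with finitely many generators is connected.

  If \<open>\<chi>\<close> violates the condition, choose \<open>n\<^sub>1 \<in> N\<^sub>1\<close> and \<open>n\<^sub>2 \<in> N\<^sub>2\<close> outside the components of \<open>1\<close> in
  the two half spaces. Conjugating them by large opposite powers in the fibre product gives a
  commutator loop on which a Mayer--Vietoris cocycle takes the value \<open>1\<close>, although the cocycle
  vanishes on short loops.

  Conversely let \<open>p\<close> be integer coordinates on the abelian quotient with finite sublevel sets,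
  evaluated on \<open>G1 \<times> G2\<close> through the difference of the two projections, so that the fibre product
  is their common kernel up to finite index. Far from the origin the sublevel sets of \<open>\<bar>p\<bar>\<^sup>2\<close> look like
  half spaces of \<open>G1 \<times> G2\<close>, in which short loops contract by the condition: push the letters of
  one factor up inside its connected half space and contract both factors separately. As the sphere
  of directions is compact, this is uniform, so large sublevel sets are simply connected, and the
  fibre product acts on them with finite quotient.
\<close>

section \<open>Words, paths and combinatorial homotopy\<close>

text \<open>The words model the full subcomplex on a vertex set \<open>Y\<close> of the Cayley
  complex whose 2-cells are all trivial loops of length at most \<open>L\<close>; no complex is
  built, and left translation supplies the group action. Three obstacles shape the proof. In each
  direction the condition grants connectivity of a half space in only one of the two factors, and
  not always in the same one, so loops are contracted for two commuting alphabets whose roles can be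
  exchanged. A sublevel set is a half space only approximately and only up to a scale, so each
  direction \<alpha> gets its own scale \<open>B\<close> and margin \<eta>, fixed before the
  distance from the origin is. Finally, a loop contracts at first only in some larger sublevel set;
  the squared length of integer coordinates is an integer, so the contraction can be pushed down one
  level at a time. The minus sign of the theorem comes from the difference of the projections: a
  character of the quotient restricts to opposite characters on the two factors.\<close>

definition wprod :: "('a, 'm) monoid_scheme \<Rightarrow> 'a list \<Rightarrow> 'a" where
  "wprod G w = foldr (\<otimes>\<^bsub>G\<^esub>) w \<one>\<^bsub>G\<^esub>"

primrec stays :: "('a, 'm) monoid_scheme \<Rightarrow> 'a set \<Rightarrow> 'a \<Rightarrow> 'a list \<Rightarrow> bool" where
  "stays G Y g [] \<longleftrightarrow> g \<in> Y"
| "stays G Y g (x # w) \<longleftrightarrow> g \<in> Y \<and> stays G Y (g \<otimes>\<^bsub>G\<^esub> x) w"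

definition winv :: "('a, 'm) monoid_scheme \<Rightarrow> 'a list \<Rightarrow> 'a list" where
  "winv G w = rev (map (\<lambda>x. inv\<^bsub>G\<^esub> x) w)"

text \<open>Edge-path homotopy in the subcomplex spanned by \<open>Y\<close>. In
  \<open>delete\<close> only the longer word must stay in \<open>Y\<close>: since \<open>s\<close>
  is trivial, the shorter word visits no further vertices. Insertions come from
  \<open>sym\<close>.\<close>

inductive homot :: "('a, 'm) monoid_scheme \<Rightarrow> 'a set \<Rightarrow> nat \<Rightarrow> 'a set \<Rightarrow> 'a \<Rightarrow> 'a list \<Rightarrow> 'a list \<Rightarrow> bool"
  for G X L Y g where
  refl: "\<lbrakk>set w \<subseteq> X; stays G Y g w\<rbrakk> \<Longrightarrow> homot G X L Y g w w"
| delete: "\<lbrakk>set (u @ s @ v) \<subseteq> X; length s \<le> L; wprod G s = \<one>\<^bsub>G\<^esub>; stays G Y g (u @ s @ v)\<rbrakk>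
    \<Longrightarrow> homot G X L Y g (u @ s @ v) (u @ v)"
| sym: "homot G X L Y g v w \<Longrightarrow> homot G X L Y g w v"
| trans: "\<lbrakk>homot G X L Y g u v; homot G X L Y g v w\<rbrakk> \<Longrightarrow> homot G X L Y g u w"

text \<open>The finitely many trivial words of length at most \<open>L\<close> serve as relators, so
  a number replaces the list of relators. Closure under inverses lets plain letters replace signed
  ones.\<close>

definition word_presented :: "('a, 'm) monoid_scheme \<Rightarrow> 'a set \<Rightarrow> nat \<Rightarrow> bool" where
  "word_presented G X L \<longleftrightarrow> finite X \<and> X \<subseteq> carrier G \<and> (\<forall>x\<in>X. inv\<^bsub>G\<^esub> x \<in> X) \<and>
    (\<forall>g\<in>carrier G. \<exists>w. set w \<subseteq> X \<and> wprod G w = g) \<and>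
    (\<forall>w. set w \<subseteq> X \<longrightarrow> wprod G w = \<one>\<^bsub>G\<^esub> \<longrightarrow> homot G X L (carrier G) \<one>\<^bsub>G\<^esub> w [])"

context group
begin

lemma wprod_Nil [simp]: "wprod G [] = \<one>"
  and wprod_Cons [simp]: "wprod G (x # w) = x \<otimes> wprod G w"
  by (simp_all add: wprod_def)

lemma wprod_closed [simp, intro]: "set w \<subseteq> carrier G \<Longrightarrow> wprod G w \<in> carrier G"
  by (induction w) auto

lemma wprod_append [simp]:
  "\<lbrakk>set u \<subseteq> carrier G; set v \<subseteq> carrier G\<rbrakk> \<Longrightarrow> wprod G (u @ v) = wprod G u \<otimes> wprod G v"
  by (induction u) (auto simp: m_assoc)

lemma winv_append [simp]: "winv G (u @ v) = winv G v @ winv G u"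
  and winv_Nil [simp]: "winv G [] = []"
  and length_winv [simp]: "length (winv G w) = length w"
  by (simp_all add: winv_def)

lemma winv_Cons: "winv G (x # w) = winv G w @ [inv x]"
  by (simp add: winv_def)

lemma set_winv_subset: "\<lbrakk>set w \<subseteq> X; \<forall>x\<in>X. inv x \<in> X\<rbrakk> \<Longrightarrow> set (winv G w) \<subseteq> X"
  by (auto simp: winv_def)

lemma set_winv [simp, intro]: "set w \<subseteq> carrier G \<Longrightarrow> set (winv G w) \<subseteq> carrier G"
  by (auto simp: winv_def)

lemma winv_winv [simp]: "set w \<subseteq> carrier G \<Longrightarrow> winv G (winv G w) = w"
  by (induction w) (auto simp: winv_Cons)

lemma wprod_winv [simp]: "set w \<subseteq> carrier G \<Longrightarrow> wprod G (winv G w) = inv (wprod G w)"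
  by (induction w) (auto simp: winv_Cons inv_mult_group)

lemma stays_append:
  "\<lbrakk>g \<in> carrier G; set u \<subseteq> carrier G; set v \<subseteq> carrier G\<rbrakk>
    \<Longrightarrow> stays G Y g (u @ v) \<longleftrightarrow> stays G Y g u \<and> stays G Y (g \<otimes> wprod G u) v"
proof (induction u arbitrary: g)
  case Nil
  then show ?case by (cases v) auto
qed (auto simp: m_assoc)

lemma stays_start: "stays G Y g w \<Longrightarrow> g \<in> Y"
  by (cases w) auto

lemma stays_iff:
  assumes "g \<in> carrier G" "set w \<subseteq> carrier G"
  shows "stays G Y g w \<longleftrightarrow> (\<forall>u v. w = u @ v \<longrightarrow> g \<otimes> wprod G u \<in> Y)"
  using assms
proof (induction w arbitrary: g)
  case (Cons x w)
  have "(\<forall>u v. x # w = u @ v \<longrightarrow> g \<otimes> wprod G u \<in> Y) \<longleftrightarrow>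
      g \<in> Y \<and> (\<forall>u v. w = u @ v \<longrightarrow> g \<otimes> wprod G (x # u) \<in> Y)"
    using Cons.prems by (simp only: Cons_eq_append_conv) (metis r_one wprod_Nil)
  also have "(\<forall>u v. w = u @ v \<longrightarrow> g \<otimes> wprod G (x # u) \<in> Y) \<longleftrightarrow>
      (\<forall>u v. w = u @ v \<longrightarrow> (g \<otimes> x) \<otimes> wprod G u \<in> Y)"
    using Cons.prems by (intro all_cong1 imp_cong) (auto simp: m_assoc)
  finally have eq: "(\<forall>u v. x # w = u @ v \<longrightarrow> g \<otimes> wprod G u \<in> Y) \<longleftrightarrow>
      g \<in> Y \<and> (\<forall>u v. w = u @ v \<longrightarrow> (g \<otimes> x) \<otimes> wprod G u \<in> Y)" .
  show ?case
    unfolding stays.simps eq using Cons.IH[of "g \<otimes> x"] Cons.prems by simp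
qed auto

lemma stays_mono: "\<lbrakk>stays G Y g w; Y \<subseteq> Z\<rbrakk> \<Longrightarrow> stays G Z g w"
  by (induction w arbitrary: g) auto

lemma stays_carrier:
  "\<lbrakk>g \<in> carrier G; set w \<subseteq> carrier G\<rbrakk> \<Longrightarrow> stays G (carrier G) g w"
  by (induction w arbitrary: g) auto

lemma stays_translate:
  "\<lbrakk>h \<in> carrier G; g \<in> carrier G; set w \<subseteq> carrier G\<rbrakk>
    \<Longrightarrow> stays G Y (h \<otimes> g) w \<longleftrightarrow> stays G {y \<in> carrier G. h \<otimes> y \<in> Y} g w"
  by (induction w arbitrary: g) (auto simp: m_assoc)

lemma stays_winv:
  assumes "g \<in> carrier G" "set w \<subseteq> carrier G"
  shows "stays G Y (g \<otimes> wprod G w) (winv G w) \<longleftrightarrow> stays G Y g w"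
  using assms
proof (induction w arbitrary: g)
  case (Cons x w)
  have "stays G Y (g \<otimes> wprod G (x # w)) (winv G (x # w)) \<longleftrightarrow>
      stays G Y ((g \<otimes> x) \<otimes> wprod G w) (winv G w) \<and>
      stays G Y ((g \<otimes> x) \<otimes> wprod G w \<otimes> wprod G (winv G w)) [inv x]"
    using Cons.prems by (simp add: winv_Cons stays_append m_assoc)
  also have "(g \<otimes> x) \<otimes> wprod G w \<otimes> wprod G (winv G w) = g \<otimes> x"
    using Cons.prems by (simp add: m_assoc)
  also have "stays G Y (g \<otimes> x) [inv x] \<longleftrightarrow> g \<otimes> x \<in> Y \<and> g \<in> Y"
    using Cons.prems by (simp add: m_assoc)
  finally show ?case
    using Cons stays_start by auto
qed simp

lemma homot_set:
  "homot G X L Y g u v \<Longrightarrow> set u \<subseteq> X \<and> set v \<subseteq> X"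
  by (induction rule: homot.induct) auto

lemma homot_stays:
  assumes "homot G X L Y g u v" "g \<in> carrier G" "X \<subseteq> carrier G"
  shows "stays G Y g u \<and> stays G Y g v \<and> wprod G u = wprod G v"
  using assms
proof (induction rule: homot.induct)
  case (delete u s v)
  then have s: "set u \<subseteq> carrier G" "set s \<subseteq> carrier G" "set v \<subseteq> carrier G"
    by auto
  with delete show ?case
    by (simp add: stays_append)
qed auto

lemma homot_mono:
  assumes "homot G X L Y g u v" "X \<subseteq> X'" "L \<le> L'" "Y \<subseteq> Y'"
  shows "homot G X' L' Y' g u v"
  using assms
proof (induction rule: homot.induct)
  case (refl w)
  then show ?case by (intro homot.refl) (auto intro: stays_mono)
next
  case (delete u s v)
  then show ?case by (intro homot.delete) (auto intro: stays_mono)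
qed (blast intro: homot.sym homot.trans)+

lemma homot_append_left:
  assumes "homot G X L Y (g \<otimes> wprod G u) v w" "stays G Y g u" "set u \<subseteq> X"
    "g \<in> carrier G" "X \<subseteq> carrier G"
  shows "homot G X L Y g (u @ v) (u @ w)"
  using assms
proof (induction rule: homot.induct)
  case (refl w)
  have "set u \<subseteq> carrier G" "set w \<subseteq> carrier G" using refl by auto
  with refl show ?case by (intro homot.refl) (auto simp: stays_append)
next
  case (delete u' s v)
  have "set u \<subseteq> carrier G" "set (u' @ s @ v) \<subseteq> carrier G" using delete by auto
  then have "stays G Y g (u @ u' @ s @ v)"
    using delete stays_append[of g u "u' @ s @ v" Y] by simp
  with delete show ?case
    using homot.delete[of "u @ u'" s v X L G Y g] by simp
qed (blast intro: homot.sym homot.trans)+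

lemma homot_append_right:
  assumes "homot G X L Y g v w" "stays G Y (g \<otimes> wprod G w) u" "set u \<subseteq> X"
    "g \<in> carrier G" "X \<subseteq> carrier G"
  shows "homot G X L Y g (v @ u) (w @ u)"
proof -
  have "homot G X L Y g (v @ u) (w @ u) \<and> wprod G v = wprod G w"
    if "homot G X L Y g v w" "stays G Y (g \<otimes> wprod G v) u \<or> stays G Y (g \<otimes> wprod G w) u" for v w
    using that
  proof (induction rule: homot.induct)
    case (refl w)
    have "set u \<subseteq> carrier G" "set w \<subseteq> carrier G" using refl assms by auto
    with refl show ?case using assms by (auto simp: stays_append intro!: homot.refl)
  next
    case (delete u' s v)
    have *: "set u \<subseteq> carrier G" "set u' \<subseteq> carrier G" "set s \<subseteq> carrier G" "set v \<subseteq> carrier G"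
      using delete assms by auto
    then have eq: "wprod G (u' @ s @ v) = wprod G (u' @ v)"
      using delete by simp
    then have "stays G Y g ((u' @ s @ v) @ u)"
      using delete.hyps(4) delete.prems assms(4) * stays_append[of g "u' @ s @ v" u Y] by auto
    with delete eq assms show ?case
      using homot.delete[of u' s "v @ u" X L G Y g] by simp
  next
    case (sym v w)
    then show ?case by (auto intro: homot.sym)
  next
    case (trans a b c)
    have "wprod G a = wprod G b" "wprod G b = wprod G c"
      using trans.hyps assms homot_stays by blast+
    with trans show ?case by (auto intro: homot.trans)
  qed
  with assms show ?thesis by blast
qed

text \<open>Left translation is an automorphism of the Cayley complex. It carries null homotopies at
  \<open>\<one>\<close> to any base point, with the region pulled back.\<close>

lemma homot_translate:
  assumes "homot G X L {y \<in> carrier G. h \<otimes> y \<in> Y} g u v"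
    "h \<in> carrier G" "g \<in> carrier G" "X \<subseteq> carrier G"
  shows "homot G X L Y (h \<otimes> g) u v"
  using assms
proof (induction rule: homot.induct)
  case (refl w)
  then show ?case using stays_translate[of h g w Y] by (intro homot.refl) auto
next
  case (delete u s v)
  then show ?case using stays_translate[of h g "u @ s @ v" Y] by (intro homot.delete) auto
qed (blast intro: homot.sym homot.trans)+

lemma homot_context:
  assumes "homot G X L Y (g \<otimes> wprod G u) s t" "stays G Y g (u @ t @ v)" "set (u @ v) \<subseteq> X"
    "g \<in> carrier G" "X \<subseteq> carrier G"
  shows "homot G X L Y g (u @ s @ v) (u @ t @ v)"
proof -
  have c: "set u \<subseteq> carrier G" "set v \<subseteq> carrier G" "set s \<subseteq> carrier G" "set t \<subseteq> carrier G"
    using assms homot_set[OF assms(1)] by auto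
  show ?thesis
    using assms c
    by (intro homot_append_left homot_append_right) (auto simp: stays_append)
qed

lemma homot_cancel:
  assumes "stays G Y g w" "set w \<subseteq> X" "\<forall>x\<in>X. inv x \<in> X" "X \<subseteq> carrier G" "g \<in> carrier G" "2 \<le> L"
  shows "homot G X L Y g (w @ winv G w) []"
  using assms(1,2,5)
proof (induction w arbitrary: g)
  case Nil
  then show ?case by (auto intro: homot.refl)
next
  case (Cons x w)
  then have x: "x \<in> X" "x \<in> carrier G" "inv x \<in> X" "set w \<subseteq> carrier G"
    using assms by auto
  have "homot G X L Y g ([x] @ (w @ winv G w) @ [inv x]) ([x] @ [] @ [inv x])"
  proof (rule homot_context)
    show "stays G Y g ([x] @ [] @ [inv x])"
      using Cons x by (auto simp: m_assoc dest: stays_start)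
  qed (use Cons x assms in auto)
  moreover have "homot G X L Y g ([] @ [x, inv x] @ []) ([] @ [])"
    using Cons x assms by (intro homot.delete) (auto simp: m_assoc dest: stays_start)
  ultimately show ?case
    by (auto simp: winv_Cons intro: homot.trans)
qed

lemma homot_cancel':
  assumes "stays G Y (g \<otimes> inv (wprod G w)) w" "set w \<subseteq> X" "\<forall>x\<in>X. inv x \<in> X" "X \<subseteq> carrier G"
    "g \<in> carrier G" "2 \<le> L"
  shows "homot G X L Y g (winv G w @ w) []"
proof -
  have w: "set w \<subseteq> carrier G" using assms by auto
  have "homot G X L Y g (winv G w @ winv G (winv G w)) []"
  proof (rule homot_cancel)
    have "g \<otimes> inv (wprod G w) \<otimes> wprod G w = g"
      using w assms by (simp add: m_assoc)
    then show "stays G Y g (winv G w)"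
      using stays_winv[of "g \<otimes> inv (wprod G w)" w Y] assms w by simp
  qed (use assms set_winv_subset[of w X] in auto)
  then show ?thesis using w by simp
qed

text \<open>Inserting \<open>winv G v @ v\<close> after \<open>u\<close> produces the loop
  \<open>u @ winv G v\<close> followed by \<open>v\<close>, and the loop contracts by
  assumption.\<close>

lemma homot_from_loop:
  assumes "homot G X L Y g (u @ winv G v) []" "stays G Y g v" "set v \<subseteq> X"
    "\<forall>x\<in>X. inv x \<in> X" "X \<subseteq> carrier G" "g \<in> carrier G" "2 \<le> L"
  shows "homot G X L Y g u v"
proof -
  have v: "set v \<subseteq> carrier G" and u: "set u \<subseteq> X" "set u \<subseteq> carrier G"
    using assms homot_set[OF assms(1)] by auto
  have st: "stays G Y g (u @ winv G v)" and eq: "wprod G (u @ winv G v) = \<one>"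
    using homot_stays[OF assms(1)] assms by auto
  have su: "stays G Y g u"
    using st u v assms by (simp add: stays_append)
  have "wprod G u = wprod G u \<otimes> inv (wprod G v) \<otimes> wprod G v"
    using u v by (simp add: m_assoc)
  then have prod: "wprod G u = wprod G v"
    using eq u v by simp
  have 1: "homot G X L Y g ((u @ winv G v) @ v) ([] @ v)"
    using assms by (intro homot_append_right) auto
  have "homot G X L Y g (u @ (winv G v @ v)) (u @ [])"
  proof (rule homot_append_left)
    have "g \<otimes> wprod G u \<otimes> inv (wprod G v) = g"
      using prod v assms by (simp add: m_assoc)
    then show "homot G X L Y (g \<otimes> wprod G u) (winv G v @ v) []"
      using assms u by (intro homot_cancel') auto
  qed (use su u assms in auto)
  with 1 show ?thesis by (auto intro: homot.trans homot.sym)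
qed

end

section \<open>Finite presentations by words\<close>

lemma (in group) normal_closure_normal:
  assumes "S \<subseteq> carrier G"
  shows "normal_closure G S \<lhd> G" "S \<subseteq> normal_closure G S"
    "\<And>N. N \<lhd> G \<Longrightarrow> S \<subseteq> N \<Longrightarrow> normal_closure G S \<subseteq> N"
proof -
  have "carrier G \<lhd> G"
    by (simp add: normal_inv_iff subgroup_self)
  then have "subgroup (\<Inter> {N. N \<lhd> G \<and> S \<subseteq> N}) G"
    using assms by (intro subgroups_Inter) (auto simp: normal_imp_subgroup)
  then show "normal_closure G S \<lhd> G"
    unfolding normal_closure_def normal_inv_iff by (auto simp: normal_inv_iff)
qed (auto simp: normal_closure_def)

definition free_class :: "'x set \<Rightarrow> ('x \<times> bool) list \<Rightarrow> ('x \<times> bool) list set" where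
  "free_class X w = free_equiv X `` {w}"

lemma free_class:
  shows carrier_free_group: "carrier (free_group X) = free_class X ` lists (X \<times> UNIV)"
    and one_free_group: "\<one>\<^bsub>free_group X\<^esub> = free_class X []"
    and free_class_append: "\<lbrakk>u \<in> lists (X \<times> UNIV); v \<in> lists (X \<times> UNIV)\<rbrakk>
      \<Longrightarrow> free_class X (u @ v) = free_class X u \<otimes>\<^bsub>free_group X\<^esub> free_class X v"
    and free_class_eq: "\<lbrakk>u \<in> lists (X \<times> UNIV); v \<in> lists (X \<times> UNIV)\<rbrakk>
      \<Longrightarrow> free_class X u = free_class X v \<longleftrightarrow> (u, v) \<in> free_equiv X"
    and free_class_closed: "u \<in> lists (X \<times> UNIV) \<Longrightarrow> free_class X u \<in> carrier (free_group X)"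
    and mem_free_class: "u \<in> lists (X \<times> UNIV) \<Longrightarrow> u \<in> free_class X u"
    and free_class_mem: "v \<in> free_class X u \<Longrightarrow> free_class X v = free_class X u \<and> v \<in> lists (X \<times> UNIV)"
proof -
  show car: "carrier (free_group X) = free_class X ` lists (X \<times> UNIV)"
    by (auto simp: free_group_def quotient_def free_class_def)
  show "\<one>\<^bsub>free_group X\<^esub> = free_class X []"
    by (simp add: free_group_def free_class_def)
  show "free_class X (u @ v) = free_class X u \<otimes>\<^bsub>free_group X\<^esub> free_class X v"
    if "u \<in> lists (X \<times> UNIV)" "v \<in> lists (X \<times> UNIV)"
    using free_group_mult[OF that] by (simp add: free_class_def)
  show eq: "free_class X u = free_class X v \<longleftrightarrow> (u, v) \<in> free_equiv X"
    if "u \<in> lists (X \<times> UNIV)" "v \<in> lists (X \<times> UNIV)" for u v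
    using eq_equiv_class_iff[OF equiv_free_equiv that] by (simp add: free_class_def)
  show "u \<in> lists (X \<times> UNIV) \<Longrightarrow> free_class X u \<in> carrier (free_group X)"
    by (simp add: car)
  show "u \<in> lists (X \<times> UNIV) \<Longrightarrow> u \<in> free_class X u"
    by (auto simp: free_class_def intro: free_equiv.refl)
  assume "v \<in> free_class X u"
  then have uv: "(u, v) \<in> free_equiv X" by (simp add: free_class_def)
  then have "u \<in> lists (X \<times> UNIV)" "v \<in> lists (X \<times> UNIV)"
    using equiv_free_equiv[of X] by (auto simp: equiv_def)
  with uv eq show "free_class X v = free_class X u \<and> v \<in> lists (X \<times> UNIV)"
    by metis
qed

text \<open>The classes of words whose images contract form a normal subgroup \<open>M\<close> of
  the free group. It contains the relators, hence the whole kernel, and this is the claim about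
  trivial words.\<close>

lemma finitely_presentedE:
  fixes G :: "('a, 'm) monoid_scheme" (structure)
  assumes "group G" "finitely_presented G"
  obtains X L where "word_presented G X L"
proof -
  interpret group G by fact
  from assms(2) obtain X0 :: "nat set" and R where X0: "finite X0" and R: "finite R"
    "R \<subseteq> carrier (free_group X0)"
    and iso: "G \<cong> free_group X0 Mod normal_closure (free_group X0) R"
    unfolding finitely_presented_def by blast
  let ?F = "free_group X0" and ?A = "lists (X0 \<times> (UNIV :: bool set))"
  let ?N = "normal_closure ?F R"
  interpret F: group ?F by (rule group_free_group)
  note N = F.normal_closure_normal[OF R(2)]
  interpret N: normal ?N ?F by (rule N(1))
  interpret Q: group "?F Mod ?N" by (rule N.factorgroup_is_group)
  from iso obtain \<psi> where \<psi>: "\<psi> \<in> iso (?F Mod ?N) G"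
    using iso_sym unfolding is_iso_def by blast
  define \<pi> where "\<pi> = (\<lambda>A. \<psi> (?N #>\<^bsub>?F\<^esub> A))"
  have \<pi>: "\<pi> \<in> hom ?F G"
    unfolding \<pi>_def using N.r_coset_hom_Mod \<psi> by (auto simp: hom_def iso_def Pi_iff)
  interpret \<pi>: group_hom ?F G \<pi>
    by unfold_locales (rule \<pi>)
  have surj: "\<exists>A\<in>carrier ?F. \<pi> A = g" if "g \<in> carrier G" for g
  proof -
    have "g \<in> \<psi> ` carrier (?F Mod ?N)"
      using \<psi> that by (auto simp: iso_def bij_betw_def)
    then show ?thesis
      by (auto simp: FactGroup_def RCOSETS_def \<pi>_def)
  qed
  have ker: "A \<in> ?N \<longleftrightarrow> \<pi> A = \<one>" if "A \<in> carrier ?F" for A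
  proof -
    have "\<psi> \<one>\<^bsub>?F Mod ?N\<^esub> = \<one>"
      using \<psi> by (intro hom_one[OF _ Q.is_group is_group]) (simp add: iso_def)
    moreover have "?N #>\<^bsub>?F\<^esub> A \<in> carrier (?F Mod ?N)"
      using that by (auto simp: FactGroup_def RCOSETS_def)
    ultimately have "\<pi> A = \<one> \<longleftrightarrow> ?N #>\<^bsub>?F\<^esub> A = ?N"
      using \<psi> Q.one_closed unfolding \<pi>_def iso_def bij_betw_def inj_on_def
      by (auto simp: FactGroup_def)
    also have "\<dots> \<longleftrightarrow> A \<in> ?N"
      using F.coset_join1[of ?N A] F.coset_join2[of A ?N] that N.subgroup_axioms N.subset by metis
    finally show ?thesis by blast
  qed
  define e where "e = (\<lambda>l. \<pi> (free_class X0 [l]))"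
  have e_closed: "e l \<in> carrier G" if "l \<in> X0 \<times> UNIV" for l
    unfolding e_def using that by (intro \<pi>.hom_closed free_class_closed) auto
  have wprod_e: "wprod G (map e w) = \<pi> (free_class X0 w)" if "w \<in> ?A" for w
    using that
  proof (induction w)
    case Nil
    then show ?case by (simp add: one_free_group[symmetric])
  next
    case (Cons l w)
    then have "free_class X0 (l # w) = free_class X0 [l] \<otimes>\<^bsub>?F\<^esub> free_class X0 w"
      using free_class_append[of "[l]" X0 w] by auto
    then show ?case
      using Cons by (simp add: e_def free_class_closed)
  qed
  have e_inv: "e (x, \<not> b) = inv (e (x, b))" if "x \<in> X0" for x b
  proof -
    have "([(x, \<not> b), (x, \<not> \<not> b)], []) \<in> free_equiv X0"
      using free_equiv.cancel[of "[]" X0 "[]" x "\<not> b"] that by simp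
    then have "free_class X0 [(x, \<not> b), (x, b)] = free_class X0 []"
      using that by (subst free_class_eq) auto
    then have "e (x, \<not> b) \<otimes> e (x, b) = \<one>"
      using wprod_e[of "[(x, \<not> b), (x, b)]"] wprod_e[of "[]"] that e_closed by auto
    then show ?thesis
      using that e_closed by (intro inv_equality[symmetric]) auto
  qed
  define X where "X = e ` (X0 \<times> UNIV)"
  have X: "finite X" "X \<subseteq> carrier G"
    using X0 e_closed by (auto simp: X_def)
  have "inv x \<in> X" if "x \<in> X" for x
  proof -
    from that obtain y b where "y \<in> X0" "x = e (y, b)" by (auto simp: X_def)
    then show ?thesis using e_inv[of y b] unfolding X_def by (metis SigmaI UNIV_I image_eqI)
  qed
  note X = X this
  have map_e: "set (map e w) \<subseteq> X \<and> set (map e w) \<subseteq> carrier G" if "w \<in> ?A" for w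
  proof -
    have "set w \<subseteq> X0 \<times> UNIV" using that by (auto simp: lists_eq_set)
    then have "set (map e w) \<subseteq> X" by (simp add: X_def image_mono)
    with X show ?thesis by blast
  qed
  define rep where "rep = (\<lambda>A. SOME w. w \<in> A \<and> w \<in> ?A \<and> free_class X0 w = A)"
  have rep: "rep A \<in> A \<and> rep A \<in> ?A \<and> free_class X0 (rep A) = A" if "A \<in> carrier ?F" for A
  proof -
    from that obtain w where "w \<in> ?A" "A = free_class X0 w"
      unfolding carrier_free_group by blast
    then have "w \<in> A \<and> w \<in> ?A \<and> free_class X0 w = A"
      using mem_free_class by blast
    then show ?thesis
      unfolding rep_def by (rule someI)
  qed
  \<comment> \<open>Two letters are needed to cancel a letter against its inverse, and one word from
    each class in \<open>R\<close> has to be short enough to be deleted.\<close>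
  define L where "L = Max (insert 2 ((length \<circ> rep) ` R))"
  have L: "2 \<le> L" "\<And>A. A \<in> R \<Longrightarrow> length (rep A) \<le> L"
    unfolding L_def using R(1) by (auto intro: Max_ge)
  let ?h = "homot G X L (carrier G) \<one>"
  have stays [simp]: "stays G (carrier G) \<one> w" if "set w \<subseteq> X" for w
    using that X by (intro stays_carrier) auto
  have eq: "?h (map e u) (map e v)" if "(u, v) \<in> free_equiv X0" for u v
    using that
  proof induction
    case (refl w)
    then show ?case using map_e by (intro homot.refl stays) auto
  next
    case (cancel u v x b)
    have "wprod G (map e [(x, b), (x, \<not> b)]) = \<one>"
      using cancel e_inv[of x b] e_closed[of "(x, b)"] by auto
    moreover have "set (map e u @ map e [(x, b), (x, \<not> b)] @ map e v) \<subseteq> X"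
      using map_e[of "u @ [(x, b), (x, \<not> b)] @ v"] cancel by auto
    ultimately have "?h (map e u @ map e [(x, b), (x, \<not> b)] @ map e v) (map e u @ map e v)"
      using L by (intro homot.delete stays) auto
    then show ?case by simp
  qed (blast intro: homot.sym homot.trans)+
  \<comment> \<open>All representatives are required to contract, so that membership can be tested
    on any one of them (\<open>M_iff\<close>).\<close>
  define M where "M = {A \<in> carrier ?F. \<forall>w\<in>A. ?h (map e w) []}"
  have M_iff: "free_class X0 w \<in> M \<longleftrightarrow> ?h (map e w) []" if "w \<in> ?A" for w
  proof
    assume "?h (map e w) []"
    moreover have "?h (map e v) (map e w)" if "v \<in> free_class X0 w" for v
      using that by (intro eq free_equiv.sym[of w]) (simp add: free_class_def)
    ultimately show "free_class X0 w \<in> M"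
      using that by (auto simp: M_def free_class_closed intro: homot.trans)
  qed (use that mem_free_class in \<open>auto simp: M_def\<close>)
  have h_append: "?h (u @ v) []" if "?h u []" "?h v []" for u v
  proof -
    have s: "set u \<subseteq> X" "set v \<subseteq> X"
      using that homot_set by blast+
    then have "?h (u @ v) ([] @ v)"
      using that X by (intro homot_append_right) (auto intro!: stays_carrier)
    with that show ?thesis by (auto intro: homot.trans)
  qed
  have h_at: "homot G X L (carrier G) g u v" if "?h u v" "g \<in> carrier G" for u v g
  proof -
    have "homot G X L {y \<in> carrier G. g \<otimes> y \<in> carrier G} \<one> u v"
      using that by (auto intro: homot_mono)
    then show ?thesis
      using homot_translate[of X L g "carrier G" \<one> u v] that X by simp
  qed
  have inv_word: "\<exists>a'\<in>?A. inv\<^bsub>?F\<^esub> free_class X0 a = free_class X0 a' \<and>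
      free_class X0 (a @ a') = free_class X0 []" if a: "a \<in> ?A" for a
  proof -
    have "inv\<^bsub>?F\<^esub> free_class X0 a \<in> free_class X0 ` ?A"
      using F.inv_closed[OF free_class_closed[OF a]] by (simp add: carrier_free_group)
    then obtain a' where a': "a' \<in> ?A" "inv\<^bsub>?F\<^esub> free_class X0 a = free_class X0 a'"
      by blast
    have "free_class X0 (a @ a') = free_class X0 a \<otimes>\<^bsub>?F\<^esub> inv\<^bsub>?F\<^esub> free_class X0 a"
      using free_class_append[OF a a'(1)] a'(2) by simp
    also have "\<dots> = free_class X0 []"
      using F.r_inv[OF free_class_closed[OF a]] one_free_group by metis
    finally show ?thesis using a' by blast
  qed
  have "M \<lhd> ?F"
  proof (subst F.normal_inv_iff, intro conjI F.subgroupI ballI)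
    have one: "free_class X0 [] \<in> M"
      by (subst M_iff) (auto intro: homot.refl)
    show "M \<subseteq> carrier ?F" by (auto simp: M_def)
    show "M \<noteq> {}" using one by blast
    have conj: "A \<otimes>\<^bsub>?F\<^esub> B \<otimes>\<^bsub>?F\<^esub> inv\<^bsub>?F\<^esub> A \<in> M" if A: "A \<in> carrier ?F" and B: "B \<in> M" for A B
    proof -
      have "B \<in> carrier ?F" using B by (simp add: M_def)
      then obtain a b where a: "a \<in> ?A" "A = free_class X0 a" and b: "b \<in> ?A" "B = free_class X0 b"
        using A by (auto simp: carrier_free_group)
      obtain a' where a': "a' \<in> ?A" "inv\<^bsub>?F\<^esub> A = free_class X0 a'"
        "free_class X0 (a @ a') = free_class X0 []"
        using inv_word a by blast
      then have "?h (map e a @ map e a') []"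
        using eq[of "a @ a'" "[]"] a a' by (auto simp: free_class_eq)
      moreover have "?h (map e a @ map e b @ map e a') (map e a @ [] @ map e a')"
      proof (rule homot_context[OF h_at])
        show "?h (map e b) []" using b B M_iff by simp
        show "\<one> \<otimes> wprod G (map e a) \<in> carrier G"
          using map_e[OF a(1)] by blast
        have "set (map e a @ [] @ map e a') \<subseteq> X"
          using map_e[OF a(1)] map_e[OF a'(1)] by simp
        then show "stays G (carrier G) \<one> (map e a @ [] @ map e a')" "set (map e a @ map e a') \<subseteq> X"
          by (rule stays) (use map_e[OF a(1)] map_e[OF a'(1)] in simp)
      qed (use X in auto)
      ultimately have "?h (map e (a @ b @ a')) []"
        by (auto intro: homot.trans)
      moreover have "A \<otimes>\<^bsub>?F\<^esub> B \<otimes>\<^bsub>?F\<^esub> inv\<^bsub>?F\<^esub> A = free_class X0 (a @ b @ a')"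
        using a b a' F.m_assoc[OF free_class_closed free_class_closed free_class_closed, of a b a']
        by (simp add: free_class_append)
      ultimately show ?thesis
        using a b a' by (simp add: M_iff)
    qed
    show "A \<otimes>\<^bsub>?F\<^esub> B \<otimes>\<^bsub>?F\<^esub> inv\<^bsub>?F\<^esub> A \<in> M" if "A \<in> carrier ?F" "B \<in> M" for A B
      using that by (rule conj)
    show "A \<otimes>\<^bsub>?F\<^esub> B \<in> M" if "A \<in> M" "B \<in> M" for A B
    proof -
      have "A \<in> carrier ?F" "B \<in> carrier ?F" using that by (auto simp: M_def)
      then obtain a b where "a \<in> ?A" "A = free_class X0 a" "b \<in> ?A" "B = free_class X0 b"
        by (auto simp: carrier_free_group)
      with that h_append show ?thesis
        by (simp add: M_iff flip: free_class_append)
    qed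
    show "inv\<^bsub>?F\<^esub> A \<in> M" if "A \<in> M" for A
    proof -
      have A: "A \<in> carrier ?F" using that by (auto simp: M_def)
      then obtain a where a: "a \<in> ?A" "A = free_class X0 a"
        by (auto simp: carrier_free_group)
      obtain a' where a': "a' \<in> ?A" "inv\<^bsub>?F\<^esub> A = free_class X0 a'"
        "free_class X0 (a @ a') = free_class X0 []"
        using inv_word a by blast
      then have 1: "?h (map e a @ map e a') []"
        using eq[of "a @ a'" "[]"] a a' by (auto simp: free_class_eq)
      have "?h (map e a @ map e a') ([] @ map e a')"
        using that a a' M_iff map_e X by (intro homot_append_right) (auto intro!: stays_carrier)
      with 1 have "?h (map e a') []"
        by (auto intro: homot.trans homot.sym)
      then show ?thesis using a' M_iff by simp
    qed
  qed
  moreover have "R \<subseteq> M"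
  proof
    fix A assume A: "A \<in> R"
    then have AF: "A \<in> carrier ?F" using R by auto
    have "\<pi> A = \<one>"
      using ker[OF AF] A N(2) by auto
    then have "wprod G (map e (rep A)) = \<one>"
      using rep[OF AF] wprod_e by simp
    then have "?h ([] @ map e (rep A) @ []) ([] @ [])"
      using L A rep[OF AF] map_e by (intro homot.delete stays) auto
    then show "A \<in> M"
      using M_iff[of "rep A"] rep[OF AF] by simp
  qed
  ultimately have NM: "?N \<subseteq> M" by (rule N(3))
  have "word_presented G X L"
    unfolding word_presented_def
  proof (intro conjI X allI impI ballI)
    fix g assume "g \<in> carrier G"
    then obtain w where w: "w \<in> ?A" "\<pi> (free_class X0 w) = g"
      using surj by (force simp: carrier_free_group)
    then show "\<exists>w. set w \<subseteq> X \<and> wprod G w = g"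
      using map_e wprod_e by (intro exI[of _ "map e w"]) auto
  next
    fix v assume v: "set v \<subseteq> X" "wprod G v = \<one>"
    then have "v \<in> lists X" by (simp add: lists_eq_set)
    then obtain w where w: "w \<in> ?A" "v = map e w"
      unfolding X_def lists_image by blast
    then have "free_class X0 w \<in> ?N"
      using v(2) wprod_e[OF w(1)] ker[OF free_class_closed[OF w(1)]] by simp
    then show "?h v []"
      using NM M_iff w by auto
  qed
  then show thesis by (rule that)
qed

text \<open>Each element of \<open>X\<close> receives a positive letter, so it is also named by the
  formal inverse of the letter of its inverse. Modulo the trivial words of length at most
  \<open>L'\<close>, a word depends only on its image word over \<open>X\<close>
  (\<open>\<tau>_word\<close>), and then only on the homotopy class of that
  (\<open>\<tau>_homot\<close>).\<close>

lemma word_presented_imp_finitely_presented: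
  fixes G :: "('a, 'm) monoid_scheme" (structure)
  assumes "group G" "word_presented G X L"
  shows "finitely_presented G"
proof -
  interpret group G by fact
  from assms(2) have X: "finite X" "X \<subseteq> carrier G" and inv: "\<And>x. x \<in> X \<Longrightarrow> inv x \<in> X"
    and gen: "\<And>g. g \<in> carrier G \<Longrightarrow> \<exists>w. set w \<subseteq> X \<and> wprod G w = g"
    and triv: "\<And>w. set w \<subseteq> X \<Longrightarrow> wprod G w = \<one> \<Longrightarrow> homot G X L (carrier G) \<one> w []"
    unfolding word_presented_def by auto
  define n where "n = card X"
  define X0 where "X0 = {..<n}"
  obtain f where f: "bij_betw f X0 X"
    using ex_bij_betw_nat_finite[OF X(1)] by (auto simp: X0_def n_def atLeast0LessThan)
  let ?F = "free_group X0" and ?A = "lists (X0 \<times> (UNIV :: bool set))"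
  interpret F: group ?F by (rule group_free_group)
  define e where "e = (\<lambda>(i, b). if b then f i else inv (f i))"
  have f_X: "f i \<in> X" if "i \<in> X0" for i
    using that f by (auto simp: bij_betw_def)
  have e_X: "e l \<in> X" if "l \<in> X0 \<times> UNIV" for l
    using that f_X inv by (auto simp: e_def)
  have map_e: "set (map e w) \<subseteq> X" "set (map e w) \<subseteq> carrier G" if "w \<in> ?A" for w
  proof -
    have "set w \<subseteq> X0 \<times> UNIV" using that by (auto simp: lists_eq_set)
    then show "set (map e w) \<subseteq> X" using e_X by auto
    then show "set (map e w) \<subseteq> carrier G" using X by blast
  qed
  have eq: "wprod G (map e u) = wprod G (map e v)" if "(u, v) \<in> free_equiv X0" for u v
    using that
  proof induction
    case (cancel u v x b)
    have "f x \<in> carrier G" using cancel f_X X by blast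
    then have "wprod G (map e [(x, b), (x, \<not> b)]) = \<one>"
      by (simp add: e_def)
    moreover have "[(x, b), (x, \<not> b)] \<in> ?A" using cancel by simp
    ultimately have "wprod G (map e ([(x, b), (x, \<not> b)] @ v)) = wprod G (map e v)"
      unfolding map_append using map_e[OF cancel(2)] map_e[of "[(x, b), (x, \<not> b)]"]
      by (subst wprod_append) auto
    then show ?case
      using map_e[OF cancel(1)] map_e[OF cancel(2)] map_e[of "[(x, b), (x, \<not> b)] @ v"] cancel
      by (simp only: map_append wprod_append append_in_lists_conv) auto
  qed simp_all
  define \<pi> where "\<pi> = (\<lambda>A. wprod G (map e (SOME w. w \<in> A)))"
  have \<pi>_class: "\<pi> (free_class X0 w) = wprod G (map e w)" if "w \<in> ?A" for w
  proof -
    have "(SOME v. v \<in> free_class X0 w) \<in> free_class X0 w"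
      using mem_free_class[OF that] by (rule someI)
    then show ?thesis
      unfolding \<pi>_def using eq by (simp add: free_class_def)
  qed
  have carF: "\<exists>w\<in>?A. A = free_class X0 w" if "A \<in> carrier ?F" for A
    using that by (auto simp: carrier_free_group)
  interpret \<pi>: group_hom ?F G \<pi>
  proof (unfold_locales, rule homI)
    fix A assume "A \<in> carrier ?F"
    then show "\<pi> A \<in> carrier G"
      using carF \<pi>_class map_e by (metis wprod_closed)
  next
    fix A B assume "A \<in> carrier ?F" "B \<in> carrier ?F"
    then obtain u v where u: "u \<in> ?A" "A = free_class X0 u" and v: "v \<in> ?A" "B = free_class X0 v"
      using carF by blast
    then have "A \<otimes>\<^bsub>?F\<^esub> B = free_class X0 (u @ v)"
      using free_class_append by metis
    then show "\<pi> (A \<otimes>\<^bsub>?F\<^esub> B) = \<pi> A \<otimes> \<pi> B"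
      using u v \<pi>_class[of "u @ v"] \<pi>_class map_e by simp
  qed
  \<comment> \<open>Length two is needed to identify the two letters that have the same value, even
    if \<open>L\<close> is smaller.\<close>
  define L' where "L' = max L 2"
  define R where "R = free_class X0 ` {w \<in> ?A. length w \<le> L' \<and> wprod G (map e w) = \<one>}"
  have "finite (X0 \<times> (UNIV :: bool set))"
    by (simp add: X0_def)
  then have "finite {w. set w \<subseteq> X0 \<times> (UNIV :: bool set) \<and> length w \<le> L'}"
    by (rule finite_lists_length_le)
  then have finR: "finite R"
    unfolding R_def by (intro finite_imageI) (rule finite_subset[rotated], auto simp: lists_eq_set)
  have RF: "R \<subseteq> carrier ?F"
    using free_class_closed by (auto simp: R_def)
  note NC = F.normal_closure_normal[OF RF]
  let ?N = "normal_closure ?F R"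
  interpret N: normal ?N ?F by (rule NC(1))
  interpret Q: group "?F Mod ?N" by (rule N.factorgroup_is_group)
  define \<tau> where "\<tau> = (\<lambda>w. ?N #>\<^bsub>?F\<^esub> free_class X0 w)"
  have \<tau>_closed: "\<tau> w \<in> carrier (?F Mod ?N)" if "w \<in> ?A" for w
    using free_class_closed[OF that] by (auto simp: \<tau>_def FactGroup_def RCOSETS_def)
  have \<tau>_append: "\<tau> (u @ v) = \<tau> u \<otimes>\<^bsub>?F Mod ?N\<^esub> \<tau> v" if "u \<in> ?A" "v \<in> ?A" for u v
    unfolding \<tau>_def free_class_append[OF that]
    using N.r_coset_hom_Mod free_class_closed[OF that(1)] free_class_closed[OF that(2)]
    by (simp add: hom_def)
  have \<tau>_one: "\<tau> w = \<one>\<^bsub>?F Mod ?N\<^esub> \<longleftrightarrow> free_class X0 w \<in> ?N" if "w \<in> ?A" for w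
    using F.coset_join1[of ?N "free_class X0 w"] F.coset_join2[of "free_class X0 w" ?N]
      free_class_closed[OF that] N.subgroup_axioms N.subset
    unfolding \<tau>_def FactGroup_def by auto
  have \<tau>_R: "\<tau> w = \<one>\<^bsub>?F Mod ?N\<^esub>" if "w \<in> ?A" "length w \<le> L'" "wprod G (map e w) = \<one>" for w
    using \<tau>_one[OF that(1)] NC(2) that by (auto simp: R_def)
  define l where "l = (\<lambda>x. (the_inv_into X0 f x, True))"
  have l: "l x \<in> X0 \<times> UNIV \<and> e (l x) = x" if "x \<in> X" for x
    using f that by (auto simp: l_def e_def bij_betw_def the_inv_into_into f_the_inv_into_f)
  have map_l: "map l w \<in> ?A" "map e (map l w) = w" if "set w \<subseteq> X" for w
  proof -
    show "map l w \<in> ?A" using that l by (auto simp: in_lists_conv_set)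
    show "map e (map l w) = w" using that l by (induction w) auto
  qed
  \<comment> \<open>Modulo relators of length two, both letters are inverse to
    \<open>(i, \<not> b)\<close>.\<close>
  have \<tau>_letter: "\<tau> [(i, b)] = \<tau> [l (e (i, b))]" if "i \<in> X0" for i b
  proof -
    let ?x = "e (i, b)" and ?y = "e (i, \<not> b)"
    have x: "?x \<in> X" "?y \<in> X" and xy: "?x \<otimes> ?y = \<one>" "?y \<otimes> ?x = \<one>"
      using that e_X[of "(i, b)"] e_X[of "(i, \<not> b)"] f_X[of i] X by (auto simp: e_def)
    have A: "[(i, b)] \<in> ?A" "[(i, \<not> b)] \<in> ?A" "[l ?x] \<in> ?A"
      using that l[OF x(1)] by auto
    have "\<tau> ([(i, b)] @ [(i, \<not> b)]) = \<one>\<^bsub>?F Mod ?N\<^esub>"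
      using that x xy X by (intro \<tau>_R) (auto simp: L'_def)
    moreover have "\<tau> ([l ?x] @ [(i, \<not> b)]) = \<one>\<^bsub>?F Mod ?N\<^esub>"
      using that x xy X l by (intro \<tau>_R) (auto simp: L'_def)
    ultimately have "\<tau> [(i, b)] \<otimes>\<^bsub>?F Mod ?N\<^esub> \<tau> [(i, \<not> b)] = \<tau> [l ?x] \<otimes>\<^bsub>?F Mod ?N\<^esub> \<tau> [(i, \<not> b)]"
      using A by (simp only: \<tau>_append)
    then show ?thesis
      using Q.right_cancel[of "\<tau> [(i, \<not> b)]"] A \<tau>_closed by metis
  qed
  have \<tau>_word: "\<tau> w = \<tau> (map l (map e w))" if "w \<in> ?A" for w
    using that
  proof (induction w)
    case (Cons a w)
    obtain i b where a: "a = (i, b)" "i \<in> X0" using Cons.hyps(1) by (cases a) auto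
    have "\<tau> ([a] @ w) = \<tau> [a] \<otimes>\<^bsub>?F Mod ?N\<^esub> \<tau> w"
      using Cons.hyps by (intro \<tau>_append) auto
    also have "\<dots> = \<tau> [l (e a)] \<otimes>\<^bsub>?F Mod ?N\<^esub> \<tau> (map l (map e w))"
      using Cons \<tau>_letter a by simp
    also have "\<dots> = \<tau> ([l (e a)] @ map l (map e w))"
      using l[of "e a"] e_X a map_l(1)[of "map e w"] map_e(1)[of w] Cons.hyps
      by (intro \<tau>_append[symmetric]) auto
    finally show ?case by simp
  qed simp
  have \<tau>_homot: "\<tau> (map l u) = \<tau> (map l v)" if "homot G X L (carrier G) \<one> u v" for u v
    using that
  proof induction
    case (delete u s v)
    have A: "map l u \<in> ?A" "map l s \<in> ?A" "map l v \<in> ?A"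
      using delete map_l(1) by auto
    have "\<tau> (map l s) = \<one>\<^bsub>?F Mod ?N\<^esub>"
      using delete A map_l(2)[of s] by (intro \<tau>_R) (auto simp: L'_def)
    then have "\<tau> (map l s @ map l v) = \<tau> (map l v)"
      using Q.l_one[OF \<tau>_closed[OF A(3)]] \<tau>_append[OF A(2,3)] by metis
    moreover have "\<tau> (map l u @ (map l s @ map l v)) = \<tau> (map l u) \<otimes>\<^bsub>?F Mod ?N\<^esub> \<tau> (map l s @ map l v)"
      using A by (intro \<tau>_append) auto
    moreover have "\<tau> (map l u @ map l v) = \<tau> (map l u) \<otimes>\<^bsub>?F Mod ?N\<^esub> \<tau> (map l v)"
      using A by (intro \<tau>_append) auto
    ultimately show ?case by simp
  qed auto
  have ker: "kernel ?F G \<pi> = ?N"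
  proof
    show "?N \<subseteq> kernel ?F G \<pi>"
    proof (rule NC(3))
      show "kernel ?F G \<pi> \<lhd> ?F" by (rule \<pi>.normal_kernel)
      show "R \<subseteq> kernel ?F G \<pi>"
      proof
        fix A assume A: "A \<in> R"
        then obtain w where "w \<in> ?A" "A = free_class X0 w" "wprod G (map e w) = \<one>"
          unfolding R_def by blast
        then show "A \<in> kernel ?F G \<pi>"
          using \<pi>_class[of w] RF A by (auto simp: kernel_def)
      qed
    qed
    show "kernel ?F G \<pi> \<subseteq> ?N"
    proof
      fix A assume "A \<in> kernel ?F G \<pi>"
      then have A: "A \<in> carrier ?F" "\<pi> A = \<one>" by (auto simp: kernel_def)
      then obtain w where w: "w \<in> ?A" "A = free_class X0 w" using carF by blast
      then have "homot G X L (carrier G) \<one> (map e w) []"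
        using A \<pi>_class map_e by (intro triv) auto
      then have "\<tau> w = \<tau> []"
        using \<tau>_homot \<tau>_word[OF w(1)] by fastforce
      also have "\<dots> = \<one>\<^bsub>?F Mod ?N\<^esub>"
        by (intro \<tau>_R) auto
      finally show "A \<in> ?N"
        using \<tau>_one w by blast
    qed
  qed
  have "\<pi> ` carrier ?F = carrier G"
  proof
    show "\<pi> ` carrier ?F \<subseteq> carrier G" by (auto intro: \<pi>.hom_closed)
    show "carrier G \<subseteq> \<pi> ` carrier ?F"
    proof
      fix g assume "g \<in> carrier G"
      then obtain w where w: "set w \<subseteq> X" "wprod G w = g" using gen by blast
      then have "\<pi> (free_class X0 (map l w)) = g"
        using \<pi>_class map_l by simp
      then show "g \<in> \<pi> ` carrier ?F"
        using free_class_closed[OF map_l(1)[OF w(1)]] by blast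
    qed
  qed
  then have "?F Mod ?N \<cong> G"
    using \<pi>.FactGroup_iso ker by simp
  then have "G \<cong> ?F Mod ?N"
    by (rule Q.iso_sym)
  moreover have "finite X0" by (simp add: X0_def)
  ultimately show ?thesis
    unfolding finitely_presented_def using finR RF by blast
qed

section \<open>Type \<open>FP\<^sub>1\<close> and connectivity\<close>

text \<open>Edges of the Cayley graph may be traversed backwards, but only to a vertex of the
  monoid; for the monoid of a character this is what keeps a path inside the half space.\<close>

inductive conn :: "('g, 'm) monoid_scheme \<Rightarrow> 'g set \<Rightarrow> 'g \<Rightarrow> 'g \<Rightarrow> bool"
  for M T x where
  refl: "x \<in> carrier M \<Longrightarrow> conn M T x x"
| step: "\<lbrakk>conn M T x y; t \<in> T\<rbrakk> \<Longrightarrow> conn M T x (y \<otimes>\<^bsub>M\<^esub> t)"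
| unstep: "\<lbrakk>conn M T x (y \<otimes>\<^bsub>M\<^esub> t); y \<in> carrier M; t \<in> T\<rbrakk> \<Longrightarrow> conn M T x y"

definition fin_connected :: "('g, 'm) monoid_scheme \<Rightarrow> bool" where
  "fin_connected M \<longleftrightarrow> (\<exists>T. finite T \<and> T \<subseteq> carrier M \<and> (\<forall>g\<in>carrier M. conn M T \<one>\<^bsub>M\<^esub> g))"

lemma augmentation_0 [simp]: "augmentation 0 = 0"
  by (simp add: augmentation_def)

lemma augmentation_add: "augmentation (c + d) = augmentation c + augmentation d"
  using augmentation_diff[of "c + d" d] by simp

lemma augmentation_cmul: "augmentation (frag_cmul n c) = n * augmentation c"
proof -
  have "augmentation (frag_cmul n c) = (\<Sum>g\<in>Poly_Mapping.keys c. Poly_Mapping.lookup (frag_cmul n c) g)"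
    unfolding augmentation_def using keys_cmul[of n c]
    by (intro sum.mono_neutral_left) (auto simp: in_keys_iff)
  then show ?thesis
    by (simp add: augmentation_def sum_distrib_left)
qed

text \<open>The linear functional that sums the coefficients over \<open>C\<close>. For a component
  \<open>C\<close> of a Cayley graph it is the 0-cocycle that detects disconnectedness.\<close>

definition restrict_augmentation :: "'g set \<Rightarrow> ('g \<Rightarrow>\<^sub>0 int) \<Rightarrow> int" where
  "restrict_augmentation C c = augmentation (frag_extend (\<lambda>g. if g \<in> C then frag_of g else 0) c)"

lemma restrict_augmentation_simps [simp]:
  "restrict_augmentation C 0 = 0"
  "restrict_augmentation C (frag_of g) = (if g \<in> C then 1 else 0)"
  "restrict_augmentation C (c - d) = restrict_augmentation C c - restrict_augmentation C d"
  by (simp_all add: restrict_augmentation_def frag_extend_diff augmentation_diff)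

lemma restrict_augmentation_add [simp]:
  "restrict_augmentation C (c + d) = restrict_augmentation C c + restrict_augmentation C d"
  using restrict_augmentation_simps(3)[of C "c + d" d] by simp

text \<open>A product \<open>h t\<close> with \<open>t\<close> in \<open>T\<close> counts exactly
  when \<open>h\<close> does, so the right factor enters only through its augmentation.\<close>

lemma restrict_augmentation_mult:
  assumes "Poly_Mapping.keys c \<subseteq> carrier M" "Poly_Mapping.keys d \<subseteq> T"
    and C: "\<And>h t. h \<in> carrier M \<Longrightarrow> t \<in> T \<Longrightarrow> h \<otimes>\<^bsub>M\<^esub> t \<in> C \<longleftrightarrow> h \<in> C"
  shows "restrict_augmentation C (c \<otimes>\<^bsub>monoid_ring M\<^esub> d) = restrict_augmentation C c * augmentation d"
  using assms(1)
proof (induction c rule: frag_induction)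
  case (one h)
  from assms(2) show ?case
    by (induction d rule: frag_induction)
      (use C one in \<open>simp_all add: monoid_ring_mult_diff augmentation_diff\<close>)
qed (simp_all add: monoid_ring_mult_diff left_diff_distrib)

lemma monoid_ring_simps:
  "carrier (monoid_ring M) = {c. Poly_Mapping.keys c \<subseteq> carrier M}"
  "c \<oplus>\<^bsub>monoid_ring M\<^esub> d = c + d" "\<zero>\<^bsub>monoid_ring M\<^esub> = 0" "\<one>\<^bsub>monoid_ring M\<^esub> = frag_of \<one>\<^bsub>M\<^esub>"
  by (simp_all add: monoid_ring_def)

lemma trivial_module_simps:
  "carrier trivial_module = UNIV" "x \<oplus>\<^bsub>trivial_module\<^esub> y = x + y" "\<zero>\<^bsub>trivial_module\<^esub> = 0"
  "c \<odot>\<^bsub>trivial_module\<^esub> x = augmentation c * x"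
  by (simp_all add: trivial_module_def)

lemma free_module_simps:
  "c \<in> carrier (free_module R S) \<longleftrightarrow>
    (\<forall>x. c x \<in> carrier R) \<and> finite {x. c x \<noteq> \<zero>\<^bsub>R\<^esub>} \<and> {x. c x \<noteq> \<zero>\<^bsub>R\<^esub>} \<subseteq> S"
  "c \<oplus>\<^bsub>free_module R S\<^esub> d = (\<lambda>x. c x \<oplus>\<^bsub>R\<^esub> d x)" "\<zero>\<^bsub>free_module R S\<^esub> = (\<lambda>x. \<zero>\<^bsub>R\<^esub>)"
  "a \<odot>\<^bsub>free_module R S\<^esub> c = (\<lambda>x. a \<otimes>\<^bsub>R\<^esub> c x)"
  by (simp_all add: free_module_def)

text \<open>The ring as a module over itself is realised by functions supported on
  \<open>{0}\<close>, which fits the type \<open>nat \<Rightarrow> _\<close> prescribed for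
  resolutions.\<close>

lemma augmentation_hom:
  assumes "monoid M"
  shows "(\<lambda>c. augmentation (c (0::nat))) \<in>
      left_module_hom (monoid_ring M) (free_module (monoid_ring M) {0}) trivial_module"
    "(\<lambda>c. augmentation (c (0::nat))) ` carrier (free_module (monoid_ring M) {0}) = carrier trivial_module"
proof -
  show "(\<lambda>c. augmentation (c (0::nat))) \<in>
      left_module_hom (monoid_ring M) (free_module (monoid_ring M) {0}) trivial_module"
    by (auto simp: left_module_hom_def free_module_simps monoid_ring_simps trivial_module_simps
        augmentation_add augmentation_mult)
  show "(\<lambda>c. augmentation (c (0::nat))) ` carrier (free_module (monoid_ring M) {0}) = carrier trivial_module"
  proof (intro equalityI subsetI)
    fix n :: int
    let ?c = "\<lambda>x :: nat. if x = 0 then frag_cmul n (frag_of \<one>\<^bsub>M\<^esub>) else 0"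
    have "{x. ?c x \<noteq> 0} \<subseteq> {0}" by auto
    moreover from this have "finite {x. ?c x \<noteq> 0}"
      by (rule finite_subset) simp
    moreover have "Poly_Mapping.keys (frag_cmul n (frag_of \<one>\<^bsub>M\<^esub>)) \<subseteq> carrier M"
      using keys_cmul[of n "frag_of \<one>\<^bsub>M\<^esub>"] monoid.one_closed[OF assms] by auto
    ultimately have "?c \<in> carrier (free_module (monoid_ring M) {0})"
      by (auto simp: free_module_simps monoid_ring_simps)
    moreover have "augmentation (?c 0) = n"
      by (simp add: augmentation_cmul)
    ultimately show "n \<in> (\<lambda>c. augmentation (c (0::nat))) ` carrier (free_module (monoid_ring M) {0})"
      by (intro image_eqI[where x = ?c]) auto
  qed (simp add: trivial_module_simps)
qed

text \<open>Let \<open>h\<close> lift \<epsilon> to the free module of rank one, where the finitely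
  many generators of the kernel of \<epsilon> become ring elements \<open>\<kappa> s\<close> of
  augmentation zero. The functional of the component of \<open>\<one>\<close> kills all left
  multiples of elements of augmentation zero supported on \<open>T\<close>. Hence it kills
  \<open>g - \<one>\<close>, which forces \<open>g\<close> into that component.\<close>

lemma FP_monoid_imp_fin_connected:
  fixes M :: "('g, 'm) monoid_scheme"
  assumes "monoid M" "FP_monoid 1 M"
  shows "fin_connected M"
proof -
  interpret M: monoid M by fact
  let ?R = "monoid_ring M" and ?Z = "trivial_module :: ('g \<Rightarrow>\<^sub>0 int, int) module"
  let ?F = "free_module ?R {0::nat}"
  interpret R: ring ?R by (rule ring_monoid_ring) fact
  from assms(2) obtain P :: "nat \<Rightarrow> ('g \<Rightarrow>\<^sub>0 int, nat \<Rightarrow> 'g \<Rightarrow>\<^sub>0 int) module" and d \<epsilon>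
    where res: "projective_resolution ?R ?Z P d \<epsilon>" and fg: "finitely_generated_module ?R (P 1)"
    unfolding FP_monoid_def FP_type_def by auto
  from res have proj: "projective_module ?R (P 0)" "projective_module ?R (P (Suc 0))"
    and \<epsilon>: "\<epsilon> \<in> left_module_hom ?R (P 0) ?Z" "\<epsilon> ` carrier (P 0) = carrier ?Z"
    and d0: "d 0 \<in> left_module_hom ?R (P (Suc 0)) (P 0)"
    and ker: "d 0 ` carrier (P 1) = module_kernel (P 0) ?Z \<epsilon>"
    unfolding projective_resolution_def by auto
  interpret P0: left_module ?R "P 0" using proj by (simp add: projective_module_def)
  interpret P1: left_module ?R "P (Suc 0)" using proj by (simp add: projective_module_def)
  interpret F: left_module ?R ?F by (rule left_module_free_module) (rule R.ring_axioms)
  obtain h where h: "h \<in> left_module_hom ?R (P 0) ?F"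
    and h\<epsilon>: "\<And>x. x \<in> carrier (P 0) \<Longrightarrow> augmentation (h x 0) = \<epsilon> x"
    using projective_module_lift[OF proj(1) F.left_module_axioms left_module_trivial_module[OF assms(1)]
        augmentation_hom[OF assms(1)] \<epsilon>(1)] by auto
  have h_closed: "h x 0 \<in> carrier ?R" if "x \<in> carrier (P 0)" for x
    using h that by (auto simp: left_module_hom_def free_module_simps Pi_iff)
  obtain e where e: "e \<in> carrier (P 0)" "\<epsilon> e = 1"
    using \<epsilon>(2) by (metis UNIV_I imageE trivial_module_simps(1))
  obtain S where S: "S \<subseteq> carrier (P 1)" "finite S"
    and span: "\<And>x. x \<in> carrier (P 1) \<Longrightarrow> \<exists>c \<in> S \<rightarrow> carrier ?R. x = (\<Oplus>\<^bsub>P 1\<^esub>s\<in>S. c s \<odot>\<^bsub>P 1\<^esub> s)"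
    using fg unfolding finitely_generated_module_def by blast
  define \<gamma> where "\<gamma> = h e 0"
  define \<kappa> where "\<kappa> = (\<lambda>s. h (d 0 s) 0)"
  have d0S: "d 0 s \<in> carrier (P 0)" "\<epsilon> (d 0 s) = 0" if "s \<in> carrier (P 1)" for s
    using ker that by (auto simp: module_kernel_def trivial_module_simps)
  have \<gamma>: "\<gamma> \<in> carrier ?R" "augmentation \<gamma> = 1"
    using e h_closed h\<epsilon> by (auto simp: \<gamma>_def)
  have \<kappa>: "\<kappa> s \<in> carrier ?R" "augmentation (\<kappa> s) = 0" if "s \<in> S" for s
    using d0S that S h_closed h\<epsilon> by (auto simp: \<kappa>_def)
  \<comment> \<open>Only the augmentation of \<gamma> is known to be one; having the support of
    \<open>\<one> - \<gamma>\<close> in \<open>T\<close> allows \<open>r\<close> to replace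
    \<open>r \<gamma>\<close> under the functional.\<close>
  define T where "T = Poly_Mapping.keys (frag_of \<one>\<^bsub>M\<^esub> - \<gamma>) \<union> (\<Union>s\<in>S. Poly_Mapping.keys (\<kappa> s))"
  have "finite T" using S by (simp add: T_def)
  moreover have T: "T \<subseteq> carrier M"
    using \<kappa>(1) \<gamma>(1) keys_diff[of "frag_of \<one>\<^bsub>M\<^esub>" \<gamma>] by (auto simp: T_def monoid_ring_simps)
  moreover have "conn M T \<one>\<^bsub>M\<^esub> g" if g: "g \<in> carrier M" for g
  proof -
    let ?C = "{g. conn M T \<one>\<^bsub>M\<^esub> g}"
    have C: "x \<otimes>\<^bsub>M\<^esub> t \<in> ?C \<longleftrightarrow> x \<in> ?C" if "x \<in> carrier M" "t \<in> T" for x t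
      using that by (auto intro: conn.intros)
    let ?\<phi> = "restrict_augmentation ?C"
    have \<phi>: "?\<phi> (c \<otimes>\<^bsub>?R\<^esub> k) = 0"
      if "c \<in> carrier ?R" "Poly_Mapping.keys k \<subseteq> T" "augmentation k = 0" for c k
      using restrict_augmentation_mult[of c M k T ?C] that C by (simp add: monoid_ring_simps)
    define r where "r = frag_of g - frag_of \<one>\<^bsub>M\<^esub>"
    have r: "r \<in> carrier ?R" "augmentation r = 0"
      using g keys_diff[of "frag_of g" "frag_of \<one>\<^bsub>M\<^esub>"]
      by (auto simp: r_def monoid_ring_simps augmentation_diff)
    have "\<epsilon> (r \<odot>\<^bsub>P 0\<^esub> e) = 0"
      using \<epsilon>(1) r e by (auto simp: left_module_hom_def trivial_module_simps)
    then have "r \<odot>\<^bsub>P 0\<^esub> e \<in> d 0 ` carrier (P 1)"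
      unfolding ker using r e by (auto simp: module_kernel_def trivial_module_simps)
    then obtain y where y: "y \<in> carrier (P 1)" "r \<odot>\<^bsub>P 0\<^esub> e = d 0 y" by blast
    obtain c where c: "c \<in> S \<rightarrow> carrier ?R" "y = (\<Oplus>\<^bsub>P (Suc 0)\<^esub>s\<in>S. c s \<odot>\<^bsub>P (Suc 0)\<^esub> s)"
      using span[OF y(1)] by auto
    have cs: "c s \<odot>\<^bsub>P (Suc 0)\<^esub> s \<in> carrier (P (Suc 0))" if "s \<in> S" for s
      using c(1) S that by auto
    have d0y: "d 0 y = (\<Oplus>\<^bsub>P 0\<^esub>s\<in>S. d 0 (c s \<odot>\<^bsub>P (Suc 0)\<^esub> s))"
      unfolding c(2) using c(1) S
      by (intro left_module_hom_finsum[OF P1.left_module_axioms P0.left_module_axioms d0]) auto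
    have "h (d 0 y) = (\<Oplus>\<^bsub>?F\<^esub>s\<in>S. h (d 0 (c s \<odot>\<^bsub>P (Suc 0)\<^esub> s)))"
      unfolding d0y using d0S(1)[simplified, OF cs]
      by (intro left_module_hom_finsum[OF P0.left_module_axioms F.left_module_axioms h]) auto
    then have hy: "h (r \<odot>\<^bsub>P 0\<^esub> e) = (\<Oplus>\<^bsub>?F\<^esub>s\<in>S. h (d 0 (c s \<odot>\<^bsub>P (Suc 0)\<^esub> s)))"
      by (simp add: y)
    have summand: "h (d 0 (c s \<odot>\<^bsub>P (Suc 0)\<^esub> s)) \<in> carrier ?F \<and> ?\<phi> (h (d 0 (c s \<odot>\<^bsub>P (Suc 0)\<^esub> s)) 0) = 0"
      if s: "s \<in> S" for s
    proof -
      have cs: "c s \<in> carrier ?R" and s1: "s \<in> carrier (P (Suc 0))" using c s S by auto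
      have "h (d 0 (c s \<odot>\<^bsub>P (Suc 0)\<^esub> s)) = c s \<odot>\<^bsub>?F\<^esub> h (d 0 s)"
        using cs s1 d0 h d0S by (auto simp: left_module_hom_def)
      moreover have "h (d 0 s) \<in> carrier ?F"
        using s1 d0S h by (auto simp: left_module_hom_def)
      moreover have "Poly_Mapping.keys (\<kappa> s) \<subseteq> T"
        using s by (auto simp: T_def)
      ultimately show ?thesis
        using \<phi>[OF cs] \<kappa>[OF s] cs F.smult_closed[OF cs] by (simp add: free_module_simps(4) \<kappa>_def)
    qed
    have sum0: "?\<phi> ((\<Oplus>\<^bsub>?F\<^esub>s\<in>A. f s) 0) = 0"
      if "\<And>s. s \<in> A \<Longrightarrow> f s \<in> carrier ?F \<and> ?\<phi> (f s 0) = 0" for A and f :: "_ \<Rightarrow> nat \<Rightarrow> 'g \<Rightarrow>\<^sub>0 int"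
      using that
    proof (induction A rule: infinite_finite_induct)
      case (insert x A)
      then show ?case
        by (subst F.M.finsum_insert) (auto simp: free_module_simps(2) monoid_ring_simps)
    qed (simp_all add: free_module_simps monoid_ring_simps)
    have "h (r \<odot>\<^bsub>P 0\<^esub> e) = r \<odot>\<^bsub>?F\<^esub> h e"
      using h r e by (auto simp: left_module_hom_def)
    then have "?\<phi> (r \<otimes>\<^bsub>?R\<^esub> \<gamma>) = 0"
      using sum0[of S "\<lambda>s. h (d 0 (c s \<odot>\<^bsub>P (Suc 0)\<^esub> s))"] summand hy by (simp add: free_module_simps(4) \<gamma>_def)
    moreover have "?\<phi> (r \<otimes>\<^bsub>?R\<^esub> (frag_of \<one>\<^bsub>M\<^esub> - \<gamma>)) = 0"
      using r \<gamma> by (intro \<phi>) (auto simp: T_def augmentation_diff)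
    moreover have "r \<otimes>\<^bsub>?R\<^esub> (frag_of \<one>\<^bsub>M\<^esub> - \<gamma>) = r - r \<otimes>\<^bsub>?R\<^esub> \<gamma>"
      using R.r_one[OF r(1)] by (simp add: monoid_ring_mult_diff monoid_ring_simps)
    ultimately have "?\<phi> r = 0" by simp
    moreover have "\<one>\<^bsub>M\<^esub> \<in> ?C" by (auto intro: conn.refl)
    ultimately show ?thesis
      by (auto simp: r_def split: if_splits)
  qed
  ultimately show ?thesis
    unfolding fin_connected_def by blast
qed

section \<open>Free resolutions\<close>

definition unit_vector :: "('r, 'k) ring_scheme \<Rightarrow> 'x \<Rightarrow> 'x \<Rightarrow> 'r" where
  "unit_vector R x = (\<lambda>y. if y = x then \<one>\<^bsub>R\<^esub> else \<zero>\<^bsub>R\<^esub>)"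

lemma (in ring) unit_vector_closed:
  "x \<in> S \<Longrightarrow> unit_vector R x \<in> carrier (free_module R S)"
proof -
  have "{y. unit_vector R x y \<noteq> \<zero>} \<subseteq> {x}" by (auto simp: unit_vector_def)
  moreover from this have "finite {y. unit_vector R x y \<noteq> \<zero>}" by (rule finite_subset) simp
  ultimately show "x \<in> S \<Longrightarrow> ?thesis" by (auto simp: free_module_simps unit_vector_def)
qed

lemma (in ring) free_module_expansion:
  assumes "c \<in> carrier (free_module R S)" "finite A" "{x. c x \<noteq> \<zero>} \<subseteq> A" "A \<subseteq> S"
  shows "c = (\<Oplus>\<^bsub>free_module R S\<^esub>x\<in>A. c x \<odot>\<^bsub>free_module R S\<^esub> unit_vector R x)"
proof -
  let ?F = "free_module R S"
  interpret F: left_module R ?F by (rule left_module_free_module) (rule ring_axioms)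
  have cR: "c x \<in> carrier R" for x using assms by (auto simp: free_module_simps)
  have "(\<Oplus>\<^bsub>?F\<^esub>x\<in>B. c x \<odot>\<^bsub>?F\<^esub> unit_vector R x) = (\<lambda>y. if y \<in> B then c y else \<zero>)" if "B \<subseteq> A" for B
    using finite_subset[OF that assms(2)] that
  proof (induction B rule: finite_induct)
    case empty
    then show ?case by (simp add: free_module_simps)
  next
    case (insert x B)
    have "(\<Oplus>\<^bsub>?F\<^esub>x\<in>insert x B. c x \<odot>\<^bsub>?F\<^esub> unit_vector R x) =
        c x \<odot>\<^bsub>?F\<^esub> unit_vector R x \<oplus>\<^bsub>?F\<^esub> (\<Oplus>\<^bsub>?F\<^esub>x\<in>B. c x \<odot>\<^bsub>?F\<^esub> unit_vector R x)"
      using insert assms(4) cR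
      by (intro F.M.finsum_insert) (auto intro!: F.smult_closed unit_vector_closed)
    also have "\<dots> = (\<lambda>y. if y \<in> insert x B then c y else \<zero>)"
      using insert cR by (auto simp: free_module_simps(2,4) unit_vector_def fun_eq_iff)
    finally show ?case .
  qed
  from this[OF order_refl] assms(3) show ?thesis by (auto simp: fun_eq_iff)
qed

text \<open>Preimages are chosen for the images of the unit vectors and extended linearly. Arbitrary
  types are allowed, so this covers in particular the test modules fixed by
  \<open>projective_module\<close>.\<close>

lemma free_module_lift:
  fixes R :: "('r, 'k) ring_scheme" and S :: "'x set"
    and M :: "('r, 'm, 'q) module_scheme" and N :: "('r, 'n, 's) module_scheme"
  assumes M: "left_module R M" and N: "left_module R N"
    and f: "f \<in> left_module_hom R M N" "f ` carrier M = carrier N"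
    and g: "g \<in> left_module_hom R (free_module R S) N"
  shows "\<exists>h \<in> left_module_hom R (free_module R S) M. \<forall>c\<in>carrier (free_module R S). f (h c) = g c"
proof -
  interpret M: left_module R M by fact
  interpret N: left_module R N by fact
  let ?F = "free_module R S"
  interpret F: left_module R ?F by (rule left_module_free_module) (rule M.R.ring_axioms)
  have "\<exists>y\<in>carrier M. f y = g (unit_vector R x)" if "x \<in> S" for x
  proof -
    have "g (unit_vector R x) \<in> carrier N"
      using g M.R.unit_vector_closed[OF that] by (auto simp: left_module_hom_def)
    then show ?thesis using f(2) by (metis imageE)
  qed
  then obtain m where m: "\<And>x. x \<in> S \<Longrightarrow> m x \<in> carrier M \<and> f (m x) = g (unit_vector R x)"
    by metis
  let ?h = "linear_combination R M m"
  have "?h \<in> left_module_hom R ?F M"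
    using m by (intro M.linear_combination_hom) auto
  moreover have "f (?h c) = g c" if c: "c \<in> carrier ?F" for c
  proof -
    let ?A = "{x. c x \<noteq> \<zero>\<^bsub>R\<^esub>}"
    have A: "finite ?A" "?A \<subseteq> S" "\<And>x. c x \<in> carrier R"
      using c by (auto simp: free_module_simps)
    have mc: "c x \<odot>\<^bsub>M\<^esub> m x \<in> carrier M" "c x \<odot>\<^bsub>?F\<^esub> unit_vector R x \<in> carrier ?F"
      "f (c x \<odot>\<^bsub>M\<^esub> m x) = g (c x \<odot>\<^bsub>?F\<^esub> unit_vector R x)" if "x \<in> ?A" for x
    proof -
      have x: "x \<in> S" using that A by auto
      show "c x \<odot>\<^bsub>M\<^esub> m x \<in> carrier M" "c x \<odot>\<^bsub>?F\<^esub> unit_vector R x \<in> carrier ?F"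
        using m[OF x] A(3) M.R.unit_vector_closed[OF x] by auto
      show "f (c x \<odot>\<^bsub>M\<^esub> m x) = g (c x \<odot>\<^bsub>?F\<^esub> unit_vector R x)"
        using f(1) g m[OF x] A(3) M.R.unit_vector_closed[OF x] by (simp add: left_module_hom_def)
    qed
    have "f (?h c) = (\<Oplus>\<^bsub>N\<^esub>x\<in>?A. f (c x \<odot>\<^bsub>M\<^esub> m x))"
      unfolding linear_combination_def using mc by (intro left_module_hom_finsum[OF M N f(1)]) auto
    also have "\<dots> = (\<Oplus>\<^bsub>N\<^esub>x\<in>?A. g (c x \<odot>\<^bsub>?F\<^esub> unit_vector R x))"
      using mc g by (intro N.M.finsum_cong') (auto simp: left_module_hom_def)
    also have "\<dots> = g (\<Oplus>\<^bsub>?F\<^esub>x\<in>?A. c x \<odot>\<^bsub>?F\<^esub> unit_vector R x)"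
      using mc by (intro left_module_hom_finsum[OF F.left_module_axioms N g, symmetric]) auto
    also have "\<dots> = g c"
      by (rule arg_cong[of _ _ g, OF M.R.free_module_expansion[OF c A(1) order_refl A(2), symmetric]])
    finally show ?thesis .
  qed
  ultimately show ?thesis by blast
qed

text \<open>A lift of \<open>g \<circ> \<phi>\<close> on the free module, composed with the section
  \<psi>, is a lift of \<open>g\<close>.\<close>

lemma projective_retract_of_free:
  fixes R :: "('r, 'k) ring_scheme" and S :: "'x set" and P :: "('r, 'p, 'm) module_scheme"
  assumes P: "left_module R P" and \<phi>: "\<phi> \<in> left_module_hom R (free_module R S) P"
    and \<psi>: "\<psi> \<in> left_module_hom R P (free_module R S)"
    and \<phi>\<psi>: "\<And>x. x \<in> carrier P \<Longrightarrow> \<phi> (\<psi> x) = x"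
  shows "projective_module R P"
  unfolding projective_module_def
proof (intro conjI P allI impI, elim conjE)
  fix M :: "('r, 'p \<Rightarrow> 'r) module" and N :: "('r, 'p) module" and f g
  assume *: "left_module R M" "left_module R N" "f \<in> left_module_hom R M N" "f ` carrier M = carrier N"
    and g: "g \<in> left_module_hom R P N"
  obtain h where h: "h \<in> left_module_hom R (free_module R S) M"
      "\<And>c. c \<in> carrier (free_module R S) \<Longrightarrow> f (h c) = (g \<circ> \<phi>) c"
    using free_module_lift[OF * left_module_hom_comp[OF \<phi> g]] by blast
  have "\<psi> x \<in> carrier (free_module R S)" if "x \<in> carrier P" for x
    using \<psi> that by (auto simp: left_module_hom_def)
  then show "\<exists>h\<in>left_module_hom R P M. \<forall>x\<in>carrier P. f (h x) = g x"
    using h \<phi>\<psi> by (intro bexI[OF _ left_module_hom_comp[OF \<psi> h(1)]]) auto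
qed

lemma projective_free_module:
  assumes "ring R"
  shows "projective_module R (free_module R S)"
  using assms
  by (intro projective_retract_of_free[where S = S and \<phi> = id and \<psi> = id] left_module_free_module)
    (auto simp: left_module_hom_def)

text \<open>\<open>FP_type\<close> prescribes the type on which resolutions live; a module is copied
  there along an injection \<open>J\<close> of its elements.\<close>

definition transport_module :: "('b \<Rightarrow> 'p) \<Rightarrow> ('r, 'b) module \<Rightarrow> ('r, 'p) module" where
  "transport_module J M = (let K = inv_into (carrier M) J in
    \<lparr>carrier = J ` carrier M, mult = (\<lambda>a b. a), one = J \<zero>\<^bsub>M\<^esub>, zero = J \<zero>\<^bsub>M\<^esub>,
     add = (\<lambda>a b. J (K a \<oplus>\<^bsub>M\<^esub> K b)), smult = (\<lambda>r a. J (r \<odot>\<^bsub>M\<^esub> K a))\<rparr>)"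

lemma left_module_transport_module:
  assumes M: "left_module R M" and J: "inj_on J (carrier M)"
  shows "left_module R (transport_module J M)"
    and "J \<in> left_module_hom R M (transport_module J M)"
    and "inv_into (carrier M) J \<in> left_module_hom R (transport_module J M) M"
proof -
  interpret M: left_module R M by fact
  let ?T = "transport_module J M" and ?K = "inv_into (carrier M) J"
  have K [simp]: "?K (J x) = x" if "x \<in> carrier M" for x
    using J that by simp
  have car: "carrier ?T = J ` carrier M" and zero: "\<zero>\<^bsub>?T\<^esub> = J \<zero>\<^bsub>M\<^esub>"
    and add: "\<And>a b. a \<oplus>\<^bsub>?T\<^esub> b = J (?K a \<oplus>\<^bsub>M\<^esub> ?K b)" and smult: "\<And>r a. r \<odot>\<^bsub>?T\<^esub> a = J (r \<odot>\<^bsub>M\<^esub> ?K a)"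
    by (simp_all add: transport_module_def Let_def)
  show "left_module R ?T"
  proof (intro left_module.intro left_module_axioms.intro abelian_groupI M.R.ring_axioms)
    fix a assume "a \<in> carrier ?T"
    then obtain x where x: "x \<in> carrier M" "a = J x" by (auto simp: car)
    then show "\<exists>b\<in>carrier ?T. b \<oplus>\<^bsub>?T\<^esub> a = \<zero>\<^bsub>?T\<^esub>"
      by (intro bexI[of _ "J (\<ominus>\<^bsub>M\<^esub> x)"]) (auto simp: car add zero M.M.l_neg)
  next
    fix a b assume "a \<in> carrier ?T" "b \<in> carrier ?T"
    then show "a \<oplus>\<^bsub>?T\<^esub> b = b \<oplus>\<^bsub>?T\<^esub> a"
      by (auto simp: car add M.M.a_comm)
  qed (auto simp: car add zero smult M.M.a_assoc M.smult_l_distr M.smult_r_distr M.smult_assoc1)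
  show "J \<in> left_module_hom R M ?T"
    by (auto simp: left_module_hom_def car add smult)
  show "?K \<in> left_module_hom R ?T M"
    by (auto simp: left_module_hom_def car add smult)
qed

text \<open>A finitely supported function is coded by an enumeration of its support together with
  the values there.\<close>

lemma finite_support_inject:
  fixes \<iota> :: "nat \<Rightarrow> 'r" and z :: 'r
  assumes \<iota>: "inj \<iota>"
  shows "\<exists>J :: ((nat \<Rightarrow> 'r) \<Rightarrow> 'r) \<Rightarrow> nat \<Rightarrow> 'r. inj_on J {c. finite {x. c x \<noteq> z}}"
proof -
  define en where "en = (\<lambda>c :: (nat \<Rightarrow> 'r) \<Rightarrow> 'r. SOME xs. set xs = {x. c x \<noteq> z})"
  have en: "set (en c) = {x. c x \<noteq> z}" if "finite {x. c x \<noteq> z}" for c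
    unfolding en_def by (rule someI_ex) (rule finite_list[OF that])
  define J where "J = (\<lambda>c k. if k = 0 then \<iota> (length (en c)) else
    (let (i, j) = prod_decode (k - 1) in
      if i < length (en c) then (if j = 0 then c (en c ! i) else (en c ! i) (j - 1)) else z))"
  have J: "J c 0 = \<iota> (length (en c))"
    "i < length (en c) \<Longrightarrow> J c (Suc (prod_encode (i, 0))) = c (en c ! i)"
    "i < length (en c) \<Longrightarrow> J c (Suc (prod_encode (i, Suc j))) = (en c ! i) j" for c i j
    by (simp_all add: J_def)
  have "inj_on J {c. finite {x. c x \<noteq> z}}"
  proof (rule inj_onI, elim CollectE)
    fix c c' assume fin: "finite {x. c x \<noteq> z}" "finite {x. c' x \<noteq> z}" and eq: "J c = J c'"
    have "\<iota> (length (en c)) = \<iota> (length (en c'))"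
      using J(1) eq by metis
    then have len: "length (en c) = length (en c')"
      using \<iota> by (simp add: inj_eq)
    have "en c ! i = en c' ! i" if "i < length (en c)" for i
      using J(3)[of i c] J(3)[of i c'] that len eq by (intro ext) metis
    then have en_eq: "en c = en c'"
      using len by (intro nth_equalityI) auto
    have vals: "c (en c ! i) = c' (en c ! i)" if "i < length (en c)" for i
      using J(2)[of i c] J(2)[of i c'] that len eq en_eq by metis
    show "c = c'"
    proof
      fix x
      show "c x = c' x"
      proof (cases "x \<in> set (en c)")
        case True
        then show ?thesis using vals by (metis in_set_conv_nth)
      next
        case False
        then show ?thesis using en[OF fin(1)] en[OF fin(2)] en_eq by auto
      qed
    qed
  qed
  then show ?thesis by blast
qed

text \<open>The free module on all elements of \<open>M\<close> maps onto \<open>M\<close>, but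
  lives on functions of functions. Coding its finitely supported elements brings it back to the type
  of \<open>M\<close>, so that the step can be iterated.\<close>

lemma projective_cover:
  fixes R :: "('r, 'k) ring_scheme" and M :: "('r, nat \<Rightarrow> 'r, 'm) module_scheme" and \<iota> :: "nat \<Rightarrow> 'r"
  assumes M: "left_module R M" and \<iota>: "inj \<iota>"
  shows "\<exists>(P :: ('r, nat \<Rightarrow> 'r) module) f. projective_module R P \<and> f \<in> left_module_hom R P M \<and>
    f ` carrier P = carrier M"
proof -
  interpret M: left_module R M by fact
  let ?F = "free_module R (carrier M)"
  have F: "left_module R ?F" by (rule left_module_free_module) (rule M.R.ring_axioms)
  obtain J :: "((nat \<Rightarrow> 'r) \<Rightarrow> 'r) \<Rightarrow> nat \<Rightarrow> 'r" where "inj_on J {c. finite {x. c x \<noteq> \<zero>\<^bsub>R\<^esub>}}"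
    using finite_support_inject[OF \<iota>] by blast
  then have J: "inj_on J (carrier ?F)"
    by (rule inj_on_subset) (auto simp: free_module_simps)
  let ?P = "transport_module J ?F" and ?K = "inv_into (carrier ?F) J"
  note T = left_module_transport_module[OF F J]
  have car: "carrier ?P = J ` carrier ?F" by (simp add: transport_module_def Let_def)
  have "projective_module R ?P"
    by (rule projective_retract_of_free[OF T(1) T(2) T(3)]) (auto simp: car f_inv_into_f)
  moreover have lc: "linear_combination R M id \<in> left_module_hom R ?F M"
    by (rule M.linear_combination_hom) auto
  then have "linear_combination R M id \<circ> ?K \<in> left_module_hom R ?P M"
    by (rule left_module_hom_comp[OF T(3)])
  moreover have "(linear_combination R M id \<circ> ?K) ` carrier ?P = carrier M"
  proof
    show "(linear_combination R M id \<circ> ?K) ` carrier ?P \<subseteq> carrier M"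
      using lc J by (auto simp: car left_module_hom_def Pi_iff)
    show "carrier M \<subseteq> (linear_combination R M id \<circ> ?K) ` carrier ?P"
    proof
      fix x assume x: "x \<in> carrier M"
      note u = M.R.unit_vector_closed[OF x]
      have "linear_combination R M id (unit_vector R x) = (\<Oplus>\<^bsub>M\<^esub>y\<in>{x}. unit_vector R x y \<odot>\<^bsub>M\<^esub> id y)"
        using x u by (intro M.linear_combination_superset) (auto simp: unit_vector_def)
      also have "\<dots> = x" using x by (simp add: unit_vector_def)
      finally have "(linear_combination R M id \<circ> ?K) (J (unit_vector R x)) = x"
        using u J by simp
      then show "x \<in> (linear_combination R M id \<circ> ?K) ` carrier ?P"
        using u unfolding car by (metis image_eqI)
    qed
  qed
  ultimately show ?thesis by blast
qed

lemma left_module_kernel: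
  fixes M :: "('r, 'p) module"
  assumes M: "left_module R M" and N: "left_module R N" and f: "f \<in> left_module_hom R M N"
  shows "left_module R (M\<lparr>carrier := module_kernel M N f\<rparr>)"
proof -
  interpret M: left_module R M by fact
  interpret N: left_module R N by fact
  have f_closed: "f x \<in> carrier N" if "x \<in> carrier M" for x
    using f that by (auto simp: left_module_hom_def)
  have f_add: "f (x \<oplus>\<^bsub>M\<^esub> y) = f x \<oplus>\<^bsub>N\<^esub> f y" if "x \<in> carrier M" "y \<in> carrier M" for x y
    using f that by (auto simp: left_module_hom_def)
  have f_smult: "f (a \<odot>\<^bsub>M\<^esub> x) = a \<odot>\<^bsub>N\<^esub> f x" if "a \<in> carrier R" "x \<in> carrier M" for a x
    using f that by (auto simp: left_module_hom_def)
  have zero: "f \<zero>\<^bsub>M\<^esub> = \<zero>\<^bsub>N\<^esub>"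
    using f_smult[of "\<zero>\<^bsub>R\<^esub>" "\<zero>\<^bsub>M\<^esub>"] f_closed[of "\<zero>\<^bsub>M\<^esub>"] by simp
  show ?thesis
  proof (intro left_module.intro left_module_axioms.intro abelian_groupI M.R.ring_axioms)
    fix x assume "x \<in> carrier (M\<lparr>carrier := module_kernel M N f\<rparr>)"
    then have x: "x \<in> carrier M" "f x = \<zero>\<^bsub>N\<^esub>" by (auto simp: module_kernel_def)
    then have "f (\<ominus>\<^bsub>M\<^esub> x) = \<zero>\<^bsub>N\<^esub>"
      using f_add[of "\<ominus>\<^bsub>M\<^esub> x" x] f_closed[of "\<ominus>\<^bsub>M\<^esub> x"] zero by (simp add: M.M.l_neg)
    with x show "\<exists>y\<in>carrier (M\<lparr>carrier := module_kernel M N f\<rparr>).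
        y \<oplus>\<^bsub>M\<lparr>carrier := module_kernel M N f\<rparr>\<^esub> x = \<zero>\<^bsub>M\<lparr>carrier := module_kernel M N f\<rparr>\<^esub>"
      by (intro bexI[of _ "\<ominus>\<^bsub>M\<^esub> x"]) (auto simp: module_kernel_def M.M.l_neg)
  qed (auto simp: module_kernel_def f_add f_smult zero M.M.a_assoc M.smult_l_distr
      M.smult_r_distr M.smult_assoc1 intro: M.M.a_comm)
qed

lemma exact_step:
  fixes R :: "('r, 'k) ring_scheme" and M N :: "('r, nat \<Rightarrow> 'r) module" and \<iota> :: "nat \<Rightarrow> 'r"
  assumes M: "left_module R M" and N: "left_module R N" and f: "f \<in> left_module_hom R M N"
    and \<iota>: "inj \<iota>"
  shows "\<exists>(P :: ('r, nat \<Rightarrow> 'r) module) d. projective_module R P \<and> d \<in> left_module_hom R P M \<and>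
    d ` carrier P = module_kernel M N f"
proof -
  obtain P :: "('r, nat \<Rightarrow> 'r) module" and d where P: "projective_module R P"
    "d \<in> left_module_hom R P (M\<lparr>carrier := module_kernel M N f\<rparr>)" "d ` carrier P = module_kernel M N f"
    using projective_cover[OF left_module_kernel[OF M N f] \<iota>] by auto
  then have "d \<in> left_module_hom R P M"
    by (auto simp: left_module_hom_def module_kernel_def Pi_iff)
  with P show ?thesis by blast
qed

text \<open>The given two terms are the ones whose finite generation matters; all later terms arise
  by covering the kernel of the preceding differential.\<close>

lemma extend_resolution:
  fixes R :: "('r, 'k) ring_scheme" and P0 P1 :: "('r, nat \<Rightarrow> 'r) module" and \<iota> :: "nat \<Rightarrow> 'r"
  assumes P: "projective_module R P0" "projective_module R P1"
    and \<epsilon>: "\<epsilon> \<in> left_module_hom R P0 A" "\<epsilon> ` carrier P0 = carrier A"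
    and d0: "d0 \<in> left_module_hom R P1 P0" "d0 ` carrier P1 = module_kernel P0 A \<epsilon>"
    and \<iota>: "inj \<iota>"
  shows "\<exists>P d. projective_resolution R A P d \<epsilon> \<and> P 0 = P0 \<and> P (Suc 0) = P1"
proof -
  \<comment> \<open>A state is a differential \<open>d\<close> from \<open>A\<close> to
    \<open>B\<close>. Only state 0 is prescribed, and \<open>nxt\<close> demands exactness between
    consecutive states.\<close>
  define good where "good = (\<lambda>(n :: nat) (A :: ('r, nat \<Rightarrow> 'r) module, B :: ('r, nat \<Rightarrow> 'r) module, d).
    projective_module R A \<and> projective_module R B \<and> d \<in> left_module_hom R A B \<and>
    (n = 0 \<longrightarrow> A = P1 \<and> B = P0 \<and> d = d0))"
  define nxt where "nxt = (\<lambda>(A :: ('r, nat \<Rightarrow> 'r) module, B :: ('r, nat \<Rightarrow> 'r) module, d)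
    (A' :: ('r, nat \<Rightarrow> 'r) module, B' :: ('r, nat \<Rightarrow> 'r) module, d').
    B' = A \<and> d' ` carrier A' = module_kernel A B d)"
  have "\<exists>f. \<forall>n. good n (f n) \<and> nxt (f n) (f (Suc n))"
  proof (rule dependent_nat_choice)
    show "\<exists>x. good 0 x"
      using P d0 by (intro exI[of _ "(P1, P0, d0)"]) (auto simp: good_def)
    fix x n assume "good n x"
    moreover obtain A B d where x: "x = (A, B, d)" by (cases x)
    ultimately have "projective_module R A" "projective_module R B" and d: "d \<in> left_module_hom R A B"
      by (auto simp: good_def)
    then have "left_module R A" "left_module R B"
      unfolding projective_module_def by blast+
    then obtain C :: "('r, nat \<Rightarrow> 'r) module" and d' where "projective_module R C"
        "d' \<in> left_module_hom R C A" "d' ` carrier C = module_kernel A B d"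
      using exact_step[OF _ _ d \<iota>] by blast
    then show "\<exists>y. good (Suc n) y \<and> nxt x y"
      using \<open>projective_module R A\<close>
      by (intro exI[of _ "(C, A, d')"]) (simp add: good_def nxt_def x)
  qed
  then obtain s where s: "\<And>n. good n (s n)" "\<And>n. nxt (s n) (s (Suc n))" by blast
  define P where "P = (\<lambda>n. case n of 0 \<Rightarrow> P0 | Suc i \<Rightarrow> fst (s i))"
  define d where "d = (\<lambda>i. snd (snd (s i)))"
  have snd_s: "fst (snd (s i)) = P i" for i
    using s(1)[of 0] s(2)[of "i - 1"]
    by (cases i) (auto simp: P_def good_def nxt_def split: prod.splits)
  have s_eq: "s i = (P (Suc i), P i, d i)" for i
    using snd_s[of i] by (simp add: P_def d_def prod_eq_iff)
  have 0: "P 0 = P0" "P (Suc 0) = P1" "d 0 = d0"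
    using s(1)[of 0] by (auto simp: s_eq good_def)
  have "projective_module R (P i)" for i
    using s(1)[of i] by (simp add: s_eq good_def)
  moreover have "d i \<in> left_module_hom R (P (Suc i)) (P i)" for i
    using s(1)[of i] by (simp add: s_eq good_def)
  moreover have "d (Suc i) ` carrier (P (Suc (Suc i))) = module_kernel (P (Suc i)) (P i) (d i)" for i
    using s(2)[of i] by (simp add: s_eq nxt_def)
  ultimately have "projective_resolution R A P d \<epsilon>"
    unfolding projective_resolution_def using \<epsilon> d0 0 by simp
  with 0 show ?thesis by blast
qed

text \<open>Unit vectors of different indices differ because \<open>\<one>\<close> and
  \<open>\<zero>\<close> do, so the expansion over \<open>S\<close> can be reindexed as a sum over
  the generators themselves, as the definition asks.\<close>

lemma finitely_generated_free_module:
  assumes "ring R" "finite S" "\<one>\<^bsub>R\<^esub> \<noteq> \<zero>\<^bsub>R\<^esub>"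
  shows "finitely_generated_module R (free_module R S)"
proof -
  interpret ring R by fact
  let ?F = "free_module R S"
  interpret F: left_module R ?F by (rule left_module_free_module) fact
  have inj: "inj_on (unit_vector R) S"
    using assms(3) by (auto simp: inj_on_def unit_vector_def fun_eq_iff split: if_splits)
  have "\<exists>c \<in> unit_vector R ` S \<rightarrow> carrier R. x = (\<Oplus>\<^bsub>?F\<^esub>s\<in>unit_vector R ` S. c s \<odot>\<^bsub>?F\<^esub> s)"
    if x: "x \<in> carrier ?F" for x
  proof -
    let ?c = "\<lambda>s. x (the_inv_into S (unit_vector R) s)"
    have xR: "x i \<in> carrier R" for i using x by (auto simp: free_module_simps)
    have "x = (\<Oplus>\<^bsub>?F\<^esub>i\<in>S. x i \<odot>\<^bsub>?F\<^esub> unit_vector R i)"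
      using x assms(2) by (intro free_module_expansion) (auto simp: free_module_simps)
    also have "\<dots> = (\<Oplus>\<^bsub>?F\<^esub>i\<in>S. ?c (unit_vector R i) \<odot>\<^bsub>?F\<^esub> unit_vector R i)"
      using inj xR by (intro F.M.finsum_cong') (auto simp: the_inv_into_f_f intro!: F.smult_closed unit_vector_closed)
    also have "\<dots> = (\<Oplus>\<^bsub>?F\<^esub>s\<in>unit_vector R ` S. ?c s \<odot>\<^bsub>?F\<^esub> s)"
      using inj xR by (intro F.M.finsum_reindex[symmetric]) (auto intro!: F.smult_closed unit_vector_closed)
    finally show ?thesis
      using xR by (intro bexI[of _ ?c]) auto
  qed
  then show ?thesis
    unfolding finitely_generated_module_def using assms(2) unit_vector_closed
    by (intro exI[of _ "unit_vector R ` S"]) auto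
qed

text \<open>The differences \<open>t - \<one>\<close> with \<open>t\<close> in \<open>T\<close>
  generate the augmentation ideal as a left ideal: along a path from \<open>\<one>\<close> one has
  \<open>y t - \<one> = y (t - \<one>) + (y - \<one>)\<close>, and backward steps subtract. This
  gives the first two terms of a resolution by free modules of finite rank.\<close>

lemma fin_connected_imp_FP_monoid:
  fixes M :: "('g, 'm) monoid_scheme"
  assumes M: "monoid M" and "fin_connected M"
  shows "FP_monoid 1 M"
proof -
  interpret M: monoid M by fact
  let ?R = "monoid_ring M" and ?Z = "trivial_module :: ('g \<Rightarrow>\<^sub>0 int, int) module"
  let ?F = "free_module ?R {0::nat}"
  interpret R: ring ?R by (rule ring_monoid_ring) fact
  interpret F: left_module ?R ?F by (rule left_module_free_module) (rule R.ring_axioms)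
  interpret Z: left_module ?R ?Z by (rule left_module_trivial_module) fact
  from assms(2) obtain T where T: "finite T" "T \<subseteq> carrier M"
    and conn: "\<And>g. g \<in> carrier M \<Longrightarrow> conn M T \<one>\<^bsub>M\<^esub> g"
    unfolding fin_connected_def by blast
  \<comment> \<open>Numbering \<open>T\<close> puts the free module with one generator for each
    element of \<open>T\<close> on the type that resolutions use.\<close>
  obtain f and n :: nat where f: "bij_betw f {..<n} T"
    using ex_bij_betw_nat_finite[OF T(1)] unfolding atLeast0LessThan by blast
  have f_closed: "f i \<in> carrier M" if "i < n" for i
    using f T that by (auto simp: bij_betw_def)
  let ?P1 = "free_module ?R {..<n}"
  define E where "E = (\<lambda>x (k :: nat). if k = 0 then x else (0 :: 'g \<Rightarrow>\<^sub>0 int))"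
  have E: "E x \<in> carrier ?F" if "x \<in> carrier ?R" for x
  proof -
    have "{k. E x k \<noteq> 0} \<subseteq> {0}" by (auto simp: E_def)
    moreover from this have "finite {k. E x k \<noteq> 0}" by (rule finite_subset) simp
    ultimately show ?thesis using that by (auto simp: free_module_simps monoid_ring_simps E_def)
  qed
  define m where "m = (\<lambda>i. E (frag_of (f i) - frag_of \<one>\<^bsub>M\<^esub>))"
  have diff1: "frag_of g - frag_of \<one>\<^bsub>M\<^esub> \<in> carrier ?R" if "g \<in> carrier M" for g
    using keys_diff[of "frag_of g" "frag_of \<one>\<^bsub>M\<^esub>"] that by (auto simp: monoid_ring_simps)
  have m: "m \<in> {..<n} \<rightarrow> carrier ?F"
    using f_closed E diff1 by (auto simp: m_def)
  define d0 where "d0 = linear_combination ?R ?F m"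
  have d0: "d0 \<in> left_module_hom ?R ?P1 ?F"
    unfolding d0_def by (rule F.linear_combination_hom[OF m])
  define \<epsilon> where "\<epsilon> = (\<lambda>c :: nat \<Rightarrow> 'g \<Rightarrow>\<^sub>0 int. augmentation (c 0))"
  note \<epsilon> = augmentation_hom[OF M, folded \<epsilon>_def]
  interpret P1: left_module ?R ?P1 by (rule left_module_free_module) (rule R.ring_axioms)
  \<comment> \<open>The ring elements that are boundaries, seen through \<open>E\<close>. They form
    a left ideal, which will contain every element minus its augmentation.\<close>
  define I where "I = {x \<in> carrier ?R. E x \<in> d0 ` carrier ?P1}"
  have I_add: "x + y \<in> I" if "x \<in> I" "y \<in> I" for x y
  proof -
    from that obtain a b where ab: "a \<in> carrier ?P1" "E x = d0 a" "b \<in> carrier ?P1" "E y = d0 b"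
      and xy: "x \<in> carrier ?R" "y \<in> carrier ?R"
      by (auto simp: I_def)
    have "E (x + y) = E x \<oplus>\<^bsub>?F\<^esub> E y"
      by (auto simp: E_def free_module_simps(2) monoid_ring_simps)
    also have "\<dots> = d0 (a \<oplus>\<^bsub>?P1\<^esub> b)"
      using d0 ab by (simp add: left_module_hom_def)
    finally have "E (x + y) \<in> d0 ` carrier ?P1"
      using ab P1.M.a_closed by blast
    moreover have "x + y \<in> carrier ?R"
      using R.a_closed[OF xy] by (simp add: monoid_ring_simps(2))
    ultimately show ?thesis by (simp add: I_def)
  qed
  have I_mult: "r \<otimes>\<^bsub>?R\<^esub> x \<in> I" if "r \<in> carrier ?R" "x \<in> I" for r x
  proof -
    from that obtain a where a: "a \<in> carrier ?P1" "E x = d0 a" and x: "x \<in> carrier ?R"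
      by (auto simp: I_def)
    have "E (r \<otimes>\<^bsub>?R\<^esub> x) = r \<odot>\<^bsub>?F\<^esub> E x"
      by (auto simp: E_def free_module_simps(4))
    also have "\<dots> = d0 (r \<odot>\<^bsub>?P1\<^esub> a)"
      using d0 a that by (simp add: left_module_hom_def)
    finally have "E (r \<otimes>\<^bsub>?R\<^esub> x) \<in> d0 ` carrier ?P1"
      using a that P1.smult_closed by blast
    with that x show ?thesis by (simp add: I_def)
  qed
  have I_diff: "x - y \<in> I" if "x \<in> I" "y \<in> I" for x y
  proof -
    have "- frag_of \<one>\<^bsub>M\<^esub> \<in> carrier ?R"
      by (auto simp: monoid_ring_simps)
    moreover have "(- frag_of \<one>\<^bsub>M\<^esub>) \<otimes>\<^bsub>?R\<^esub> y = - y"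
    proof -
      have "y \<in> carrier ?R" using that by (simp add: I_def)
      then have "frag_of \<one>\<^bsub>M\<^esub> \<otimes>\<^bsub>?R\<^esub> y = y"
        using R.l_one by (simp add: monoid_ring_simps)
      then show ?thesis
        using monoid_ring_mult_diff(1)[of M 0 "frag_of \<one>\<^bsub>M\<^esub>" y] by simp
    qed
    ultimately have "- y \<in> I" using I_mult that by metis
    with I_add[OF that(1)] show ?thesis by fastforce
  qed
  have I_gen: "frag_of t - frag_of \<one>\<^bsub>M\<^esub> \<in> I" if "t \<in> T" for t
  proof -
    from that f obtain i where i: "i < n" "f i = t" by (auto simp: bij_betw_def)
    note u = R.unit_vector_closed[of i "{..<n}"]
    have "d0 (unit_vector ?R i) = (\<Oplus>\<^bsub>?F\<^esub>j\<in>{i}. unit_vector ?R i j \<odot>\<^bsub>?F\<^esub> m j)"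
      unfolding d0_def using u i m by (intro F.linear_combination_superset) (auto simp: unit_vector_def)
    also have "\<dots> = m i"
    proof -
      have "m i \<in> carrier ?F" using m i by auto
      then show ?thesis
        by (simp add: unit_vector_def)
    qed
    finally have "E (frag_of t - frag_of \<one>\<^bsub>M\<^esub>) = d0 (unit_vector ?R i)"
      using i by (simp add: m_def)
    then have "E (frag_of t - frag_of \<one>\<^bsub>M\<^esub>) \<in> d0 ` carrier ?P1"
      using u i by simp
    then show ?thesis
      using diff1 T that by (auto simp: I_def)
  qed
  have I_0: "0 \<in> I"
  proof -
    have "E 0 = d0 \<zero>\<^bsub>?P1\<^esub>"
      by (simp add: E_def d0_def linear_combination_def free_module_simps monoid_ring_simps)
    then have "E 0 \<in> d0 ` carrier ?P1" using P1.M.zero_closed by blast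
    then show ?thesis by (simp add: I_def monoid_ring_simps)
  qed
  have I_conn: "y \<in> carrier M \<and> frag_of y - frag_of \<one>\<^bsub>M\<^esub> \<in> I" if "conn M T \<one>\<^bsub>M\<^esub> y" for y
    using that
  proof induction
    case refl
    then show ?case using I_0 by simp
  next
    case (step y t)
    have "frag_of (y \<otimes>\<^bsub>M\<^esub> t) - frag_of \<one>\<^bsub>M\<^esub> =
        frag_of y \<otimes>\<^bsub>?R\<^esub> (frag_of t - frag_of \<one>\<^bsub>M\<^esub>) + (frag_of y - frag_of \<one>\<^bsub>M\<^esub>)"
      using step by (simp add: monoid_ring_mult_diff)
    moreover have "frag_of y \<otimes>\<^bsub>?R\<^esub> (frag_of t - frag_of \<one>\<^bsub>M\<^esub>) \<in> I"
      using step I_gen by (intro I_mult) (auto simp: monoid_ring_simps)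
    ultimately have "frag_of (y \<otimes>\<^bsub>M\<^esub> t) - frag_of \<one>\<^bsub>M\<^esub> \<in> I"
      using step I_add by metis
    with step T show ?case by auto
  next
    case (unstep y t)
    have "frag_of y - frag_of \<one>\<^bsub>M\<^esub> =
        (frag_of (y \<otimes>\<^bsub>M\<^esub> t) - frag_of \<one>\<^bsub>M\<^esub>) - frag_of y \<otimes>\<^bsub>?R\<^esub> (frag_of t - frag_of \<one>\<^bsub>M\<^esub>)"
      using unstep by (simp add: monoid_ring_mult_diff)
    moreover have "frag_of y \<otimes>\<^bsub>?R\<^esub> (frag_of t - frag_of \<one>\<^bsub>M\<^esub>) \<in> I"
      using unstep I_gen by (intro I_mult) (auto simp: monoid_ring_simps)
    ultimately have "frag_of y - frag_of \<one>\<^bsub>M\<^esub> \<in> I"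
      using unstep I_diff by metis
    with unstep show ?case by simp
  qed
  have I_all: "c - frag_cmul (augmentation c) (frag_of \<one>\<^bsub>M\<^esub>) \<in> I"
    if "Poly_Mapping.keys c \<subseteq> carrier M" for c
    using that
  proof (induction c rule: frag_induction)
    case zero
    then show ?case using I_0 by simp
  next
    case (one x)
    then show ?case using I_conn[OF conn] by simp
  next
    case (diff a b)
    have "a - b - frag_cmul (augmentation (a - b)) (frag_of \<one>\<^bsub>M\<^esub>) =
      (a - frag_cmul (augmentation a) (frag_of \<one>\<^bsub>M\<^esub>)) - (b - frag_cmul (augmentation b) (frag_of \<one>\<^bsub>M\<^esub>))"
      by (simp add: augmentation_diff frag_cmul_diff_distrib)
    then show ?case using I_diff[OF diff] by (simp only:)
  qed
  have exact: "d0 ` carrier ?P1 = module_kernel ?F ?Z \<epsilon>"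
  proof
    show "d0 ` carrier ?P1 \<subseteq> module_kernel ?F ?Z \<epsilon>"
    proof (rule image_subsetI)
      fix c assume c: "c \<in> carrier ?P1"
      let ?A = "{x. c x \<noteq> \<zero>\<^bsub>?R\<^esub>}"
      have A: "?A \<subseteq> {..<n}" "\<And>x. c x \<in> carrier ?R"
        using c by (auto simp: free_module_simps)
      have cm: "c x \<odot>\<^bsub>?F\<^esub> m x \<in> carrier ?F" if "x \<in> ?A" for x
        using A m that by auto
      have "\<epsilon> (d0 c) = (\<Oplus>\<^bsub>?Z\<^esub>x\<in>?A. \<epsilon> (c x \<odot>\<^bsub>?F\<^esub> m x))"
        unfolding d0_def linear_combination_def using cm
        by (intro left_module_hom_finsum[OF F.left_module_axioms Z.left_module_axioms \<epsilon>(1)]) auto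
      also have "\<dots> = (\<Oplus>\<^bsub>?Z\<^esub>x\<in>?A. \<zero>\<^bsub>?Z\<^esub>)"
        by (intro Z.M.finsum_cong')
          (auto simp: \<epsilon>_def free_module_simps(4) m_def E_def augmentation_mult augmentation_diff trivial_module_simps)
      also have "\<dots> = \<zero>\<^bsub>?Z\<^esub>" by simp
      finally show "d0 c \<in> module_kernel ?F ?Z \<epsilon>"
        using d0 c by (auto simp: module_kernel_def left_module_hom_def)
    qed
    show "module_kernel ?F ?Z \<epsilon> \<subseteq> d0 ` carrier ?P1"
    proof
      fix c assume "c \<in> module_kernel ?F ?Z \<epsilon>"
      then have c: "c \<in> carrier ?F" "augmentation (c 0) = 0"
        by (auto simp: module_kernel_def \<epsilon>_def trivial_module_simps)
      then have "c 0 \<in> I"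
        using I_all[of "c 0"] by (auto simp: free_module_simps monoid_ring_simps)
      moreover have "c = E (c 0)"
        using c by (auto simp: E_def free_module_simps monoid_ring_simps fun_eq_iff)
      ultimately show "c \<in> d0 ` carrier ?P1" by (auto simp: I_def)
    qed
  qed
  \<comment> \<open>The coding of the later terms needs infinitely many ring elements; multiples of
    the unit are told apart by the augmentation.\<close>
  have \<iota>: "inj (\<lambda>k. frag_cmul (int k) (frag_of \<one>\<^bsub>M\<^esub>))"
  proof (rule injI)
    fix j k assume "frag_cmul (int j) (frag_of \<one>\<^bsub>M\<^esub>) = frag_cmul (int k) (frag_of \<one>\<^bsub>M\<^esub>)"
    then have "augmentation (frag_cmul (int j) (frag_of \<one>\<^bsub>M\<^esub>)) = augmentation (frag_cmul (int k) (frag_of \<one>\<^bsub>M\<^esub>))"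
      by simp
    then show "j = k" by (simp add: augmentation_cmul)
  qed
  obtain P d where P: "projective_resolution ?R ?Z P d \<epsilon>" "P 0 = ?F" "P (Suc 0) = ?P1"
    using extend_resolution[OF projective_free_module[OF R.ring_axioms] projective_free_module[OF R.ring_axioms]
        \<epsilon> d0 exact \<iota>] by blast
  have one0: "\<one>\<^bsub>?R\<^esub> \<noteq> \<zero>\<^bsub>?R\<^esub>"
    by (simp add: monoid_ring_simps)
  have fg: "finitely_generated_module ?R (P 0)" "finitely_generated_module ?R (P (Suc 0))"
    unfolding P(2,3) by (rule finitely_generated_free_module[OF R.ring_axioms _ one0], simp)+
  have "finitely_generated_module ?R (P i)" if "i \<le> 1" for i
    using that fg by (cases i) simp_all
  with P(1) show ?thesis
    unfolding FP_monoid_def FP_type_def by blast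
qed

theorem FP_monoid_1_iff_fin_connected:
  "monoid M \<Longrightarrow> FP_monoid 1 M \<longleftrightarrow> fin_connected M"
  using FP_monoid_imp_fin_connected fin_connected_imp_FP_monoid by blast

section \<open>A Mayer--Vietoris cocycle\<close>

lemma (in group) inv_cancel_left:
  "\<lbrakk>x \<in> carrier G; y \<in> carrier G\<rbrakk> \<Longrightarrow> x \<otimes> (inv x \<otimes> y) = y"
  "\<lbrakk>x \<in> carrier G; y \<in> carrier G\<rbrakk> \<Longrightarrow> inv x \<otimes> (x \<otimes> y) = y"
  by (simp_all flip: m_assoc)

lemma (in group) conn_translate:
  assumes "conn (G\<lparr>carrier := P\<rparr>) T x y" "h \<in> carrier G" "T \<subseteq> carrier G" "P \<subseteq> carrier G" "x \<in> P"
    and P: "\<And>p. p \<in> P \<Longrightarrow> h \<otimes> p \<in> P"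
    and T: "\<And>p t. p \<in> P \<Longrightarrow> t \<in> T \<Longrightarrow> p \<otimes> t \<in> P"
  shows "conn (G\<lparr>carrier := P\<rparr>) T (h \<otimes> x) (h \<otimes> y) \<and> y \<in> P"
  using assms(1)
proof induction
  case refl
  then show ?case using P by (auto intro: conn.refl)
next
  case (step y t)
  then have "h \<otimes> (y \<otimes> t) = (h \<otimes> y) \<otimes> t" using assms by (auto simp: m_assoc subset_iff)
  then show ?case
    using conn.step[of "G\<lparr>carrier := P\<rparr>" T "h \<otimes> x" "h \<otimes> y" t] step T by simp
next
  case (unstep y t)
  then have "h \<otimes> (y \<otimes> t) = (h \<otimes> y) \<otimes> t" using assms by (auto simp: m_assoc subset_iff)
  then show ?case
    using conn.unstep[of "G\<lparr>carrier := P\<rparr>" T "h \<otimes> x" "h \<otimes> y" t] unstep P by simp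
qed

lemma conn_trans:
  assumes "conn M T x y" "conn M T y z"
  shows "conn M T x z"
  using assms(2,1) by (induction) (auto intro: conn.intros)

text \<open>The letters of nonnegative value connect every path in the half space, and sorting a word
  by sign, which changes it only modulo \<open>N\<close>, moves it into the half space.\<close>

lemma (in group) conn_of_kernel:
  assumes \<chi>: "\<And>x y. x \<in> carrier G \<Longrightarrow> y \<in> carrier G \<Longrightarrow> \<chi> (x \<otimes> y) = \<chi> x + (\<chi> y :: real)"
    and S: "S \<subseteq> carrier G" "\<And>s. s \<in> S \<Longrightarrow> inv s \<in> S"
    and gen: "\<And>g. g \<in> carrier G \<Longrightarrow> \<exists>w. set w \<subseteq> S \<and> wprod G w = g"
    and N: "N \<lhd> G" "derived G (carrier G) \<subseteq> N" "\<And>n. n \<in> N \<Longrightarrow> \<chi> n = 0"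
    and T: "T = {s \<in> S. 0 \<le> \<chi> s}"
    and conn: "\<And>n. n \<in> N \<Longrightarrow> conn (character_monoid G \<chi>) T \<one> n"
    and g: "g \<in> carrier G" "0 \<le> \<chi> g"
  shows "conn (character_monoid G \<chi>) T \<one> g"
proof -
  interpret N: normal N G by fact
  let ?P = "{g \<in> carrier G. 0 \<le> \<chi> g}" and ?M = "character_monoid G \<chi>"
  have M: "?M = G\<lparr>carrier := ?P\<rparr>" by (simp add: character_monoid_def)
  have one: "\<chi> \<one> = 0" using \<chi>[of \<one> \<one>] by simp
  have \<chi>_inv: "\<chi> (inv x) = - \<chi> x" if "x \<in> carrier G" for x
    using \<chi>[of x "inv x"] that one by simp
  have letter: "conn ?M T h (h \<otimes> s)" if "h \<in> ?P" "s \<in> S" "h \<otimes> s \<in> ?P" for h s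
  proof (cases "0 \<le> \<chi> s")
    case True
    then show ?thesis using that conn.step[OF conn.refl, of h ?M s T] by (simp add: M T)
  next
    case False
    have s: "s \<in> carrier G" "inv s \<in> T" using that S False \<chi>_inv by (auto simp: T)
    then have "(h \<otimes> s) \<otimes> inv s = h" using that by (simp add: m_assoc)
    then show ?thesis using that s conn.unstep[of ?M T h "h \<otimes> s" "inv s"] conn.refl[of h ?M T] by (simp add: M)
  qed
  have word: "conn ?M T h (h \<otimes> wprod G w)" if "stays G ?P h w" "set w \<subseteq> S" "h \<in> carrier G" for h w
    using that
  proof (induction w arbitrary: h)
    case Nil
    then show ?case by (auto simp: M intro: conn.refl)
  next
    case (Cons x w)
    have "x \<in> carrier G" "set w \<subseteq> carrier G" using Cons.prems S by auto
    moreover have "conn ?M T h (h \<otimes> x)"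
      using Cons.prems stays_start[of ?P "h \<otimes> x" w] by (intro letter) auto
    moreover have "conn ?M T (h \<otimes> x) (h \<otimes> x \<otimes> wprod G w)"
      using Cons \<open>x \<in> carrier G\<close> by auto
    ultimately show ?case using conn_trans Cons.prems by (fastforce simp: m_assoc)
  qed
  \<comment> \<open>A letter outside \<open>Q\<close> moves right past \<open>p\<close> at the cost
    of a commutator, which lies in \<open>N\<close> and is carried to the end by conjugation with
    \<open>q\<close>.\<close>
  have sort: "\<exists>n\<in>N. wprod G w = wprod G (filter Q w) \<otimes> wprod G (filter (\<lambda>x. \<not> Q x) w) \<otimes> n"
    if "set w \<subseteq> carrier G" for w Q
    using that
  proof (induction w)
    case Nil
    then show ?case using N.one_closed by auto
  next
    case (Cons x w)
    define p where "p = wprod G (filter Q w)"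
    define q where "q = wprod G (filter (\<lambda>x. \<not> Q x) w)"
    have pq: "p \<in> carrier G" "q \<in> carrier G" and x: "x \<in> carrier G"
      using Cons.prems by (auto simp: p_def q_def intro!: wprod_closed)
    obtain n where n: "n \<in> N" "wprod G w = p \<otimes> q \<otimes> n"
      using Cons by (auto simp: p_def q_def)
    have nG: "n \<in> carrier G" using n N.subset by auto
    show ?case
    proof (cases "Q x")
      case True
      then show ?thesis
        using n nG pq x by (intro bexI[of _ n]) (auto simp: m_assoc simp flip: p_def q_def)
    next
      case False
      define c where "c = inv x \<otimes> inv p \<otimes> x \<otimes> p"
      have "inv x \<otimes> inv p \<otimes> inv (inv x) \<otimes> inv (inv p) \<in> derived G (carrier G)"
        unfolding derived_def using x pq by (intro generate.incl) blast
      then have c: "c \<in> N" "c \<in> carrier G"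
        using N(2) N.subset x pq by (auto simp: c_def)
      then have c': "inv q \<otimes> c \<otimes> q \<in> N"
        using N.inv_op_closed1 pq by simp
      have xp: "x \<otimes> p = p \<otimes> x \<otimes> c"
        using x pq by (simp add: c_def m_assoc inv_cancel_left)
      have "wprod G (x # w) = x \<otimes> p \<otimes> q \<otimes> n"
        using n nG x pq by (simp add: m_assoc)
      also have "\<dots> = p \<otimes> (x \<otimes> q) \<otimes> ((inv q \<otimes> c \<otimes> q) \<otimes> n)"
        unfolding xp using c nG x pq by (simp add: m_assoc inv_cancel_left)
      finally have "wprod G (x # w) = wprod G (filter Q (x # w)) \<otimes>
          wprod G (filter (\<lambda>x. \<not> Q x) (x # w)) \<otimes> ((inv q \<otimes> c \<otimes> q) \<otimes> n)"
        using False by (simp add: p_def q_def)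
      moreover have "(inv q \<otimes> c \<otimes> q) \<otimes> n \<in> N" using c' n by simp
      ultimately show ?thesis by blast
    qed
  qed
  obtain w where w: "set w \<subseteq> S" "wprod G w = g" using gen g by blast
  then have wG: "set w \<subseteq> carrier G" using S by auto
  define u where "u = filter (\<lambda>s. 0 \<le> \<chi> s) w"
  define v where "v = filter (\<lambda>s. \<not> 0 \<le> \<chi> s) w"
  have uv: "set u \<subseteq> S" "set v \<subseteq> S" "set u \<subseteq> carrier G" "set v \<subseteq> carrier G"
    using w wG by (auto simp: u_def v_def)
  obtain n where n: "n \<in> N" "g = wprod G (u @ v) \<otimes> n"
    using sort[OF wG, of "\<lambda>s. 0 \<le> \<chi> s"] w uv by (auto simp: u_def v_def)
  have nG: "n \<in> carrier G" using n N.subset by auto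
  have up: "stays G ?P h u" if "h \<in> ?P" "set u \<subseteq> carrier G" "\<forall>s\<in>set u. 0 \<le> \<chi> s" for u h
    using that by (induction u arbitrary: h) (auto simp: \<chi>)
  \<comment> \<open>The letters of \<open>v\<close> are negative, so every point of the path lies at
    or above its end point, whose value is nonnegative.\<close>
  have down: "stays G ?P h v \<and> \<chi> (h \<otimes> wprod G v) \<le> \<chi> h"
    if "h \<in> carrier G" "0 \<le> \<chi> (h \<otimes> wprod G v)" "set v \<subseteq> carrier G" "\<forall>s\<in>set v. \<chi> s < 0" for v h
    using that
  proof (induction v arbitrary: h)
    case (Cons x v)
    then have "h \<otimes> wprod G (x # v) = h \<otimes> x \<otimes> wprod G v" by (simp add: m_assoc)
    with Cons have "stays G ?P (h \<otimes> x) v" "\<chi> (h \<otimes> wprod G (x # v)) \<le> \<chi> (h \<otimes> x)"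
      by auto
    moreover have "\<chi> (h \<otimes> x) < \<chi> h" using Cons.prems by (simp add: \<chi>)
    ultimately show ?case using Cons.prems by auto
  qed auto
  have val: "\<chi> (wprod G (u @ v)) = \<chi> g"
  proof -
    have "wprod G (u @ v) \<in> carrier G" using uv by auto
    from \<chi>[OF this nG] show ?thesis
      using N(3)[OF n(1)] unfolding n(2)[symmetric] by simp
  qed
  have st: "stays G ?P \<one> (u @ v)"
  proof -
    have "stays G ?P \<one> u"
      using uv one by (intro up) (auto simp: u_def)
    moreover have "stays G ?P (wprod G u) v"
      using uv g val by (intro down[THEN conjunct1]) (auto simp: v_def)
    ultimately show ?thesis
      using uv by (simp add: stays_append)
  qed
  let ?g = "wprod G (u @ v)"
  have "?g \<in> ?P" using val g uv by auto
  \<comment> \<open>Translation by \<open>?g\<close> maps the half space into itself and turns the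
    connection of \<open>\<one>\<close> with \<open>n\<close> into one of \<open>?g\<close> with
    \<open>g\<close>.\<close>
  then have "conn ?M T (?g \<otimes> \<one>) (?g \<otimes> n)"
    unfolding M using conn[OF n(1)] S
    by (intro conn_translate[THEN conjunct1]) (auto simp: T \<chi> M one)
  moreover have "conn ?M T \<one> (\<one> \<otimes> ?g)"
    using st uv by (intro word) auto
  ultimately show ?thesis
    using conn_trans n(2) uv by auto
qed

text \<open>Evaluation of the 1-cochain \<open>c\<close> on the path that starts at
  \<open>h\<close>.\<close>

primrec path_sum :: "('a, 'm) monoid_scheme \<Rightarrow> ('a \<Rightarrow> 'a \<Rightarrow> int) \<Rightarrow> 'a \<Rightarrow> 'a list \<Rightarrow> int" where
  "path_sum G c h [] = 0"
| "path_sum G c h (x # w) = c h (h \<otimes>\<^bsub>G\<^esub> x) + path_sum G c (h \<otimes>\<^bsub>G\<^esub> x) w"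

lemma (in group) path_sum_append:
  "\<lbrakk>h \<in> carrier G; set u \<subseteq> carrier G; set v \<subseteq> carrier G\<rbrakk>
    \<Longrightarrow> path_sum G c h (u @ v) = path_sum G c h u + path_sum G c (h \<otimes> wprod G u) v"
  by (induction u arbitrary: h) (auto simp: m_assoc)

lemma (in group) word_value_bound:
  assumes \<chi>: "\<And>x y. x \<in> carrier G \<Longrightarrow> y \<in> carrier G \<Longrightarrow> \<chi> (x \<otimes> y) = \<chi> x + (\<chi> y :: real)"
    and "set w \<subseteq> Y" "Y \<subseteq> carrier G" "\<And>y. y \<in> Y \<Longrightarrow> \<bar>\<chi> y\<bar> \<le> c"
  shows "\<bar>\<chi> (wprod G w)\<bar> \<le> real (length w) * c"
  using assms(2)
proof (induction w)
  case Nil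
  then show ?case using \<chi>[of \<one> \<one>] by simp
next
  case (Cons x w)
  then have "\<chi> (wprod G (x # w)) = \<chi> x + \<chi> (wprod G w)"
    using assms(3) by (auto intro!: \<chi>)
  moreover have "\<bar>\<chi> x\<bar> \<le> c" using Cons assms by auto
  ultimately show ?case using Cons by (auto simp: algebra_simps)
qed

text \<open>The Mayer--Vietoris coboundary of \<open>E1 \<and> E2\<close> for the cover of the level set by
  \<open>{- K \<le> \<chi>}\<close> and \<open>{\<chi> \<le> 0}\<close>, where \<open>E1\<close> and \<open>E2\<close> are locally constant: it vanishes on short loops,
  because these lie in one of the two parts.\<close>

lemma (in group) mayer_vietoris_cocycle:
  assumes wp: "word_presented G Y L"
    and \<chi>: "\<And>x y. x \<in> carrier G \<Longrightarrow> y \<in> carrier G \<Longrightarrow> \<chi> (x \<otimes> y) = \<chi> x + (\<chi> y :: real)"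
    and c0: "\<And>y. y \<in> Y \<Longrightarrow> \<bar>\<chi> y\<bar> \<le> c0" "0 \<le> c0" and K: "2 * real L * c0 \<le> K"
    and E1: "\<And>h y. h \<in> carrier G \<Longrightarrow> y \<in> Y \<Longrightarrow> - K \<le> \<chi> h \<Longrightarrow> - K \<le> \<chi> (h \<otimes> y) \<Longrightarrow> E1 h = E1 (h \<otimes> y)"
    and E2: "\<And>h y. h \<in> carrier G \<Longrightarrow> y \<in> Y \<Longrightarrow> \<chi> h \<le> 0 \<Longrightarrow> \<chi> (h \<otimes> y) \<le> 0 \<Longrightarrow> E2 h = E2 (h \<otimes> y)"
    and A: "set A \<subseteq> Y" "stays G {h \<in> carrier G. \<chi> h \<le> 0} \<one> A" "\<chi> (wprod G A) = 0"
    and B: "set B \<subseteq> Y" "stays G {h \<in> carrier G. - K \<le> \<chi> h} \<one> B" "\<chi> (wprod G B) = 0"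
    and comm: "wprod G A \<otimes> wprod G B = wprod G B \<otimes> wprod G A"
    and one: "E1 \<one>" "E2 \<one>"
  shows "E1 (wprod G A) \<and> E2 (wprod G A) \<or> E1 (wprod G A \<otimes> wprod G B) \<and> E2 (wprod G A \<otimes> wprod G B)
    \<or> E1 (wprod G B) \<and> E2 (wprod G B)"
proof (rule ccontr)
  assume contr: "\<not> ?thesis"
  from wp have Y: "Y \<subseteq> carrier G" "\<forall>y\<in>Y. inv y \<in> Y"
    and triv: "\<And>w. set w \<subseteq> Y \<Longrightarrow> wprod G w = \<one> \<Longrightarrow> homot G Y L (carrier G) \<one> w []"
    unfolding word_presented_def by auto
  define E where "E = (\<lambda>h. if E1 h \<and> E2 h then 1 else (0 :: int))"
  \<comment> \<open>The coboundary of \<open>E\<close>, cut off below \<open>- K\<close>. On an edge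
    inside both parts \<open>E1\<close> and \<open>E2\<close> are constant, so the coboundary is
    zero there and \<open>c\<close> vanishes on all edges of \<open>?U2\<close>.\<close>
  define c where "c = (\<lambda>h h'. if - K \<le> \<chi> h \<and> - K \<le> \<chi> h' then E h' - E h else 0)"
  let ?U1 = "{h \<in> carrier G. - K \<le> \<chi> h}" and ?U2 = "{h \<in> carrier G. \<chi> h \<le> 0}"
  have U1: "path_sum G c h w = E (h \<otimes> wprod G w) - E h"
    if "stays G ?U1 h w" "set w \<subseteq> carrier G" "h \<in> carrier G" for h w
    using that
  proof (induction w arbitrary: h)
    case (Cons x w)
    then show ?case
      using stays_start[of ?U1 "h \<otimes> x" w] by (auto simp: c_def m_assoc)
  qed simp
  have U2: "path_sum G c h w = 0"
    if "stays G ?U2 h w" "set w \<subseteq> Y" "h \<in> carrier G" for h w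
    using that
  proof (induction w arbitrary: h)
    case (Cons x w)
    have "c h (h \<otimes> x) = 0"
      using Cons.prems stays_start[of ?U2 "h \<otimes> x" w] E1[of h x] E2[of h x] by (auto simp: c_def E_def)
    then show ?case
      using Cons Y by auto
  qed simp
  have \<chi>1: "\<chi> \<one> = 0" using \<chi>[of \<one> \<one>] by simp
  \<comment> \<open>Along a word of at most \<open>L\<close> letters the value moves at most
    \<open>K / 2\<close> away from its start, so the loop lies in \<open>?U1\<close> if it starts at
    or above \<open>- K / 2\<close> and in \<open>?U2\<close> otherwise.\<close>
  have short: "path_sum G c h s = 0"
    if s: "set s \<subseteq> Y" "length s \<le> L" "wprod G s = \<one>" and h: "h \<in> carrier G" for h s
  proof -
    have sG: "set s \<subseteq> carrier G" using s Y by auto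
    have bound: "\<bar>\<chi> (wprod G u)\<bar> \<le> K / 2" if "s = u @ v" for u v
    proof -
      have "\<bar>\<chi> (wprod G u)\<bar> \<le> real (length u) * c0"
        using s that Y c0 by (intro word_value_bound[OF \<chi>]) auto
      also have "\<dots> \<le> real L * c0"
        using s that c0(2) by (intro mult_right_mono) auto
      finally show ?thesis using K by simp
    qed
    show ?thesis
    proof (cases "- K / 2 \<le> \<chi> h")
      case True
      have "stays G ?U1 h s"
        unfolding stays_iff[OF h sG]
      proof (intro allI impI)
        fix u v assume "s = u @ v"
        then show "h \<otimes> wprod G u \<in> ?U1"
          using bound[of u v] True h sG by (auto simp: \<chi>)
      qed
      then show ?thesis using U1[OF _ sG h] s h by simp
    next
      case False
      have "stays G ?U2 h s"
        unfolding stays_iff[OF h sG]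
      proof (intro allI impI)
        fix u v assume "s = u @ v"
        then show "h \<otimes> wprod G u \<in> ?U2"
          using bound[of u v] False h sG by (auto simp: \<chi>)
      qed
      then show ?thesis using U2 s h by simp
    qed
  qed
  have invariant: "path_sum G c \<one> u = path_sum G c \<one> v" if "homot G Y L (carrier G) \<one> u v" for u v
    using that
  proof induction
    case (delete u s v)
    then have "set u \<subseteq> carrier G" "set s \<subseteq> carrier G" "set v \<subseteq> carrier G" using Y by auto
    then show ?case using delete short[of s "wprod G u"] by (simp add: path_sum_append)
  qed auto
  \<comment> \<open>Both \<open>A\<close> segments run in \<open>?U2\<close> and contribute zero.
    The \<open>B\<close> segments contribute \<open>E (a b) - E a = 0\<close> and
    \<open>E \<one> - E b = 1\<close>. The total 1 contradicts the contractibility of the commutator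
    loop.\<close>
  let ?w = "A @ B @ winv G A @ winv G B" and ?a = "wprod G A" and ?b = "wprod G B"
  have AG: "set A \<subseteq> carrier G" and BG: "set B \<subseteq> carrier G" using A B Y by auto
  have wY: "set ?w \<subseteq> Y" using A B set_winv_subset[of _ Y] Y by auto
  have ab: "?a \<in> carrier G" "?b \<in> carrier G" using AG BG by auto
  have cancel: "?a \<otimes> ?b \<otimes> inv ?a = ?b"
    using comm ab by (simp add: m_assoc)
  have "wprod G ?w = ?a \<otimes> ?b \<otimes> inv ?a \<otimes> inv ?b"
    using AG BG by (simp add: m_assoc)
  then have "wprod G ?w = \<one>"
    using cancel ab by simp
  then have "path_sum G c \<one> ?w = 0"
    using invariant[OF triv[OF wY]] by simp
  moreover have "path_sum G c \<one> A = 0"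
    using U2 A by simp
  moreover have "path_sum G c ?a B = 0"
  proof -
    have "stays G ?U1 (?a \<otimes> \<one>) B"
      by (rule iffD2[OF stays_translate]) (use ab BG B A in \<open>auto simp: \<chi> intro: stays_mono\<close>)
    then show ?thesis
      using U1[of ?a B] ab BG contr by (auto simp: E_def)
  qed
  moreover have "path_sum G c (?a \<otimes> ?b) (winv G A) = 0"
  proof -
    have "stays G ?U2 (?b \<otimes> \<one>) A"
      by (rule iffD2[OF stays_translate]) (use ab AG B A in \<open>auto simp: \<chi> intro: stays_mono\<close>)
    then have "stays G ?U2 (?b \<otimes> ?a) (winv G A)"
      using stays_winv[of ?b A ?U2] ab AG by simp
    then show ?thesis
      using U2 ab comm set_winv_subset[OF A(1) Y(2)] by simp
  qed
  moreover have "path_sum G c ?b (winv G B) = 1"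
  proof -
    have "stays G ?U1 ?b (winv G B)"
      using stays_winv[of \<one> B ?U1] ab BG B by simp
    then show ?thesis
      using U1[of ?b "winv G B"] ab BG contr one by (auto simp: E_def)
  qed
  ultimately show False
    using AG BG ab cancel by (simp add: path_sum_append)
qed

text \<open>The projections of the fibre product enter as surjections \<open>f1\<close> and
  \<open>f2\<close> with trivial common kernel. By the sign in \<open>\<chi>12\<close> a single
  function \<chi> on \<open>H\<close> measures both half spaces: that of \<open>G1\<close>
  corresponds to an upper part of \<open>H\<close> and that of \<open>G2\<close> to a lower part, so
  after a shift they cover \<open>H\<close> and overlap in a strip.\<close>

lemma word_presented_imp_fin_connected:
  fixes H :: "('h, 'k) monoid_scheme" and G1 :: "('a, 'm) monoid_scheme" and G2 :: "('b, 'n) monoid_scheme"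
  assumes H: "group H" and G1: "group G1" and G2: "group G2" and wp: "word_presented H Y L"
    and f1: "f1 \<in> hom H G1" "f1 ` carrier H = carrier G1"
    and f2: "f2 \<in> hom H G2" "f2 ` carrier H = carrier G2"
    and inj: "\<And>h. h \<in> carrier H \<Longrightarrow> f1 h = \<one>\<^bsub>G1\<^esub> \<Longrightarrow> f2 h = \<one>\<^bsub>G2\<^esub> \<Longrightarrow> h = \<one>\<^bsub>H\<^esub>"
    and N1: "N1 \<lhd> G1" "derived G1 (carrier G1) \<subseteq> N1"
      "\<And>n. n \<in> N1 \<Longrightarrow> \<exists>h\<in>carrier H. f1 h = n \<and> f2 h = \<one>\<^bsub>G2\<^esub>"
    and N2: "N2 \<lhd> G2" "derived G2 (carrier G2) \<subseteq> N2"
      "\<And>n. n \<in> N2 \<Longrightarrow> \<exists>h\<in>carrier H. f1 h = \<one>\<^bsub>G1\<^esub> \<and> f2 h = n"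
    and \<chi>1: "\<And>x y. x \<in> carrier G1 \<Longrightarrow> y \<in> carrier G1 \<Longrightarrow> \<chi>1 (x \<otimes>\<^bsub>G1\<^esub> y) = \<chi>1 x + (\<chi>1 y :: real)"
    and \<chi>2: "\<And>x y. x \<in> carrier G2 \<Longrightarrow> y \<in> carrier G2 \<Longrightarrow> \<chi>2 (x \<otimes>\<^bsub>G2\<^esub> y) = \<chi>2 x + (\<chi>2 y :: real)"
    and \<chi>12: "\<And>h. h \<in> carrier H \<Longrightarrow> \<chi>2 (f2 h) = - \<chi>1 (f1 h)"
    and nz: "\<exists>g\<in>carrier G1. \<chi>1 g \<noteq> 0"
  shows "fin_connected (character_monoid G1 \<chi>1) \<or> fin_connected (character_monoid G2 \<chi>2)"
proof (rule ccontr)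
  assume contr: "\<not> ?thesis"
  interpret H: group H by fact
  interpret G1: group G1 by fact
  interpret G2: group G2 by fact
  interpret f1: group_hom H G1 f1 by unfold_locales (rule f1)
  interpret f2: group_hom H G2 f2 by unfold_locales (rule f2)
  from wp have Y: "finite Y" "Y \<subseteq> carrier H" "\<And>y. y \<in> Y \<Longrightarrow> inv\<^bsub>H\<^esub> y \<in> Y"
    and gen: "\<And>h. h \<in> carrier H \<Longrightarrow> \<exists>w. set w \<subseteq> Y \<and> wprod H w = h"
    unfolding word_presented_def by auto
  have map1: "wprod G1 (map f1 w) = f1 (wprod H w)" if "set w \<subseteq> carrier H" for w
    using that by (induction w) auto
  have map2: "wprod G2 (map f2 w) = f2 (wprod H w)" if "set w \<subseteq> carrier H" for w
    using that by (induction w) auto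
  define \<chi> where "\<chi> = (\<lambda>h. \<chi>1 (f1 h))"
  have \<chi>: "\<chi> (x \<otimes>\<^bsub>H\<^esub> y) = \<chi> x + \<chi> y" if "x \<in> carrier H" "y \<in> carrier H" for x y
    using that by (simp add: \<chi>_def \<chi>1)
  have \<chi>_one: "\<chi> \<one>\<^bsub>H\<^esub> = 0" using \<chi>[of "\<one>\<^bsub>H\<^esub>" "\<one>\<^bsub>H\<^esub>"] by simp
  have \<chi>_inv: "\<chi> (inv\<^bsub>H\<^esub> x) = - \<chi> x" if "x \<in> carrier H" for x
    using \<chi>[of x "inv\<^bsub>H\<^esub> x"] that \<chi>_one by simp
  have \<chi>2_f2: "\<chi>2 (f2 h) = - \<chi> h" if "h \<in> carrier H" for h
    using \<chi>12[OF that] by (simp add: \<chi>_def)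
  have \<chi>1_one: "\<chi>1 \<one>\<^bsub>G1\<^esub> = 0" and \<chi>2_one: "\<chi>2 \<one>\<^bsub>G2\<^esub> = 0"
    using \<chi>1[of "\<one>\<^bsub>G1\<^esub>" "\<one>\<^bsub>G1\<^esub>"] \<chi>2[of "\<one>\<^bsub>G2\<^esub>" "\<one>\<^bsub>G2\<^esub>"] by simp_all
  define T1 where "T1 = {s \<in> f1 ` Y. 0 \<le> \<chi>1 s}"
  define T2 where "T2 = {s \<in> f2 ` Y. 0 \<le> \<chi>2 s}"
  define M1 where "M1 = character_monoid G1 \<chi>1"
  define M2 where "M2 = character_monoid G2 \<chi>2"
  have N1_0: "\<chi>1 n = 0" if "n \<in> N1" for n
    using N1(3)[OF that] \<chi>12 \<chi>2_one by force
  have N2_0: "\<chi>2 n = 0" if "n \<in> N2" for n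
    using N2(3)[OF that] \<chi>12 \<chi>1_one by force
  have S1: "f1 ` Y \<subseteq> carrier G1" "\<And>s. s \<in> f1 ` Y \<Longrightarrow> inv\<^bsub>G1\<^esub> s \<in> f1 ` Y"
    and S2: "f2 ` Y \<subseteq> carrier G2" "\<And>s. s \<in> f2 ` Y \<Longrightarrow> inv\<^bsub>G2\<^esub> s \<in> f2 ` Y"
    using Y by (auto simp: subset_iff simp flip: f1.hom_inv f2.hom_inv)
  have gen1: "\<exists>w. set w \<subseteq> f1 ` Y \<and> wprod G1 w = g" if "g \<in> carrier G1" for g
  proof -
    from that f1(2) obtain h where "h \<in> carrier H" "f1 h = g" by (metis imageE)
    with gen obtain w where "set w \<subseteq> Y" "f1 (wprod H w) = g" by blast
    then show ?thesis using map1[of w] Y by (intro exI[of _ "map f1 w"]) auto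
  qed
  have gen2: "\<exists>w. set w \<subseteq> f2 ` Y \<and> wprod G2 w = g" if "g \<in> carrier G2" for g
  proof -
    from that f2(2) obtain h where "h \<in> carrier H" "f2 h = g" by (metis imageE)
    with gen obtain w where "set w \<subseteq> Y" "f2 (wprod H w) = g" by blast
    then show ?thesis using map2[of w] Y by (intro exI[of _ "map f2 w"]) auto
  qed
  have fin: "finite T1" "finite T2" "T1 \<subseteq> carrier M1" "T2 \<subseteq> carrier M2"
    using Y S1 S2 by (auto simp: T1_def T2_def M1_def M2_def character_monoid_def)
  have M_one: "\<one>\<^bsub>M1\<^esub> = \<one>\<^bsub>G1\<^esub>" "\<one>\<^bsub>M2\<^esub> = \<one>\<^bsub>G2\<^esub>"
    and M_mult: "\<And>x y. x \<otimes>\<^bsub>M1\<^esub> y = x \<otimes>\<^bsub>G1\<^esub> y" "\<And>x y. x \<otimes>\<^bsub>M2\<^esub> y = x \<otimes>\<^bsub>G2\<^esub> y"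
    and M_car: "\<And>x. x \<in> carrier M1 \<longleftrightarrow> x \<in> carrier G1 \<and> 0 \<le> \<chi>1 x"
      "\<And>x. x \<in> carrier M2 \<longleftrightarrow> x \<in> carrier G2 \<and> 0 \<le> \<chi>2 x"
    by (auto simp: M1_def M2_def character_monoid_def)
  have "\<not> fin_connected M1" "\<not> fin_connected M2"
    using contr by (simp_all add: M1_def M2_def)
  then have "\<not> (\<forall>g\<in>carrier M1. conn M1 T1 \<one>\<^bsub>G1\<^esub> g)" "\<not> (\<forall>g\<in>carrier M2. conn M2 T2 \<one>\<^bsub>G2\<^esub> g)"
    unfolding fin_connected_def M_one using fin by blast+
  then have not_conn: "\<exists>g\<in>carrier M1. \<not> conn M1 T1 \<one>\<^bsub>G1\<^esub> g" "\<exists>g\<in>carrier M2. \<not> conn M2 T2 \<one>\<^bsub>G2\<^esub> g"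
    by simp_all
  have "\<exists>n\<in>N1. \<not> conn M1 T1 \<one>\<^bsub>G1\<^esub> n"
  proof (rule ccontr)
    assume "\<not> ?thesis"
    then have *: "conn (character_monoid G1 \<chi>1) T1 \<one>\<^bsub>G1\<^esub> n" if "n \<in> N1" for n
      using that by (simp add: M1_def)
    have "conn M1 T1 \<one>\<^bsub>G1\<^esub> g" if "g \<in> carrier M1" for g
      using G1.conn_of_kernel[OF \<chi>1 S1 gen1 N1(1,2) N1_0 T1_def *, of g] that
      by (simp add: M_car M1_def[symmetric])
    then show False using not_conn(1) by simp
  qed
  then obtain n1 where n1: "n1 \<in> N1" "\<not> conn M1 T1 \<one>\<^bsub>G1\<^esub> n1" by auto
  have "\<exists>n\<in>N2. \<not> conn M2 T2 \<one>\<^bsub>G2\<^esub> n"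
  proof (rule ccontr)
    assume "\<not> ?thesis"
    then have *: "conn (character_monoid G2 \<chi>2) T2 \<one>\<^bsub>G2\<^esub> n" if "n \<in> N2" for n
      using that by (simp add: M2_def)
    have "conn M2 T2 \<one>\<^bsub>G2\<^esub> g" if "g \<in> carrier M2" for g
      using G2.conn_of_kernel[OF \<chi>2 S2 gen2 N2(1,2) N2_0 T2_def *, of g] that
      by (simp add: M_car M2_def[symmetric])
    then show False using not_conn(2) by simp
  qed
  then obtain n2 where n2: "n2 \<in> N2" "\<not> conn M2 T2 \<one>\<^bsub>G2\<^esub> n2" by auto
  obtain \<alpha> where \<alpha>: "\<alpha> \<in> carrier H" "f1 \<alpha> = n1" "f2 \<alpha> = \<one>\<^bsub>G2\<^esub>" using N1(3)[OF n1(1)] by blast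
  obtain \<beta> where \<beta>: "\<beta> \<in> carrier H" "f1 \<beta> = \<one>\<^bsub>G1\<^esub>" "f2 \<beta> = n2" using N2(3)[OF n2(1)] by blast
  obtain W where W: "set W \<subseteq> Y" "wprod H W = \<alpha>" using gen \<alpha> by blast
  obtain B where B: "set B \<subseteq> Y" "wprod H B = \<beta>" using gen \<beta> by blast
  have \<chi>\<alpha>: "\<chi> \<alpha> = 0" and \<chi>\<beta>: "\<chi> \<beta> = 0"
    using N1_0[OF n1(1)] \<alpha> \<beta> \<chi>1_one by (simp_all add: \<chi>_def)
  obtain t where t: "t \<in> Y" "0 < \<chi> t"
  proof -
    have "\<exists>y\<in>Y. \<chi> y \<noteq> 0"
    proof (rule ccontr)
      assume *: "\<not> ?thesis"
      have "\<bar>\<chi> (wprod H w)\<bar> \<le> real (length w) * 0" if "set w \<subseteq> Y" for w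
        using * that Y by (intro H.word_value_bound[OF \<chi>]) auto
      then have "\<chi> h = 0" if "h \<in> carrier H" for h
        using gen[OF that] by auto
      moreover obtain g where "g \<in> carrier G1" "\<chi>1 g \<noteq> 0" using nz by blast
      moreover from this f1(2) obtain h where "h \<in> carrier H" "f1 h = g" by (metis imageE)
      ultimately show False unfolding \<chi>_def by metis
    qed
    then obtain y where "y \<in> Y" "\<chi> y \<noteq> 0" by blast
    then show thesis
      using that[of y] that[of "inv\<^bsub>H\<^esub> y"] Y \<chi>_inv[of y] by (cases "0 < \<chi> y") auto
  qed
  have tH: "t \<in> carrier H" using t Y by auto
  define c0 where "c0 = Max ((\<lambda>y. \<bar>\<chi> y\<bar>) ` Y)"
  have c0: "\<bar>\<chi> y\<bar> \<le> c0" if "y \<in> Y" for y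
    unfolding c0_def using Y that by (intro Max_ge) auto
  have c0_nonneg: "0 \<le> c0" using c0[OF t(1)] by simp
  have WH: "set W \<subseteq> carrier H" and BH: "set B \<subseteq> carrier H" using W B Y by auto
  \<comment> \<open>\<open>2 L c0\<close> is the width of the strip that the cocycle needs. The
    lengths of \<open>W\<close> and \<open>B\<close> keep the conjugated path of \<open>W\<close>
    below 0 and the path of \<open>B\<close> above \<open>- K\<close>.\<close>
  obtain k :: nat where k: "real (2 * L + length W + length B) * c0 / \<chi> t \<le> real k"
    using real_arch_simple by blast
  define K where "K = real k * \<chi> t"
  have K0: "real (2 * L + length W + length B) * c0 \<le> K"
    using k t by (simp add: K_def field_simps)
  have K: "2 * real L * c0 \<le> K" "real (length W) * c0 \<le> K" "real (length B) * c0 \<le> K" "0 \<le> K"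
  proof -
    have *: "0 \<le> real L * c0" "0 \<le> real (length W) * c0" "0 \<le> real (length B) * c0"
      using c0_nonneg by simp_all
    then show "2 * real L * c0 \<le> K" "real (length W) * c0 \<le> K" "real (length B) * c0 \<le> K" "0 \<le> K"
      using K0 by (simp_all add: algebra_simps)
  qed
  define \<tau> where "\<tau> = wprod H (replicate k t)"
  have \<tau>: "\<tau> \<in> carrier H" using tH by (auto simp: \<tau>_def)
  have \<chi>_rep: "\<chi> (wprod H (replicate j t)) = real j * \<chi> t" for j
  proof (induction j)
    case (Suc j)
    have "set (replicate j t) \<subseteq> carrier H" using tH by auto
    then show ?case using Suc tH by (simp add: \<chi> algebra_simps)
  qed (simp add: \<chi>_one)
  \<comment> \<open>The path descends to level \<open>- K\<close>, reads \<open>W\<close> there and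
    returns; so it stays in the lower part although \<open>W\<close> alone need not.\<close>
  define A where "A = winv H (replicate k t) @ W @ replicate k t"
  have tk: "set (replicate k t) \<subseteq> Y" "set (replicate k t) \<subseteq> carrier H" using t tH by auto
  have AY: "set A \<subseteq> Y"
    using tk W H.set_winv_subset[of "replicate k t" Y] Y by (auto simp: A_def)
  have A: "wprod H A = inv\<^bsub>H\<^esub> \<tau> \<otimes>\<^bsub>H\<^esub> \<alpha> \<otimes>\<^bsub>H\<^esub> \<tau>"
    using tk WH W \<tau> \<alpha> by (simp add: A_def \<tau>_def H.m_assoc)
  have \<chi>\<tau>: "\<chi> \<tau> = K" by (simp add: \<tau>_def \<chi>_rep K_def)
  let ?U2 = "{h \<in> carrier H. \<chi> h \<le> 0}" and ?U1 = "{h \<in> carrier H. - K \<le> \<chi> h}"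
  have rep: "stays H ?U2 (inv\<^bsub>H\<^esub> \<tau>) (replicate k t)"
    unfolding H.stays_iff[OF H.inv_closed[OF \<tau>] tk(2)]
  proof (intro allI impI)
    fix u v assume uv: "replicate k t = u @ v"
    then have "u = replicate (length u) t" "length u \<le> k"
      by (metis append_eq_conv_conj length_append length_replicate take_replicate le_add1 min.absorb1)+
    then have "\<chi> (wprod H u) = real (length u) * \<chi> t" "wprod H u \<in> carrier H"
      using \<chi>_rep tH by (metis, metis H.wprod_closed set_replicate_conv_if empty_subsetI insert_subset)
    moreover have "real (length u) * \<chi> t \<le> K"
      unfolding K_def using \<open>length u \<le> k\<close> t by (intro mult_right_mono) auto
    ultimately show "inv\<^bsub>H\<^esub> \<tau> \<otimes>\<^bsub>H\<^esub> wprod H u \<in> ?U2"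
      using \<tau> by (simp add: \<chi> \<chi>_inv \<chi>\<tau>)
  qed
  have stA: "stays H ?U2 \<one>\<^bsub>H\<^esub> A"
  proof -
    have 1: "stays H ?U2 \<one>\<^bsub>H\<^esub> (winv H (replicate k t))"
      using H.stays_winv[of "inv\<^bsub>H\<^esub> \<tau>" "replicate k t" ?U2] rep \<tau> tk by (simp flip: \<tau>_def)
    have 2: "stays H ?U2 (inv\<^bsub>H\<^esub> \<tau>) W"
      unfolding H.stays_iff[OF H.inv_closed[OF \<tau>] WH]
    proof (intro allI impI)
      fix u v assume uv: "W = u @ v"
      then have u: "set u \<subseteq> Y" "wprod H u \<in> carrier H" using W WH by auto
      have "\<bar>\<chi> (wprod H u)\<bar> \<le> real (length u) * c0"
        using u Y c0 by (intro H.word_value_bound[OF \<chi>]) auto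
      also have "\<dots> \<le> real (length W) * c0"
        using uv c0_nonneg by (intro mult_right_mono) auto
      finally show "inv\<^bsub>H\<^esub> \<tau> \<otimes>\<^bsub>H\<^esub> wprod H u \<in> ?U2"
        using \<tau> u K by (simp add: \<chi> \<chi>_inv \<chi>\<tau>)
    qed
    have 3: "stays H ?U2 (inv\<^bsub>H\<^esub> \<tau> \<otimes>\<^bsub>H\<^esub> \<alpha>) (replicate k t)"
    proof -
      have "inv\<^bsub>H\<^esub> \<tau> \<otimes>\<^bsub>H\<^esub> wprod H u \<in> ?U2 \<Longrightarrow> set u \<subseteq> carrier H \<Longrightarrow> inv\<^bsub>H\<^esub> \<tau> \<otimes>\<^bsub>H\<^esub> \<alpha> \<otimes>\<^bsub>H\<^esub> wprod H u \<in> ?U2" for u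
        using \<tau> \<alpha> by (simp add: \<chi> \<chi>\<alpha>)
      then show ?thesis
        using rep \<tau> \<alpha> tk(2)
        by (subst H.stays_iff) (auto simp: H.stays_iff)
    qed
    show ?thesis
      unfolding A_def using 1 2 3 tk WH W \<tau> \<alpha>
      by (simp add: H.stays_append flip: \<tau>_def)
  qed
  have stB: "stays H ?U1 \<one>\<^bsub>H\<^esub> B"
    unfolding H.stays_iff[OF H.one_closed BH]
  proof (intro allI impI)
    fix u v assume uv: "B = u @ v"
    then have u: "set u \<subseteq> Y" "wprod H u \<in> carrier H" using B BH by auto
    have "\<bar>\<chi> (wprod H u)\<bar> \<le> real (length u) * c0"
      using u Y c0 by (intro H.word_value_bound[OF \<chi>]) auto
    also have "\<dots> \<le> real (length B) * c0"
      using uv c0_nonneg by (intro mult_right_mono) auto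
    finally show "\<one>\<^bsub>H\<^esub> \<otimes>\<^bsub>H\<^esub> wprod H u \<in> ?U1"
      using u K by simp
  qed
  \<comment> \<open>Translation by \<tau>, which has value \<open>K\<close>, moves the upper part
    \<open>?U1\<close> into the half space of \<open>\<chi>1\<close>, where the component can be
    read off.\<close>
  define E1 where "E1 = (\<lambda>h. conn M1 T1 \<one>\<^bsub>G1\<^esub> (f1 \<tau> \<otimes>\<^bsub>G1\<^esub> f1 h))"
  define E2 where "E2 = (\<lambda>h. conn M2 T2 \<one>\<^bsub>G2\<^esub> (f2 h))"
  have step1: "conn M1 T1 x g \<longleftrightarrow> conn M1 T1 x (g \<otimes>\<^bsub>G1\<^esub> f1 y)"
    if "g \<in> carrier G1" "0 \<le> \<chi>1 g" "0 \<le> \<chi>1 (g \<otimes>\<^bsub>G1\<^esub> f1 y)" "y \<in> Y" for x g y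
  proof (cases "0 \<le> \<chi>1 (f1 y)")
    case True
    then have "f1 y \<in> T1" using that by (auto simp: T1_def)
    then show ?thesis using that conn.step[of M1 T1 x g "f1 y"] conn.unstep[of M1 T1 x g "f1 y"]
      by (auto simp: M_car M_mult)
  next
    case False
    have y: "y \<in> carrier H" using that Y by auto
    have "f1 (inv\<^bsub>H\<^esub> y) \<in> T1" using that y Y False \<chi>_inv[OF y] by (auto simp: T1_def \<chi>_def simp del: f1.hom_inv)
    moreover have "g \<otimes>\<^bsub>G1\<^esub> f1 y \<otimes>\<^bsub>G1\<^esub> f1 (inv\<^bsub>H\<^esub> y) = g" using that y by (simp add: G1.m_assoc)
    ultimately show ?thesis
      using that y conn.step[of M1 T1 x "g \<otimes>\<^bsub>G1\<^esub> f1 y" "f1 (inv\<^bsub>H\<^esub> y)"] conn.unstep[of M1 T1 x "g \<otimes>\<^bsub>G1\<^esub> f1 y" "f1 (inv\<^bsub>H\<^esub> y)"]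
      by (auto simp: M_car M_mult simp del: f1.hom_inv)
  qed
  have step2: "conn M2 T2 x g \<longleftrightarrow> conn M2 T2 x (g \<otimes>\<^bsub>G2\<^esub> f2 y)"
    if "g \<in> carrier G2" "0 \<le> \<chi>2 g" "0 \<le> \<chi>2 (g \<otimes>\<^bsub>G2\<^esub> f2 y)" "y \<in> Y" for x g y
  proof (cases "0 \<le> \<chi>2 (f2 y)")
    case True
    then have "f2 y \<in> T2" using that by (auto simp: T2_def)
    then show ?thesis using that conn.step[of M2 T2 x g "f2 y"] conn.unstep[of M2 T2 x g "f2 y"]
      by (auto simp: M_car M_mult)
  next
    case False
    have y: "y \<in> carrier H" "inv\<^bsub>H\<^esub> y \<in> carrier H" using that Y by auto
    have "f2 (inv\<^bsub>H\<^esub> y) \<in> T2" using that y Y False \<chi>_inv[OF y(1)] \<chi>2_f2[OF y(1)] \<chi>2_f2[OF y(2)]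
      by (auto simp: T2_def simp del: f2.hom_inv)
    moreover have "g \<otimes>\<^bsub>G2\<^esub> f2 y \<otimes>\<^bsub>G2\<^esub> f2 (inv\<^bsub>H\<^esub> y) = g" using that y by (simp add: G2.m_assoc)
    ultimately show ?thesis
      using that y conn.step[of M2 T2 x "g \<otimes>\<^bsub>G2\<^esub> f2 y" "f2 (inv\<^bsub>H\<^esub> y)"] conn.unstep[of M2 T2 x "g \<otimes>\<^bsub>G2\<^esub> f2 y" "f2 (inv\<^bsub>H\<^esub> y)"]
      by (auto simp: M_car M_mult simp del: f2.hom_inv)
  qed
  \<comment> \<open>Right multiplication by the positive letter \<open>t\<close> follows edges
    inside the half space. With \<open>f1A\<close> this identifies \<open>E1\<close> at the end of
    \<open>A\<close> with the question whether \<open>n1\<close> is connected to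
    \<open>\<one>\<close>.\<close>
  have \<tau>_path: "conn M1 T1 x g \<longleftrightarrow> conn M1 T1 x (g \<otimes>\<^bsub>G1\<^esub> f1 (wprod H (replicate j t)))"
    if "g \<in> carrier G1" "0 \<le> \<chi>1 g" for x g j
    using that
  proof (induction j arbitrary: g)
    case (Suc j)
    have r: "set (replicate j t) \<subseteq> carrier H" using tH by auto
    have ge: "0 \<le> \<chi>1 (g \<otimes>\<^bsub>G1\<^esub> f1 t)"
      using Suc.prems tH t by (simp add: \<chi>1 \<chi>_def)
    have "conn M1 T1 x g \<longleftrightarrow> conn M1 T1 x (g \<otimes>\<^bsub>G1\<^esub> f1 t)"
      using Suc.prems t ge by (intro step1)
    also have "\<dots> \<longleftrightarrow> conn M1 T1 x (g \<otimes>\<^bsub>G1\<^esub> f1 t \<otimes>\<^bsub>G1\<^esub> f1 (wprod H (replicate j t)))"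
      using Suc.prems tH ge by (intro Suc.IH) auto
    finally show ?case using Suc.prems tH r by (simp add: G1.m_assoc)
  qed simp
  have n1G: "n1 \<in> carrier G1" and n2G: "n2 \<in> carrier G2"
    using \<alpha> \<beta> f1.hom_closed f2.hom_closed by metis+
  have comm: "wprod H A \<otimes>\<^bsub>H\<^esub> \<beta> = \<beta> \<otimes>\<^bsub>H\<^esub> wprod H A"
  proof -
    let ?a = "wprod H A"
    have a: "?a \<in> carrier H" "f2 ?a = \<one>\<^bsub>G2\<^esub>" unfolding A using \<tau> \<alpha> by (simp_all add: G2.m_assoc)
    have "(?a \<otimes>\<^bsub>H\<^esub> \<beta>) \<otimes>\<^bsub>H\<^esub> inv\<^bsub>H\<^esub> (\<beta> \<otimes>\<^bsub>H\<^esub> ?a) = \<one>\<^bsub>H\<^esub>"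
      using a \<beta> n2G by (intro inj) (simp_all add: H.inv_mult_group)
    then show ?thesis
      using a \<beta> by (metis H.inv_closed H.inv_inv H.inv_equality H.m_closed)
  qed
  have f1A: "f1 \<tau> \<otimes>\<^bsub>G1\<^esub> f1 (wprod H A) = n1 \<otimes>\<^bsub>G1\<^esub> f1 \<tau>"
    unfolding A using \<tau> \<alpha> n1G by (simp add: G1.m_assoc G1.inv_cancel_left)
  have "E1 (wprod H A) \<and> E2 (wprod H A) \<or>
    E1 (wprod H A \<otimes>\<^bsub>H\<^esub> wprod H B) \<and> E2 (wprod H A \<otimes>\<^bsub>H\<^esub> wprod H B) \<or> E1 (wprod H B) \<and> E2 (wprod H B)"
  proof (rule H.mayer_vietoris_cocycle[OF wp \<chi> c0 c0_nonneg K(1) _ _ AY stA _ B(1) stB])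
    show "E1 h = E1 (h \<otimes>\<^bsub>H\<^esub> y)"
      if "h \<in> carrier H" "y \<in> Y" "- K \<le> \<chi> h" "- K \<le> \<chi> (h \<otimes>\<^bsub>H\<^esub> y)" for h y
    proof -
      have y: "y \<in> carrier H" using that Y by auto
      have "0 \<le> \<chi>1 (f1 (\<tau> \<otimes>\<^bsub>H\<^esub> h))" "0 \<le> \<chi>1 (f1 (\<tau> \<otimes>\<^bsub>H\<^esub> h \<otimes>\<^bsub>H\<^esub> y))"
        using that y \<tau> \<chi>[of \<tau> h] \<chi>[of \<tau> "h \<otimes>\<^bsub>H\<^esub> y"] \<chi>\<tau>
        by (simp_all add: \<chi>_def H.m_assoc del: f1.hom_mult)
      then show ?thesis
        using step1[of "f1 \<tau> \<otimes>\<^bsub>G1\<^esub> f1 h" y "\<one>\<^bsub>G1\<^esub>"] that y \<tau> by (simp add: E1_def G1.m_assoc)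
    qed
    show "E2 h = E2 (h \<otimes>\<^bsub>H\<^esub> y)"
      if "h \<in> carrier H" "y \<in> Y" "\<chi> h \<le> 0" "\<chi> (h \<otimes>\<^bsub>H\<^esub> y) \<le> 0" for h y
    proof -
      have y: "y \<in> carrier H" "h \<otimes>\<^bsub>H\<^esub> y \<in> carrier H" using that Y by auto
      have "0 \<le> \<chi>2 (f2 h)" "0 \<le> \<chi>2 (f2 (h \<otimes>\<^bsub>H\<^esub> y))"
        using that y \<chi>2_f2 by (simp_all del: f2.hom_mult)
      then show ?thesis
        using step2[of "f2 h" y "\<one>\<^bsub>G2\<^esub>"] that y by (simp add: E2_def)
    qed
    show "\<chi> (wprod H A) = 0" unfolding A using \<tau> \<alpha> by (simp add: \<chi> \<chi>_inv \<chi>\<alpha>)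
    show "\<chi> (wprod H B) = 0" using B \<chi>\<beta> by simp
    show "wprod H A \<otimes>\<^bsub>H\<^esub> wprod H B = wprod H B \<otimes>\<^bsub>H\<^esub> wprod H A" using comm B by simp
    show "E1 \<one>\<^bsub>H\<^esub>"
      using \<tau>_path[of "\<one>\<^bsub>G1\<^esub>" "\<one>\<^bsub>G1\<^esub>" k] \<tau> \<chi>1_one conn.refl[of "\<one>\<^bsub>G1\<^esub>" M1 T1]
      by (simp add: E1_def M_car flip: \<tau>_def)
    show "E2 \<one>\<^bsub>H\<^esub>"
      using \<chi>2_one conn.refl[of "\<one>\<^bsub>G2\<^esub>" M2 T2] by (simp add: E2_def M_car)
  qed
  moreover have "\<not> E1 (wprod H A)"
    using \<tau>_path[of n1 "\<one>\<^bsub>G1\<^esub>" k] n1 n1G N1_0 f1A by (simp add: E1_def flip: \<tau>_def)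
  moreover have "\<not> E1 (wprod H A \<otimes>\<^bsub>H\<^esub> wprod H B)"
  proof -
    have "wprod H A \<in> carrier H" using AY Y by auto
    then have "f1 (wprod H A \<otimes>\<^bsub>H\<^esub> wprod H B) = f1 (wprod H A)"
      using B \<beta> by simp
    with \<open>\<not> E1 (wprod H A)\<close> show ?thesis by (simp add: E1_def)
  qed
  moreover have "\<not> E2 (wprod H B)"
    using n2 B \<beta> by (simp add: E2_def)
  ultimately show False by blast
qed

section \<open>Loops in half-space-like regions of a direct product\<close>

definition word_ball :: "('a, 'm) monoid_scheme \<Rightarrow> 'a set \<Rightarrow> nat \<Rightarrow> 'a set" where
  "word_ball G X D = {wprod G f | f. set f \<subseteq> X \<and> length f \<le> D}"

context group
begin

lemma stays_word_ball:
  assumes "set w \<subseteq> X" "length w \<le> D" "X \<subseteq> carrier G"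
  shows "stays G (word_ball G X D) \<one> w"
proof -
  have w: "set w \<subseteq> carrier G" using assms by auto
  show ?thesis
    unfolding stays_iff[OF one_closed w]
  proof (intro allI impI)
    fix u v assume "w = u @ v"
    then have "set u \<subseteq> X" "length u \<le> D" "wprod G u \<in> carrier G" using assms w by auto
    then show "\<one> \<otimes> wprod G u \<in> word_ball G X D"
      by (auto simp: word_ball_def)
  qed
qed

lemma word_ball_mono: "D \<le> D' \<Longrightarrow> word_ball G X D \<subseteq> word_ball G X D'"
  by (auto simp: word_ball_def)

text \<open>A homotopy passes through finitely many words, and these visit only a bounded part of
  the Cayley graph.\<close>

lemma homot_bounded:
  assumes "homot G X L (carrier G) \<one> w w'" "X \<subseteq> carrier G"
  shows "\<exists>D. homot G X L (word_ball G X D) \<one> w w'"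
  using assms
proof (induction rule: homot.induct)
  case (refl w)
  then show ?case
    by (intro exI[of _ "length w"] homot.refl stays_word_ball) auto
next
  case (delete u s v)
  then show ?case
    by (intro exI[of _ "length (u @ s @ v)"] homot.delete stays_word_ball) auto
next
  case (sym v w)
  then show ?case by (auto intro: homot.sym)
next
  case (trans u v w)
  from trans.IH[OF trans.prems] obtain D D' where *: "homot G X L (word_ball G X D) \<one> u v" "homot G X L (word_ball G X D') \<one> v w"
    by auto
  have "homot G X L (word_ball G X (max D D')) \<one> u v" "homot G X L (word_ball G X (max D D')) \<one> v w"
    by (rule homot_mono[OF *(1)] homot_mono[OF *(2)]; simp add: word_ball_mono)+
  then show ?case by (intro exI) (rule homot.trans)
qed

text \<open>Over a finite alphabet there are finitely many words of length at most \<open>l\<close>;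
  the largest of their radii works for all.\<close>

lemma homot_bounded_uniform:
  assumes X: "finite X" "X \<subseteq> carrier G"
    and triv: "\<And>w. set w \<subseteq> X \<Longrightarrow> wprod G w = \<one> \<Longrightarrow> homot G X L (carrier G) \<one> w []"
  shows "\<exists>D. \<forall>w. set w \<subseteq> X \<and> length w \<le> l \<and> wprod G w = \<one> \<longrightarrow> homot G X L (word_ball G X D) \<one> w []"
proof -
  let ?S = "{w. set w \<subseteq> X \<and> length w \<le> l}"
  have fin: "finite ?S" by (rule finite_lists_length_le) fact
  have "\<forall>w\<in>?S. \<exists>D. wprod G w = \<one> \<longrightarrow> homot G X L (word_ball G X D) \<one> w []"
    using triv homot_bounded[OF _ X(2)] by blast
  then obtain D where D: "\<And>w. w \<in> ?S \<Longrightarrow> wprod G w = \<one> \<Longrightarrow> homot G X L (word_ball G X (D w)) \<one> w []"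
    by metis
  have "homot G X L (word_ball G X (Max (D ` ?S))) \<one> w []" if "w \<in> ?S" "wprod G w = \<one>" for w
  proof -
    have "D w \<le> Max (D ` ?S)" using fin that by (intro Max_ge) auto
    then show ?thesis by (intro homot_mono[OF D[OF that]] word_ball_mono) auto
  qed
  then show ?thesis by blast
qed

end

text \<open>\<open>W\<close> is a region of the Cayley graph that near \<open>\<one>\<close> behaves like a half space for \<open>\<chi>\<close>.\<close>

definition half_like ::
  "('a, 'm) monoid_scheme \<Rightarrow> 'a set \<Rightarrow> ('a \<Rightarrow> real) \<Rightarrow> nat \<Rightarrow> real \<Rightarrow> 'a set \<Rightarrow> bool" where
  "half_like G X \<chi> B \<eta> W \<longleftrightarrow> (\<forall>u v. set u \<subseteq> X \<and> set v \<subseteq> X \<and> length u \<le> B \<and> length v \<le> B \<and>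
    wprod G u \<in> W \<and> \<eta> \<le> \<chi> (wprod G v) \<longrightarrow> wprod G u \<otimes>\<^bsub>G\<^esub> wprod G v \<in> W)"

lemma half_like_mono: "half_like G X \<chi> B \<eta> W \<Longrightarrow> B' \<le> B \<Longrightarrow> half_like G X \<chi> B' \<eta> W"
  unfolding half_like_def by (meson order_trans)

lemma half_likeD:
  "\<lbrakk>half_like G X \<chi> B \<eta> W; set u \<subseteq> X; set v \<subseteq> X; length u \<le> B; length v \<le> B; wprod G u \<in> W;
    \<eta> \<le> \<chi> (wprod G v)\<rbrakk> \<Longrightarrow> wprod G u \<otimes>\<^bsub>G\<^esub> wprod G v \<in> W"
  unfolding half_like_def by blast

text \<open>The depth \<open>c\<close> absorbs the passage from unspecified generators of the monoid
  to the alphabet \<open>X\<close>. Only end points spelled by words over \<open>X\<close> are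
  considered, because \<open>X\<close> will be the alphabet of a single factor of
  \<open>G\<close>.\<close>

definition half_space_connected ::
  "('a, 'm) monoid_scheme \<Rightarrow> 'a set \<Rightarrow> ('a \<Rightarrow> real) \<Rightarrow> bool" where
  "half_space_connected G X \<chi> \<longleftrightarrow> (\<exists>c. \<forall>u. set u \<subseteq> X \<and> 0 \<le> \<chi> (wprod G u) \<longrightarrow>
    (\<exists>v. set v \<subseteq> X \<and> wprod G v = wprod G u \<and> stays G {g \<in> carrier G. - c \<le> \<chi> g} \<one>\<^bsub>G\<^esub> v))"

text \<open>An internal direct product given by two commuting alphabets, so that the factors can
  trade places (\<open>swapped\<close>). The bound \<open>4 \<le> L\<close> admits the commutator
  squares \<open>[x, y, inv x, inv y]\<close>.\<close>

locale two_factor_words = group G for G (structure) +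
  fixes X1 X2 :: "'a set" and L :: nat
  assumes fin1: "finite X1" and fin2: "finite X2"
    and X1: "X1 \<subseteq> carrier G" "\<forall>x\<in>X1. inv x \<in> X1"
    and X2: "X2 \<subseteq> carrier G" "\<forall>x\<in>X2. inv x \<in> X2"
    and letters_commute: "\<And>x y. x \<in> X1 \<Longrightarrow> y \<in> X2 \<Longrightarrow> x \<otimes> y = y \<otimes> x"
    and L: "4 \<le> L"
    and triv1: "\<And>w. set w \<subseteq> X1 \<Longrightarrow> wprod G w = \<one> \<Longrightarrow> homot G X1 L (carrier G) \<one> w []"
    and triv2: "\<And>w. set w \<subseteq> X2 \<Longrightarrow> wprod G w = \<one> \<Longrightarrow> homot G X2 L (carrier G) \<one> w []"
    and indep: "\<And>u v. set u \<subseteq> X1 \<Longrightarrow> set v \<subseteq> X2 \<Longrightarrow> wprod G u \<otimes> wprod G v = \<one> \<Longrightarrow>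
      wprod G u = \<one> \<and> wprod G v = \<one>"
begin

abbreviation X :: "'a set" where "X \<equiv> X1 \<union> X2"

lemma X: "finite X" "X \<subseteq> carrier G" "\<forall>x\<in>X. inv x \<in> X"
  using fin1 fin2 X1 X2 by auto

lemma words_commute:
  "\<lbrakk>set u \<subseteq> X1; set v \<subseteq> X2\<rbrakk> \<Longrightarrow> wprod G u \<otimes> wprod G v = wprod G v \<otimes> wprod G u"
proof (induction u)
  case (Cons x u)
  have x: "x \<in> carrier G" "x \<in> X1" and u: "wprod G u \<in> carrier G" using Cons.prems X1 by auto
  have "x \<otimes> wprod G v = wprod G v \<otimes> x" if "set v \<subseteq> X2" for v
    using that
  proof (induction v)
    case (Cons y v)
    then have y: "y \<in> carrier G" "wprod G v \<in> carrier G" using X2 by auto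
    have "x \<otimes> (y \<otimes> wprod G v) = y \<otimes> (x \<otimes> wprod G v)"
      using Cons.prems x y letters_commute[of x y] by (simp flip: m_assoc)
    then show ?case using Cons x y by (simp add: m_assoc)
  qed (use x in simp)
  then have *: "x \<otimes> wprod G v = wprod G v \<otimes> x" using Cons.prems by simp
  have v: "wprod G v \<in> carrier G" using Cons.prems X2 by auto
  have "wprod G (x # u) \<otimes> wprod G v = x \<otimes> (wprod G v \<otimes> wprod G u)"
    using Cons x u v by (simp add: m_assoc)
  also have "\<dots> = wprod G v \<otimes> wprod G (x # u)"
    using * x u v by (simp flip: m_assoc)
  finally show ?case .
qed (use X2 in auto)

lemma swap_letters:
  assumes "x \<in> X1" "y \<in> X2" "g \<in> carrier G" "g \<in> Y" "g \<otimes> x \<in> Y" "g \<otimes> y \<in> Y" "g \<otimes> (x \<otimes> y) \<in> Y"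
  shows "homot G X L Y g [x, y] [y, x]"
proof (rule homot_from_loop)
  have c: "x \<in> carrier G" "y \<in> carrier G" using assms X1 X2 by auto
  have eq: "x \<otimes> y = y \<otimes> x" using assms letters_commute by auto
  have "x \<otimes> y \<otimes> inv x = y" using c eq by (simp add: m_assoc)
  then have 1: "g \<otimes> x \<otimes> y \<otimes> inv x = g \<otimes> y" using c assms(3) by (simp add: m_assoc)
  show "stays G Y g [y, x]" using assms c eq by (simp add: m_assoc)
  have "homot G X L Y g ([] @ [x, y, inv x, inv y] @ []) ([] @ [])"
  proof (rule homot.delete)
    show "wprod G [x, y, inv x, inv y] = \<one>"
      using \<open>x \<otimes> y \<otimes> inv x = y\<close> c by (simp flip: m_assoc)
    show "stays G Y g ([] @ [x, y, inv x, inv y] @ [])"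
      using assms c 1 by (simp add: m_assoc)
  qed (use assms X L in auto)
  then show "homot G X L Y g ([x, y] @ winv G [y, x]) []"
    by (simp add: winv_def)
qed (use assms X L in auto)

lemma commute_letter:
  assumes "x \<in> X1" "set v \<subseteq> X2" "g \<in> carrier G"
    and "\<And>v' v''. v = v' @ v'' \<Longrightarrow> g \<otimes> wprod G v' \<in> Y \<and> g \<otimes> x \<otimes> wprod G v' \<in> Y"
  shows "homot G X L Y g (x # v) (v @ [x])"
  using assms(2-)
proof (induction v arbitrary: g)
  case Nil
  have "stays G Y g [x]" using Nil(3)[of "[]" "[]"] assms(1) X1 Nil(2) by auto
  then show ?case using assms by (auto intro: homot.refl)
next
  case (Cons y v)
  have c: "x \<in> carrier G" "y \<in> carrier G" "y \<in> X2" "set v \<subseteq> carrier G" using Cons.prems assms X1 X2 by auto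
  have eq: "x \<otimes> y = y \<otimes> x" using assms(1) c letters_commute by auto
  have Y: "g \<in> Y" "g \<otimes> x \<in> Y" "g \<otimes> y \<in> Y" "g \<otimes> x \<otimes> y \<in> Y"
    using Cons.prems(3)[of "[]" "y # v"] Cons.prems(3)[of "[y]" v] c Cons.prems(2) by auto
  have IH: "homot G X L Y (g \<otimes> y) (x # v) (v @ [x])"
  proof (rule Cons.IH)
    fix v' v'' assume v: "v = v' @ v''"
    have vc: "wprod G v' \<in> carrier G" using v c by auto
    have "g \<otimes> y \<otimes> x = g \<otimes> x \<otimes> y" using c eq Cons.prems(2) by (simp add: m_assoc)
    then show "g \<otimes> y \<otimes> wprod G v' \<in> Y \<and> g \<otimes> y \<otimes> x \<otimes> wprod G v' \<in> Y"
      using Cons.prems(3)[of "y # v'" v''] v c vc Cons.prems(2) by (simp add: m_assoc)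
  qed (use Cons.prems c in auto)
  then have st: "stays G Y (g \<otimes> y) (x # v)"
    using homot_stays[OF IH] c Cons.prems(2) X by auto
  have "homot G X L Y g ([x, y] @ v) ([y, x] @ v)"
  proof (rule homot_append_right)
    show "homot G X L Y g [x, y] [y, x]"
      using Y Cons.prems(2) c assms(1) by (intro swap_letters) (auto simp: m_assoc)
    show "stays G Y (g \<otimes> wprod G [y, x]) v"
      using st c Cons.prems(2) by (simp add: m_assoc)
  qed (use Cons.prems X in auto)
  moreover have "homot G X L Y g ([y] @ (x # v)) ([y] @ (v @ [x]))"
    using IH Y c Cons.prems(2) X by (intro homot_append_left) auto
  ultimately show ?case using homot.trans by simp
qed

text \<open>The two paths bound a rectangle filled by commutator squares; only the lattice points of
  the rectangle have to lie in \<open>Y\<close>.\<close>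

lemma grid:
  assumes "set u \<subseteq> X1" "set v \<subseteq> X2" "g \<in> carrier G"
    and "\<And>u' u'' v' v''. u = u' @ u'' \<Longrightarrow> v = v' @ v'' \<Longrightarrow> g \<otimes> wprod G u' \<otimes> wprod G v' \<in> Y"
  shows "homot G X L Y g (u @ v) (v @ u)"
  using assms(1,3,4)
proof (induction u arbitrary: g)
  case Nil
  have "stays G Y g v"
    using Nil assms(2) X2 by (subst stays_iff) (auto dest: Nil(3)[of "[]" "[]"])
  then show ?case using assms by (auto intro: homot.refl)
next
  case (Cons x u)
  have c: "x \<in> carrier G" "x \<in> X1" "set u \<subseteq> carrier G" "set v \<subseteq> carrier G" using Cons.prems assms X1 X2 by auto
  have IH: "homot G X L Y (g \<otimes> x) (u @ v) (v @ u)"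
  proof (rule Cons.IH)
    fix u' u'' v' v'' assume *: "u = u' @ u''" "v = v' @ v''"
    then have "wprod G u' \<in> carrier G" "wprod G v' \<in> carrier G" using c by auto
    then show "g \<otimes> x \<otimes> wprod G u' \<otimes> wprod G v' \<in> Y"
      using Cons.prems(3)[of "x # u'" u'' v' v''] * c Cons.prems(2) by (simp add: m_assoc)
  qed (use Cons.prems c in auto)
  have st: "stays G Y (g \<otimes> x) (v @ u)"
    using homot_stays[OF IH] c Cons.prems(2) X by auto
  have g: "g \<in> Y" using Cons.prems(3)[of "[]" "x # u" "[]" v] Cons.prems(2) by auto
  have letter: "homot G X L Y g (x # v) (v @ [x])"
  proof (rule commute_letter)
    fix v' v'' assume *: "v = v' @ v''"
    then have "wprod G v' \<in> carrier G" using c by auto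
    then show "g \<otimes> wprod G v' \<in> Y \<and> g \<otimes> x \<otimes> wprod G v' \<in> Y"
      using Cons.prems(3)[of "[]" "x # u" v' v''] Cons.prems(3)[of "[x]" u v' v''] * c Cons.prems(2)
      by simp
  qed (use Cons.prems c assms in auto)
  have "homot G X L Y g ([x] @ (u @ v)) ([x] @ (v @ u))"
    using IH g c Cons.prems(2) X stays_start[OF st] by (intro homot_append_left) auto
  moreover have "homot G X L Y g ((x # v) @ u) ((v @ [x]) @ u)"
  proof (rule homot_append_right[OF letter])
    have "wprod G v \<in> carrier G" "x \<otimes> wprod G v = wprod G v \<otimes> x"
      using c words_commute[of "[x]" v] assms(2) by auto
    then show "stays G Y (g \<otimes> wprod G (v @ [x])) u"
      using st c Cons.prems(2) by (simp add: stays_append m_assoc)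
  qed (use Cons.prems X in auto)
  ultimately show ?case using homot.trans by simp
qed

end

text \<open>\<open>a\<close> and \<open>b\<close> are letters that climb, one in each factor. As the
  factors commute, a path in one factor can be carried up along the letter of the other without
  changing its word.\<close>

locale two_factor_character = two_factor_words G X1 X2 L for G (structure) and X1 X2 L +
  fixes \<chi> :: "'a \<Rightarrow> real" and a b :: 'a and \<eta> C :: real
  assumes \<chi>: "\<And>x y. x \<in> carrier G \<Longrightarrow> y \<in> carrier G \<Longrightarrow> \<chi> (x \<otimes> y) = \<chi> x + \<chi> y"
    and a: "a \<in> X1" "\<eta> \<le> \<chi> a" and b: "b \<in> X2" "\<eta> \<le> \<chi> b" and \<eta>: "0 < \<eta>"
    and C: "\<And>x. x \<in> X1 \<union> X2 \<Longrightarrow> \<bar>\<chi> x\<bar> \<le> C"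
begin

lemma C_nonneg: "0 \<le> C" using C[of a] a by auto

lemma \<chi>_one: "\<chi> \<one> = 0" using \<chi>[of \<one> \<one>] by simp

lemma \<chi>_word: "set w \<subseteq> X \<Longrightarrow> \<bar>\<chi> (wprod G w)\<bar> \<le> real (length w) * C"
  using word_value_bound[of \<chi> w X C] \<chi> C X by blast

lemma \<chi>_word_le: "set w \<subseteq> X \<Longrightarrow> length w \<le> n \<Longrightarrow> - real n * C \<le> \<chi> (wprod G w)"
proof -
  assume w: "set w \<subseteq> X" "length w \<le> n"
  have "real (length w) * C \<le> real n * C" using w C_nonneg by (intro mult_right_mono) auto
  then show ?thesis using \<chi>_word[OF w(1)] by simp
qed

lemma \<chi>_rep: "x \<in> carrier G \<Longrightarrow> \<chi> (wprod G (replicate j x)) = real j * \<chi> x"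
proof (induction j)
  case (Suc j)
  then have "wprod G (replicate j x) \<in> carrier G" by (intro wprod_closed) auto
  then show ?case using Suc by (simp add: \<chi> algebra_simps)
qed (simp add: \<chi>_one)

lemma \<chi>_append: "set u \<subseteq> X \<Longrightarrow> set v \<subseteq> X \<Longrightarrow> \<chi> (wprod G (u @ v)) = \<chi> (wprod G u) + \<chi> (wprod G v)"
proof -
  assume "set u \<subseteq> X" "set v \<subseteq> X"
  then have "set u \<subseteq> carrier G" "set v \<subseteq> carrier G" using X by auto
  then show ?thesis by (simp add: \<chi>)
qed

lemma rep_prefix: "replicate k (x :: 'z) = u @ v \<Longrightarrow> \<exists>j\<le>k. u = replicate j x"
  by (metis append_eq_conv_conj length_append length_replicate le_add1 take_replicate min.absorb1)

lemma rising_stays: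
  assumes "half_like G X \<chi> B \<eta> W" "set u \<subseteq> X" "length u \<le> B" "k \<le> B" "wprod G u \<in> W"
    and x: "x \<in> X" "\<eta> \<le> \<chi> x"
  shows "stays G W (wprod G u) (replicate k x)"
proof -
  have xc: "x \<in> carrier G" and uc: "set u \<subseteq> carrier G" using x assms X by auto
  have rc: "set (replicate k x) \<subseteq> carrier G" using xc by (simp add: set_replicate_conv_if)
  show ?thesis
    unfolding stays_iff[OF wprod_closed[OF uc] rc]
  proof (intro allI impI)
    fix v w assume vw: "replicate k x = v @ w"
    obtain j where j: "j \<le> k" "v = replicate j x" using rep_prefix[OF vw] by (elim exE conjE)
    show "wprod G u \<otimes> wprod G v \<in> W"
    proof (cases "j = 0")
      case True
      then show ?thesis using assms uc j by simp
    next
      case False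
      have "1 * \<eta> \<le> real j * \<chi> x" using False x \<eta> by (intro mult_mono) auto
      then have "\<eta> \<le> \<chi> (wprod G v)" using \<chi>_rep[OF xc] j by simp
      then show ?thesis
        using assms j x by (intro half_likeD[OF assms(1)]) auto
    qed
  qed
qed

text \<open>\<open>half_like\<close> is applied to the jump by \<open>v @ w'\<close> as a whole, so
  the total gain counts and not what happens along \<open>v\<close>.\<close>

lemma high_stays:
  assumes W: "half_like G X \<chi> B \<eta> W" "set u \<subseteq> X" "length u \<le> B" "wprod G u \<in> W"
    and v: "set v \<subseteq> X" "set w \<subseteq> X" "length v + length w \<le> B"
    and high: "\<And>w' w''. w = w' @ w'' \<Longrightarrow> \<eta> \<le> \<chi> (wprod G v) + \<chi> (wprod G w')"
  shows "stays G W (wprod G u \<otimes> wprod G v) w"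
proof -
  have c: "set u \<subseteq> carrier G" "set v \<subseteq> carrier G" "set w \<subseteq> carrier G" using assms X by auto
  then have pc: "wprod G u \<otimes> wprod G v \<in> carrier G" by auto
  show ?thesis
    unfolding stays_iff[OF pc c(3)]
  proof (intro allI impI)
    fix w' w'' assume w: "w = w' @ w''"
    then have w': "set w' \<subseteq> X" "set w' \<subseteq> carrier G" "length (v @ w') \<le> B" using v c by auto
    have "wprod G u \<otimes> wprod G (v @ w') \<in> W"
      using W v w' high[OF w] \<chi>_append[of v w'] by (intro half_likeD[OF W(1)]) auto
    then show "wprod G u \<otimes> wprod G v \<otimes> wprod G w' \<in> W"
      using c w' by (simp add: m_assoc)
  qed
qed

text \<open>An \<open>X1\<close>-loop is carried along a power of \<open>b\<close>, with which it
  commutes, to a height where the whole ball needed for its contraction lies in \<open>W\<close>;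
  there it is contracted, and the climb is cancelled.\<close>

lemma loops_lift:
  "\<exists>B. \<forall>W u w. half_like G X \<chi> B \<eta> W \<longrightarrow> set u \<subseteq> X \<longrightarrow> length u \<le> l \<longrightarrow>
    set w \<subseteq> X1 \<longrightarrow> length w \<le> l \<longrightarrow> wprod G w = \<one> \<longrightarrow> stays G W (wprod G u) w \<longrightarrow>
    homot G X L W (wprod G u) w []"
proof -
  obtain D where D: "\<And>w. set w \<subseteq> X1 \<Longrightarrow> length w \<le> l \<Longrightarrow> wprod G w = \<one> \<Longrightarrow>
      homot G X1 L (word_ball G X1 D) \<one> w []"
    using homot_bounded_uniform[OF fin1 X1(1) triv1, of l] by blast
  \<comment> \<open>At height \<open>k * \<eta>\<close> a word of length \<open>D\<close> may lose
    \<open>D * C\<close> and still leave a gain of \<eta>.\<close>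
  obtain k :: nat where "(real D * C + \<eta>) / \<eta> \<le> real k" using real_arch_simple by blast
  then have k: "real D * C + \<eta> \<le> real k * \<eta>" using \<eta> by (simp add: field_simps)
  define B where "B = 2 * l + k + D"
  show ?thesis
  proof (intro exI[of _ B] allI impI)
    fix W u w
    assume W: "half_like G X \<chi> B \<eta> W" and u: "set u \<subseteq> X" "length u \<le> l"
      and w: "set w \<subseteq> X1" "length w \<le> l" "wprod G w = \<one>" and st: "stays G W (wprod G u) w"
    let ?r = "replicate k b" and ?g = "wprod G u"
    have bc: "b \<in> carrier G" "set ?r \<subseteq> X2" "set ?r \<subseteq> X" "set ?r \<subseteq> carrier G" using b X2 by auto
    have "set u \<subseteq> carrier G" using u X by blast
    then have uc: "set u \<subseteq> carrier G" "?g \<in> carrier G" "?g \<in> W" using stays_start[OF st] by auto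
    have wc: "set w \<subseteq> carrier G" "set w \<subseteq> X" using w X1 by auto
    have kb: "real D * C + \<eta> \<le> real k * \<chi> b"
    proof -
      have "real k * \<eta> \<le> real k * \<chi> b" using b by (intro mult_left_mono) auto
      then show ?thesis using k by simp
    qed
    have rise: "stays G W ?g ?r"
      using W u uc b by (intro rising_stays[where B = B]) (auto simp: B_def)
    have gr: "homot G X L W ?g (w @ ?r) (?r @ w)"
    proof (rule grid)
      fix u' u'' v' v'' assume *: "w = u' @ u''" "?r = v' @ v''"
      then have u': "set u' \<subseteq> X" "set u' \<subseteq> carrier G" "length u' \<le> l" using w wc by auto
      have "?g \<otimes> wprod G u' \<in> W" using st * wc uc by (simp add: stays_iff)
      then have "stays G W (wprod G (u @ u')) ?r"
        using W u uc b u' by (intro rising_stays[where B = B]) (auto simp: B_def)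
      then show "?g \<otimes> wprod G u' \<otimes> wprod G v' \<in> W"
        using * u' uc bc by (simp add: stays_iff)
    qed (use w bc uc in auto)
    have null: "homot G X L W (?g \<otimes> wprod G ?r \<otimes> \<one>) w []"
    proof (rule homot_translate)
      have "word_ball G X1 D \<subseteq> {y \<in> carrier G. ?g \<otimes> wprod G ?r \<otimes> y \<in> W}"
      proof
        fix y assume "y \<in> word_ball G X1 D"
        then obtain f where f: "set f \<subseteq> X1" "length f \<le> D" "y = wprod G f" by (auto simp: word_ball_def)
        then have fc: "set f \<subseteq> X" "set f \<subseteq> carrier G" using X1 by auto
        have "\<eta> \<le> \<chi> (wprod G (?r @ f))"
          using \<chi>_append[OF bc(3) fc(1)] \<chi>_rep[OF bc(1), of k] \<chi>_word_le[OF fc(1) f(2)] kb by simp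
        then have "?g \<otimes> wprod G (?r @ f) \<in> W"
          using W u uc bc fc f by (intro half_likeD[OF W]) (auto simp: B_def)
        then show "y \<in> {y \<in> carrier G. ?g \<otimes> wprod G ?r \<otimes> y \<in> W}"
          using f fc bc uc by (simp add: m_assoc)
      qed
      then show "homot G X L {y \<in> carrier G. ?g \<otimes> wprod G ?r \<otimes> y \<in> W} \<one> w []"
        using D[OF w] by (auto intro: homot_mono)
    qed (use uc bc X in auto)
    have gc: "?g \<otimes> wprod G ?r \<in> carrier G" using uc bc by auto
    have cancel: "homot G X L W ?g (?r @ winv G ?r) []"
      using rise bc X uc L by (intro homot_cancel) auto
    have down: "stays G W (?g \<otimes> wprod G ?r) (winv G ?r)"
      using rise stays_winv[of ?g ?r W] uc bc by simp
    have winvr: "set (winv G ?r) \<subseteq> X" using set_winv_subset[OF bc(3) X(3)] .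
    have "homot G X L W ?g (w @ (?r @ winv G ?r)) (w @ [])"
      using cancel st wc uc X w by (intro homot_append_left) auto
    moreover have "homot G X L W ?g ((w @ ?r) @ winv G ?r) ((?r @ w) @ winv G ?r)"
      using gr down wc uc X w bc winvr by (intro homot_append_right) auto
    moreover have "homot G X L W ?g (?r @ w @ winv G ?r) (?r @ [] @ winv G ?r)"
    proof (rule homot_context)
      show "homot G X L W (?g \<otimes> wprod G ?r) w []" using null gc by simp
      show "stays G W ?g (?r @ [] @ winv G ?r)"
        using rise down uc bc by (simp add: stays_append)
    qed (use bc winvr uc X in auto)
    ultimately show "homot G X L W ?g w []"
      using cancel by (simp, blast intro: homot.trans homot.sym)
  qed
qed

end

section \<open>Separating the letters of the two factors\<close>

definition (in two_factor_words) subst_word :: "('a \<Rightarrow> 'a list) \<Rightarrow> 'a list \<Rightarrow> 'a list" where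
  "subst_word y w = concat (map (\<lambda>x. if x \<in> X1 then y x else [x]) w)"

definition (in two_factor_words) part1 :: "('a \<Rightarrow> 'a list) \<Rightarrow> 'a list \<Rightarrow> 'a list" where
  "part1 y w = concat (map (\<lambda>x. if x \<in> X1 then y x else []) w)"

definition (in two_factor_words) part2 :: "'a list \<Rightarrow> 'a list" where
  "part2 w = filter (\<lambda>x. x \<notin> X1) w"

context two_factor_words
begin

lemma subst_word_simps [simp]:
  "subst_word y [] = []" "subst_word y (x # w) = (if x \<in> X1 then y x else [x]) @ subst_word y w"
  "part1 y [] = []" "part1 y (x # w) = (if x \<in> X1 then y x else []) @ part1 y w"
  "part2 [] = []" "part2 (x # w) = (if x \<in> X1 then [] else [x]) @ part2 w"
  by (simp_all add: subst_word_def part1_def part2_def)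

lemma part2_set: "set w \<subseteq> X \<Longrightarrow> set (part2 w) \<subseteq> X2"
  by (auto simp: part2_def)

lemma part1_set: "(\<And>x. x \<in> X1 \<Longrightarrow> set (y x) \<subseteq> X1) \<Longrightarrow> set (part1 y w) \<subseteq> X1"
  by (induction w) auto

lemma subst_word_set: "(\<And>x. x \<in> X1 \<Longrightarrow> set (y x) \<subseteq> X1) \<Longrightarrow> set w \<subseteq> X \<Longrightarrow> set (subst_word y w) \<subseteq> X"
  by (induction w) auto

text \<open>\<open>y x\<close> is the word that replaces an \<open>X1\<close>-letter
  \<open>x\<close>. An \<open>X2\<close>-letter at the front is moved behind all of
  \<open>part1\<close> along a \<open>grid\<close>; hence the region must contain the full rectangle
  of products of prefixes of the two parts.\<close>

lemma sort_word:
  assumes y: "\<And>x. x \<in> X1 \<Longrightarrow> set (y x) \<subseteq> X1"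
    and "set w \<subseteq> X" "g \<in> carrier G"
    and "\<And>p p' q q'. part1 y w = p @ p' \<Longrightarrow> part2 w = q @ q' \<Longrightarrow> g \<otimes> wprod G p \<otimes> wprod G q \<in> Y"
  shows "homot G X L Y g (subst_word y w) (part1 y w @ part2 w)"
  using assms(2-)
proof (induction w arbitrary: g)
  case Nil
  then show ?case using Nil(3)[of "[]" "[]" "[]" "[]"] by (auto intro: homot.refl)
next
  case (Cons x w)
  have xw: "x \<in> X" "set w \<subseteq> X" using Cons.prems by auto
  have p1: "set (part1 y w) \<subseteq> X1" "set (part1 y w) \<subseteq> carrier G"
    using part1_set[of y w, OF y] X1 by blast+
  have p2: "set (part2 w) \<subseteq> X2" "set (part2 w) \<subseteq> carrier G"
    using part2_set[OF xw(2)] X2 by blast+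
  show ?case
  proof (cases "x \<in> X1")
    case True
    then have yx: "set (y x) \<subseteq> X1" "set (y x) \<subseteq> carrier G" using y X1 by blast+
    then have gy: "g \<otimes> wprod G (y x) \<in> carrier G" using Cons.prems(2) by auto
    have IH: "homot G X L Y (g \<otimes> wprod G (y x)) (subst_word y w) (part1 y w @ part2 w)"
    proof (rule Cons.IH[OF xw(2) gy])
      fix p p' q q' assume *: "part1 y w = p @ p'" "part2 w = q @ q'"
      have "g \<otimes> wprod G (y x @ p) \<otimes> wprod G q \<in> Y"
        using True * by (intro Cons.prems(3)[of _ p' q q']) auto
      moreover have "set p \<subseteq> carrier G" "set q \<subseteq> carrier G" using * p1 p2 by auto
      ultimately show "g \<otimes> wprod G (y x) \<otimes> wprod G p \<otimes> wprod G q \<in> Y"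
        using yx Cons.prems(2) by (simp add: m_assoc)
    qed
    have "stays G Y g (y x)"
      unfolding stays_iff[OF Cons.prems(2) yx(2)]
    proof (intro allI impI)
      fix u v assume uv: "y x = u @ v"
      have "g \<otimes> wprod G u \<otimes> wprod G [] \<in> Y"
        using True uv by (intro Cons.prems(3)[of _ "v @ part1 y w" _ "part2 w"]) auto
      then show "g \<otimes> wprod G u \<in> Y" using uv yx Cons.prems(2) by simp
    qed
    then have "homot G X L Y g (y x @ subst_word y w) (y x @ (part1 y w @ part2 w))"
      using IH yx Cons.prems(2) X by (intro homot_append_left) auto
    then show ?thesis using True by simp
  next
    case False
    then have x2: "x \<in> X2" "x \<in> carrier G" using xw X2 by auto
    have swap: "wprod G p \<otimes> x = x \<otimes> wprod G p" if "set p \<subseteq> X1" for p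
      using words_commute[OF that, of "[x]"] x2 by simp
    have pt: "g \<otimes> x \<otimes> wprod G p \<otimes> wprod G q \<in> Y \<and> g \<otimes> wprod G p \<in> Y"
      if *: "part1 y w = p @ p'" "part2 w = q @ q'" for p p' q q'
    proof -
      have c: "set p \<subseteq> X1" "wprod G p \<in> carrier G" "wprod G q \<in> carrier G" using * p1 p2 by auto
      have "g \<otimes> wprod G p \<otimes> wprod G (x # q) \<in> Y" "g \<otimes> wprod G p \<otimes> wprod G [] \<in> Y"
        using False * Cons.prems(3)[of p p' "x # q" q'] Cons.prems(3)[of p p' "[]" "x # part2 w"] by auto
      moreover have "g \<otimes> wprod G p \<otimes> (x \<otimes> wprod G q) = g \<otimes> (wprod G p \<otimes> x) \<otimes> wprod G q"
        using c x2 Cons.prems(2) by (simp add: m_assoc)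
      ultimately show ?thesis
        using c x2 Cons.prems(2) swap[OF c(1)] by (simp add: m_assoc)
    qed
    have IH: "homot G X L Y (g \<otimes> x) (subst_word y w) (part1 y w @ part2 w)"
      using Cons.prems xw x2 pt by (intro Cons.IH) auto
    have g: "g \<in> Y" using pt[of "[]" "part1 y w" "[]" "part2 w"] Cons.prems(2) by simp
    have st: "stays G Y (g \<otimes> x) (part1 y w @ part2 w)"
      using homot_stays[OF IH] x2 Cons.prems(2) X by auto
    have 1: "homot G X L Y g ([x] @ subst_word y w) ([x] @ (part1 y w @ part2 w))"
      using IH g x2 Cons.prems(2) X stays_start[OF st] by (intro homot_append_left) auto
    have "homot G X L Y g (part1 y w @ [x]) ([x] @ part1 y w)"
    proof (rule grid)
      fix u' u'' v' v'' assume *: "part1 y w = u' @ u''" "[x] = v' @ v''"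
      then have c: "set u' \<subseteq> X1" "wprod G u' \<in> carrier G" using p1 by auto
      have "v' = [] \<or> v' = [x]" using *(2) by (auto simp: Cons_eq_append_conv)
      then show "g \<otimes> wprod G u' \<otimes> wprod G v' \<in> Y"
        using pt[OF *(1), of "[]" "part2 w"] c x2 Cons.prems(2) swap[OF c(1)] by (auto simp: m_assoc)
    qed (use p1 x2 Cons.prems in auto)
    then have 2: "homot G X L Y g (([x] @ part1 y w) @ part2 w) ((part1 y w @ [x]) @ part2 w)"
    proof (intro homot_append_right homot.sym[of G X L Y g "part1 y w @ [x]"])
      have c: "wprod G (part1 y w) \<in> carrier G" using p1 by auto
      have "g \<otimes> wprod G (part1 y w @ [x]) = g \<otimes> x \<otimes> wprod G (part1 y w)"
        using p1 c x2 Cons.prems(2) swap[OF p1(1)] by (simp add: m_assoc)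
      then show "stays G Y (g \<otimes> wprod G (part1 y w @ [x])) (part2 w)"
        using st p1 p2 x2 Cons.prems(2) by (simp add: stays_append)
    qed (use p2 Cons.prems X in auto)
    have "homot G X L Y g ([x] @ subst_word y w) ((part1 y w @ [x]) @ part2 w)"
      using 1 2 by (auto intro: homot.trans)
    then show ?thesis using False by simp
  qed
qed

lemma subst_word_id: "subst_word (\<lambda>x. [x]) w = w"
  by (induction w) auto

text \<open>In the whole group a word can be sorted freely; by \<open>indep\<close> both sorted
  parts are trivial, and each contracts within its factor.\<close>

lemma full_null:
  assumes w: "set w \<subseteq> X" "wprod G w = \<one>"
  shows "homot G X L (carrier G) \<one> w []"
proof -
  let ?p = "part1 (\<lambda>x. [x]) w" and ?q = "part2 w"
  have p: "set ?p \<subseteq> X1" "set ?p \<subseteq> carrier G" and q: "set ?q \<subseteq> X2" "set ?q \<subseteq> carrier G"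
    using part1_set[of "\<lambda>x. [x]" w] part2_set[OF w(1)] X1 X2 by auto
  have h: "homot G X L (carrier G) \<one> w (?p @ ?q)"
  proof -
    have "homot G X L (carrier G) \<one> (subst_word (\<lambda>x. [x]) w) (?p @ ?q)"
    proof (rule sort_word)
      fix r r' s s' assume "?p = r @ r'" "?q = s @ s'"
      then have "set r \<subseteq> carrier G" "set s \<subseteq> carrier G" using p q by auto
      then show "\<one> \<otimes> wprod G r \<otimes> wprod G s \<in> carrier G" by simp
    qed (use w in auto)
    then show ?thesis by (simp add: subst_word_id)
  qed
  then have "wprod G ?p \<otimes> wprod G ?q = \<one>"
    using homot_stays[OF h] w p q X by simp
  then have pq: "wprod G ?p = \<one>" "wprod G ?q = \<one>"
    using indep p q by blast+
  have 1: "homot G X L (carrier G) \<one> (?p @ ?q) (?p @ [])"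
  proof (rule homot_append_left)
    show "homot G X L (carrier G) (\<one> \<otimes> wprod G ?p) ?q []"
      using pq triv2[OF q(1) pq(2)] by (auto intro: homot_mono)
  qed (use p X in \<open>auto intro: stays_carrier\<close>)
  have "homot G X L (carrier G) \<one> ?p []"
    using triv1[OF p(1) pq(1)] by (auto intro: homot_mono)
  with h 1 show ?thesis by (auto intro: homot.trans)
qed

lemma swapped: "two_factor_words G X2 X1 L"
proof (intro two_factor_words.intro two_factor_words_axioms.intro is_group)
  fix u v assume *: "set u \<subseteq> X2" "set v \<subseteq> X1" "wprod G u \<otimes> wprod G v = \<one>"
  then have "wprod G v \<otimes> wprod G u = \<one>"
    using words_commute[of v u] by simp
  then show "wprod G u = \<one> \<and> wprod G v = \<one>" using indep[of v u] * by simp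
qed (use fin1 fin2 X1 X2 letters_commute L triv1 triv2 in auto)

end

section \<open>Loops and paths in half-like regions\<close>

context two_factor_character
begin

text \<open>For an end point of negative value the path to its inverse is translated and reversed;
  the result dips at most \<open>c\<close> below the end point.\<close>

lemma half_space_paths:
  assumes "half_space_connected G X1 \<chi>"
  obtains c where "0 \<le> c" "\<And>u. set u \<subseteq> X1 \<Longrightarrow> \<exists>v. set v \<subseteq> X1 \<and> wprod G v = wprod G u \<and>
    stays G {g \<in> carrier G. - c + min 0 (\<chi> (wprod G u)) \<le> \<chi> g} \<one> v"
proof -
  from assms obtain c where c: "\<And>u. set u \<subseteq> X1 \<Longrightarrow> 0 \<le> \<chi> (wprod G u) \<Longrightarrow>
      \<exists>v. set v \<subseteq> X1 \<and> wprod G v = wprod G u \<and> stays G {g \<in> carrier G. - c \<le> \<chi> g} \<one> v"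
    unfolding half_space_connected_def by blast
  show thesis
  proof (rule that[of "max 0 c"])
    fix u assume u: "set u \<subseteq> X1"
    then have uc: "set u \<subseteq> carrier G" using X1 by blast
    show "\<exists>v. set v \<subseteq> X1 \<and> wprod G v = wprod G u \<and>
        stays G {g \<in> carrier G. - max 0 c + min 0 (\<chi> (wprod G u)) \<le> \<chi> g} \<one> v"
    proof (cases "0 \<le> \<chi> (wprod G u)")
      case True
      then obtain v where "set v \<subseteq> X1" "wprod G v = wprod G u" "stays G {g \<in> carrier G. - c \<le> \<chi> g} \<one> v"
        using c u by blast
      moreover from this(3) have "stays G {g \<in> carrier G. - max 0 c + min 0 (\<chi> (wprod G u)) \<le> \<chi> g} \<one> v"
        by (rule stays_mono) (use True in auto)
      ultimately show ?thesis by blast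
    next
      case False
      let ?u = "winv G u" and ?g = "wprod G u"
      have iu: "set ?u \<subseteq> X1" using set_winv_subset u X1 by blast
      have gc: "?g \<in> carrier G" using uc by auto
      have inv: "\<chi> (inv ?g) = - \<chi> ?g"
        using \<chi>[of ?g "inv ?g"] gc \<chi>_one by simp
      then obtain v where v: "set v \<subseteq> X1" "wprod G v = inv ?g" "stays G {g \<in> carrier G. - c \<le> \<chi> g} \<one> v"
        using c[OF iu] uc False by auto
      have vc: "set v \<subseteq> carrier G" using v X1 by blast
      have "stays G {g \<in> carrier G. - max 0 c + min 0 (\<chi> ?g) \<le> \<chi> g} (?g \<otimes> \<one>) v"
        unfolding stays_translate[OF gc one_closed vc]
        by (rule stays_mono[OF v(3)]) (use False gc in \<open>auto simp: \<chi>\<close>)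
      then have "stays G {g \<in> carrier G. - max 0 c + min 0 (\<chi> ?g) \<le> \<chi> g} \<one> (winv G v)"
        using stays_winv[OF gc vc] v gc by simp
      moreover have "set (winv G v) \<subseteq> X1" using set_winv_subset v X1 by blast
      moreover have "wprod G (winv G v) = ?g" using v vc gc by simp
      ultimately show ?thesis by blast
    qed
  qed simp
qed

text \<open>Every \<open>X1\<close>-letter of the loop is pushed up along \<open>a\<close>; the pushed loop lies so high that its two
  components can be separated and contracted one after the other.\<close>

lemma local_loops:
  assumes "half_space_connected G X1 \<chi>"
  shows "\<exists>B. \<forall>W w. half_like G X \<chi> B \<eta> W \<longrightarrow> set w \<subseteq> X \<longrightarrow> length w \<le> l \<longrightarrow> wprod G w = \<one> \<longrightarrow>
    stays G W \<one> w \<longrightarrow> homot G X L W \<one> w []"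
proof -
  obtain c where c: "0 \<le> c" and paths: "\<And>u. set u \<subseteq> X1 \<Longrightarrow> \<exists>v. set v \<subseteq> X1 \<and> wprod G v = wprod G u \<and>
      stays G {g \<in> carrier G. - c + min 0 (\<chi> (wprod G u)) \<le> \<chi> g} \<one> v"
    using half_space_paths[OF assms] by blast
  obtain D where D: "\<And>w. set w \<subseteq> X2 \<Longrightarrow> length w \<le> l \<Longrightarrow> wprod G w = \<one> \<Longrightarrow>
      homot G X2 L (word_ball G X2 D) \<one> w []"
    using homot_bounded_uniform[OF fin2 X2(1) triv2, of l] by blast
  \<comment> \<open>The height to climb: \<open>2 l C\<close> for the fluctuation of both parts of
    the loop, \<open>C + c\<close> for the dip of one replacement path, \<open>D C\<close> for the
    ball in which the \<open>X2\<close>-part contracts, and \<eta> as the margin of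
    \<open>half_like\<close>.\<close>
  obtain m :: nat where "(2 * real l * C + C + c + real D * C + \<eta>) / \<eta> \<le> real m" using real_arch_simple by blast
  then have m: "2 * real l * C + C + c + real D * C + \<eta> \<le> real m * \<eta>" using \<eta> by (simp add: field_simps)
  let ?a = "replicate m a"
  have ac: "a \<in> carrier G" "set ?a \<subseteq> X1" "set ?a \<subseteq> X" "set ?a \<subseteq> carrier G" "wprod G ?a \<in> carrier G"
    using a X1 by (auto simp: set_replicate_conv_if)
  have wa: "set (winv G ?a) \<subseteq> X1" "set (winv G ?a) \<subseteq> X" "set (winv G ?a) \<subseteq> carrier G"
    using set_winv_subset[OF ac(2)] X1 by blast+
  have \<chi>a: "2 * real l * C + C + c + real D * C + \<eta> \<le> \<chi> (wprod G ?a)"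
  proof -
    have "real m * \<eta> \<le> real m * \<chi> a" using a by (intro mult_left_mono) auto
    then show ?thesis using m \<chi>_rep[OF ac(1), of m] by simp
  qed
  have lC: "0 \<le> 2 * real l * C" "0 \<le> real D * C" using C_nonneg by simp_all
  \<comment> \<open>The conjugate of \<open>x\<close> by the climb has the same value as
    \<open>x\<close>, so connectivity gives a path for it that dips by at most \<open>c + C\<close>.
    This bound does not involve \<open>m\<close>; otherwise climbing higher would be of no
    use.\<close>
  have "\<exists>v. set v \<subseteq> X1 \<and> wprod G v = inv (wprod G ?a) \<otimes> (x \<otimes> wprod G ?a) \<and>
      stays G {g \<in> carrier G. - c - C \<le> \<chi> g} \<one> v" if "x \<in> X1" for x
  proof -
    have xc: "x \<in> carrier G" using that X1 by auto
    let ?u = "winv G ?a @ [x] @ ?a"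
    have u: "set ?u \<subseteq> X1" "set ?u \<subseteq> carrier G" using wa ac that xc by auto
    obtain v where v: "set v \<subseteq> X1" "wprod G v = wprod G ?u"
        "stays G {g \<in> carrier G. - c + min 0 (\<chi> (wprod G ?u)) \<le> \<chi> g} \<one> v"
      using paths[OF u(1)] by blast
    have eq: "wprod G ?u = inv (wprod G ?a) \<otimes> (x \<otimes> wprod G ?a)"
      using ac wa xc by simp
    have "\<chi> (inv (wprod G ?a)) = - \<chi> (wprod G ?a)"
      using \<chi>[of "wprod G ?a" "inv (wprod G ?a)"] ac \<chi>_one by simp
    then have "\<chi> (wprod G ?u) = \<chi> x"
      using ac xc unfolding eq by (simp add: \<chi>)
    then have "- C \<le> min 0 (\<chi> (wprod G ?u))"
      using C[of x] that C_nonneg by auto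
    then have "stays G {g \<in> carrier G. - c - C \<le> \<chi> g} \<one> v"
      by (intro stays_mono[OF v(3)]) auto
    then show ?thesis using v eq by auto
  qed
  then have "\<forall>x\<in>X1. \<exists>v. set v \<subseteq> X1 \<and> wprod G v = inv (wprod G ?a) \<otimes> (x \<otimes> wprod G ?a) \<and>
      stays G {g \<in> carrier G. - c - C \<le> \<chi> g} \<one> v" ..
  from bchoice[OF this] obtain y where "\<forall>x\<in>X1. set (y x) \<subseteq> X1 \<and>
      wprod G (y x) = inv (wprod G ?a) \<otimes> (x \<otimes> wprod G ?a) \<and>
      stays G {g \<in> carrier G. - c - C \<le> \<chi> g} \<one> (y x)" ..
  then have y: "\<And>x. x \<in> X1 \<Longrightarrow> set (y x) \<subseteq> X1"
    "\<And>x. x \<in> X1 \<Longrightarrow> wprod G (y x) = inv (wprod G ?a) \<otimes> (x \<otimes> wprod G ?a)"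
    "\<And>x. x \<in> X1 \<Longrightarrow> stays G {g \<in> carrier G. - c - C \<le> \<chi> g} \<one> (y x)"
    by simp_all
  define M where "M = Max (insert 1 ((length \<circ> y) ` X1))"
  have M: "length (y x) \<le> M" if "x \<in> X1" for x
    unfolding M_def using fin1 that by (intro Max_ge) auto
  have yc: "set (y x) \<subseteq> carrier G" if "x \<in> X1" for x using y(1)[OF that] X1 by blast
  have y_prefix: "- c - C \<le> \<chi> (wprod G p)" if "x \<in> X1" "y x = p @ p'" for x p p'
    using y(3)[OF that(1)] that(2) yc[OF that(1)] stays_iff[OF one_closed yc[OF that(1)]] by auto
  have \<chi>y: "\<chi> (wprod G (y x)) = \<chi> x" if "x \<in> X1" for x
  proof -
    have "\<chi> (inv (wprod G ?a)) = - \<chi> (wprod G ?a)"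
      using \<chi>[of "wprod G ?a" "inv (wprod G ?a)"] ac \<chi>_one by simp
    moreover have "x \<in> carrier G" using that X1 by auto
    ultimately show ?thesis unfolding y(2)[OF that] using ac by (simp add: \<chi>)
  qed
  \<comment> \<open>A bound for all words that occur: at most \<open>l\<close> replacement paths of
    length at most \<open>M\<close>, one more for a single letter, some copies of \<open>?a\<close>,
    and the words of length \<open>D\<close>.\<close>
  define l' where "l' = (l + 1) * M + 4 * m + l + D + 1"
  obtain B0 where B0: "\<And>W u w. half_like G X \<chi> B0 \<eta> W \<Longrightarrow> set u \<subseteq> X \<Longrightarrow> length u \<le> l' \<Longrightarrow>
      set w \<subseteq> X1 \<Longrightarrow> length w \<le> l' \<Longrightarrow> wprod G w = \<one> \<Longrightarrow> stays G W (wprod G u) w \<Longrightarrow>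
      homot G X L W (wprod G u) w []"
    using loops_lift[of l'] by blast
  show ?thesis
  proof (intro exI[of _ "B0 + l'"] allI impI)
    fix W w
    assume W0: "half_like G X \<chi> (B0 + l') \<eta> W" and w: "set w \<subseteq> X" "length w \<le> l" "wprod G w = \<one>"
      and st: "stays G W \<one> w"
    have W: "half_like G X \<chi> B0 \<eta> W" "half_like G X \<chi> l' \<eta> W"
      using W0 by (auto intro: half_like_mono)
    have lenM: "M \<le> l'" "m \<le> l'" "l \<le> l'" "m + M \<le> l'" unfolding l'_def by (simp_all add: add_mult_distrib)
    let ?Y = "\<lambda>x. if x \<in> X1 then y x else [x]"
    have Y: "set (?Y x) \<subseteq> X" "set (?Y x) \<subseteq> carrier G" "wprod G ?a \<otimes> wprod G (?Y x) = x \<otimes> wprod G ?a"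
      if "x \<in> X" for x
    proof -
      show s: "set (?Y x) \<subseteq> X" using y(1) that by auto
      then show "set (?Y x) \<subseteq> carrier G" using X by blast
      have xc: "x \<in> carrier G" using that X by auto
      show "wprod G ?a \<otimes> wprod G (?Y x) = x \<otimes> wprod G ?a"
        using y(2)[of x] ac xc that words_commute[OF ac(2), of "[x]"] by (auto simp: inv_cancel_left)
    qed
    \<comment> \<open>For \<open>x\<close> in \<open>X1\<close> the detour and \<open>x\<close>
      bound a loop inside one factor, which \<open>loops_lift\<close> contracts. For
      \<open>x\<close> in \<open>X2\<close> the detour bounds a rectangle of commutator
      squares.\<close>
    have letter: "homot G X L W (wprod G u) [x] (?a @ ?Y x @ winv G ?a)"
      if u: "set u \<subseteq> X" "length u < l" "wprod G u \<in> W" "wprod G (u @ [x]) \<in> W" and x: "x \<in> X" for u x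
    proof -
      have uc: "set u \<subseteq> carrier G" "wprod G u \<in> carrier G" and xc: "x \<in> carrier G"
        using u x X by blast+
      have ux: "set (u @ [x]) \<subseteq> X" using u x by auto
      have eq_ux: "wprod G (u @ [x]) = wprod G u \<otimes> x" using uc xc by simp
      let ?g = "wprod G u"
      have up: "stays G W ?g ?a"
        using W u a lenM by (intro rising_stays[where B = l']) auto
      have upx: "stays G W (?g \<otimes> x) ?a"
        using rising_stays[OF W(2) ux, of m a] u a lenM unfolding eq_ux by auto
      have down: "stays G W (?g \<otimes> x \<otimes> wprod G ?a) (winv G ?a)"
        using upx stays_winv[of "?g \<otimes> x" ?a W] ac uc xc by simp
      show ?thesis
      proof (cases "x \<in> X1")
        case True
        have mid: "stays G W (?g \<otimes> wprod G ?a) (y x)"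
        proof (rule high_stays[OF W(2)])
          show "\<eta> \<le> \<chi> (wprod G ?a) + \<chi> (wprod G w')" if "y x = w' @ w''" for w' w''
            using y_prefix[OF True that] \<chi>a lC by linarith
          show "length ?a + length (y x) \<le> l'" using M[OF True] lenM by simp
        qed (use u ac y(1)[OF True] lenM in auto)
        let ?lam = "?a @ y x @ winv G ?a"
        have lamc: "set ?lam \<subseteq> X1" "set ?lam \<subseteq> carrier G" using ac wa y(1)[OF True] yc[OF True] by auto
        have prod: "?g \<otimes> (wprod G ?a \<otimes> wprod G (y x)) = ?g \<otimes> x \<otimes> wprod G ?a"
          using Y(3)[OF x] True uc xc ac by (simp add: m_assoc)
        have lam_st: "stays G W ?g ?lam"
          using up mid down prod ac yc[OF True] wa uc by (simp add: stays_append m_assoc)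
        have lam_prod: "wprod G ?lam = x"
        proof -
          have "wprod G ?lam = (wprod G ?a \<otimes> wprod G (y x)) \<otimes> inv (wprod G ?a)"
            using ac yc[OF True] wa by (simp add: m_assoc)
          then show ?thesis using Y(3)[OF x] True xc ac by (simp add: m_assoc)
        qed
        have "homot G X L W ?g (?lam @ winv G [x]) []"
        proof (rule B0[OF W(1) u(1)])
          have ix: "inv x \<in> X1" using True X1 by auto
          show "set (?lam @ winv G [x]) \<subseteq> X1" using lamc ix by (simp add: winv_def)
          show "length (?lam @ winv G [x]) \<le> l'" using M[OF True] unfolding l'_def by (simp add: add_mult_distrib)
          show "wprod G (?lam @ winv G [x]) = \<one>"
            using lam_prod lamc xc by (subst wprod_append) (auto simp: winv_def)
          have "?g \<otimes> x \<otimes> inv x = ?g" using uc xc by (simp add: m_assoc)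
          then show "stays G W ?g (?lam @ winv G [x])"
            using lam_st lam_prod lamc xc uc u unfolding eq_ux by (subst stays_append) (auto simp: winv_def)
        qed (use u lenM in auto)
        then have "homot G X L W ?g ?lam [x]"
        proof (rule homot_from_loop)
          show "stays G W ?g [x]" using u(3,4) unfolding eq_ux by simp
          show "2 \<le> L" using L by simp
          show "set [x] \<subseteq> X" using x by simp
        qed (rule X(2,3) uc(2))+
        then show ?thesis using True by (simp add: homot.sym)
      next
        case False
        then have x2: "x \<in> X2" using x by auto
        have "homot G X L W ?g (?a @ [x]) ([x] @ ?a)"
        proof (rule grid)
          fix u' u'' v' v'' assume *: "?a = u' @ u''" "[x] = v' @ v''"
          then have c': "set u' \<subseteq> X1" "wprod G u' \<in> carrier G" using ac by auto
          have "?g \<otimes> wprod G u' \<in> W" "?g \<otimes> x \<otimes> wprod G u' \<in> W"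
            using up upx * uc xc ac by (auto simp: stays_iff)
          moreover have "v' = [] \<or> v' = [x]" using *(2) by (auto simp: Cons_eq_append_conv)
          moreover have "wprod G u' \<otimes> x = x \<otimes> wprod G u'"
            using words_commute[OF c'(1), of "[x]"] x2 xc by simp
          ultimately show "?g \<otimes> wprod G u' \<otimes> wprod G v' \<in> W"
            using uc xc c' by (auto simp: m_assoc)
        qed (use ac x2 uc in auto)
        then have 1: "homot G X L W ?g (([x] @ ?a) @ winv G ?a) ((?a @ [x]) @ winv G ?a)"
        proof (intro homot_append_right homot.sym[of G X L W ?g "?a @ [x]"])
          have "?g \<otimes> wprod G (?a @ [x]) = ?g \<otimes> x \<otimes> wprod G ?a"
            using ac xc uc words_commute[OF ac(2), of "[x]"] x2 by (simp add: m_assoc)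
          then show "stays G W (?g \<otimes> wprod G (?a @ [x])) (winv G ?a)" using down by simp
        qed (use wa uc X in auto)
        have "homot G X L W ?g ([x] @ (?a @ winv G ?a)) ([x] @ [])"
        proof (rule homot_append_left)
          show "homot G X L W (?g \<otimes> wprod G [x]) (?a @ winv G ?a) []"
            using upx ac xc uc X L by (intro homot_cancel) auto
        qed (use u uc xc x X eq_ux in auto)
        with 1 show ?thesis using False by (auto intro: homot.trans homot.sym)
      qed
    qed
    \<comment> \<open>Between consecutive detours the word \<open>winv G ?a @ ?a\<close> cancels, so
      a single climb and a single descent remain.\<close>
    have push: "homot G X L W (wprod G u) v (?a @ subst_word y v @ winv G ?a)"
      if "set u \<subseteq> X" "set v \<subseteq> X" "length u + length v \<le> l" "stays G W (wprod G u) v" for u v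
      using that
    proof (induction v arbitrary: u)
      case Nil
      have "homot G X L W (wprod G u) (?a @ winv G ?a) []"
      proof (rule homot_cancel)
        show "stays G W (wprod G u) ?a"
          using W Nil a lenM by (intro rising_stays[where B = l']) auto
        show "wprod G u \<in> carrier G" using Nil(1) X by blast
      qed (use ac X L in auto)
      then show ?case by (simp add: homot.sym)
    next
      case (Cons x v)
      let ?g = "wprod G u"
      have x: "x \<in> X" "x \<in> carrier G" and v: "set v \<subseteq> X" "set v \<subseteq> carrier G"
        and uc: "set u \<subseteq> carrier G"
        using Cons.prems(1,2) X(2) by (auto simp: subset_iff)
      have u: "set u \<subseteq> carrier G" "?g \<in> carrier G" using uc by auto
      have ux: "wprod G (u @ [x]) = ?g \<otimes> x" using x u by simp
      have st_x: "?g \<in> W" "stays G W (?g \<otimes> x) v" using Cons.prems by auto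
      have sx: "?g \<otimes> x \<in> W" using stays_start[OF st_x(2)] .
      have l1: "homot G X L W ?g [x] (?a @ ?Y x @ winv G ?a)"
        using Cons.prems st_x sx ux x by (intro letter) auto
      have IH: "homot G X L W (?g \<otimes> x) v (?a @ subst_word y v @ winv G ?a)"
        using Cons.IH[of "u @ [x]"] Cons.prems x v st_x unfolding ux by auto
      have sv: "set (subst_word y v) \<subseteq> X" "set (subst_word y v) \<subseteq> carrier G"
        using subst_word_set[of y v, OF y(1) v(1)] X by blast+
      note Yx = Y[OF x(1)]
      have s1: "stays G W ?g (?a @ ?Y x @ winv G ?a)" "wprod G (?a @ ?Y x @ winv G ?a) = wprod G [x]"
        using homot_stays[OF l1] u X by auto
      have s2: "stays G W (?g \<otimes> x) (?a @ subst_word y v @ winv G ?a)"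
        using homot_stays[OF IH] u x X by auto
      have 1: "homot G X L W ?g ([x] @ v) ([x] @ (?a @ subst_word y v @ winv G ?a))"
        using IH st_x sx x u X by (intro homot_append_left) auto
      have 2: "homot G X L W ?g ([x] @ (?a @ subst_word y v @ winv G ?a))
          ((?a @ ?Y x @ winv G ?a) @ (?a @ subst_word y v @ winv G ?a))"
        using l1 s1 s2 x u ac wa sv X by (intro homot_append_right) auto
      have prod: "?g \<otimes> wprod G (?a @ ?Y x) = ?g \<otimes> x \<otimes> wprod G ?a"
        using Yx(2,3) ac u x by (simp add: m_assoc)
      have 3: "homot G X L W ?g ((?a @ ?Y x) @ (winv G ?a @ ?a) @ (subst_word y v @ winv G ?a))
          ((?a @ ?Y x) @ [] @ (subst_word y v @ winv G ?a))"
      proof (rule homot_context)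
        have "?g \<otimes> x \<otimes> wprod G ?a \<otimes> inv (wprod G ?a) = ?g \<otimes> x"
          using ac u x by (simp add: m_assoc)
        then show "homot G X L W (?g \<otimes> wprod G (?a @ ?Y x)) (winv G ?a @ ?a) []"
          unfolding prod using s2 ac wa sv u x X L by (intro homot_cancel') (auto simp: stays_append)
        have c: "set (?a @ ?Y x) \<subseteq> carrier G" "set (subst_word y v @ winv G ?a) \<subseteq> carrier G"
          using ac Yx sv wa by auto
        have "stays G W ?g (?a @ ?Y x)"
          using s1 stays_append[OF u(2) c(1) wa(3)] by simp
        moreover have "stays G W (?g \<otimes> x \<otimes> wprod G ?a) (subst_word y v @ winv G ?a)"
          using s2 stays_append[of "?g \<otimes> x" ?a "subst_word y v @ winv G ?a" W] ac c u x by simp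
        ultimately show "stays G W ?g ((?a @ ?Y x) @ [] @ (subst_word y v @ winv G ?a))"
          using stays_append[OF u(2) c, of W] prod by simp
        show "set ((?a @ ?Y x) @ (subst_word y v @ winv G ?a)) \<subseteq> X"
          using ac Yx sv wa by auto
      qed (use u X in auto)
      have "homot G X L W ?g (x # v) (?a @ ?Y x @ subst_word y v @ winv G ?a)"
        using homot.trans[OF homot.trans[OF 1 2], of "?a @ ?Y x @ subst_word y v @ winv G ?a"] 3 by simp
      then show ?case by simp
    qed
    have w1: "\<one> \<in> W" using stays_start[OF st] .
    have tr: "homot G X L W \<one> w (?a @ subst_word y w @ winv G ?a)"
      using push[of "[]" w] w st by simp
    let ?p = "part1 y w" and ?q = "part2 w"
    have p: "set ?p \<subseteq> X1" "set ?p \<subseteq> carrier G" and q: "set ?q \<subseteq> X2" "set ?q \<subseteq> carrier G"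
      using part1_set[of y w, OF y(1)] part2_set[OF w(1)] X1 X2 by blast+
    have lenq: "length ?q \<le> l" using w by (auto simp: part2_def intro: order_trans[OF length_filter_le])
    have len_part1: "length (part1 y v) \<le> length v * M" for v
      using M by (induction v) (auto simp: add_mono trans_le_add2)
    have lenp: "length ?p \<le> l * M"
      using len_part1[of w] w by (meson mult_le_mono1 order_trans)
    \<comment> \<open>Dips do not accumulate: a completed replacement path has the value of its
      letter, and only the last, unfinished one can dip by \<open>c + C\<close>.\<close>
    have part1_prefix: "- real (length v) * C - c - C \<le> \<chi> (wprod G r)"
      if "part1 y v = r @ r'" "set v \<subseteq> X" for v r r'
      using that
    proof (induction v arbitrary: r)
      case Nil
      then show ?case using \<chi>_one c C_nonneg by simp
    next
      case (Cons x v)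
      show ?case
      proof (cases "x \<in> X1")
        case True
        then have "y x @ part1 y v = r @ r'" using Cons.prems by simp
        then consider r'' where "y x = r @ r''" | r'' where "r = y x @ r''" "part1 y v = r'' @ r'"
          by (auto simp: append_eq_append_conv2)
        then show ?thesis
        proof cases
          case 1
          have "0 \<le> real (length v) * C" using C_nonneg by simp
          moreover have "- real (length (x # v)) * C = - C - real (length v) * C" by (simp add: algebra_simps)
          ultimately show ?thesis using y_prefix[OF True 1] C_nonneg by linarith
        next
          case 2
          have "set r'' \<subseteq> X1" using part1_set[of y v, OF y(1)] 2 by auto
          then have "\<chi> (wprod G r) = \<chi> x + \<chi> (wprod G r'')"
            using \<chi>_append[of "y x" r''] y(1)[OF True] \<chi>y[OF True] 2 by auto
          moreover have "- C \<le> \<chi> x" using C[of x] True by auto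
          ultimately show ?thesis
            using Cons.IH[OF 2(2)] Cons.prems by (simp add: algebra_simps)
        qed
      next
        case False
        then show ?thesis using Cons C_nonneg by (fastforce simp: algebra_simps)
      qed
    qed
    \<comment> \<open>Every point of the rectangle spanned by the two parts is reached from
      \<open>\<one>\<close> by one jump of value at least \<eta>; this is the region that
      \<open>sort_word\<close> needs.\<close>
    have high: "wprod G ?a \<otimes> wprod G r \<otimes> wprod G s \<in> W"
      if *: "?p = r @ r'" "?q = s @ s'" for r r' s s'
    proof -
      have c': "set r \<subseteq> X" "set s \<subseteq> X" "set r \<subseteq> carrier G" "set s \<subseteq> carrier G"
        using * p q by auto
      have len: "length s \<le> l" "length r \<le> l * M" using * lenq lenp by auto
      have "real (length w) * C \<le> real l * C" using w C_nonneg by (intro mult_right_mono) auto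
      then have "- real l * C - c - C \<le> \<chi> (wprod G r)"
        using part1_prefix[OF *(1) w(1)] by simp
      moreover have "- real l * C \<le> \<chi> (wprod G s)"
        using \<chi>_word_le[OF c'(2) len(1)] .
      moreover have "\<chi> (wprod G (?a @ r @ s)) = \<chi> (wprod G ?a) + \<chi> (wprod G r) + \<chi> (wprod G s)"
        using \<chi>_append[of ?a "r @ s"] \<chi>_append[of r s] ac c' by auto
      ultimately have "\<eta> \<le> \<chi> (wprod G (?a @ r @ s))"
        using \<chi>a lC by linarith
      moreover have "length (?a @ r @ s) \<le> l'" using len by (simp add: l'_def add_mult_distrib)
      ultimately have "wprod G [] \<otimes> wprod G (?a @ r @ s) \<in> W"
        using W w1 ac c' by (intro half_likeD[OF W(2)]) auto
      then show ?thesis using ac c' by (simp add: m_assoc)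
    qed
    have sorted: "homot G X L W (wprod G ?a) (subst_word y w) (?p @ ?q)"
      using high by (intro sort_word y w ac) auto
    have sw: "set (subst_word y w) \<subseteq> X" "set (subst_word y w) \<subseteq> carrier G"
      using subst_word_set[of y w, OF y(1) w(1)] X by blast+
    have "wprod G (?a @ subst_word y w @ winv G ?a) = \<one>"
      using homot_stays[OF tr] w X by simp
    then have "wprod G ?a \<otimes> wprod G (subst_word y w) \<otimes> inv (wprod G ?a) = \<one>"
      using ac wa sw by (simp add: m_assoc)
    then have "inv (inv (wprod G ?a)) = wprod G ?a \<otimes> wprod G (subst_word y w)"
      using ac sw by (intro inv_equality) auto
    then have "wprod G (subst_word y w) = \<one>"
      using ac sw by simp
    then have "wprod G ?p \<otimes> wprod G ?q = \<one>"
      using homot_stays[OF sorted] ac p q X by simp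
    then have pq: "wprod G ?p = \<one>" "wprod G ?q = \<one>"
      using indep p q by blast+
    have stp: "stays G W (wprod G ?a) ?p"
      unfolding stays_iff[OF ac(5) p(2)]
    proof (intro allI impI)
      fix r r' assume *: "?p = r @ r'"
      then have "wprod G r \<in> carrier G" using p by auto
      then show "wprod G ?a \<otimes> wprod G r \<in> W"
        using high[OF *, of "[]" ?q] ac by simp
    qed
    have np: "homot G X L W (wprod G ?a) ?p []"
      using W ac p pq lenp stp by (intro B0) (auto simp: l'_def add_mult_distrib)
    have nq: "homot G X L W (wprod G ?a \<otimes> \<one>) ?q []"
    proof (rule homot_translate)
      have "word_ball G X2 D \<subseteq> {z \<in> carrier G. wprod G ?a \<otimes> z \<in> W}"
      proof
        fix z assume "z \<in> word_ball G X2 D"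
        then obtain f where f: "set f \<subseteq> X2" "length f \<le> D" "z = wprod G f" by (auto simp: word_ball_def)
        then have fc: "set f \<subseteq> X" "set f \<subseteq> carrier G" using X2 by auto
        have "\<eta> \<le> \<chi> (wprod G (?a @ f))"
          using \<chi>_append[OF ac(3) fc(1)]  \<chi>_word_le[OF fc(1) f(2)] \<chi>a lC c C_nonneg by linarith
        then have "wprod G [] \<otimes> wprod G (?a @ f) \<in> W"
          using ac fc f w1 by (intro half_likeD[OF W(2)]) (auto simp: l'_def)
        then show "z \<in> {z \<in> carrier G. wprod G ?a \<otimes> z \<in> W}"
          using f fc ac by simp
      qed
      then show "homot G X L {z \<in> carrier G. wprod G ?a \<otimes> z \<in> W} \<one> ?q []"
        using D[OF q(1) lenq pq(2)] by (auto intro: homot_mono)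
    qed (use ac X in auto)
    have stq: "stays G W (wprod G ?a) ?q"
      using homot_stays[OF nq] ac X by simp
    have "homot G X L W (wprod G ?a) (?p @ ?q) ([] @ ?q)"
      using np stq q ac X by (intro homot_append_right) auto
    then have null: "homot G X L W (wprod G ?a) (subst_word y w) []"
      using sorted nq ac by (auto intro: homot.trans)
    have up: "stays G W \<one> ?a"
      using rising_stays[OF W(2), of "[]" m a] a lenM w1 by simp
    have "homot G X L W \<one> (?a @ subst_word y w @ winv G ?a) (?a @ [] @ winv G ?a)"
    proof (rule homot_context)
      show "homot G X L W (\<one> \<otimes> wprod G ?a) (subst_word y w) []" using null ac by simp
      show "stays G W \<one> (?a @ [] @ winv G ?a)"
        using up stays_winv[of \<one> ?a W] ac wa by (simp add: stays_append)
    qed (use ac wa X in auto)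
    moreover have "homot G X L W \<one> (?a @ winv G ?a) []"
      using up ac X L by (intro homot_cancel) auto
    ultimately show "homot G X L W \<one> w []"
      using tr by (auto intro: homot.trans)
  qed
qed

end

context two_factor_character
begin

lemma parts_of_word:
  assumes "set d \<subseteq> X"
  shows "wprod G d = wprod G (part1 (\<lambda>x. [x]) d) \<otimes> wprod G (part2 d)"
    "set (part1 (\<lambda>x. [x]) d) \<subseteq> X1" "set (part2 d) \<subseteq> X2"
    "length (part1 (\<lambda>x. [x]) d) + length (part2 d) = length d"
proof -
  show p1: "set (part1 (\<lambda>x. [x]) d) \<subseteq> X1" for d by (intro part1_set) auto
  show p2: "set (part2 d) \<subseteq> X2" using part2_set assms .
  show "length (part1 (\<lambda>x. [x]) d) + length (part2 d) = length d"
    by (induction d) auto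
  show "wprod G d = wprod G (part1 (\<lambda>x. [x]) d) \<otimes> wprod G (part2 d)"
    using assms
  proof (induction d)
    case (Cons x d)
    have c: "x \<in> carrier G" "wprod G (part1 (\<lambda>x. [x]) d) \<in> carrier G" "wprod G (part2 d) \<in> carrier G"
      using Cons.prems X p1[of d] part2_set[of d] X1 X2 by (auto intro!: wprod_closed)
    show ?case
    proof (cases "x \<in> X1")
      case True
      then show ?thesis using Cons c by (simp add: m_assoc)
    next
      case False
      then have "x \<in> X2" using Cons.prems by auto
      then have sw: "wprod G (part1 (\<lambda>x. [x]) d) \<otimes> x = x \<otimes> wprod G (part1 (\<lambda>x. [x]) d)"
        using words_commute[OF p1[of d], of "[x]"] c by simp
      have "x \<otimes> wprod G (part1 (\<lambda>x. [x]) d) \<otimes> wprod G (part2 d) =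
          wprod G (part1 (\<lambda>x. [x]) d) \<otimes> (x \<otimes> wprod G (part2 d))"
        unfolding sw[symmetric] using c by (simp add: m_assoc)
      then show ?thesis using False Cons c by (simp add: m_assoc)
    qed
  qed simp
qed

text \<open>A path that only visits points above \<open>\<one>\<close>, above the end point, or high up.\<close>

lemma local_paths:
  "\<exists>B. \<forall>W d. half_like G X \<chi> B \<eta> W \<longrightarrow> set d \<subseteq> X \<longrightarrow> length d \<le> l \<longrightarrow> \<one> \<in> W \<longrightarrow> wprod G d \<in> W \<longrightarrow>
    (\<exists>e. set e \<subseteq> X \<and> length e \<le> B \<and> wprod G e = wprod G d \<and> stays G W \<one> e)"
proof -
  \<comment> \<open>While the second part of \<open>d\<close> is read, the losses of both parts, at
    most \<open>l * C\<close> each, have to be compensated.\<close>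
  obtain k :: nat where "(2 * real l * C + \<eta>) / \<eta> \<le> real k" using real_arch_simple by blast
  then have k: "2 * real l * C + \<eta> \<le> real k * \<eta>" using \<eta> by (simp add: field_simps)
  let ?a = "replicate k a" and ?b = "replicate k b"
  have ac: "a \<in> carrier G" "set ?a \<subseteq> X1" "set ?a \<subseteq> X" "set ?a \<subseteq> carrier G" "wprod G ?a \<in> carrier G"
    and bc: "b \<in> carrier G" "set ?b \<subseteq> X2" "set ?b \<subseteq> X" "set ?b \<subseteq> carrier G" "wprod G ?b \<in> carrier G"
    using a b X1 X2 by (auto simp: set_replicate_conv_if)
  have wab: "set (winv G ?a) \<subseteq> X" "set (winv G ?a) \<subseteq> carrier G" "set (winv G ?b) \<subseteq> X" "set (winv G ?b) \<subseteq> carrier G"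
    using set_winv_subset[OF ac(3) X(3)] set_winv_subset[OF bc(3) X(3)] X by blast+
  have "real k * \<eta> \<le> real k * \<chi> a" "real k * \<eta> \<le> real k * \<chi> b"
    using a b by (auto intro!: mult_left_mono)
  then have \<chi>k: "2 * real l * C + \<eta> \<le> \<chi> (wprod G ?a)" "2 * real l * C + \<eta> \<le> \<chi> (wprod G ?b)"
    using k \<chi>_rep[OF ac(1), of k] \<chi>_rep[OF bc(1), of k] by simp_all
  have lC: "0 \<le> real l * C" using C_nonneg by simp
  show ?thesis
  proof (intro exI[of _ "4 * k + 2 * l + 1"] allI impI)
    fix W d
    assume W: "half_like G X \<chi> (4 * k + 2 * l + 1) \<eta> W" and d: "set d \<subseteq> X" "length d \<le> l"
      and ends: "\<one> \<in> W" "wprod G d \<in> W"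
    let ?d1 = "part1 (\<lambda>x. [x]) d" and ?d2 = "part2 d"
    note dd = parts_of_word[OF d(1)]
    have d1: "set ?d1 \<subseteq> X" "set ?d1 \<subseteq> carrier G" "length ?d1 \<le> l"
      and d2: "set ?d2 \<subseteq> X" "set ?d2 \<subseteq> carrier G" "length ?d2 \<le> l"
      using dd d X1 X2 by auto
    \<comment> \<open>The climb along \<open>b\<close> covers the reading of the
      \<open>X1\<close>-part, the climb along \<open>a\<close> that of the \<open>X2\<close>-part.
      As \<open>b\<close> commutes with \<open>?d1 @ ?a\<close>, its descent is a reversed climb
      from a high point; the final descent is the reversed climb from the end point itself.\<close>
    let ?e = "?b @ ?d1 @ ?a @ winv G ?b @ ?d2 @ winv G ?a"
    let ?A = "wprod G ?a" and ?Bb = "wprod G ?b" and ?D1 = "wprod G ?d1" and ?D2 = "wprod G ?d2"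
    have DC: "?D1 \<in> carrier G" "?D2 \<in> carrier G" using d1 d2 by auto
    have low: "- real l * C \<le> \<chi> (wprod G r)" if "set r \<subseteq> X" "length r \<le> l" for r
      using \<chi>_word_le[OF that] .
    have s1: "stays G W \<one> ?b"
      using rising_stays[OF W, of "[]" k b] b ends by simp
    have s2: "stays G W ?Bb ?d1"
    proof -
      have "stays G W (wprod G [] \<otimes> wprod G ?b) ?d1"
      proof (rule high_stays[OF W])
        fix r r' assume r: "?d1 = r @ r'"
        then have "set r \<subseteq> X" "length r \<le> l" using d1 by auto
        from low[OF this] show "\<eta> \<le> \<chi> (wprod G ?b) + \<chi> (wprod G r)" using \<chi>k lC by linarith
      qed (use ends bc d1 in auto)
      then show ?thesis using bc by simp
    qed
    have s3: "stays G W (?Bb \<otimes> ?D1) ?a"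
    proof -
      have "stays G W (wprod G [] \<otimes> wprod G (?b @ ?d1)) ?a"
      proof (rule high_stays[OF W])
        fix r r' assume r: "?a = r @ r'"
        then obtain j where j: "r = replicate j a" by (metis rep_prefix)
        have "0 \<le> \<chi> (wprod G r)" unfolding j using \<chi>_rep[OF ac(1), of j] a \<eta> by simp
        moreover have "\<chi> (wprod G (?b @ ?d1)) = \<chi> ?Bb + \<chi> ?D1" using \<chi>_append bc d1 by blast
        ultimately show "\<eta> \<le> \<chi> (wprod G (?b @ ?d1)) + \<chi> (wprod G r)"
          using low[OF d1(1,3)] \<chi>k lC by linarith
      qed (use ends ac bc d1 in auto)
      then show ?thesis using bc d1 by simp
    qed
    have comm: "?Bb \<otimes> ?D1 \<otimes> ?A = ?D1 \<otimes> ?A \<otimes> ?Bb"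
    proof -
      have "set (?d1 @ ?a) \<subseteq> X1" using dd ac by auto
      from words_commute[OF this bc(2)] show ?thesis using d1 ac bc by (simp add: m_assoc)
    qed
    have s4: "stays G W (?D1 \<otimes> ?A \<otimes> ?Bb) (winv G ?b)"
    proof -
      have "stays G W (wprod G [] \<otimes> wprod G (?d1 @ ?a)) ?b"
      proof (rule high_stays[OF W])
        fix r r' assume r: "?b = r @ r'"
        then obtain j where j: "r = replicate j b" by (metis rep_prefix)
        have "0 \<le> \<chi> (wprod G r)" unfolding j using \<chi>_rep[OF bc(1), of j] b \<eta> by simp
        moreover have "\<chi> (wprod G (?d1 @ ?a)) = \<chi> ?D1 + \<chi> ?A" using \<chi>_append ac d1 by blast
        ultimately show "\<eta> \<le> \<chi> (wprod G (?d1 @ ?a)) + \<chi> (wprod G r)"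
          using low[OF d1(1,3)] \<chi>k lC by linarith
      qed (use ends ac bc d1 in auto)
      then have "stays G W (?D1 \<otimes> ?A) ?b" using ac d1 by simp
      then show ?thesis using stays_winv[of "?D1 \<otimes> ?A" ?b W] DC ac bc by simp
    qed
    have s5: "stays G W (?D1 \<otimes> ?A) ?d2"
    proof -
      have "stays G W (wprod G [] \<otimes> wprod G (?d1 @ ?a)) ?d2"
      proof (rule high_stays[OF W])
        fix r r' assume r: "?d2 = r @ r'"
        then have "set r \<subseteq> X" "length r \<le> l" using d2 by auto
        moreover have "\<chi> (wprod G (?d1 @ ?a)) = \<chi> ?D1 + \<chi> ?A" using \<chi>_append ac d1 by blast
        ultimately show "\<eta> \<le> \<chi> (wprod G (?d1 @ ?a)) + \<chi> (wprod G r)"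
          using low[of r] low[OF d1(1,3)] \<chi>k by linarith
      qed (use ends ac d1 d2 in auto)
      then show ?thesis using ac d1 by simp
    qed
    have comm2: "?A \<otimes> ?D2 = ?D2 \<otimes> ?A" using words_commute[OF ac(2) dd(3)] .
    have s6: "stays G W (?D1 \<otimes> ?A \<otimes> ?D2) (winv G ?a)"
    proof -
      have "stays G W (wprod G d) ?a"
        using rising_stays[OF W d(1), of k a] d a ends by simp
      moreover have "wprod G d \<in> carrier G" using dd DC by simp
      ultimately have "stays G W (wprod G d \<otimes> ?A) (winv G ?a)"
        using stays_winv[of "wprod G d" ?a W] ac by simp
      moreover have "wprod G d \<otimes> ?A = ?D1 \<otimes> ?A \<otimes> ?D2"
        using dd(1) DC ac comm2 by (simp add: m_assoc)
      ultimately show ?thesis by simp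
    qed
    have prod4: "?D1 \<otimes> ?A \<otimes> ?Bb \<otimes> inv ?Bb = ?D1 \<otimes> ?A" using DC ac bc by (simp add: m_assoc)
    have "stays G W \<one> ?e"
      using s1 s2 s3 s4 s5 s6 comm prod4 DC ac bc wab d1 d2 by (simp add: stays_append)
    moreover have "wprod G ?e = wprod G d"
    proof -
      have "wprod G ?e = (?Bb \<otimes> ?D1 \<otimes> ?A) \<otimes> inv ?Bb \<otimes> ?D2 \<otimes> inv ?A"
        using DC ac bc wab d1 d2 by (simp add: m_assoc)
      also have "\<dots> = ?D1 \<otimes> (?A \<otimes> ?D2) \<otimes> inv ?A"
        unfolding comm prod4 using DC ac by (simp add: m_assoc)
      also have "\<dots> = wprod G d"
        unfolding comm2 dd(1) using DC ac by (simp add: m_assoc)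
      finally show ?thesis .
    qed
    moreover have "set ?e \<subseteq> X" using ac bc wab d1 d2 by auto
    moreover have "length ?e \<le> 4 * k + 2 * l + 1" using d1 d2 by simp
    ultimately show "\<exists>e. set e \<subseteq> X \<and> length e \<le> 4 * k + 2 * l + 1 \<and> wprod G e = wprod G d \<and> stays G W \<one> e"
      by blast
  qed
qed

end

section \<open>Compactness of the sphere of directions\<close>

text \<open>Subsequences are extracted one coordinate after the other; in each coordinate a bounded
  monotone subsequence converges.\<close>

lemma convergent_subsequences:
  fixes s :: "nat \<Rightarrow> nat \<Rightarrow> real"
  assumes "\<And>j. j < d \<Longrightarrow> Bseq (s j)"
  shows "\<exists>r. strict_mono r \<and> (\<forall>j<d. convergent (\<lambda>n. s j (r n)))"
  using assms
proof (induction d)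
  case 0
  then show ?case by (intro exI[of _ id]) (auto simp: strict_mono_def)
next
  case (Suc d)
  then obtain r where r: "strict_mono r" "\<And>j. j < d \<Longrightarrow> convergent (\<lambda>n. s j (r n))"
    by (metis less_SucI)
  obtain f :: "nat \<Rightarrow> nat" where f: "strict_mono f" "monoseq (\<lambda>n. s d (r (f n)))"
    using seq_monosub[of "\<lambda>n. s d (r n)"] by blast
  have "Bseq (\<lambda>n. s d (r (f n)))"
    using Bseq_subseq[OF Suc.prems[of d], of "r \<circ> f"] by simp
  then have "convergent (\<lambda>n. s d (r (f n)))"
    using f(2) by (rule Bseq_monoseq_convergent)
  moreover have "convergent (\<lambda>n. s j (r (f n)))" if "j < d" for j
    using convergent_subseq_convergent[OF r(2)[OF that] f(1)] by (simp add: comp_def)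
  ultimately show ?case
    using strict_mono_compose[OF r(1) f(1)] by (intro exI[of _ "\<lambda>n. r (f n)"]) (auto simp: less_Suc_eq)
qed

definition sq_norm :: "nat \<Rightarrow> (nat \<Rightarrow> 'a \<Rightarrow> int) \<Rightarrow> 'a \<Rightarrow> int" where
  "sq_norm d p g = (\<Sum>j<d. (p j g)\<^sup>2)"

text \<open>The linear form \<alpha> on the coordinates. Unit vectors \<alpha> parametrise the
  sphere of directions.\<close>

definition comb_character :: "nat \<Rightarrow> (nat \<Rightarrow> 'a \<Rightarrow> int) \<Rightarrow> (nat \<Rightarrow> real) \<Rightarrow> 'a \<Rightarrow> real" where
  "comb_character d p \<alpha> g = (\<Sum>j<d. \<alpha> j * real_of_int (p j g))"

lemma sq_norm_nonneg: "0 \<le> sq_norm d p g"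
  by (simp add: sq_norm_def sum_nonneg)

text \<open>Far away from the origin, the sublevel sets of \<open>sq_norm\<close> look like half spaces on any
  prescribed scale; the direction is a limit of the points \<open>- p g / \<surd>(sq_norm g)\<close>.\<close>

lemma (in group) half_space_directions:
  fixes p :: "nat \<Rightarrow> 'a \<Rightarrow> int" and B :: "(nat \<Rightarrow> real) \<Rightarrow> nat" and \<eta> :: "(nat \<Rightarrow> real) \<Rightarrow> real"
  assumes p: "\<And>j x y. j < d \<Longrightarrow> x \<in> carrier G \<Longrightarrow> y \<in> carrier G \<Longrightarrow> p j (x \<otimes> y) = p j x + p j y"
    and X: "finite X" "X \<subseteq> carrier G"
    and \<eta>: "\<And>\<alpha>. (\<Sum>j<d. (\<alpha> j)\<^sup>2) = 1 \<Longrightarrow> 0 < \<eta> \<alpha>"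
  shows "\<exists>R::nat. \<forall>g\<in>carrier G. int R \<le> sq_norm d p g \<longrightarrow> (\<exists>\<alpha>. (\<Sum>j<d. (\<alpha> j)\<^sup>2) = 1 \<and> B \<alpha> \<le> R \<and>
    (\<forall>u v. set u \<subseteq> X \<and> set v \<subseteq> X \<and> length u \<le> B \<alpha> \<and> length v \<le> B \<alpha> \<and>
      \<eta> \<alpha> \<le> comb_character d p \<alpha> (wprod G v) \<longrightarrow>
      sq_norm d p (g \<otimes> wprod G u \<otimes> wprod G v) < sq_norm d p (g \<otimes> wprod G u)))"
proof -
  let ?N = "sq_norm d p" and ?c = "comb_character d p"
  define good where "good = (\<lambda>R g \<alpha>. B \<alpha> \<le> R \<and>
    (\<forall>u v. set u \<subseteq> X \<and> set v \<subseteq> X \<and> length u \<le> B \<alpha> \<and> length v \<le> B \<alpha> \<and>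
      \<eta> \<alpha> \<le> ?c \<alpha> (wprod G v) \<longrightarrow> ?N (g \<otimes> wprod G u \<otimes> wprod G v) < ?N (g \<otimes> wprod G u)))"
  have "\<exists>R::nat. \<forall>g\<in>carrier G. int R \<le> ?N g \<longrightarrow> (\<exists>\<alpha>. (\<Sum>j<d. (\<alpha> j)\<^sup>2) = 1 \<and> good R g \<alpha>)"
  proof (rule ccontr)
  assume "\<not> ?thesis"
  then have "\<forall>n::nat. \<exists>g. g \<in> carrier G \<and> int (Suc n) \<le> ?N g \<and> (\<forall>\<alpha>. (\<Sum>j<d. (\<alpha> j)\<^sup>2) = 1 \<longrightarrow> \<not> good (Suc n) g \<alpha>)"
    by blast
  from choice[OF this] obtain g where g: "\<And>n. g n \<in> carrier G" "\<And>n. int (Suc n) \<le> ?N (g n)"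
    and bad: "\<And>n \<alpha>. (\<Sum>j<d. (\<alpha> j)\<^sup>2) = 1 \<Longrightarrow> \<not> good (Suc n) (g n) \<alpha>"
    by blast
  define S where "S = (\<lambda>n. sqrt (real_of_int (?N (g n))))"
  have S2: "(S n)\<^sup>2 = real_of_int (?N (g n))" for n
    using sq_norm_nonneg[of d p "g n"] by (simp add: S_def)
  have Sge: "sqrt (real (Suc n)) \<le> S n" for n
    unfolding S_def using g(2)[of n] by (metis of_int_le_iff of_int_of_nat_eq real_sqrt_le_iff)
  have Spos: "0 < S n" for n
    using Sge[of n] by (smt (verit) of_nat_0_less_iff real_sqrt_gt_0_iff zero_less_Suc)
  \<comment> \<open>The minus sign makes this the unit vector from \<open>g n\<close> towards the
    origin, so that a gain in the character means a loss in norm.\<close>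
  define \<beta> where "\<beta> = (\<lambda>j n. - real_of_int (p j (g n)) / S n)"
  have \<beta>_sum: "(\<Sum>j<d. (\<beta> j n)\<^sup>2) = 1" for n
  proof -
    have "(\<Sum>j<d. (\<beta> j n)\<^sup>2) = (\<Sum>j<d. (real_of_int (p j (g n)))\<^sup>2) / (S n)\<^sup>2"
      by (simp add: \<beta>_def power_divide sum_divide_distrib)
    also have "\<dots> = 1"
    proof -
      have "(\<Sum>j<d. (real_of_int (p j (g n)))\<^sup>2) = (S n)\<^sup>2"
        using S2[of n] by (simp add: sq_norm_def)
      then show ?thesis using Spos[of n] by (simp only:) simp
    qed
    finally show ?thesis .
  qed
  have "Bseq (\<beta> j)" if "j < d" for j
  proof (rule BseqI'[where K = 1])
    fix n
    have "(\<beta> j n)\<^sup>2 \<le> (\<Sum>j<d. (\<beta> j n)\<^sup>2)"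
      using that by (intro member_le_sum) auto
    then show "norm (\<beta> j n) \<le> 1"
      using \<beta>_sum[of n] by (simp add: abs_square_le_1)
  qed
  then obtain r where r: "strict_mono r" "\<And>j. j < d \<Longrightarrow> convergent (\<lambda>n. \<beta> j (r n))"
    using convergent_subsequences[of d \<beta>] by blast
  define \<alpha> where "\<alpha> = (\<lambda>j. lim (\<lambda>n. \<beta> j (r n)))"
  have lim: "(\<lambda>n. \<beta> j (r n)) \<longlonglongrightarrow> \<alpha> j" if "j < d" for j
    unfolding \<alpha>_def using r(2)[OF that] by (simp add: convergent_LIMSEQ_iff)
  have "(\<lambda>n. \<Sum>j<d. (\<beta> j (r n))\<^sup>2) \<longlonglongrightarrow> (\<Sum>j<d. (\<alpha> j)\<^sup>2)"
    by (intro tendsto_sum tendsto_power lim) simp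
  then have unit: "(\<Sum>j<d. (\<alpha> j)\<^sup>2) = 1"
    using LIMSEQ_unique[of "\<lambda>_. 1 :: real"] by (simp add: \<beta>_sum)
  define e where "e = \<eta> \<alpha>"
  have e: "0 < e" using \<eta>[OF unit] by (simp add: e_def)
  let ?W = "{w. set w \<subseteq> X \<and> length w \<le> B \<alpha>}"
  have finW: "finite ?W" by (rule finite_lists_length_le) (rule X)
  define K where "K = Max (insert 1 ((\<lambda>(j, w). \<bar>real_of_int (p j (wprod G w))\<bar>) ` ({..<d} \<times> ?W)))"
  have K: "1 \<le> K" "\<And>j w. j < d \<Longrightarrow> w \<in> ?W \<Longrightarrow> \<bar>real_of_int (p j (wprod G w))\<bar> \<le> K"
  proof -
    have fin: "finite (insert 1 ((\<lambda>(j, w). \<bar>real_of_int (p j (wprod G w))\<bar>) ` ({..<d} \<times> ?W)))"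
      using finW by simp
    show "1 \<le> K" unfolding K_def by (rule Max_ge[OF fin]) simp
    show "\<bar>real_of_int (p j (wprod G w))\<bar> \<le> K" if "j < d" "w \<in> ?W" for j w
      unfolding K_def by (rule Max_ge[OF fin]) (use that in force)
  qed
  have "(\<lambda>n. \<Sum>j<d. \<bar>\<beta> j (r n) - \<alpha> j\<bar>) \<longlonglongrightarrow> (\<Sum>j<d. \<bar>\<alpha> j - \<alpha> j\<bar>)"
    by (intro tendsto_sum tendsto_rabs tendsto_diff lim) auto
  \<comment> \<open>The coordinates of \<open>v\<close> are bounded by \<open>K\<close>, so this
    accuracy keeps at least \<open>e / 2\<close> of the gain \<open>e\<close> when the limit
    direction is replaced by the actual one.\<close>
  then have "eventually (\<lambda>n. (\<Sum>j<d. \<bar>\<beta> j (r n) - \<alpha> j\<bar>) < e / (2 * K)) sequentially"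
    using e K(1) by (intro order_tendstoD(2)[where y = 0]) auto
  then obtain n0 where n0: "\<And>n. n0 \<le> n \<Longrightarrow> (\<Sum>j<d. \<bar>\<beta> j (r n) - \<alpha> j\<bar>) < e / (2 * K)"
    by (auto simp: eventually_sequentially)
  \<comment> \<open>The step by \<open>v\<close> changes the squared norm by at most
    \<open>- S * e + 3 * d * K\<^sup>2\<close>, a linear term against bounded quadratic ones; hence
    \<open>S\<close> has to exceed \<open>3 * d * K\<^sup>2 / e\<close>.\<close>
  obtain n1 :: nat where n1: "(3 * real d * K\<^sup>2 / e)\<^sup>2 < real n1" using reals_Archimedean2 by blast
  define n where "n = max (max n0 n1) (B \<alpha>)"
  let ?m = "r n"
  have rn: "n \<le> ?m" using r(1) by (rule strict_mono_imp_increasing)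
  have Sbig: "3 * real d * K\<^sup>2 < S ?m * e"
  proof -
    have "3 * real d * K\<^sup>2 / e = sqrt ((3 * real d * K\<^sup>2 / e)\<^sup>2)" using e by simp
    also have "\<dots> < sqrt (real (Suc ?m))"
      using n1 rn by (intro real_sqrt_less_mono) (simp add: n_def)
    also have "\<dots> \<le> S ?m" by (rule Sge)
    finally show ?thesis using e by (simp add: field_simps)
  qed
  have "good (Suc ?m) (g ?m) \<alpha>"
    unfolding good_def
  proof (intro conjI allI impI; (elim conjE)?)
    show "B \<alpha> \<le> Suc ?m" using rn by (simp add: n_def)
    fix u v assume uv: "set u \<subseteq> X" "set v \<subseteq> X" "length u \<le> B \<alpha>" "length v \<le> B \<alpha>"
      and v: "\<eta> \<alpha> \<le> ?c \<alpha> (wprod G v)"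
    have c: "wprod G u \<in> carrier G" "wprod G v \<in> carrier G" using uv X by auto
    define P where "P = (\<lambda>j. real_of_int (p j (g ?m)))"
    define U where "U = (\<lambda>j. real_of_int (p j (wprod G u)))"
    define V where "V = (\<lambda>j. real_of_int (p j (wprod G v)))"
    have UV: "\<bar>U j\<bar> \<le> K" "\<bar>V j\<bar> \<le> K" if "j < d" for j
      using K(2)[OF that] uv by (auto simp: U_def V_def)
    have P\<beta>: "P j = - S ?m * \<beta> j ?m" for j
      using Spos[of ?m] by (simp add: P_def \<beta>_def)
    have guv: "p j (g ?m \<otimes> wprod G u \<otimes> wprod G v) = p j (g ?m) + p j (wprod G u) + p j (wprod G v)"
      "p j (g ?m \<otimes> wprod G u) = p j (g ?m) + p j (wprod G u)" if "j < d" for j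
      using p[OF that] c g(1) by simp_all
    have "real_of_int (?N (g ?m \<otimes> wprod G u \<otimes> wprod G v)) - real_of_int (?N (g ?m \<otimes> wprod G u)) =
        (\<Sum>j<d. (P j + U j + V j)\<^sup>2) - (\<Sum>j<d. (P j + U j)\<^sup>2)"
      unfolding sq_norm_def by (simp add: guv P_def U_def V_def)
    also have "\<dots> = (\<Sum>j<d. 2 * (P j * V j) + (2 * U j * V j + (V j)\<^sup>2))"
      unfolding sum_subtractf[symmetric] by (intro sum.cong) (auto simp: power2_eq_square algebra_simps)
    also have "\<dots> = 2 * (\<Sum>j<d. P j * V j) + (\<Sum>j<d. 2 * U j * V j + (V j)\<^sup>2)"
      by (simp add: sum.distrib sum_distrib_left)
    also have "(\<Sum>j<d. 2 * U j * V j + (V j)\<^sup>2) \<le> (\<Sum>j<d. 3 * K\<^sup>2)"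
    proof (rule sum_mono)
      fix j assume "j \<in> {..<d}"
      then have j: "\<bar>U j\<bar> \<le> K" "\<bar>V j\<bar> \<le> K" using UV by auto
      have "U j * V j \<le> \<bar>U j\<bar> * \<bar>V j\<bar>" by (metis abs_ge_self abs_mult)
      also have "\<dots> \<le> K * K" using j by (intro mult_mono) auto
      finally have "U j * V j \<le> K\<^sup>2" by (simp add: power2_eq_square)
      moreover have "(V j)\<^sup>2 \<le> K\<^sup>2" using j by (metis abs_ge_zero power2_abs power_mono)
      ultimately show "2 * U j * V j + (V j)\<^sup>2 \<le> 3 * K\<^sup>2" by simp
    qed
    also have "(\<Sum>j<d. 3 * K\<^sup>2) = 3 * real d * K\<^sup>2" by simp
    also have "(\<Sum>j<d. P j * V j) \<le> - S ?m * (e / 2)"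
    proof -
      have "(\<Sum>j<d. (\<beta> j ?m - \<alpha> j) * V j) \<ge> - (\<Sum>j<d. \<bar>\<beta> j ?m - \<alpha> j\<bar> * K)"
      proof -
        have "\<bar>(\<Sum>j<d. (\<beta> j ?m - \<alpha> j) * V j)\<bar> \<le> (\<Sum>j<d. \<bar>(\<beta> j ?m - \<alpha> j) * V j\<bar>)"
          by (rule sum_abs)
        also have "\<dots> \<le> (\<Sum>j<d. \<bar>\<beta> j ?m - \<alpha> j\<bar> * K)"
          unfolding abs_mult using UV by (intro sum_mono mult_left_mono) auto
        finally show ?thesis by linarith
      qed
      moreover have "(\<Sum>j<d. \<bar>\<beta> j ?m - \<alpha> j\<bar> * K) \<le> e / 2"
      proof -
        have "(\<Sum>j<d. \<bar>\<beta> j ?m - \<alpha> j\<bar>) * K \<le> e / (2 * K) * K"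
        proof (rule mult_right_mono)
          have "n0 \<le> n" by (simp add: n_def)
          from n0[OF this] show "(\<Sum>j<d. \<bar>\<beta> j ?m - \<alpha> j\<bar>) \<le> e / (2 * K)" by simp
        qed (use K(1) in simp)
        then show ?thesis using K(1) by (simp add: sum_distrib_right)
      qed
      moreover have "(\<Sum>j<d. \<beta> j ?m * V j) = (\<Sum>j<d. (\<beta> j ?m - \<alpha> j) * V j) + ?c \<alpha> (wprod G v)"
        unfolding comb_character_def V_def[symmetric] sum.distrib[symmetric]
        by (simp add: V_def algebra_simps)
      ultimately have "e / 2 \<le> (\<Sum>j<d. \<beta> j ?m * V j)"
        using v by (simp add: e_def)
      then have "S ?m * (e / 2) \<le> S ?m * (\<Sum>j<d. \<beta> j ?m * V j)"
        using Spos[of ?m] by (intro mult_left_mono) auto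
      moreover have "(\<Sum>j<d. P j * V j) = - (S ?m * (\<Sum>j<d. \<beta> j ?m * V j))"
        unfolding P\<beta> by (simp add: sum_distrib_left sum_negf mult.assoc)
      ultimately show ?thesis by simp
    qed
    finally have "real_of_int (?N (g ?m \<otimes> wprod G u \<otimes> wprod G v)) - real_of_int (?N (g ?m \<otimes> wprod G u)) < 0"
      using Sbig by simp
    then show "?N (g ?m \<otimes> wprod G u \<otimes> wprod G v) < ?N (g ?m \<otimes> wprod G u)"
      by simp
  qed
  with bad[OF unit] show False by blast
  qed
  then show ?thesis unfolding good_def .
qed

section \<open>Transport of homotopies along vertex maps\<close>

primrec path_map :: "('a, 'm) monoid_scheme \<Rightarrow> ('a \<Rightarrow> 'a \<Rightarrow> 'b list) \<Rightarrow> 'a \<Rightarrow> 'a list \<Rightarrow> 'b list" where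
  "path_map G e g [] = []"
| "path_map G e g (x # w) = e g x @ path_map G e (g \<otimes>\<^bsub>G\<^esub> x) w"

text \<open>A map between subcomplexes of two Cayley complexes: vertices by \<open>P\<close>, edges
  by the paths \<open>e\<close>, short loops to contractible ones. \<open>P\<close> need not be
  multiplicative, so that both retractions onto sublevel sets and coset projections fit.\<close>

locale path_transport = G: group G + K: group K
  for G :: "('a, 'm) monoid_scheme" (structure) and K :: "('b, 'n) monoid_scheme" +
  fixes X :: "'a set" and Y :: "'a set" and X' Y' :: "'b set" and L L' :: nat
    and P :: "'a \<Rightarrow> 'b" and e :: "'a \<Rightarrow> 'a \<Rightarrow> 'b list"
  assumes X: "X \<subseteq> carrier G" and X': "X' \<subseteq> carrier K"
    and P: "\<And>g. g \<in> carrier G \<Longrightarrow> g \<in> Y \<Longrightarrow> P g \<in> carrier K \<and> P g \<in> Y'"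
    and edge: "\<And>g x. g \<in> carrier G \<Longrightarrow> x \<in> X \<Longrightarrow> g \<in> Y \<Longrightarrow> g \<otimes> x \<in> Y \<Longrightarrow>
      set (e g x) \<subseteq> X' \<and> P g \<otimes>\<^bsub>K\<^esub> wprod K (e g x) = P (g \<otimes> x) \<and> stays K Y' (P g) (e g x)"
    and loop: "\<And>g s. g \<in> carrier G \<Longrightarrow> set s \<subseteq> X \<Longrightarrow> length s \<le> L \<Longrightarrow> wprod G s = \<one> \<Longrightarrow> stays G Y g s \<Longrightarrow>
      homot K X' L' Y' (P g) (path_map G e g s) []"
begin

lemma path_map_append:
  "\<lbrakk>g \<in> carrier G; set u \<subseteq> carrier G\<rbrakk>
    \<Longrightarrow> path_map G e g (u @ v) = path_map G e g u @ path_map G e (g \<otimes> wprod G u) v"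
  by (induction u arbitrary: g) (auto simp: G.m_assoc)

lemma path_map:
  assumes "g \<in> carrier G" "set w \<subseteq> X" "stays G Y g w"
  shows "set (path_map G e g w) \<subseteq> X' \<and> P g \<otimes>\<^bsub>K\<^esub> wprod K (path_map G e g w) = P (g \<otimes> wprod G w) \<and>
    stays K Y' (P g) (path_map G e g w)"
  using assms
proof (induction w arbitrary: g)
  case Nil
  then show ?case using P by auto
next
  case (Cons x w)
  have x: "x \<in> carrier G" "set w \<subseteq> carrier G" "x \<in> X" using Cons.prems X by auto
  have g: "g \<in> Y" "g \<otimes> x \<in> Y" "stays G Y (g \<otimes> x) w" using Cons.prems G.stays_start by auto
  note E = edge[OF Cons.prems(1) x(3) g(1,2)]
  have IH: "set (path_map G e (g \<otimes> x) w) \<subseteq> X'"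
    "P (g \<otimes> x) \<otimes>\<^bsub>K\<^esub> wprod K (path_map G e (g \<otimes> x) w) = P (g \<otimes> x \<otimes> wprod G w)"
    "stays K Y' (P (g \<otimes> x)) (path_map G e (g \<otimes> x) w)"
    using Cons.IH[of "g \<otimes> x"] Cons.prems x g by auto
  have c: "set (e g x) \<subseteq> carrier K" "set (path_map G e (g \<otimes> x) w) \<subseteq> carrier K" "P g \<in> carrier K"
    using E IH X' P[OF Cons.prems(1) g(1)] by blast+
  then have ce: "wprod K (e g x) \<in> carrier K" "wprod K (path_map G e (g \<otimes> x) w) \<in> carrier K" by auto
  show ?case
  proof (intro conjI)
    show "set (path_map G e g (x # w)) \<subseteq> X'" using E IH by simp
    show "stays K Y' (P g) (path_map G e g (x # w))"
      using E IH c by (simp add: K.stays_append)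
    have "P g \<otimes>\<^bsub>K\<^esub> wprod K (path_map G e g (x # w)) =
        P g \<otimes>\<^bsub>K\<^esub> wprod K (e g x) \<otimes>\<^bsub>K\<^esub> wprod K (path_map G e (g \<otimes> x) w)"
      using c ce by (simp add: K.m_assoc)
    also have "\<dots> = P (g \<otimes> wprod G (x # w))"
      using E IH(2) x Cons.prems(1) by (simp add: G.m_assoc)
    finally show "P g \<otimes>\<^bsub>K\<^esub> wprod K (path_map G e g (x # w)) = P (g \<otimes> wprod G (x # w))" .
  qed
qed

lemma homot_map:
  assumes "homot G X L Y g u v" "g \<in> carrier G"
  shows "homot K X' L' Y' (P g) (path_map G e g u) (path_map G e g v)"
  using assms
proof (induction rule: homot.induct)
  case (refl w)
  then show ?case using path_map by (intro homot.refl) auto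
next
  case (delete u s v)
  have c: "set u \<subseteq> carrier G" "set s \<subseteq> carrier G" "set v \<subseteq> carrier G" using delete X by auto
  have st: "stays G Y g u" "stays G Y (g \<otimes> wprod G u) s" "stays G Y (g \<otimes> wprod G u) v"
    using delete c by (auto simp: G.stays_append)
  let ?g = "g \<otimes> wprod G u"
  have gu: "?g \<in> carrier G" using delete c by auto
  have eq: "path_map G e g (u @ s @ v) = path_map G e g u @ path_map G e ?g s @ path_map G e ?g v"
    using path_map_append[OF delete.prems c(1)] path_map_append[OF gu c(2)] delete gu by simp
  have eq': "path_map G e g (u @ v) = path_map G e g u @ [] @ path_map G e ?g v"
    using path_map_append[OF delete.prems c(1)] by simp
  have stv: "stays G Y g (u @ v)" using st c delete by (simp add: G.stays_append)
  note pu = path_map[OF delete.prems _ st(1)]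
  note puv = path_map[OF delete.prems _ stv]
  have g: "g \<in> Y" using G.stays_start[OF st(1)] .
  show ?case
    unfolding eq eq'
  proof (rule K.homot_context)
    show "homot K X' L' Y' (P g \<otimes>\<^bsub>K\<^esub> wprod K (path_map G e g u)) (path_map G e ?g s) []"
      using loop[OF gu _ delete.hyps(2,3) st(2)] pu delete.hyps(1) by auto
    show "stays K Y' (P g) (path_map G e g u @ [] @ path_map G e ?g v)"
      using puv delete.hyps(1) eq' by auto
    show "set (path_map G e g u @ path_map G e ?g v) \<subseteq> X'"
      using puv delete.hyps(1) eq' by auto
    show "P g \<in> carrier K" using P[OF delete.prems g] by blast
  qed (rule X')
qed (blast intro: homot.sym homot.trans)+

end

section \<open>Sublevel sets are simply connected\<close>

lemma (in two_factor_words) X_word_closed: "set w \<subseteq> X \<Longrightarrow> set w \<subseteq> carrier G \<and> wprod G w \<in> carrier G"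
  using X(2) wprod_closed by blast

text \<open>Either factor may be the one with the connected half space, so the locale is interpreted
  in both orders. The larger scale serves both conclusions, because being \<open>half_like\<close>
  at a scale implies it at smaller scales.\<close>

lemma (in two_factor_words) direction_data:
  assumes \<chi>: "\<And>x y. x \<in> carrier G \<Longrightarrow> y \<in> carrier G \<Longrightarrow> \<chi> (x \<otimes> y) = \<chi> x + (\<chi> y :: real)"
    and hs: "half_space_connected G X1 \<chi> \<or> half_space_connected G X2 \<chi>"
    and a: "a \<in> X1" "0 < \<chi> a" and b: "b \<in> X2" "0 < \<chi> b"
  shows "\<exists>B \<eta>. 0 < \<eta> \<and> 1 \<le> B \<and> \<eta> \<le> \<chi> a \<and>
    (\<forall>W w. half_like G X \<chi> B \<eta> W \<longrightarrow> set w \<subseteq> X \<longrightarrow> length w \<le> l \<longrightarrow> wprod G w = \<one> \<longrightarrow>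
      stays G W \<one> w \<longrightarrow> homot G X L W \<one> w []) \<and>
    (\<forall>W w. half_like G X \<chi> B \<eta> W \<longrightarrow> set w \<subseteq> X \<longrightarrow> length w \<le> l \<longrightarrow> \<one> \<in> W \<longrightarrow> wprod G w \<in> W \<longrightarrow>
      (\<exists>e. set e \<subseteq> X \<and> length e \<le> B \<and> wprod G e = wprod G w \<and> stays G W \<one> e))"
proof -
  define \<eta> where "\<eta> = min (\<chi> a) (\<chi> b)"
  define C where "C = Max ((\<lambda>x. \<bar>\<chi> x\<bar>) ` X)"
  have C: "\<bar>\<chi> x\<bar> \<le> C" if "x \<in> X" for x
    unfolding C_def using X that by (intro Max_ge) auto
  have \<eta>: "0 < \<eta>" "\<eta> \<le> \<chi> a" "\<eta> \<le> \<chi> b" using a b by (auto simp: \<eta>_def)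
  interpret F: two_factor_character G X1 X2 L \<chi> a b \<eta> C
    by unfold_locales (use \<chi> a b \<eta> C in auto)
  interpret S: two_factor_words G X2 X1 L by (rule swapped)
  interpret S: two_factor_character G X2 X1 L \<chi> b a \<eta> C
    by unfold_locales (use \<chi> a b \<eta> C in auto)
  obtain B1 where B1: "\<And>W w. half_like G X \<chi> B1 \<eta> W \<Longrightarrow> set w \<subseteq> X \<Longrightarrow> length w \<le> l \<Longrightarrow> wprod G w = \<one> \<Longrightarrow>
      stays G W \<one> w \<Longrightarrow> homot G X L W \<one> w []"
    using hs F.local_loops[of l] S.local_loops[of l] unfolding Un_commute[of X2 X1] by blast
  obtain B2 where B2: "\<And>W w. half_like G X \<chi> B2 \<eta> W \<Longrightarrow> set w \<subseteq> X \<Longrightarrow> length w \<le> l \<Longrightarrow> \<one> \<in> W \<Longrightarrow> wprod G w \<in> W \<Longrightarrow>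
      \<exists>e. set e \<subseteq> X \<and> length e \<le> B2 \<and> wprod G e = wprod G w \<and> stays G W \<one> e"
    using F.local_paths[of l] by blast
  show ?thesis
  proof (intro exI[of _ "max 1 (max B1 B2)"] exI[of _ \<eta>] conjI allI impI \<eta>)
    fix W w
    assume *: "half_like G X \<chi> (max 1 (max B1 B2)) \<eta> W" "set w \<subseteq> X" "length w \<le> l"
    then have h: "half_like G X \<chi> B1 \<eta> W" "half_like G X \<chi> B2 \<eta> W"
      by (auto intro: half_like_mono)
    show "homot G X L W \<one> w []" if "wprod G w = \<one>" "stays G W \<one> w"
      using B1[OF h(1) *(2,3) that] .
    show "\<exists>e. set e \<subseteq> X \<and> length e \<le> max 1 (max B1 B2) \<and> wprod G e = wprod G w \<and> stays G W \<one> e"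
      if ends: "\<one> \<in> W" "wprod G w \<in> W"
    proof -
      obtain e where "set e \<subseteq> X" "length e \<le> B2" "wprod G e = wprod G w" "stays G W \<one> e"
        using B2[OF h(2) *(2,3) ends] by blast
      then show ?thesis by (intro exI[of _ e]) auto
    qed
  qed simp
qed

text \<open>Every unit vector \<alpha> stands for a direction. For each of them
  \<open>directions\<close> supplies the connected half space in one factor and letters that climb
  in both.\<close>

locale lattice_words = two_factor_words G X1 X2 L for G (structure) and X1 X2 L +
  fixes d :: nat and p :: "nat \<Rightarrow> 'a \<Rightarrow> int"
  assumes p: "\<And>j x y. j < d \<Longrightarrow> x \<in> carrier G \<Longrightarrow> y \<in> carrier G \<Longrightarrow> p j (x \<otimes> y) = p j x + p j y"
    and directions: "\<And>\<alpha>. (\<Sum>j<d. (\<alpha> j)\<^sup>2) = 1 \<Longrightarrow>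
      (half_space_connected G X1 (comb_character d p \<alpha>) \<or> half_space_connected G X2 (comb_character d p \<alpha>)) \<and>
      (\<exists>a\<in>X1. 0 < comb_character d p \<alpha> a) \<and> (\<exists>b\<in>X2. 0 < comb_character d p \<alpha> b)"
    and gen: "\<And>g. g \<in> carrier G \<Longrightarrow> \<exists>w. set w \<subseteq> X1 \<union> X2 \<and> wprod G w = g"
begin

abbreviation N :: "'a \<Rightarrow> int" where "N \<equiv> sq_norm d p"

definition sublevel :: "int \<Rightarrow> 'a set" where
  "sublevel r = {g \<in> carrier G. N g \<le> r}"

lemma sublevel_mono: "r \<le> r' \<Longrightarrow> sublevel r \<subseteq> sublevel r'"
  by (auto simp: sublevel_def)

lemma comb_additive:
  "x \<in> carrier G \<Longrightarrow> y \<in> carrier G \<Longrightarrow>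
    comb_character d p \<alpha> (x \<otimes> y) = comb_character d p \<alpha> x + comb_character d p \<alpha> y"
  unfolding comb_character_def sum.distrib[symmetric]
  by (intro sum.cong) (auto simp: p algebra_simps)

text \<open>By \<open>(x + y)\<^sup>2 \<le> 2 * x\<^sup>2 + 2 * y\<^sup>2\<close> in each
  coordinate.\<close>

lemma norm_near:
  "\<exists>r. \<forall>g f. g \<in> carrier G \<and> N g \<le> R \<and> set f \<subseteq> X \<and> length f \<le> D \<longrightarrow> N (g \<otimes> wprod G f) \<le> r"
proof -
  let ?W = "{w. set w \<subseteq> X \<and> length w \<le> D}"
  have finW: "finite ?W" by (rule finite_lists_length_le) (rule X)
  define M where "M = Max ((\<lambda>w. N (wprod G w)) ` ?W)"
  have M: "N (wprod G f) \<le> M" if "f \<in> ?W" for f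
    unfolding M_def using finW that by (intro Max_ge) auto
  have "N (g \<otimes> wprod G f) \<le> 2 * R + 2 * M" if g: "g \<in> carrier G" "N g \<le> R" and f: "f \<in> ?W" for g f
  proof -
    have fc: "wprod G f \<in> carrier G" using f X_word_closed by auto
    have "N (g \<otimes> wprod G f) \<le> (\<Sum>j<d. 2 * (p j g)\<^sup>2 + 2 * (p j (wprod G f))\<^sup>2)"
      unfolding sq_norm_def
    proof (rule sum_mono)
      fix j assume "j \<in> {..<d}"
      then have "p j (g \<otimes> wprod G f) = p j g + p j (wprod G f)" using p g fc by auto
      moreover have "0 \<le> (p j g - p j (wprod G f))\<^sup>2" by simp
      ultimately show "(p j (g \<otimes> wprod G f))\<^sup>2 \<le> 2 * (p j g)\<^sup>2 + 2 * (p j (wprod G f))\<^sup>2"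
        by (simp add: power2_eq_square algebra_simps)
    qed
    also have "\<dots> = 2 * N g + 2 * N (wprod G f)"
      by (simp add: sq_norm_def sum.distrib sum_distrib_left)
    finally show ?thesis using g M[OF f] by simp
  qed
  then show ?thesis by (intro exI[of _ "2 * R + 2 * M"]) auto
qed

text \<open>\<open>half_space_directions\<close> compares the norms of two nearby points and never a
  norm with the level, so one \<open>R\<close> serves all levels \<open>r\<close>. Seen from a
  distant \<open>g\<close>, every sublevel set is \<open>half_like\<close> for a common \<alpha>,
  and the lemmas on half-like regions apply.\<close>

lemma local_data:
  "\<exists>R::nat.
    (\<forall>g r w. g \<in> carrier G \<longrightarrow> int R \<le> N g \<longrightarrow> set w \<subseteq> X \<longrightarrow> length w \<le> l \<longrightarrow> wprod G w = \<one> \<longrightarrow>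
      stays G (sublevel r) g w \<longrightarrow> homot G X L (sublevel r) g w []) \<and>
    (\<forall>g r w. g \<in> carrier G \<longrightarrow> int R \<le> N g \<longrightarrow> set w \<subseteq> X \<longrightarrow> length w \<le> l \<longrightarrow> g \<in> sublevel r \<longrightarrow>
      g \<otimes> wprod G w \<in> sublevel r \<longrightarrow>
      (\<exists>e. set e \<subseteq> X \<and> length e \<le> R \<and> wprod G e = wprod G w \<and> stays G (sublevel r) g e)) \<and>
    (\<forall>g\<in>carrier G. int R \<le> N g \<longrightarrow> (\<exists>x\<in>X. N (g \<otimes> x) < N g))"
proof -
  let ?c = "comb_character d p"
  define data where "data = (\<lambda>\<alpha> B \<eta>. 0 < \<eta> \<and> 1 \<le> B \<and> (\<exists>a\<in>X. \<eta> \<le> ?c \<alpha> a) \<and>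
    (\<forall>W w. half_like G X (?c \<alpha>) B \<eta> W \<longrightarrow> set w \<subseteq> X \<longrightarrow> length w \<le> l \<longrightarrow> wprod G w = \<one> \<longrightarrow>
      stays G W \<one> w \<longrightarrow> homot G X L W \<one> w []) \<and>
    (\<forall>W w. half_like G X (?c \<alpha>) B \<eta> W \<longrightarrow> set w \<subseteq> X \<longrightarrow> length w \<le> l \<longrightarrow> \<one> \<in> W \<longrightarrow> wprod G w \<in> W \<longrightarrow>
      (\<exists>e. set e \<subseteq> X \<and> length e \<le> B \<and> wprod G e = wprod G w \<and> stays G W \<one> e)))"
  \<comment> \<open>Scale and margin become functions of \<alpha> before the compactness argument,
    which chooses \<open>R\<close> in dependence on them.\<close>
  have ex: "\<exists>B \<eta>. (\<Sum>j<d. (\<alpha> j)\<^sup>2) = 1 \<longrightarrow> data \<alpha> B \<eta>" for \<alpha>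
  proof (cases "(\<Sum>j<d. (\<alpha> j)\<^sup>2) = 1")
    case True
    then obtain a b where ab: "a \<in> X1" "0 < ?c \<alpha> a" "b \<in> X2" "0 < ?c \<alpha> b"
      and hs: "half_space_connected G X1 (?c \<alpha>) \<or> half_space_connected G X2 (?c \<alpha>)"
      using directions by blast
    have "a \<in> X" using ab by simp
    then show ?thesis
      using direction_data[OF comb_additive hs ab, of l] unfolding data_def by blast
  qed auto
  from ex have "\<forall>\<alpha>. \<exists>B. \<exists>\<eta>. (\<Sum>j<d. (\<alpha> j)\<^sup>2) = 1 \<longrightarrow> data \<alpha> B \<eta>" ..
  from choice[OF this] obtain B where "\<forall>\<alpha>. \<exists>\<eta>. (\<Sum>j<d. (\<alpha> j)\<^sup>2) = 1 \<longrightarrow> data \<alpha> (B \<alpha>) \<eta>" ..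
  from choice[OF this] obtain \<eta> where data: "\<And>\<alpha>. (\<Sum>j<d. (\<alpha> j)\<^sup>2) = 1 \<Longrightarrow> data \<alpha> (B \<alpha>) (\<eta> \<alpha>)" by blast
  have \<eta>: "0 < \<eta> \<alpha>" if "(\<Sum>j<d. (\<alpha> j)\<^sup>2) = 1" for \<alpha>
    using data[OF that] by (simp add: data_def)
  obtain R :: nat where R: "\<And>g. g \<in> carrier G \<Longrightarrow> int R \<le> N g \<Longrightarrow> \<exists>\<alpha>. (\<Sum>j<d. (\<alpha> j)\<^sup>2) = 1 \<and> B \<alpha> \<le> R \<and>
    (\<forall>u v. set u \<subseteq> X \<and> set v \<subseteq> X \<and> length u \<le> B \<alpha> \<and> length v \<le> B \<alpha> \<and>
      \<eta> \<alpha> \<le> ?c \<alpha> (wprod G v) \<longrightarrow> N (g \<otimes> wprod G u \<otimes> wprod G v) < N (g \<otimes> wprod G u))"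
    using half_space_directions[of d p X \<eta> B, OF p X(1,2) \<eta>] by blast
  have near: "\<exists>\<alpha>. data \<alpha> (B \<alpha>) (\<eta> \<alpha>) \<and> B \<alpha> \<le> R \<and> (\<exists>x\<in>X. N (g \<otimes> x) < N g) \<and>
      (\<forall>r. half_like G X (?c \<alpha>) (B \<alpha>) (\<eta> \<alpha>) {y \<in> carrier G. g \<otimes> y \<in> sublevel r})"
    if g: "g \<in> carrier G" "int R \<le> N g" for g
  proof -
    obtain \<alpha> where \<alpha>: "(\<Sum>j<d. (\<alpha> j)\<^sup>2) = 1" "B \<alpha> \<le> R"
      and dec: "\<And>u v. set u \<subseteq> X \<Longrightarrow> set v \<subseteq> X \<Longrightarrow> length u \<le> B \<alpha> \<Longrightarrow> length v \<le> B \<alpha> \<Longrightarrow>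
        \<eta> \<alpha> \<le> ?c \<alpha> (wprod G v) \<Longrightarrow> N (g \<otimes> wprod G u \<otimes> wprod G v) < N (g \<otimes> wprod G u)"
      using R[OF g] by blast
    note D = data[OF \<alpha>(1)]
    from D obtain a where a: "a \<in> X" "\<eta> \<alpha> \<le> ?c \<alpha> a" "1 \<le> B \<alpha>" by (auto simp: data_def)
    have ac: "a \<in> carrier G" using a X by auto
    have "N (g \<otimes> a) < N g"
      using dec[of "[]" "[a]"] a ac g by simp
    moreover have "half_like G X (?c \<alpha>) (B \<alpha>) (\<eta> \<alpha>) {y \<in> carrier G. g \<otimes> y \<in> sublevel r}" for r
      unfolding half_like_def
    proof (intro allI impI, elim conjE)
      fix u v assume uv: "set u \<subseteq> X" "set v \<subseteq> X" "length u \<le> B \<alpha>" "length v \<le> B \<alpha>"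
        "wprod G u \<in> {y \<in> carrier G. g \<otimes> y \<in> sublevel r}" "\<eta> \<alpha> \<le> ?c \<alpha> (wprod G v)"
      have "set v \<subseteq> carrier G" using uv(2) X(2) by blast
      then have "wprod G v \<in> carrier G" by auto
      then show "wprod G u \<otimes> wprod G v \<in> {y \<in> carrier G. g \<otimes> y \<in> sublevel r}"
        using dec[OF uv(1,2,3,4,6)] uv(5) g by (auto simp: sublevel_def m_assoc)
    qed
    ultimately show ?thesis using D \<alpha> a by blast
  qed
  show ?thesis
  proof (intro exI[of _ R] conjI allI impI ballI)
    fix g r w
    assume g: "g \<in> carrier G" "int R \<le> N g" and w: "set w \<subseteq> X" "length w \<le> l"
    obtain \<alpha> where D: "data \<alpha> (B \<alpha>) (\<eta> \<alpha>)" "B \<alpha> \<le> R"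
      and hl: "half_like G X (?c \<alpha>) (B \<alpha>) (\<eta> \<alpha>) {y \<in> carrier G. g \<otimes> y \<in> sublevel r}"
      using near[OF g] by blast
    have wc: "set w \<subseteq> carrier G" using w X by blast
    show "homot G X L (sublevel r) g w []" if "wprod G w = \<one>" "stays G (sublevel r) g w"
    proof -
      have "stays G (sublevel r) (g \<otimes> \<one>) w" using that g by simp
      then have "stays G {y \<in> carrier G. g \<otimes> y \<in> sublevel r} \<one> w"
        using stays_translate[OF g(1) one_closed wc] by simp
      then have "homot G X L {y \<in> carrier G. g \<otimes> y \<in> sublevel r} \<one> w []"
        using D(1) hl w that unfolding data_def by blast
      then have "homot G X L (sublevel r) (g \<otimes> \<one>) w []"
        using g X by (intro homot_translate) auto
      then show ?thesis using g by simp
    qed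
    show "\<exists>e. set e \<subseteq> X \<and> length e \<le> R \<and> wprod G e = wprod G w \<and> stays G (sublevel r) g e"
      if "g \<in> sublevel r" "g \<otimes> wprod G w \<in> sublevel r"
    proof -
      have "\<one> \<in> {y \<in> carrier G. g \<otimes> y \<in> sublevel r}" "wprod G w \<in> {y \<in> carrier G. g \<otimes> y \<in> sublevel r}"
        using that g wc by auto
      then obtain e where e: "set e \<subseteq> X" "length e \<le> B \<alpha>" "wprod G e = wprod G w"
          "stays G {y \<in> carrier G. g \<otimes> y \<in> sublevel r} \<one> e"
        using D(1) hl w unfolding data_def by blast
      have ec: "set e \<subseteq> carrier G" using e X by blast
      have "stays G (sublevel r) (g \<otimes> \<one>) e"
        using stays_translate[OF g(1) one_closed ec] e by simp
      then have "stays G (sublevel r) g e" using g by simp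
      then show ?thesis using e D by (intro exI[of _ e]) auto
    qed
  qed (use near in blast)
qed

text \<open>Far out \<open>local_data\<close> applies. For base points of norm below
  \<open>R\<close> the ball of radius \<open>D\<close> around them lies in
  \<open>sublevel r0\<close>, and there loops contract as in the whole group.\<close>

lemma uniform_loops:
  "\<exists>r0. \<forall>r\<ge>r0. \<forall>g w. g \<in> carrier G \<longrightarrow> set w \<subseteq> X \<longrightarrow> length w \<le> l \<longrightarrow> wprod G w = \<one> \<longrightarrow>
    stays G (sublevel r) g w \<longrightarrow> homot G X L (sublevel r) g w []"
proof -
  obtain R :: nat where R: "\<forall>g r w. g \<in> carrier G \<longrightarrow> int R \<le> N g \<longrightarrow> set w \<subseteq> X \<longrightarrow> length w \<le> l \<longrightarrow>
      wprod G w = \<one> \<longrightarrow> stays G (sublevel r) g w \<longrightarrow> homot G X L (sublevel r) g w []"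
    using local_data[of l] by (elim exE conjE, intro that)
  obtain D where D: "\<And>w. set w \<subseteq> X \<Longrightarrow> length w \<le> l \<Longrightarrow> wprod G w = \<one> \<Longrightarrow> homot G X L (word_ball G X D) \<one> w []"
    using homot_bounded_uniform[OF X(1,2) full_null, of l] by blast
  obtain r0 where r0: "\<And>g f. g \<in> carrier G \<Longrightarrow> N g \<le> int R \<Longrightarrow> set f \<subseteq> X \<Longrightarrow> length f \<le> D \<Longrightarrow> N (g \<otimes> wprod G f) \<le> r0"
    using norm_near[of "int R" D] by blast
  show ?thesis
  proof (intro exI[of _ r0] allI impI)
    fix r g w
    assume r: "r0 \<le> r" and g: "g \<in> carrier G" and w: "set w \<subseteq> X" "length w \<le> l" "wprod G w = \<one>"
      and st: "stays G (sublevel r) g w"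
    show "homot G X L (sublevel r) g w []"
    proof (cases "int R \<le> N g")
      case True
      then show ?thesis using R g w st by blast
    next
      case False
      have "word_ball G X D \<subseteq> {y \<in> carrier G. g \<otimes> y \<in> sublevel r}"
      proof
        fix y assume "y \<in> word_ball G X D"
        then obtain f where f: "set f \<subseteq> X" "length f \<le> D" "y = wprod G f" by (auto simp: word_ball_def)
        have "set f \<subseteq> carrier G" using f X by blast
        then have "wprod G f \<in> carrier G" by auto
        then show "y \<in> {y \<in> carrier G. g \<otimes> y \<in> sublevel r}"
          using r0[OF g _ f(1,2)] False f r g by (auto simp: sublevel_def)
      qed
      then have "homot G X L {y \<in> carrier G. g \<otimes> y \<in> sublevel r} \<one> w []"
        using D[OF w] by (auto intro: homot_mono)
      then have "homot G X L (sublevel r) (g \<otimes> \<one>) w []"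
        using g X by (intro homot_translate) auto
      then show ?thesis using g by simp
    qed
  qed
qed

text \<open>Near the origin the given word itself stays in \<open>sublevel r0\<close> and serves as
  the path; this is why \<open>l\<close> enters the bound \<open>m\<close>.\<close>

lemma uniform_paths:
  "\<exists>r0 m. \<forall>r\<ge>r0. \<forall>g w. g \<in> carrier G \<longrightarrow> set w \<subseteq> X \<longrightarrow> length w \<le> l \<longrightarrow> g \<in> sublevel r \<longrightarrow>
    g \<otimes> wprod G w \<in> sublevel r \<longrightarrow>
    (\<exists>e. set e \<subseteq> X \<and> length e \<le> m \<and> wprod G e = wprod G w \<and> stays G (sublevel r) g e)"
proof -
  obtain R :: nat where R: "\<forall>g r w. g \<in> carrier G \<longrightarrow> int R \<le> N g \<longrightarrow> set w \<subseteq> X \<longrightarrow> length w \<le> l \<longrightarrow>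
      g \<in> sublevel r \<longrightarrow> g \<otimes> wprod G w \<in> sublevel r \<longrightarrow>
      (\<exists>e. set e \<subseteq> X \<and> length e \<le> R \<and> wprod G e = wprod G w \<and> stays G (sublevel r) g e)"
    using local_data[of l] by (elim exE conjE, intro that)
  obtain r0 where r0: "\<And>g f. g \<in> carrier G \<Longrightarrow> N g \<le> int R \<Longrightarrow> set f \<subseteq> X \<Longrightarrow> length f \<le> l \<Longrightarrow> N (g \<otimes> wprod G f) \<le> r0"
    using norm_near[of "int R" l] by blast
  show ?thesis
  proof (intro exI[of _ r0] exI[of _ "max R l"] allI impI)
    fix r g w
    assume r: "r0 \<le> r" and g: "g \<in> carrier G" and w: "set w \<subseteq> X" "length w \<le> l"
      and ends: "g \<in> sublevel r" "g \<otimes> wprod G w \<in> sublevel r"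
    show "\<exists>e. set e \<subseteq> X \<and> length e \<le> max R l \<and> wprod G e = wprod G w \<and> stays G (sublevel r) g e"
    proof (cases "int R \<le> N g")
      case True
      then obtain e where "set e \<subseteq> X" "length e \<le> R" "wprod G e = wprod G w" "stays G (sublevel r) g e"
        using R[rule_format, OF g True w ends] by blast
      then show ?thesis by (intro exI[of _ e]) auto
    next
      case False
      have wc: "set w \<subseteq> carrier G" using w X by blast
      have "stays G (sublevel r) g w"
        unfolding stays_iff[OF g wc]
      proof (intro allI impI)
        fix u v assume uv: "w = u @ v"
        have "N (g \<otimes> wprod G u) \<le> r0" using False uv w by (intro r0 g) auto
        moreover have "set u \<subseteq> carrier G" using uv wc by simp
        ultimately show "g \<otimes> wprod G u \<in> sublevel r" using r g by (auto simp: sublevel_def)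
      qed
      then show ?thesis using w by (intro exI[of _ w]) auto
    qed
  qed
qed

lemma uniform_descent:
  "\<exists>r0. \<forall>g\<in>carrier G. r0 < N g \<longrightarrow> (\<exists>x\<in>X. N (g \<otimes> x) < N g)"
proof -
  obtain R :: nat where "\<forall>g\<in>carrier G. int R \<le> N g \<longrightarrow> (\<exists>x\<in>X. N (g \<otimes> x) < N g)"
    using local_data[of 0] by (elim exE conjE, intro that)
  then show ?thesis by (intro exI[of _ "int R"]) auto
qed

end

context lattice_words
begin

text \<open>Above the level \<open>r0\<close> every vertex has a neighbour closer to the origin; moving all vertices of
  \<open>sublevel (r + 1)\<close> outside \<open>sublevel r\<close> there retracts homotopies into \<open>sublevel r\<close>.\<close>

lemma push_down:
  "\<exists>r0\<ge>0. \<forall>r\<ge>r0.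
    (\<forall>g w. g \<in> sublevel r \<longrightarrow> set w \<subseteq> X \<longrightarrow> stays G (sublevel r) g w \<longrightarrow>
      homot G X L (sublevel (r + 1)) g w [] \<longrightarrow> homot G X L (sublevel r) g w []) \<and>
    (\<forall>g w. g \<in> sublevel r \<longrightarrow> set w \<subseteq> X \<longrightarrow> stays G (sublevel (r + 1)) g w \<longrightarrow> g \<otimes> wprod G w \<in> sublevel r \<longrightarrow>
      (\<exists>v. set v \<subseteq> X \<and> wprod G v = wprod G w \<and> stays G (sublevel r) g v))"
proof -
  \<comment> \<open>Length 3: back up from the moved start, across the edge, and down at the other
    end, at most one letter each.\<close>
  obtain r1 m where paths: "\<forall>r\<ge>r1. \<forall>g w. g \<in> carrier G \<longrightarrow> set w \<subseteq> X \<longrightarrow> length w \<le> 3 \<longrightarrow> g \<in> sublevel r \<longrightarrow>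
      g \<otimes> wprod G w \<in> sublevel r \<longrightarrow>
      (\<exists>e. set e \<subseteq> X \<and> length e \<le> m \<and> wprod G e = wprod G w \<and> stays G (sublevel r) g e)"
    using uniform_paths[of 3] by (elim exE, intro that)
  \<comment> \<open>At least one, because edges inside \<open>sublevel r\<close> keep their single
    letter.\<close>
  define m' where "m' = max 1 m"
  obtain r2 where loops: "\<forall>r\<ge>r2. \<forall>g w. g \<in> carrier G \<longrightarrow> set w \<subseteq> X \<longrightarrow> length w \<le> L * m' \<longrightarrow> wprod G w = \<one> \<longrightarrow>
      stays G (sublevel r) g w \<longrightarrow> homot G X L (sublevel r) g w []"
    using uniform_loops[of "L * m'"] by (elim exE, intro that)
  obtain r3 where descent: "\<forall>g\<in>carrier G. r3 < N g \<longrightarrow> (\<exists>x\<in>X. N (g \<otimes> x) < N g)"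
    using uniform_descent by (elim exE, intro that)
  define r0 where "r0 = max 0 (max r1 (max r2 r3))"
  show ?thesis
  proof (intro exI[of _ r0] conjI allI impI)
    show "0 \<le> r0" by (simp add: r0_def)
    fix r assume "r0 \<le> r"
    then have r: "r1 \<le> r" "r2 \<le> r" "r3 \<le> r" by (auto simp: r0_def)
    have "\<exists>dn. set dn \<subseteq> X \<and> length dn \<le> 1 \<and> g \<otimes> wprod G dn \<in> sublevel r \<and> (g \<in> sublevel r \<longrightarrow> dn = [])"
      if "g \<in> sublevel (r + 1)" for g
    proof (cases "g \<in> sublevel r")
      case True
      then show ?thesis by (intro exI[of _ "[]"]) (auto simp: sublevel_def)
    next
      case False
      then have g: "g \<in> carrier G" "N g = r + 1" using that by (auto simp: sublevel_def)
      then obtain x where x: "x \<in> X" "N (g \<otimes> x) < N g" using descent r by force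
      then have "x \<in> carrier G" using X by auto
      then show ?thesis using x g False by (intro exI[of _ "[x]"]) (auto simp: sublevel_def)
    qed
    then have "\<forall>g\<in>sublevel (r + 1). \<exists>dn. set dn \<subseteq> X \<and> length dn \<le> 1 \<and> g \<otimes> wprod G dn \<in> sublevel r \<and>
        (g \<in> sublevel r \<longrightarrow> dn = [])" ..
    from bchoice[OF this] obtain dn where dn: "\<forall>g\<in>sublevel (r + 1). set (dn g) \<subseteq> X \<and> length (dn g) \<le> 1 \<and>
        g \<otimes> wprod G (dn g) \<in> sublevel r \<and> (g \<in> sublevel r \<longrightarrow> dn g = [])" ..
    define P where "P = (\<lambda>g. g \<otimes> wprod G (dn g))"
    have dnc: "set (dn g) \<subseteq> X" "set (dn g) \<subseteq> carrier G" "wprod G (dn g) \<in> carrier G" "length (dn g) \<le> 1"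
      if "g \<in> sublevel (r + 1)" for g
      using dn that X_word_closed[of "dn g"] by auto
    have PY: "P g \<in> carrier G \<and> P g \<in> sublevel r" if "g \<in> sublevel (r + 1)" for g
      using dn that by (auto simp: P_def sublevel_def)
    have P_id: "P g = g" if "g \<in> sublevel r" for g
    proof -
      have "g \<in> sublevel (r + 1)" "g \<in> carrier G" using that by (auto simp: sublevel_def)
      then show ?thesis using dn that by (auto simp: P_def)
    qed
    have "\<exists>e. set e \<subseteq> X \<and> length e \<le> m' \<and> P g \<otimes> wprod G e = P (g \<otimes> x) \<and> stays G (sublevel r) (P g) e \<and>
        (g \<in> sublevel r \<and> g \<otimes> x \<in> sublevel r \<longrightarrow> e = [x])"
      if g: "g \<in> sublevel (r + 1)" "g \<otimes> x \<in> sublevel (r + 1)" and x: "x \<in> X" for g x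
    proof (cases "g \<in> sublevel r \<and> g \<otimes> x \<in> sublevel r")
      case True
      moreover have "x \<in> carrier G" using x X by auto
      ultimately show ?thesis using x P_id by (intro exI[of _ "[x]"]) (auto simp: m'_def)
    next
      case False
      let ?w = "winv G (dn g) @ [x] @ dn (g \<otimes> x)"
      have gc: "g \<in> carrier G" "x \<in> carrier G" using g x X by (auto simp: sublevel_def)
      note d1 = dnc[OF g(1)] and d2 = dnc[OF g(2)]
      have w: "set ?w \<subseteq> X" "length ?w \<le> 3" using d1 d2 x set_winv_subset[OF d1(1) X(3)] by auto
      have wi: "set (winv G (dn g)) \<subseteq> carrier G" using d1 by auto
      have Pw: "P g \<otimes> wprod G ?w = P (g \<otimes> x)"
      proof -
        have "P g \<otimes> inv (wprod G (dn g)) = g"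
          using gc d1 by (simp add: P_def m_assoc)
        moreover have "P g \<otimes> wprod G ?w = P g \<otimes> inv (wprod G (dn g)) \<otimes> (x \<otimes> wprod G (dn (g \<otimes> x)))"
          using gc d1 d2 wi PY[OF g(1)] by (simp add: m_assoc)
        ultimately show ?thesis using gc d2 by (simp add: P_def m_assoc)
      qed
      have "P g \<otimes> wprod G ?w \<in> sublevel r" unfolding Pw using PY[OF g(2)] by blast
      then obtain e where e: "set e \<subseteq> X" "length e \<le> m" "wprod G e = wprod G ?w" "stays G (sublevel r) (P g) e"
        using paths[rule_format, OF r(1) _ w, of "P g"] PY[OF g(1)] by blast
      then show ?thesis
        using Pw False by (intro exI[of _ e]) (auto simp: m'_def)
    qed
    then have "\<forall>q. \<exists>e. fst q \<in> sublevel (r + 1) \<and> fst q \<otimes> snd q \<in> sublevel (r + 1) \<and> snd q \<in> X \<longrightarrow>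
        set e \<subseteq> X \<and> length e \<le> m' \<and> P (fst q) \<otimes> wprod G e = P (fst q \<otimes> snd q) \<and>
        stays G (sublevel r) (P (fst q)) e \<and>
        (fst q \<in> sublevel r \<and> fst q \<otimes> snd q \<in> sublevel r \<longrightarrow> e = [snd q])"
      by blast
    from choice[OF this] obtain e0 where e0: "\<forall>q. fst q \<in> sublevel (r + 1) \<and> fst q \<otimes> snd q \<in> sublevel (r + 1) \<and> snd q \<in> X \<longrightarrow>
        set (e0 q) \<subseteq> X \<and> length (e0 q) \<le> m' \<and> P (fst q) \<otimes> wprod G (e0 q) = P (fst q \<otimes> snd q) \<and>
        stays G (sublevel r) (P (fst q)) (e0 q) \<and>
        (fst q \<in> sublevel r \<and> fst q \<otimes> snd q \<in> sublevel r \<longrightarrow> e0 q = [snd q])" ..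
    define e where "e = (\<lambda>g x. e0 (g, x))"
    have e: "set (e g x) \<subseteq> X \<and> length (e g x) \<le> m' \<and> P g \<otimes> wprod G (e g x) = P (g \<otimes> x) \<and>
        stays G (sublevel r) (P g) (e g x) \<and> (g \<in> sublevel r \<and> g \<otimes> x \<in> sublevel r \<longrightarrow> e g x = [x])"
      if "g \<in> sublevel (r + 1)" "g \<otimes> x \<in> sublevel (r + 1)" "x \<in> X" for g x
      using e0[rule_format, of "(g, x)"] that by (simp add: e_def)
    have edge_path: "set (path_map G e g s) \<subseteq> X \<and> P g \<otimes> wprod G (path_map G e g s) = P (g \<otimes> wprod G s) \<and>
        stays G (sublevel r) (P g) (path_map G e g s) \<and> length (path_map G e g s) \<le> length s * m'"
      if "g \<in> carrier G" "set s \<subseteq> X" "stays G (sublevel (r + 1)) g s" for g s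
      using that
    proof (induction s arbitrary: g)
      case Nil
      then show ?case using PY by auto
    next
      case (Cons x s)
      have x: "x \<in> carrier G" "x \<in> X" "set s \<subseteq> X" using Cons.prems X by auto
      have st: "g \<in> sublevel (r + 1)" "g \<otimes> x \<in> sublevel (r + 1)" "stays G (sublevel (r + 1)) (g \<otimes> x) s"
        using Cons.prems stays_start by auto
      note E = e[OF st(1,2) x(2)]
      have IH: "set (path_map G e (g \<otimes> x) s) \<subseteq> X"
        "P (g \<otimes> x) \<otimes> wprod G (path_map G e (g \<otimes> x) s) = P (g \<otimes> x \<otimes> wprod G s)"
        "stays G (sublevel r) (P (g \<otimes> x)) (path_map G e (g \<otimes> x) s)"
        "length (path_map G e (g \<otimes> x) s) \<le> length s * m'"
        using Cons.IH[of "g \<otimes> x"] Cons.prems x st by auto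
      have c: "set (e g x) \<subseteq> carrier G" "wprod G (e g x) \<in> carrier G"
          "set (path_map G e (g \<otimes> x) s) \<subseteq> carrier G" "wprod G (path_map G e (g \<otimes> x) s) \<in> carrier G"
        using X_word_closed E IH(1) by blast+
      have Pg: "P g \<in> carrier G" using PY[OF st(1)] by blast
      have "P g \<otimes> wprod G (path_map G e g (x # s)) =
          P g \<otimes> wprod G (e g x) \<otimes> wprod G (path_map G e (g \<otimes> x) s)"
        using c Pg by (simp add: m_assoc)
      also have "\<dots> = P (g \<otimes> wprod G (x # s))"
        using E IH(2) x X_word_closed[OF x(3)] Cons.prems(1) by (simp add: m_assoc)
      finally show ?case
        using E IH c Pg by (simp add: stays_append)
    qed
    interpret T: path_transport G G X "sublevel (r + 1)" X "sublevel r" L L P e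
    proof unfold_locales
      show "X \<subseteq> carrier G" by (rule X)
      show "P g \<in> carrier G \<and> P g \<in> sublevel r" if "g \<in> sublevel (r + 1)" for g
        using PY[OF that] .
      show "set (e g x) \<subseteq> X \<and> P g \<otimes> wprod G (e g x) = P (g \<otimes> x) \<and> stays G (sublevel r) (P g) (e g x)"
        if "g \<in> carrier G" "x \<in> X" "g \<in> sublevel (r + 1)" "g \<otimes> x \<in> sublevel (r + 1)" for g x
        using e that by blast
      show "homot G X L (sublevel r) (P g) (path_map G e g s) []"
        if g: "g \<in> carrier G" and s: "set s \<subseteq> X" "length s \<le> L" "wprod G s = \<one>" "stays G (sublevel (r + 1)) g s" for g s
      proof -
        note ep = edge_path[OF g s(1,4)]
        have "g \<in> sublevel (r + 1)" using stays_start[OF s(4)] .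
        then have Pg: "P g \<in> carrier G" using PY by blast
        have "length s * m' \<le> L * m'" using s by simp
        then have len: "length (path_map G e g s) \<le> L * m'" using ep by linarith
        have "wprod G (path_map G e g s) \<in> carrier G" using ep X_word_closed by blast
        then have "wprod G (path_map G e g s) = \<one>"
          using ep s g Pg by simp
        then show ?thesis
          using loops[rule_format, OF r(2) Pg _ len] ep by blast
      qed
    qed
    \<comment> \<open>The transport is a retraction: words inside \<open>sublevel r\<close> are
      unchanged, so a null homotopy of such a word is mapped to a null homotopy of the same
      word.\<close>
    have id: "path_map G e g w = w" if "g \<in> carrier G" "set w \<subseteq> X" "stays G (sublevel r) g w" for g w
      using that
    proof (induction w arbitrary: g)
      case (Cons x w)
      have st: "g \<in> sublevel r" "g \<otimes> x \<in> sublevel r" using Cons.prems stays_start by auto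
      moreover from this have "g \<in> sublevel (r + 1)" "g \<otimes> x \<in> sublevel (r + 1)" by (auto simp: sublevel_def)
      ultimately have "e g x = [x]" using e Cons.prems by auto
      then show ?case using Cons X by auto
    qed simp
    show "homot G X L (sublevel r) g w []"
      if "g \<in> sublevel r" "set w \<subseteq> X" "stays G (sublevel r) g w" "homot G X L (sublevel (r + 1)) g w []" for g w
    proof -
      have gc: "g \<in> carrier G" using that(1) by (simp add: sublevel_def)
      show ?thesis
        using T.homot_map[OF that(4) gc] id[OF gc that(2,3)] P_id[OF that(1)] by simp
    qed
    show "\<exists>v. set v \<subseteq> X \<and> wprod G v = wprod G w \<and> stays G (sublevel r) g v"
      if "g \<in> sublevel r" "set w \<subseteq> X" "stays G (sublevel (r + 1)) g w" "g \<otimes> wprod G w \<in> sublevel r" for g w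
    proof -
      have gc: "g \<in> carrier G" using that(1) by (simp add: sublevel_def)
      have ep: "set (path_map G e g w) \<subseteq> X" "g \<otimes> wprod G (path_map G e g w) = g \<otimes> wprod G w"
        "stays G (sublevel r) g (path_map G e g w)"
        using edge_path[OF gc that(2,3)] P_id[OF that(1)] P_id[OF that(4)] by auto
      then have "wprod G (path_map G e g w) = wprod G w"
        using gc X_word_closed[OF ep(1)] X_word_closed[OF that(2)] by simp
      with ep show ?thesis by blast
    qed
  qed
qed

lemma one_sublevel: "0 \<le> r \<Longrightarrow> \<one> \<in> sublevel r"
proof -
  have "p j \<one> = 0" if "j < d" for j using p[OF that, of \<one> \<one>] by simp
  then have "N \<one> = 0" by (simp add: sq_norm_def)
  then show "0 \<le> r \<Longrightarrow> \<one> \<in> sublevel r" by (simp add: sublevel_def)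
qed

lemma word_ball_sublevel: "\<exists>n::nat. word_ball G X D \<subseteq> sublevel (r + int n)"
proof -
  obtain R where R: "\<And>g f. g \<in> carrier G \<Longrightarrow> N g \<le> 0 \<Longrightarrow> set f \<subseteq> X \<Longrightarrow> length f \<le> D \<Longrightarrow> N (g \<otimes> wprod G f) \<le> R"
    using norm_near[of 0 D] by blast
  have "N \<one> \<le> 0" using one_sublevel[of 0] by (simp add: sublevel_def)
  then have "N (wprod G f) \<le> R" if "set f \<subseteq> X" "length f \<le> D" for f
    using R[OF one_closed _ that] X_word_closed[OF that(1)] by simp
  then have "word_ball G X D \<subseteq> sublevel (r + int (nat (R - r)))"
    using X_word_closed by (fastforce simp: word_ball_def sublevel_def)
  then show ?thesis ..
qed

text \<open>A contraction in the whole group visits a bounded part, hence takes place in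
  \<open>sublevel (r0 + n)\<close> for some \<open>n\<close>; \<open>push_down\<close> then lowers
  the level \<open>n\<close> times. Connecting paths are lowered in the same way.\<close>

lemma sublevel_simply_connected:
  "\<exists>r\<ge>0. (\<forall>w. set w \<subseteq> X \<longrightarrow> wprod G w = \<one> \<longrightarrow> stays G (sublevel r) \<one> w \<longrightarrow> homot G X L (sublevel r) \<one> w []) \<and>
    (\<forall>g\<in>sublevel r. \<exists>w. set w \<subseteq> X \<and> wprod G w = g \<and> stays G (sublevel r) \<one> w)"
proof -
  from push_down obtain r0 where r0: "0 \<le> r0" and push: "\<forall>r\<ge>r0.
    (\<forall>g w. g \<in> sublevel r \<longrightarrow> set w \<subseteq> X \<longrightarrow> stays G (sublevel r) g w \<longrightarrow>
      homot G X L (sublevel (r + 1)) g w [] \<longrightarrow> homot G X L (sublevel r) g w []) \<and>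
    (\<forall>g w. g \<in> sublevel r \<longrightarrow> set w \<subseteq> X \<longrightarrow> stays G (sublevel (r + 1)) g w \<longrightarrow> g \<otimes> wprod G w \<in> sublevel r \<longrightarrow>
      (\<exists>v. set v \<subseteq> X \<and> wprod G v = wprod G w \<and> stays G (sublevel r) g v))"
    by (elim exE conjE)
  have down: "homot G X L (sublevel r0) \<one> w []"
    if "homot G X L (sublevel (r0 + int n)) \<one> w []" "set w \<subseteq> X" "stays G (sublevel r0) \<one> w" for n w
    using that
  proof (induction n)
    case (Suc n)
    have "stays G (sublevel (r0 + int n)) \<one> w"
      using Suc.prems(3) by (rule stays_mono) (simp add: sublevel_mono)
    then have "homot G X L (sublevel (r0 + int n)) \<one> w []"
      using push[rule_format, of "r0 + int n", THEN conjunct1, rule_format, of \<one> w] Suc.prems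
        one_sublevel[of "r0 + int n"] r0 by (simp add: ac_simps)
    then show ?case using Suc by blast
  qed simp
  have downp: "\<exists>v. set v \<subseteq> X \<and> wprod G v = wprod G w \<and> stays G (sublevel r0) \<one> v"
    if "stays G (sublevel (r0 + int n)) \<one> w" "set w \<subseteq> X" "wprod G w \<in> sublevel r0" for n w
    using that
  proof (induction n arbitrary: w)
    case 0
    then show ?case by auto
  next
    case (Suc n)
    have "wprod G w \<in> sublevel (r0 + int n)" "wprod G w \<in> carrier G"
      using Suc.prems(3) by (auto simp: sublevel_def)
    then obtain v where v: "set v \<subseteq> X" "wprod G v = wprod G w" "stays G (sublevel (r0 + int n)) \<one> v"
      using push[rule_format, of "r0 + int n", THEN conjunct2, rule_format, of \<one> w] Suc.prems
        one_sublevel[of "r0 + int n"] r0 by (auto simp: ac_simps)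
    then show ?case using Suc.IH[of v] Suc.prems(3) by auto
  qed
  show ?thesis
  proof (intro exI[of _ r0] conjI allI impI ballI r0)
    fix w assume w: "set w \<subseteq> X" "wprod G w = \<one>" "stays G (sublevel r0) \<one> w"
    obtain D where D: "homot G X L (word_ball G X D) \<one> w []"
      using homot_bounded[OF full_null[OF w(1,2)] X(2)] by blast
    obtain n :: nat where "word_ball G X D \<subseteq> sublevel (r0 + int n)" using word_ball_sublevel by blast
    then have "homot G X L (sublevel (r0 + int n)) \<one> w []"
      using D by (auto intro: homot_mono)
    then show "homot G X L (sublevel r0) \<one> w []" using down w by blast
  next
    fix g assume g: "g \<in> sublevel r0"
    then have "g \<in> carrier G" by (simp add: sublevel_def)
    then obtain w where w: "set w \<subseteq> X" "wprod G w = g" using gen by blast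
    obtain n :: nat where "word_ball G X (length w) \<subseteq> sublevel (r0 + int n)" using word_ball_sublevel by blast
    then have "stays G (sublevel (r0 + int n)) \<one> w"
      using stays_word_ball[OF w(1) order_refl X(2)] by (rule stays_mono[rotated])
    then show "\<exists>w. set w \<subseteq> X \<and> wprod G w = g \<and> stays G (sublevel r0) \<one> w"
      using downp w g by blast
  qed
qed

section \<open>The kernel is finitely presented\<close>

text \<open>\<open>H\<close> acts on a simply connected sublevel set with finite quotient. The vertices are mapped
  to \<open>H\<close> equivariantly by dividing by representatives \<open>s\<close> of the cosets.\<close>

lemma kernel_word_presented:
  fixes \<kappa> :: "'a \<Rightarrow> 'c"
  assumes H: "subgroup H G"
    and \<kappa>: "\<And>g g'. g \<in> carrier G \<Longrightarrow> g' \<in> carrier G \<Longrightarrow> \<kappa> g = \<kappa> g' \<longleftrightarrow> g \<otimes> inv g' \<in> H"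
    and fin: "\<And>r. finite (\<kappa> ` sublevel r)"
    and pH: "\<And>j h. j < d \<Longrightarrow> h \<in> H \<Longrightarrow> p j h = 0"
  shows "\<exists>Z M. word_presented (G\<lparr>carrier := H\<rparr>) Z M"
proof -
  interpret H: subgroup H G by fact
  let ?K = "G\<lparr>carrier := H\<rparr>"
  interpret K: group ?K by (rule H.subgroup_is_group) (rule is_group)
  from sublevel_simply_connected obtain r where r: "0 \<le> r"
    and null: "\<forall>w. set w \<subseteq> X \<longrightarrow> wprod G w = \<one> \<longrightarrow> stays G (sublevel r) \<one> w \<longrightarrow> homot G X L (sublevel r) \<one> w []"
    and path: "\<forall>g\<in>sublevel r. \<exists>w. set w \<subseteq> X \<and> wprod G w = g \<and> stays G (sublevel r) \<one> w"
    by (elim exE conjE)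
  let ?Y = "sublevel r"
  have wprodK: "wprod ?K w = wprod G w" for w by (simp add: wprod_def)
  have invK: "inv\<^bsub>?K\<^esub> h = inv h" if "h \<in> H" for h using that H m_inv_consistent by simp
  have NH: "N (h \<otimes> g) = N g" if "h \<in> H" "g \<in> carrier G" for h g
    using that H.mem_carrier pH unfolding sq_norm_def by (intro sum.cong) (auto simp: p)
  have YH: "h \<otimes> g \<in> ?Y" if "h \<in> H" "g \<in> ?Y" for h g
    using that NH H.mem_carrier by (auto simp: sublevel_def)
  have one_Y: "\<one> \<in> ?Y" using one_sublevel r .
  have H_Y: "h \<in> ?Y" if "h \<in> H" for h using YH[OF that one_Y] that by simp
  \<comment> \<open>The coset of \<open>\<one>\<close> is represented by \<open>\<one>\<close>, so
    that \<theta> is the identity on \<open>H\<close>.\<close>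
  define s where "s = (\<lambda>c. if c = \<kappa> \<one> then \<one> else (SOME g. g \<in> ?Y \<and> \<kappa> g = c))"
  have s: "s (\<kappa> g) \<in> ?Y" "\<kappa> (s (\<kappa> g)) = \<kappa> g" if "g \<in> ?Y" for g
  proof -
    have "s (\<kappa> g) \<in> ?Y \<and> \<kappa> (s (\<kappa> g)) = \<kappa> g"
    proof (cases "\<kappa> g = \<kappa> \<one>")
      case False
      then have "s (\<kappa> g) = (SOME g'. g' \<in> ?Y \<and> \<kappa> g' = \<kappa> g)" by (simp add: s_def)
      then show ?thesis using someI[of "\<lambda>g'. g' \<in> ?Y \<and> \<kappa> g' = \<kappa> g" g] that by simp
    qed (simp add: s_def one_Y)
    then show "s (\<kappa> g) \<in> ?Y" "\<kappa> (s (\<kappa> g)) = \<kappa> g" by auto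
  qed
  have Yc: "g \<in> carrier G" if "g \<in> ?Y" for g using that by (simp add: sublevel_def)
  define \<theta> where "\<theta> = (\<lambda>g. g \<otimes> inv (s (\<kappa> g)))"
  have \<theta>: "\<theta> g \<in> H" if "g \<in> ?Y" for g
    using \<kappa>[OF Yc[OF that] Yc[OF s(1)[OF that]]] s(2)[OF that] by (simp add: \<theta>_def)
  have \<theta>c: "\<theta> g \<in> carrier G" if "g \<in> ?Y" for g using \<theta>[OF that] H.mem_carrier by blast
  have \<kappa>H: "\<kappa> (h \<otimes> g) = \<kappa> g" if "h \<in> H" "g \<in> carrier G" for h g
  proof -
    have "h \<in> carrier G" using that H.mem_carrier by blast
    then have "h \<otimes> g \<otimes> inv g = h" using that by (simp add: m_assoc)
    then show ?thesis using \<kappa>[of "h \<otimes> g" g] that H.mem_carrier by simp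
  qed
  have \<theta>H: "\<theta> (h \<otimes> g) = h \<otimes> \<theta> g" if "h \<in> H" "g \<in> ?Y" for h g
    using that \<kappa>H[OF that(1) Yc[OF that(2)]] H.mem_carrier[OF that(1)] Yc[OF that(2)] Yc[OF s(1)[OF that(2)]]
    by (simp add: \<theta>_def m_assoc)
  have \<theta>_one: "\<theta> \<one> = \<one>" by (simp add: \<theta>_def s_def)
  have \<theta>_id: "\<theta> h = h" if "h \<in> H" for h
    using \<theta>H[OF that one_Y] \<theta>_one H.mem_carrier[OF that] by simp
  define z where "z = (\<lambda>g x. inv (\<theta> g) \<otimes> \<theta> (g \<otimes> x))"
  define Z where "Z = {z g x | g x. g \<in> ?Y \<and> x \<in> X \<and> g \<otimes> x \<in> ?Y}"
  \<comment> \<open>A label depends only on the cosets of the two end points and on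
    \<open>x\<close>. This makes \<open>Z\<close> finite, as only finitely many cosets meet the
    sublevel set.\<close>
  have z_eq: "z g x = s (\<kappa> g) \<otimes> x \<otimes> inv (s (\<kappa> (g \<otimes> x)))" if "g \<in> ?Y" "x \<in> X" "g \<otimes> x \<in> ?Y" for g x
  proof -
    have c: "g \<in> carrier G" "x \<in> carrier G" "s (\<kappa> g) \<in> carrier G" "s (\<kappa> (g \<otimes> x)) \<in> carrier G"
      using that Yc s X by auto
    then show ?thesis
      by (simp add: z_def \<theta>_def inv_mult_group m_assoc inv_cancel_left)
  qed
  have ZH: "Z \<subseteq> H"
    using \<theta> by (auto simp: Z_def z_def)
  have finZ: "finite Z"
  proof -
    have "Z \<subseteq> (\<lambda>(c, x, c'). s c \<otimes> x \<otimes> inv (s c')) ` (\<kappa> ` ?Y \<times> X \<times> \<kappa> ` ?Y)"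
    proof
      fix y assume "y \<in> Z"
      then obtain g x where gx: "g \<in> ?Y" "x \<in> X" "g \<otimes> x \<in> ?Y" and y: "y = z g x" by (auto simp: Z_def)
      then have "(\<kappa> g, x, \<kappa> (g \<otimes> x)) \<in> \<kappa> ` ?Y \<times> X \<times> \<kappa> ` ?Y" by blast
      moreover have "y = (\<lambda>(c, x, c'). s c \<otimes> x \<otimes> inv (s c')) (\<kappa> g, x, \<kappa> (g \<otimes> x))"
        using z_eq[OF gx] y by simp
      ultimately show "y \<in> (\<lambda>(c, x, c'). s c \<otimes> x \<otimes> inv (s c')) ` (\<kappa> ` ?Y \<times> X \<times> \<kappa> ` ?Y)" by (rule rev_image_eqI)
    qed
    then show ?thesis by (rule finite_subset) (use fin X(1) in blast)
  qed
  have Zinv: "inv y \<in> Z" if "y \<in> Z" for y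
  proof -
    from that obtain g x where gx: "g \<in> ?Y" "x \<in> X" "g \<otimes> x \<in> ?Y" and y: "y = z g x" by (auto simp: Z_def)
    have c: "g \<in> carrier G" "x \<in> carrier G" "inv x \<in> X" using gx Yc X by auto
    have gxx: "g \<otimes> x \<otimes> inv x = g" using c by (simp add: m_assoc)
    have "inv y = z (g \<otimes> x) (inv x)"
      using \<theta>c[OF gx(1)] \<theta>c[OF gx(3)] by (simp add: y z_def gxx inv_mult_group)
    moreover have "g \<otimes> x \<otimes> inv x \<in> ?Y" using gxx gx by simp
    ultimately show ?thesis unfolding Z_def using gx(3) c(3) by blast
  qed
  define e where "e = (\<lambda>g x. [z g x])"
  have edge: "set (e g x) \<subseteq> Z \<and> \<theta> g \<otimes> wprod G (e g x) = \<theta> (g \<otimes> x)"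
    if "g \<in> ?Y" "x \<in> X" "g \<otimes> x \<in> ?Y" for g x
    using that \<theta>c by (auto simp: e_def Z_def z_def inv_cancel_left)
  have len: "length (path_map G e g w) = length w" for g w
    by (induction w arbitrary: g) (auto simp: e_def)
  have edge_path: "set (path_map G e g w) \<subseteq> Z \<and> \<theta> g \<otimes> wprod G (path_map G e g w) = \<theta> (g \<otimes> wprod G w)"
    if "stays G ?Y g w" "set w \<subseteq> X" for g w
    using that
  proof (induction w arbitrary: g)
    case Nil
    then show ?case using \<theta>c Yc by simp
  next
    case (Cons x w)
    have st: "g \<in> ?Y" "g \<otimes> x \<in> ?Y" "stays G ?Y (g \<otimes> x) w" "x \<in> X" "set w \<subseteq> X"
      using Cons.prems stays_start by auto
    note E = edge[OF st(1,4,2)]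
    have IH: "set (path_map G e (g \<otimes> x) w) \<subseteq> Z"
      "\<theta> (g \<otimes> x) \<otimes> wprod G (path_map G e (g \<otimes> x) w) = \<theta> (g \<otimes> x \<otimes> wprod G w)"
      using Cons.IH[OF st(3,5)] by auto
    have "Z \<subseteq> carrier G" using ZH H.subset by blast
    then have c: "set (e g x) \<subseteq> carrier G" "set (path_map G e (g \<otimes> x) w) \<subseteq> carrier G" using E IH by blast+
    have wc: "wprod G w \<in> carrier G" "x \<in> carrier G" using X_word_closed[OF st(5)] st(4) X by auto
    have "\<theta> g \<otimes> wprod G (path_map G e g (x # w)) = \<theta> g \<otimes> wprod G (e g x) \<otimes> wprod G (path_map G e (g \<otimes> x) w)"
      using c \<theta>c[OF st(1)] by (simp add: m_assoc)
    also have "\<dots> = \<theta> (g \<otimes> wprod G (x # w))"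
      using E IH wc Yc[OF st(1)] by (simp add: m_assoc)
    finally show ?case using E IH by simp
  qed
  have "\<exists>w. set w \<subseteq> X \<and> wprod G w = y \<and> stays G ?Y \<one> w" if "y \<in> Z" for y
    using path H_Y ZH that by blast
  then have "\<forall>y\<in>Z. \<exists>w. set w \<subseteq> X \<and> wprod G w = y \<and> stays G ?Y \<one> w" ..
  from bchoice[OF this] obtain \<pi> where \<pi>: "\<forall>y\<in>Z. set (\<pi> y) \<subseteq> X \<and> wprod G (\<pi> y) = y \<and> stays G ?Y \<one> (\<pi> y)" ..
  \<comment> \<open>Besides the images of short loops, there must be room for the relator saying
    that a generator \<open>y\<close> equals the label word of its chosen path
    \<open>\<pi> y\<close>, of length \<open>Suc (length (\<pi> y))\<close>.\<close>
  define M where "M = Max (insert (max L 2) ((\<lambda>y. Suc (length (\<pi> y))) ` Z))"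
  have M: "L \<le> M" "2 \<le> M" "\<And>y. y \<in> Z \<Longrightarrow> Suc (length (\<pi> y)) \<le> M"
  proof -
    have fin: "finite (insert (max L 2) ((\<lambda>y. Suc (length (\<pi> y))) ` Z))" using finZ by simp
    have "max L 2 \<le> M" unfolding M_def by (rule Max_ge[OF fin]) simp
    then show "L \<le> M" "2 \<le> M" by auto
    show "Suc (length (\<pi> y)) \<le> M" if "y \<in> Z" for y
      unfolding M_def by (rule Max_ge[OF fin]) (use that in simp)
  qed
  have ZK: "Z \<subseteq> carrier ?K" using ZH by simp
  have stK: "stays ?K H g w" if "g \<in> H" "set w \<subseteq> Z" for g w
    using K.stays_carrier[of g w] that ZH by auto
  interpret T: path_transport G ?K X ?Y Z H L M \<theta> e
  proof unfold_locales
    show "X \<subseteq> carrier G" by (rule X)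
    show "Z \<subseteq> carrier ?K" by (rule ZK)
    show "\<theta> g \<in> carrier ?K \<and> \<theta> g \<in> H" if "g \<in> ?Y" for g using \<theta>[OF that] by simp
    show "set (e g x) \<subseteq> Z \<and> \<theta> g \<otimes>\<^bsub>?K\<^esub> wprod ?K (e g x) = \<theta> (g \<otimes> x) \<and> stays ?K H (\<theta> g) (e g x)"
      if "x \<in> X" "g \<in> ?Y" "g \<otimes> x \<in> ?Y" for g x
      using edge[of g x] that \<theta> stK[of "\<theta> g" "e g x"] by (simp add: wprodK)
    show "homot ?K Z M H (\<theta> g) (path_map G e g w) []"
      if w: "set w \<subseteq> X" "length w \<le> L" "wprod G w = \<one>" "stays G ?Y g w" for g w
    proof -
      have g: "g \<in> ?Y" using stays_start[OF w(4)] .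
      note ep = edge_path[OF w(4,1)]
      have "wprod G (path_map G e g w) \<in> carrier G"
        using ep ZH H.subset by (intro wprod_closed) blast
      then have "wprod G (path_map G e g w) = \<one>"
        using ep w(3) Yc[OF g] \<theta>c[OF g] by simp
      then have "homot ?K Z M H (\<theta> g) ([] @ path_map G e g w @ []) ([] @ [])"
        using ep w M(1) len[of g w] \<theta>[OF g] by (intro homot.delete) (auto simp: wprodK intro: stK)
      then show ?thesis by simp
    qed
  qed
  have equiv: "path_map G e (h \<otimes> g) w = path_map G e g w" if "h \<in> H" "stays G ?Y g w" "set w \<subseteq> X" for h g w
    using that
  proof (induction w arbitrary: g)
    case (Cons x w)
    have st: "g \<in> ?Y" "g \<otimes> x \<in> ?Y" "stays G ?Y (g \<otimes> x) w" "x \<in> X" "set w \<subseteq> X"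
      using Cons.prems stays_start by auto
    have c: "h \<in> carrier G" "g \<in> carrier G" "x \<in> carrier G" using Cons.prems H.mem_carrier Yc st X by auto
    have "h \<otimes> g \<otimes> x = h \<otimes> (g \<otimes> x)" using c by (simp add: m_assoc)
    moreover have "z (h \<otimes> g) x = z g x"
    proof -
      have "\<theta> (h \<otimes> g \<otimes> x) = h \<otimes> \<theta> (g \<otimes> x)"
        using \<theta>H[OF Cons.prems(1) st(2)] c by (simp add: m_assoc)
      then show ?thesis
        using \<theta>H[OF Cons.prems(1) st(1)] c \<theta>c[OF st(1)] \<theta>c[OF st(2)]
        by (simp add: z_def inv_mult_group m_assoc inv_cancel_left)
    qed
    ultimately show ?case using Cons.IH[OF Cons.prems(1) st(3,5)] by (simp add: e_def)
  qed simp
  have Z2: "\<forall>x\<in>Z. inv\<^bsub>?K\<^esub> x \<in> Z" using Zinv invK ZH by auto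
  have letter: "homot ?K Z M H h [y] (path_map G e \<one> (\<pi> y))" if "y \<in> Z" "h \<in> H" for h y
  proof (rule homot.sym, rule K.homot_from_loop)
    have \<pi>y: "set (\<pi> y) \<subseteq> X" "wprod G (\<pi> y) = y" "stays G ?Y \<one> (\<pi> y)" using \<pi> that by auto
    have y: "y \<in> H" "y \<in> carrier G" using that ZH H.subset by auto
    have ep: "set (path_map G e \<one> (\<pi> y)) \<subseteq> Z" "wprod G (path_map G e \<one> (\<pi> y)) = y"
    proof -
      note ep' = edge_path[OF \<pi>y(3,1)]
      then show s: "set (path_map G e \<one> (\<pi> y)) \<subseteq> Z" by blast
      have "wprod G (path_map G e \<one> (\<pi> y)) \<in> carrier G"
        using s ZH H.subset by (intro wprod_closed) blast
      then show "wprod G (path_map G e \<one> (\<pi> y)) = y"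
        using ep' \<pi>y(2) \<theta>_one \<theta>_id[OF y(1)] y by simp
    qed
    let ?l = "path_map G e \<one> (\<pi> y) @ winv ?K [y]"
    have wi: "winv ?K [y] = [inv y]" using invK[OF y(1)] by (simp add: winv_def)
    have sl: "set ?l \<subseteq> Z" using ep Zinv that wi by auto
    have "set (path_map G e \<one> (\<pi> y)) \<subseteq> carrier G" using ep ZH H.subset by blast
    then have "wprod G ?l = \<one>" using ep y by (simp add: wi)
    then have "homot ?K Z M H h ([] @ ?l @ []) ([] @ [])"
      using sl M(3)[OF that(1)] len[of \<one> "\<pi> y"] that
        stK[OF that(2) sl]
      by (intro homot.delete) (auto simp: wprodK)
    then show "homot ?K Z M H h ?l []" by simp
    show "stays ?K H h [y]" using stK[OF that(2), of "[y]"] that(1) by simp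
  qed (use that ZK Z2 M in auto)
  \<comment> \<open>A word over \<open>Z\<close> need not label a path in the sublevel set.
    Replacing each letter by the label word of its chosen path makes it do so, since labels are
    invariant under translation by \<open>H\<close> (\<open>equiv\<close>).\<close>
  have expand: "set w \<subseteq> Z \<Longrightarrow> \<exists>v. set v \<subseteq> X \<and> wprod G v = wprod G w \<and> stays G ?Y \<one> v \<and>
      (\<forall>h\<in>H. homot ?K Z M H h w (path_map G e \<one> v))" for w
  proof (induction w)
    case Nil
    show ?case
      using one_Y stK by (intro exI[of _ "[]"]) (auto intro!: homot.refl)
  next
    case (Cons y w)
    then obtain v where v: "set v \<subseteq> X" "wprod G v = wprod G w" "stays G ?Y \<one> v"
      and hv: "\<And>h. h \<in> H \<Longrightarrow> homot ?K Z M H h w (path_map G e \<one> v)" by auto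
    have y: "y \<in> Z" "y \<in> H" "y \<in> carrier G" "set w \<subseteq> Z" using Cons.prems ZH H.subset by auto
    have \<pi>y: "set (\<pi> y) \<subseteq> X" "wprod G (\<pi> y) = y" "stays G ?Y \<one> (\<pi> y)" using \<pi> y by auto
    have c: "set (\<pi> y) \<subseteq> carrier G" "set v \<subseteq> carrier G" using \<pi>y v X_word_closed by blast+
    have "stays G {g \<in> carrier G. y \<otimes> g \<in> ?Y} \<one> v"
      using v(3) by (rule stays_mono) (use YH[OF y(2)] Yc in auto)
    then have sty: "stays G ?Y y v"
      using stays_translate[OF y(3) one_closed c(2)] y by simp
    then have st: "stays G ?Y \<one> (\<pi> y @ v)"
      using c \<pi>y y by (simp add: stays_append)
    have pm: "path_map G e \<one> (\<pi> y @ v) = path_map G e \<one> (\<pi> y) @ path_map G e \<one> v"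
    proof -
      have "path_map G e \<one> (\<pi> y @ v) = path_map G e \<one> (\<pi> y) @ path_map G e (\<one> \<otimes> y) v"
        using T.path_map_append[OF one_closed c(1), of v] \<pi>y(2) by simp
      moreover have "path_map G e (y \<otimes> \<one>) v = path_map G e \<one> v"
        using equiv[OF y(2) v(3,1)] .
      ultimately show ?thesis using y by simp
    qed
    have "homot ?K Z M H h (y # w) (path_map G e \<one> (\<pi> y @ v))" if h: "h \<in> H" for h
    proof -
      have hy: "h \<otimes> y \<in> H" using h y by simp
      have "homot ?K Z M H h ([y] @ w) ([y] @ path_map G e \<one> v)"
      proof (rule K.homot_append_left)
        show "homot ?K Z M H (h \<otimes>\<^bsub>?K\<^esub> wprod ?K [y]) w (path_map G e \<one> v)"
          using hv[OF hy] y by (simp add: wprodK)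
      qed (use h y ZK stK in auto)
      moreover have "homot ?K Z M H h ([y] @ path_map G e \<one> v) (path_map G e \<one> (\<pi> y) @ path_map G e \<one> v)"
      proof (rule K.homot_append_right[OF letter[OF y(1) h]])
        have ep: "set (path_map G e \<one> v) \<subseteq> Z" "set (path_map G e \<one> (\<pi> y)) \<subseteq> Z"
          using edge_path v \<pi>y by blast+
        then show "set (path_map G e \<one> v) \<subseteq> Z" by blast
        have "wprod ?K (path_map G e \<one> (\<pi> y)) \<in> H"
          using K.wprod_closed[of "path_map G e \<one> (\<pi> y)"] ep ZK by auto
        then show "stays ?K H (h \<otimes>\<^bsub>?K\<^esub> wprod ?K (path_map G e \<one> (\<pi> y))) (path_map G e \<one> v)"
          using h ep by (intro stK) auto
      qed (use h ZK in auto)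
      ultimately show ?thesis unfolding pm by (auto intro: homot.trans)
    qed
    moreover have "wprod G (\<pi> y @ v) = wprod G (y # w)" using c \<pi>y v by simp
    moreover have "set (\<pi> y @ v) \<subseteq> X" using \<pi>y v by simp
    ultimately show ?case using st by blast
  qed
  have "word_presented ?K Z M"
    unfolding word_presented_def
  proof (intro conjI finZ ZK ballI allI impI)
    show "inv\<^bsub>?K\<^esub> x \<in> Z" if "x \<in> Z" for x using Z2 that by blast
    fix g assume "g \<in> carrier ?K"
    then have g: "g \<in> H" by simp
    obtain w where w: "set w \<subseteq> X" "wprod G w = g" "stays G ?Y \<one> w"
      using path H_Y[OF g] by blast
    note ep = edge_path[OF w(3,1)]
    have "wprod G (path_map G e \<one> w) \<in> carrier G"
      using ep ZH H.subset by (intro wprod_closed) blast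
    then have "wprod G (path_map G e \<one> w) = g"
      using ep w \<theta>_one \<theta>_id[OF g] H.mem_carrier[OF g] by simp
    then show "\<exists>w. set w \<subseteq> Z \<and> wprod ?K w = g"
      using ep by (auto simp: wprodK)
  next
    fix w assume w: "set w \<subseteq> Z" "wprod ?K w = \<one>\<^bsub>?K\<^esub>"
    obtain v where v: "set v \<subseteq> X" "wprod G v = wprod G w" "stays G ?Y \<one> v"
      and hv: "\<And>h. h \<in> H \<Longrightarrow> homot ?K Z M H h w (path_map G e \<one> v)"
      using expand[OF w(1)] by blast
    have "homot G X L ?Y \<one> v []"
      using null v w by (simp add: wprodK)
    then have "homot ?K Z M H (\<theta> \<one>) (path_map G e \<one> v) (path_map G e \<one> [])"
      by (rule T.homot_map) simp
    then have "homot ?K Z M H \<one> w []"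
      using hv[OF H.one_closed] \<theta>_one by (auto intro: homot.trans)
    then show "homot ?K Z M (carrier ?K) \<one>\<^bsub>?K\<^esub> w []" by simp
  qed
  then show ?thesis by blast
qed

end

section \<open>Integer coordinates on a finitely generated abelian group\<close>

context comm_group
begin

text \<open>A homomorphism to integer vectors whose image spans the real space, since by the second
  clause no nonzero linear form vanishes on it. The third clause makes it proper, in particular with
  finite kernel, so torsion is tolerated.\<close>

definition integer_coordinates :: "'a set \<Rightarrow> nat \<Rightarrow> (nat \<Rightarrow> 'a \<Rightarrow> int) \<Rightarrow> bool" where
  "integer_coordinates A d p \<longleftrightarrow>
    (\<forall>j<d. \<forall>x\<in>A. \<forall>y\<in>A. p j (x \<otimes> y) = p j x + p j y) \<and>
    (\<forall>\<alpha>. (\<exists>j<d. \<alpha> j \<noteq> 0) \<longrightarrow> (\<exists>x\<in>A. comb_character d p \<alpha> x \<noteq> 0)) \<and>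
    (\<forall>r. finite {x \<in> A. sq_norm d p x \<le> r})"

lemma additive_int_pow:
  fixes f :: "'a \<Rightarrow> int"
  assumes A: "subgroup A G" and add: "\<And>x y. x \<in> A \<Longrightarrow> y \<in> A \<Longrightarrow> f (x \<otimes> y) = f x + f y" and x: "x \<in> A"
  shows "f (x [^] (k::int)) = k * f x"
proof -
  have car: "x \<in> carrier G" using A x by (rule subgroup.mem_carrier)
  have pow: "x [^] (i::int) \<in> A" for i
    using subgroup_int_pow_closed[OF A x] .
  have one: "f \<one> = 0"
    using add[OF subgroup.one_closed[OF A] subgroup.one_closed[OF A]] by simp
  have nat: "f (x [^] int n) = int n * f x" for n
  proof (induction n)
    case 0
    then show ?case by (simp add: one)
  next
    case (Suc n)
    have "x [^] int (Suc n) = x [^] int n \<otimes> x"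
      using int_pow_mult[OF car, of "int n" 1] car by (simp add: add.commute int_pow_1)
    then show ?case using add[OF pow x, of "int n"] Suc by (simp add: algebra_simps)
  qed
  show ?thesis
  proof (cases "0 \<le> k")
    case True
    then show ?thesis using nat[of "nat k"] by simp
  next
    case False
    have "x [^] k \<otimes> x [^] (- k) = \<one>"
      using int_pow_mult[OF car, of k "- k"] by simp
    then have "f (x [^] k) + f (x [^] (- k)) = 0"
      using add[OF pow pow, of k "- k"] one by simp
    then show ?thesis using nat[of "nat (- k)"] False by simp
  qed
qed

definition adjoin :: "'a set \<Rightarrow> 'a \<Rightarrow> 'a set" where
  "adjoin A s = {a \<otimes> s [^] (k::int) | a k. a \<in> A}"

lemma adjoin_mult:
  assumes "a \<in> carrier G" "b \<in> carrier G" "s \<in> carrier G"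
  shows "(a \<otimes> s [^] (k::int)) \<otimes> (b \<otimes> s [^] l) = (a \<otimes> b) \<otimes> s [^] (k + l)"
  using assms by (simp add: int_pow_mult[symmetric] m_ac)

lemma subgroup_adjoin:
  assumes A: "subgroup A G" and s: "s \<in> carrier G"
  shows "subgroup (adjoin A s) G" "A \<subseteq> adjoin A s" "s \<in> adjoin A s"
proof -
  note car = subgroup.mem_carrier[OF A]
  show sub: "A \<subseteq> adjoin A s"
  proof
    fix a assume a: "a \<in> A"
    have "a = a \<otimes> s [^] (0::int)" using car[OF a] by simp
    then show "a \<in> adjoin A s" unfolding adjoin_def using a by blast
  qed
  have "s = \<one> \<otimes> s [^] (1::int)" using s by (simp add: int_pow_1)
  then show "s \<in> adjoin A s" unfolding adjoin_def using subgroup.one_closed[OF A] by blast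
  show "subgroup (adjoin A s) G"
  proof (rule subgroupI)
    show "adjoin A s \<subseteq> carrier G" unfolding adjoin_def using car s by auto
    show "adjoin A s \<noteq> {}" using sub subgroup.one_closed[OF A] by blast
  next
    fix x assume "x \<in> adjoin A s"
    then obtain a k where x: "x = a \<otimes> s [^] (k::int)" "a \<in> A" unfolding adjoin_def by blast
    have "inv x = inv a \<otimes> s [^] (- k)"
      using car[OF x(2)] s by (simp add: x(1) inv_mult int_pow_neg)
    then show "inv x \<in> adjoin A s"
      unfolding adjoin_def using subgroup.m_inv_closed[OF A x(2)] by blast
  next
    fix x y assume "x \<in> adjoin A s" "y \<in> adjoin A s"
    then obtain a k b l where *: "x = a \<otimes> s [^] (k::int)" "a \<in> A" "y = b \<otimes> s [^] (l::int)" "b \<in> A"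
      unfolding adjoin_def by blast
    have "x \<otimes> y = (a \<otimes> b) \<otimes> s [^] (k + l)"
      unfolding * using car *(2,4) s by (intro adjoin_mult) auto
    then show "x \<otimes> y \<in> adjoin A s"
      unfolding adjoin_def using subgroup.m_closed[OF A *(2,4)] by blast
  qed
qed

text \<open>Raising to the power \<open>n\<close> maps the larger subgroup into \<open>A\<close>,
  where coordinates exist. On \<open>A\<close> it only scales them by \<open>n\<close>, so no linear
  form is lost; finiteness holds because the exponent of \<open>s\<close> can be reduced modulo
  \<open>n\<close>.\<close>

lemma integer_coordinates_adjoin_torsion:
  assumes A: "subgroup A G" and s: "s \<in> carrier G" and p: "integer_coordinates A d p"
    and n: "0 < n" "s [^] (n::int) \<in> A"
  shows "integer_coordinates (adjoin A s) d (\<lambda>j x. p j (x [^] n))"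
proof -
  note car = subgroup.mem_carrier[OF A]
  note car' = subgroup.mem_carrier[OF subgroup_adjoin(1)[OF A s]]
  note add = p[unfolded integer_coordinates_def, THEN conjunct1, rule_format]
  note sep = p[unfolded integer_coordinates_def, THEN conjunct2, THEN conjunct1, rule_format]
  note fin = p[unfolded integer_coordinates_def, THEN conjunct2, THEN conjunct2, rule_format]
  have pow: "p j (x [^] (k::int)) = k * p j x" if "j < d" "x \<in> A" for j x k
    using additive_int_pow[OF A _ that(2), of "p j"] add that(1) by blast
  have split: "(a \<otimes> s [^] k) [^] n = a [^] n \<otimes> (s [^] n) [^] k" if "a \<in> A" for a and k :: int
    using car[OF that] s by (simp add: int_pow_distrib int_pow_pow mult.commute)
  have A_pow: "x [^] n \<in> A" if xA: "x \<in> adjoin A s" for x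
  proof -
    obtain a k where x: "x = a \<otimes> s [^] (k::int)" "a \<in> A" using xA unfolding adjoin_def by blast
    show ?thesis unfolding x(1) split[OF x(2)]
      using subgroup_int_pow_closed[OF A] n(2) x(2) by (intro subgroup.m_closed[OF A])
  qed
  show ?thesis
    unfolding integer_coordinates_def
  proof (intro conjI allI impI ballI)
    fix j x y assume j: "j < d" and x: "x \<in> adjoin A s" and y: "y \<in> adjoin A s"
    show "p j ((x \<otimes> y) [^] n) = p j (x [^] n) + p j (y [^] n)"
      using car'[OF x] car'[OF y] add[OF j A_pow[OF x] A_pow[OF y]] by (simp add: int_pow_distrib)
  next
    fix \<alpha> :: "nat \<Rightarrow> real" assume "\<exists>j<d. \<alpha> j \<noteq> 0"
    then obtain x where x: "x \<in> A" "comb_character d p \<alpha> x \<noteq> 0" using sep by blast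
    have "comb_character d (\<lambda>j x. p j (x [^] n)) \<alpha> x = real_of_int n * comb_character d p \<alpha> x"
      unfolding comb_character_def sum_distrib_left
      by (rule sum.cong) (simp_all add: pow x(1))
    then show "\<exists>x\<in>adjoin A s. comb_character d (\<lambda>j x. p j (x [^] n)) \<alpha> x \<noteq> 0"
      using n(1) x subgroup_adjoin(2)[OF A s] by (intro bexI[of _ x]) auto
  next
    fix r :: int
    \<comment> \<open>For \<open>x\<close> equal to \<open>a\<close> times the \<open>k\<close>-th
      power of \<open>s\<close> with \<open>0 \<le> k < n\<close>, the coordinates of
      \<open>a\<close> satisfy \<open>n * p j a = p j (x [^] n) - k * p j (s [^] n)\<close>;
      squaring and summing bounds \<open>sq_norm d p a\<close> by \<open>r'\<close>.\<close>
    define r' where "r' = 2 * r + 2 * n\<^sup>2 * sq_norm d p (s [^] n)"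
    have "{x \<in> adjoin A s. sq_norm d (\<lambda>j x. p j (x [^] n)) x \<le> r} \<subseteq>
      (\<lambda>(a, k). a \<otimes> s [^] k) ` ({x \<in> A. sq_norm d p x \<le> r'} \<times> {0..<n})"
    proof
      fix x assume "x \<in> {x \<in> adjoin A s. sq_norm d (\<lambda>j x. p j (x [^] n)) x \<le> r}"
      then have x: "x \<in> adjoin A s" and r: "sq_norm d (\<lambda>j x. p j (x [^] n)) x \<le> r" by auto
      obtain a' l where x': "x = a' \<otimes> s [^] (l::int)" "a' \<in> A" using x unfolding adjoin_def by blast
      define a k where "a = a' \<otimes> (s [^] n) [^] (l div n)" and "k = l mod n"
      have a: "a \<in> A" unfolding a_def
        using subgroup_int_pow_closed[OF A n(2)] x'(2) by (intro subgroup.m_closed[OF A])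
      have k: "0 \<le> k" "k < n" unfolding k_def using n(1) by auto
      have "(s [^] n) [^] (l div n) \<otimes> s [^] k = s [^] l"
        using s by (simp add: int_pow_pow int_pow_mult[symmetric] k_def)
      then have xa: "x = a \<otimes> s [^] k"
        unfolding x'(1) a_def using car[OF x'(2)] s by (simp add: m_assoc)
      have "(p j a)\<^sup>2 \<le> 2 * (p j (x [^] n))\<^sup>2 + 2 * n\<^sup>2 * (p j (s [^] n))\<^sup>2" if j: "j < d" for j
      proof -
        have "p j (x [^] n) = n * p j a + k * p j (s [^] n)"
          unfolding xa split[OF a]
          using add[OF j subgroup_int_pow_closed[OF A a] subgroup_int_pow_closed[OF A n(2)]]
          by (simp add: pow j a n(2))
        then have e: "n * p j a = p j (x [^] n) - k * p j (s [^] n)" by simp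
        have "(p j a)\<^sup>2 \<le> n\<^sup>2 * (p j a)\<^sup>2"
          using n(1) by (simp add: mult_le_cancel_right1 power2_eq_square) (smt (verit) mult_le_cancel_right1)
        also have "\<dots> = (p j (x [^] n) - k * p j (s [^] n))\<^sup>2"
          unfolding e[symmetric] by (simp add: power_mult_distrib)
        also have "\<dots> \<le> 2 * (p j (x [^] n))\<^sup>2 + 2 * (k * p j (s [^] n))\<^sup>2"
          using zero_le_power2[of "p j (x [^] n) + k * p j (s [^] n)"]
          by (simp add: power2_sum power2_diff)
        also have "\<dots> \<le> 2 * (p j (x [^] n))\<^sup>2 + 2 * n\<^sup>2 * (p j (s [^] n))\<^sup>2"
        proof -
          have "k\<^sup>2 \<le> n\<^sup>2" using k by (intro power_mono) auto
          then show ?thesis by (simp add: power_mult_distrib mult_right_mono)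
        qed
        finally show ?thesis .
      qed
      then have "sq_norm d p a \<le> (\<Sum>j<d. 2 * (p j (x [^] n))\<^sup>2 + 2 * n\<^sup>2 * (p j (s [^] n))\<^sup>2)"
        unfolding sq_norm_def by (intro sum_mono) auto
      also have "\<dots> = 2 * sq_norm d (\<lambda>j x. p j (x [^] n)) x + 2 * n\<^sup>2 * sq_norm d p (s [^] n)"
        unfolding sq_norm_def by (simp add: sum.distrib sum_distrib_left)
      also have "\<dots> \<le> r'" unfolding r'_def using r by simp
      finally have "(a, k) \<in> {x \<in> A. sq_norm d p x \<le> r'} \<times> {0..<n}" using a k by simp
      then show "x \<in> (\<lambda>(a, k). a \<otimes> s [^] k) ` ({x \<in> A. sq_norm d p x \<le> r'} \<times> {0..<n})"
        by (rule rev_image_eqI) (simp add: xa)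
    qed
    then show "finite {x \<in> adjoin A s. sq_norm d (\<lambda>j x. p j (x [^] n)) x \<le> r}"
      by (rule finite_subset) (intro finite_imageI finite_cartesian_product fin finite_atLeastLessThan_int)
  qed
qed

text \<open>No nonzero power of \<open>s\<close> lies in \<open>A\<close>, so the exponent of
  \<open>s\<close> is well defined and becomes one more coordinate.\<close>

lemma integer_coordinates_adjoin_free:
  assumes A: "subgroup A G" and s: "s \<in> carrier G" and p: "integer_coordinates A d p"
    and n: "\<And>n::int. s [^] n \<in> A \<Longrightarrow> n = 0"
  shows "\<exists>q. integer_coordinates (adjoin A s) (Suc d) q"
proof -
  note car = subgroup.mem_carrier[OF A]
  note add = p[unfolded integer_coordinates_def, THEN conjunct1, rule_format]
  note sep = p[unfolded integer_coordinates_def, THEN conjunct2, THEN conjunct1, rule_format]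
  note fin = p[unfolded integer_coordinates_def, THEN conjunct2, THEN conjunct2, rule_format]
  have mem: "a \<otimes> s [^] k \<in> adjoin A s" if "a \<in> A" for a and k :: int
    unfolding adjoin_def using that by blast
  have unique: "a = b \<and> k = l" if "a \<otimes> s [^] (k::int) = b \<otimes> s [^] (l::int)" and a: "a \<in> A" and b: "b \<in> A" for a b k l
  proof -
    have "inv b \<otimes> a = inv b \<otimes> (a \<otimes> s [^] k) \<otimes> s [^] (- k)"
      using car[OF a] car[OF b] s by (simp add: m_assoc int_pow_mult[symmetric])
    also have "\<dots> = inv b \<otimes> (b \<otimes> s [^] l) \<otimes> s [^] (- k)" using that(1) by simp
    also have "\<dots> = s [^] (l - k)"
      using car[OF b] s by (simp add: m_assoc[symmetric] int_pow_mult[symmetric])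
    finally have "s [^] (l - k) \<in> A"
      using a b by (metis subgroup.m_closed[OF A] subgroup.m_inv_closed[OF A])
    then have "k = l" using n[of "l - k"] by simp
    then show ?thesis using that(1) car[OF a] car[OF b] s by simp
  qed
  have "\<forall>x\<in>adjoin A s. \<exists>ak. fst ak \<in> A \<and> x = fst ak \<otimes> s [^] (snd ak :: int)"
    unfolding adjoin_def by auto
  then obtain c where c: "\<forall>x\<in>adjoin A s. fst (c x) \<in> A \<and> x = fst (c x) \<otimes> s [^] (snd (c x) :: int)"
    by (rule bchoice[THEN exE])
  have ceq: "c (a \<otimes> s [^] k) = (a, k)" if "a \<in> A" for a k
  proof -
    have "a \<otimes> s [^] k \<in> adjoin A s" unfolding adjoin_def using that by blast
    then show ?thesis using c unique that by (metis prod.collapse)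
  qed
  define q where "q j x = (if j < d then p j (fst (c x)) else snd (c x))" for j x
  have qeq: "q j (a \<otimes> s [^] k) = (if j < d then p j a else k)" if "a \<in> A" for a k j
    by (simp add: q_def ceq that)
  have N: "sq_norm (Suc d) q (a \<otimes> s [^] k) = sq_norm d p a + k\<^sup>2" if "a \<in> A" for a k
    by (simp add: sq_norm_def qeq that)
  have C: "comb_character (Suc d) q \<alpha> (a \<otimes> s [^] k) = comb_character d p \<alpha> a + \<alpha> d * real_of_int k" if "a \<in> A" for a k \<alpha>
    by (simp add: comb_character_def qeq that)
  have "integer_coordinates (adjoin A s) (Suc d) q"
    unfolding integer_coordinates_def
  proof (intro conjI allI impI ballI)
    fix j x y assume j: "j < Suc d" and x: "x \<in> adjoin A s" and y: "y \<in> adjoin A s"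
    obtain a k b l where *: "x = a \<otimes> s [^] (k::int)" "a \<in> A" "y = b \<otimes> s [^] (l::int)" "b \<in> A"
      using x y unfolding adjoin_def by blast
    have xy: "x \<otimes> y = (a \<otimes> b) \<otimes> s [^] (k + l)"
      unfolding * using car *(2,4) s by (intro adjoin_mult) auto
    show "q j (x \<otimes> y) = q j x + q j y"
      unfolding xy unfolding *(1,3) qeq[OF *(2)] qeq[OF *(4)] qeq[OF subgroup.m_closed[OF A *(2,4)]]
      using add *(2,4) by simp
  next
    fix \<alpha> :: "nat \<Rightarrow> real" assume \<alpha>: "\<exists>j<Suc d. \<alpha> j \<noteq> 0"
    show "\<exists>x\<in>adjoin A s. comb_character (Suc d) q \<alpha> x \<noteq> 0"
    proof (cases "\<exists>j<d. \<alpha> j \<noteq> 0")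
      case True
      then obtain x where x: "x \<in> A" "comb_character d p \<alpha> x \<noteq> 0" using sep by blast
      then show ?thesis using C[OF x(1), of \<alpha> 0]
        by (intro bexI[OF _ mem[OF x(1), of 0]]) simp
    next
      case False
      then have "\<alpha> d \<noteq> 0" "comb_character d p \<alpha> \<one> = 0"
        using \<alpha> by (auto simp: less_Suc_eq comb_character_def)
      then show ?thesis using C[OF subgroup.one_closed[OF A], of \<alpha> 1] by (intro bexI[OF _ mem[OF subgroup.one_closed[OF A], of 1]]) simp
    qed
  next
    fix r :: int
    have "{x \<in> adjoin A s. sq_norm (Suc d) q x \<le> r} \<subseteq>
      (\<lambda>(a, k). a \<otimes> s [^] k) ` ({x \<in> A. sq_norm d p x \<le> r} \<times> {- r..r})"
    proof
      fix x assume "x \<in> {x \<in> adjoin A s. sq_norm (Suc d) q x \<le> r}"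
      then obtain a k where x: "x = a \<otimes> s [^] (k::int)" "a \<in> A" and r: "sq_norm d p a + k\<^sup>2 \<le> r"
        unfolding adjoin_def using N by auto
      have "0 \<le> k\<^sup>2" "\<bar>k\<bar> \<le> k\<^sup>2"
        by (simp, metis abs_le_square_iff abs_of_nonneg abs_zero int_one_le_iff_zero_less linorder_not_le mult_le_cancel_left1 order_le_less power2_abs power2_eq_square zero_less_abs_iff abs_ge_zero)
      then have "(a, k) \<in> {x \<in> A. sq_norm d p x \<le> r} \<times> {- r..r}"
        using r x(2) sq_norm_nonneg[of d p a] by auto
      then show "x \<in> (\<lambda>(a, k). a \<otimes> s [^] k) ` ({x \<in> A. sq_norm d p x \<le> r} \<times> {- r..r})"
        by (rule rev_image_eqI) (simp add: x(1))
    qed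
    then show "finite {x \<in> adjoin A s. sq_norm (Suc d) q x \<le> r}"
      by (rule finite_subset) (intro finite_imageI finite_cartesian_product fin finite_atLeastAtMost_int)
  qed
  then show ?thesis by (intro exI)
qed

text \<open>The generators are adjoined one at a time: each either has a positive power in the
  subgroup reached so far or contributes a new coordinate.\<close>

lemma integer_coordinates_exist:
  assumes S: "finite S" "S \<subseteq> carrier G"
    and gen: "\<And>g. g \<in> carrier G \<Longrightarrow> \<exists>w. set w \<subseteq> S \<and> wprod G w = g"
  shows "\<exists>d p. integer_coordinates (carrier G) d p"
proof -
  have "\<exists>A d p. subgroup A G \<and> S \<subseteq> A \<and> integer_coordinates A d p"
    using S
  proof (induction S)
    case empty
    have "integer_coordinates {\<one>} 0 p" for p
      by (simp add: integer_coordinates_def)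
    then show ?case using triv_subgroup by blast
  next
    case (insert s S)
    then obtain A d p where A: "subgroup A G" "S \<subseteq> A" and p: "integer_coordinates A d p" by auto
    have s: "s \<in> carrier G" using insert.prems by simp
    have "\<exists>d p. integer_coordinates (adjoin A s) d p"
    proof (cases "\<exists>n::int. 0 < n \<and> s [^] n \<in> A")
      case True
      then show ?thesis using integer_coordinates_adjoin_torsion[OF A(1) s p] by blast
    next
      case False
      have "n = 0" if "s [^] n \<in> A" for n :: int
      proof (rule ccontr)
        assume "n \<noteq> 0"
        moreover have "s [^] (- n) \<in> A"
          using subgroup.m_inv_closed[OF A(1) that] s by (simp add: int_pow_neg)
        ultimately show False using False that by (metis neg_0_less_iff_less linorder_neqE)
      qed
      then show ?thesis using integer_coordinates_adjoin_free[OF A(1) s p] by blast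
    qed
    then show ?case using subgroup_adjoin[OF A(1) s] A(2) by blast
  qed
  then obtain A d p where A: "subgroup A G" "S \<subseteq> A" and p: "integer_coordinates A d p" by auto
  have "wprod G w \<in> A" if "set w \<subseteq> S" for w
    using that A subgroup.one_closed[OF A(1)] subgroup.m_closed[OF A(1)] by (induction w) auto
  then have "A = carrier G" using gen subgroup.subset[OF A(1)] by blast
  then show ?thesis using p by blast
qed

end

section \<open>Fibre products over an abelian group\<close>

text \<open>Each monoid generator is spelled by a word of length at most \<open>l\<close> over
  \<open>X\<close>; read inside the half space, the spelling dips by at most \<open>l * C\<close>,
  which becomes the depth \<open>c\<close>. Backward steps use reversed spellings.\<close>

lemma (in group) half_space_connected_if_fin_connected:
  assumes \<chi>: "\<And>x y. x \<in> carrier G \<Longrightarrow> y \<in> carrier G \<Longrightarrow> \<chi> (x \<otimes> y) = \<chi> x + (\<chi> y :: real)"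
    and X: "finite X" "X \<subseteq> carrier G" "\<forall>x\<in>X. inv x \<in> X"
    and gen: "\<And>g. g \<in> carrier G \<Longrightarrow> \<exists>w. set w \<subseteq> X \<and> wprod G w = g"
    and conn: "fin_connected (character_monoid G \<chi>)"
  shows "half_space_connected G X \<chi>"
proof -
  let ?M = "character_monoid G \<chi>"
  obtain T where T: "finite T" "T \<subseteq> carrier ?M" and con: "\<And>g. g \<in> carrier ?M \<Longrightarrow> conn ?M T \<one> g"
    using conn unfolding fin_connected_def by (auto simp: character_monoid_def)
  have T': "t \<in> carrier G" "0 \<le> \<chi> t" if "t \<in> T" for t
    using T(2) that by (auto simp: character_monoid_def)
  have "\<forall>t\<in>T. \<exists>w. set w \<subseteq> X \<and> wprod G w = t"
    using gen T' by blast
  then obtain wd where wd: "\<And>t. t \<in> T \<Longrightarrow> set (wd t) \<subseteq> X" "\<And>t. t \<in> T \<Longrightarrow> wprod G (wd t) = t"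
    using bchoice[of T "\<lambda>t w. set w \<subseteq> X \<and> wprod G w = t"] by blast
  have wdc: "set (wd t) \<subseteq> carrier G" if "t \<in> T" for t using wd(1)[OF that] X(2) by blast
  define C where "C = Max (insert 0 ((\<lambda>x. \<bar>\<chi> x\<bar>) ` X))"
  have C: "0 \<le> C" "\<And>x. x \<in> X \<Longrightarrow> \<bar>\<chi> x\<bar> \<le> C"
    unfolding C_def using X(1) by (auto intro!: Max_ge)
  define l where "l = Max (insert 0 ((\<lambda>t. length (wd t)) ` T))"
  have l: "length (wd t) \<le> l" if "t \<in> T" for t
    unfolding l_def using T(1) that by (auto intro!: Max_ge)
  define c where "c = real l * C"
  have \<chi>1: "\<chi> \<one> = 0" using \<chi>[of \<one> \<one>] by simp
  have c0: "0 \<le> c" unfolding c_def using C by simp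
  let ?Y = "{g \<in> carrier G. - c \<le> \<chi> g}"
  have seg: "stays G ?Y y (wd t)" if t: "t \<in> T" and y: "y \<in> carrier G" "0 \<le> \<chi> y" for t y
    unfolding stays_iff[OF y(1) wdc[OF t]]
  proof (intro allI impI)
    fix u v assume uv: "wd t = u @ v"
    have u: "set u \<subseteq> X" "set u \<subseteq> carrier G" "length u \<le> l"
      using wd(1)[OF t] wdc[OF t] l[OF t] unfolding uv by auto
    have "\<bar>\<chi> (wprod G u)\<bar> \<le> real (length u) * C"
      using \<chi> u(1) X(2) C(2) by (rule word_value_bound)
    also have "\<dots> \<le> c" unfolding c_def using u C by (intro mult_right_mono) auto
    finally show "y \<otimes> wprod G u \<in> ?Y" using y u \<chi>[of y "wprod G u"] by auto
  qed
  have path: "g \<in> carrier G \<and> 0 \<le> \<chi> g \<and> (\<exists>v. set v \<subseteq> X \<and> wprod G v = g \<and> stays G ?Y \<one> v)"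
    if "conn ?M T \<one> g" for g
    using that
  proof induction
    case refl
    show ?case using \<chi>1 c0 by (auto intro!: exI[of _ "[]"])
  next
    case (step y t)
    then obtain v where v: "set v \<subseteq> X" "wprod G v = y" "stays G ?Y \<one> v" by blast
    have y: "y \<in> carrier G" "0 \<le> \<chi> y" using step by auto
    have vc: "set v \<subseteq> carrier G" using v X by auto
    have "stays G ?Y \<one> (v @ wd t)"
      using seg[OF step(2) y] v vc y by (simp add: stays_append wdc[OF step(2)])
    moreover have "wprod G (v @ wd t) = y \<otimes> t" using wd(2)[OF step(2)] wdc[OF step(2)] vc v by simp
    moreover have "y \<otimes>\<^bsub>?M\<^esub> t = y \<otimes> t" by (simp add: character_monoid_def)
    ultimately show ?case
      using T'[OF step(2)] y v wd(1)[OF step(2)] \<chi>[of y t] by (intro conjI exI[of _ "v @ wd t"]) auto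
  next
    case (unstep y t)
    have yt: "y \<otimes>\<^bsub>?M\<^esub> t = y \<otimes> t" by (simp add: character_monoid_def)
    then obtain v where v: "set v \<subseteq> X" "wprod G v = y \<otimes> t" "stays G ?Y \<one> v" using unstep.IH by metis
    have y: "y \<in> carrier G" "0 \<le> \<chi> y" using unstep(2) by (auto simp: character_monoid_def)
    have vc: "set v \<subseteq> carrier G" using v X by auto
    have w: "wprod G (wd t) = t" "set (wd t) \<subseteq> carrier G" using wd(2) wdc unstep(3) by auto
    have "stays G ?Y (y \<otimes> wprod G (wd t)) (winv G (wd t))"
      unfolding stays_winv[OF y(1) w(2)] by (rule seg[OF unstep(3) y])
    then have "stays G ?Y \<one> (v @ winv G (wd t))"
      using v vc y w by (simp add: stays_append T'[OF unstep(3)])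
    moreover have "wprod G (v @ winv G (wd t)) = y"
      using w vc v y T'[OF unstep(3)] by (simp add: m_assoc)
    ultimately show ?case
      using y v set_winv_subset[OF wd(1)[OF unstep(3)] X(3)] by (intro conjI exI[of _ "v @ winv G (wd t)"]) auto
  qed
  show ?thesis
    unfolding half_space_connected_def
  proof (rule exI[of _ c], intro allI impI)
    fix u assume u: "set u \<subseteq> X \<and> 0 \<le> \<chi> (wprod G u)"
    then have "wprod G u \<in> carrier G" using X by auto
    then have "wprod G u \<in> carrier ?M" using u by (auto simp: character_monoid_def)
    then show "\<exists>v. set v \<subseteq> X \<and> wprod G v = wprod G u \<and> stays G ?Y \<one> v" using path con by blast
  qed
qed

section \<open>Words, homotopies and half spaces under homomorphisms\<close>

lemma (in group_hom) wprod_map: "set w \<subseteq> carrier G \<Longrightarrow> wprod H (map h w) = h (wprod G w)"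
  by (induction w) auto

lemma (in group_hom) stays_map:
  "\<lbrakk>g \<in> carrier G; set w \<subseteq> carrier G\<rbrakk> \<Longrightarrow> stays H Y (h g) (map h w) \<longleftrightarrow> stays G {g \<in> carrier G. h g \<in> Y} g w"
  by (induction w arbitrary: g) (auto simp flip: hom_mult)

lemma (in group_hom) set_map_closed: "set w \<subseteq> carrier G \<Longrightarrow> set (map h w) \<subseteq> carrier H"
  by auto

lemma words_over_image: "set w \<subseteq> h ` X \<Longrightarrow> \<exists>u. set u \<subseteq> X \<and> w = map h u"
  by (induction w) (auto simp: image_iff, metis insert_subset list.simps(15) list.simps(9))

lemma (in group_hom) homot_hom:
  assumes "homot G X L (carrier G) \<one>\<^bsub>G\<^esub> u v" "X \<subseteq> carrier G"
  shows "homot H (h ` X) L (carrier H) \<one>\<^bsub>H\<^esub> (map h u) (map h v)"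
  using assms(1)
proof induction
  case (refl w)
  then have "set w \<subseteq> carrier G" using assms(2) by auto
  then show ?case using refl set_map_closed by (intro homot.refl H.stays_carrier) auto
next
  case (delete u s v)
  then have c: "set u \<subseteq> carrier G" "set s \<subseteq> carrier G" "set v \<subseteq> carrier G" using assms(2) by auto
  have "homot H (h ` X) L (carrier H) \<one>\<^bsub>H\<^esub> (map h u @ map h s @ map h v) (map h u @ map h v)"
  proof (rule homot.delete)
    show "wprod H (map h s) = \<one>\<^bsub>H\<^esub>" using delete wprod_map[OF c(2)] by simp
    show "stays H (carrier H) \<one>\<^bsub>H\<^esub> (map h u @ map h s @ map h v)"
      using c[THEN set_map_closed] by (intro H.stays_carrier) simp_all
    show "set (map h u @ map h s @ map h v) \<subseteq> h ` X" using delete by auto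
  qed (use delete in simp)
  then show ?case by simp
qed (blast intro: homot.sym homot.trans)+

lemma (in group_hom) trivial_words_image:
  assumes wp: "word_presented G X L" and "L \<le> L'" and inj: "inj_on h (carrier G)"
    and w: "set w \<subseteq> h ` X" "wprod H w = \<one>\<^bsub>H\<^esub>"
  shows "homot H (h ` X) L' (carrier H) \<one>\<^bsub>H\<^esub> w []"
proof -
  have X: "X \<subseteq> carrier G" using wp by (auto simp: word_presented_def)
  obtain u where u: "set u \<subseteq> X" "w = map h u" using words_over_image[OF w(1)] by blast
  have uc: "set u \<subseteq> carrier G" using u X by auto
  have "h (wprod G u) = h \<one>\<^bsub>G\<^esub>" using w(2) wprod_map[OF uc] u(2) by simp
  then have "wprod G u = \<one>\<^bsub>G\<^esub>" using inj_onD[OF inj] uc by blast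
  then have "homot G X L (carrier G) \<one>\<^bsub>G\<^esub> u []" using wp u by (auto simp: word_presented_def)
  from homot_hom[OF this X] have "homot H (h ` X) L (carrier H) \<one>\<^bsub>H\<^esub> w []" using u by simp
  then show ?thesis by (rule H.homot_mono) (simp_all add: assms(2))
qed

lemma (in group_hom) half_space_connected_image:
  assumes "half_space_connected G X (\<lambda>g. \<psi> (h g))" "X \<subseteq> carrier G"
  shows "half_space_connected H (h ` X) \<psi>"
proof -
  from assms(1) obtain c where c: "\<forall>u. set u \<subseteq> X \<and> 0 \<le> \<psi> (h (wprod G u)) \<longrightarrow>
    (\<exists>v. set v \<subseteq> X \<and> wprod G v = wprod G u \<and> stays G {g \<in> carrier G. - c \<le> \<psi> (h g)} \<one>\<^bsub>G\<^esub> v)"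
    unfolding half_space_connected_def by blast
  show ?thesis
    unfolding half_space_connected_def
  proof (rule exI[of _ c], intro allI impI)
    fix w assume w: "set w \<subseteq> h ` X \<and> 0 \<le> \<psi> (wprod H w)"
    then obtain u where u: "set u \<subseteq> X" "w = map h u" using words_over_image[of w h X] by blast
    have uc: "set u \<subseteq> carrier G" using u assms(2) by auto
    obtain v where v: "set v \<subseteq> X" "wprod G v = wprod G u" "stays G {g \<in> carrier G. - c \<le> \<psi> (h g)} \<one>\<^bsub>G\<^esub> v"
      using c u w wprod_map[OF uc] by force
    have vc: "set v \<subseteq> carrier G" using v assms(2) by auto
    have "stays H {g \<in> carrier H. - c \<le> \<psi> g} (h \<one>\<^bsub>G\<^esub>) (map h v)"
      unfolding stays_map[OF G.one_closed vc] using v(3) by (rule G.stays_mono) auto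
    then show "\<exists>v. set v \<subseteq> h ` X \<and> wprod H v = wprod H w \<and> stays H {g \<in> carrier H. - c \<le> \<psi> g} \<one>\<^bsub>H\<^esub> v"
      using v u wprod_map[OF vc] wprod_map[OF uc] by (intro exI[of _ "map h v"]) auto
  qed
qed

text \<open>If no letter were positive, closure under inverses would make all letters, and hence all
  words, have value zero.\<close>

lemma (in group) positive_letter:
  assumes \<chi>: "\<And>x y. x \<in> carrier G \<Longrightarrow> y \<in> carrier G \<Longrightarrow> \<chi> (x \<otimes> y) = \<chi> x + (\<chi> y :: real)"
    and X: "X \<subseteq> carrier G" "\<forall>x\<in>X. inv x \<in> X"
    and gen: "\<And>g. g \<in> carrier G \<Longrightarrow> \<exists>w. set w \<subseteq> X \<and> wprod G w = g"
    and g: "g \<in> carrier G" "\<chi> g \<noteq> 0"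
  shows "\<exists>x\<in>X. 0 < \<chi> x"
proof (rule ccontr)
  assume "\<not> ?thesis"
  then have neg: "\<chi> x \<le> 0" if "x \<in> X" for x using that by force
  have one: "\<chi> \<one> = 0" using \<chi>[of \<one> \<one>] by simp
  have zero: "\<chi> x = 0" if "x \<in> X" for x
  proof -
    have "\<chi> x + \<chi> (inv x) = 0" using \<chi>[of x "inv x"] X that one by auto
    then show ?thesis using neg[OF that] neg[of "inv x"] X that by auto
  qed
  obtain w where w: "set w \<subseteq> X" "wprod G w = g" using gen g by blast
  have "\<bar>\<chi> (wprod G w)\<bar> \<le> real (length w) * 0"
    using \<chi> w(1) X(1) by (rule word_value_bound) (simp_all add: zero)
  then show False using w g by simp
qed

text \<open>The coordinates of \<open>Q\<close> are pulled back along the difference \<kappa> of the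
  projections, whose kernel is \<open>H\<close>. A character of \<open>Q\<close> thus restricts to
  \<chi> on the first factor and to \<open>- \<chi>\<close> on the second, which is the pair that
  \<open>cond\<close> speaks about.\<close>

lemma fin_connected_imp_word_presented:
  fixes G1 :: "('a, 'm) monoid_scheme" and G2 :: "('b, 'n) monoid_scheme" and Q :: "('q, 'k) monoid_scheme"
  assumes G1: "group G1" and G2: "group G2" and Q: "comm_group Q"
    and wp1: "word_presented G1 X1 L1" and wp2: "word_presented G2 X2 L2"
    and \<pi>1: "\<pi>1 \<in> hom G1 Q" "\<pi>1 ` carrier G1 = carrier Q"
    and \<pi>2: "\<pi>2 \<in> hom G2 Q" "\<pi>2 ` carrier G2 = carrier Q"
    and cond: "\<And>\<chi>. (\<And>x y. x \<in> carrier Q \<Longrightarrow> y \<in> carrier Q \<Longrightarrow> \<chi> (x \<otimes>\<^bsub>Q\<^esub> y) = \<chi> x + (\<chi> y :: real)) \<Longrightarrow>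
      \<exists>x\<in>carrier Q. \<chi> x \<noteq> 0 \<Longrightarrow>
      fin_connected (character_monoid G1 (\<lambda>g. \<chi> (\<pi>1 g))) \<or> fin_connected (character_monoid G2 (\<lambda>g. - \<chi> (\<pi>2 g)))"
    and H: "subgroup H (G1 \<times>\<times> G2)" "H = {(x, y) \<in> carrier G1 \<times> carrier G2. \<pi>1 x = \<pi>2 y}"
  shows "\<exists>Z M. word_presented ((G1 \<times>\<times> G2)\<lparr>carrier := H\<rparr>) Z M"
proof -
  interpret G1: group G1 by fact
  interpret G2: group G2 by fact
  interpret Q: comm_group Q by fact
  interpret \<pi>1: group_hom G1 Q \<pi>1 by unfold_locales (rule \<pi>1)
  interpret \<pi>2: group_hom G2 Q \<pi>2 by unfold_locales (rule \<pi>2)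
  let ?G = "G1 \<times>\<times> G2"
  interpret G: group ?G by (rule DirProd_group) fact+
  define i1 where "i1 x = (x, \<one>\<^bsub>G2\<^esub>)" for x :: 'a
  define i2 where "i2 y = (\<one>\<^bsub>G1\<^esub>, y)" for y :: 'b
  interpret i1: group_hom G1 ?G i1 by unfold_locales (auto simp: hom_def i1_def)
  interpret i2: group_hom G2 ?G i2 by unfold_locales (auto simp: hom_def i2_def)
  from wp1 have X1: "finite X1" "X1 \<subseteq> carrier G1" "\<forall>x\<in>X1. inv\<^bsub>G1\<^esub> x \<in> X1"
    and gen1: "\<And>g. g \<in> carrier G1 \<Longrightarrow> \<exists>w. set w \<subseteq> X1 \<and> wprod G1 w = g"
    unfolding word_presented_def by auto
  from wp2 have X2: "finite X2" "X2 \<subseteq> carrier G2" "\<forall>x\<in>X2. inv\<^bsub>G2\<^esub> x \<in> X2"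
    and gen2: "\<And>g. g \<in> carrier G2 \<Longrightarrow> \<exists>w. set w \<subseteq> X2 \<and> wprod G2 w = g"
    unfolding word_presented_def by auto
  have surj1: "\<exists>x\<in>carrier G1. \<pi>1 x = q" if "q \<in> carrier Q" for q
    using that unfolding \<pi>1(2)[symmetric] by force
  have surj2: "\<exists>x\<in>carrier G2. \<pi>2 x = q" if "q \<in> carrier Q" for q
    using that unfolding \<pi>2(2)[symmetric] by force
  have "\<exists>d P. Q.integer_coordinates (carrier Q) d P"
  proof (rule Q.integer_coordinates_exist)
    show "finite (\<pi>1 ` X1)" "\<pi>1 ` X1 \<subseteq> carrier Q" using X1 by auto
    fix q assume "q \<in> carrier Q"
    then obtain x where x: "x \<in> carrier G1" "\<pi>1 x = q" using surj1 by blast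
    obtain w where w: "set w \<subseteq> X1" "wprod G1 w = x" using gen1 x by blast
    then have "set w \<subseteq> carrier G1" using X1 by auto
    then show "\<exists>w. set w \<subseteq> \<pi>1 ` X1 \<and> wprod Q w = q"
      using w x \<pi>1.wprod_map by (intro exI[of _ "map \<pi>1 w"]) auto
  qed
  then obtain d P where P: "Q.integer_coordinates (carrier Q) d P" by blast
  note P_add = P[unfolded Q.integer_coordinates_def, THEN conjunct1, rule_format]
  note P_sep = P[unfolded Q.integer_coordinates_def, THEN conjunct2, THEN conjunct1, rule_format]
  note P_fin = P[unfolded Q.integer_coordinates_def, THEN conjunct2, THEN conjunct2, rule_format]
  define \<kappa> where "\<kappa> g = \<pi>1 (fst g) \<otimes>\<^bsub>Q\<^esub> inv\<^bsub>Q\<^esub> \<pi>2 (snd g)" for g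
  define p where "p j g = P j (\<kappa> g)" for j g
  have "\<kappa> \<in> hom ?G Q"
    by (rule homI) (auto simp: \<kappa>_def Q.inv_mult Q.m_ac)
  then interpret \<kappa>: group_hom ?G Q \<kappa> by unfold_locales
  define L where "L = max 4 (max L1 L2)"
  have inj: "inj_on i1 (carrier G1)" "inj_on i2 (carrier G2)" by (auto simp: inj_on_def i1_def i2_def)
  have car: "i1 ` X1 \<subseteq> carrier ?G" "i2 ` X2 \<subseteq> carrier ?G"
    using X1 X2 by (auto simp: i1_def i2_def)
  have in1: "\<exists>x. x \<in> carrier G1 \<and> wprod ?G u = i1 x" if u: "set u \<subseteq> i1 ` X1" for u
  proof -
    obtain v where v: "set v \<subseteq> X1" "u = map i1 v" using words_over_image[OF u] by blast
    then have "set v \<subseteq> carrier G1" using X1 by auto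
    then show ?thesis using i1.wprod_map v by blast
  qed
  have in2: "\<exists>y. y \<in> carrier G2 \<and> wprod ?G u = i2 y" if u: "set u \<subseteq> i2 ` X2" for u
  proof -
    obtain v where v: "set v \<subseteq> X2" "u = map i2 v" using words_over_image[OF u] by blast
    then have "set v \<subseteq> carrier G2" using X2 by auto
    then show ?thesis using i2.wprod_map v by blast
  qed
  have comb_add: "comb_character d P \<alpha> (x \<otimes>\<^bsub>Q\<^esub> y) = comb_character d P \<alpha> x + comb_character d P \<alpha> y"
    if "x \<in> carrier Q" "y \<in> carrier Q" for \<alpha> x y
    unfolding comb_character_def using that by (simp add: P_add sum.distrib algebra_simps)
  have comb: "comb_character d p \<alpha> g = comb_character d P \<alpha> (\<kappa> g)" for \<alpha> g
    by (simp add: comb_character_def p_def)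
  have comb_inv: "comb_character d P \<alpha> (inv\<^bsub>Q\<^esub> x) = - comb_character d P \<alpha> x" if "x \<in> carrier Q" for \<alpha> x
    using comb_add[of x "inv\<^bsub>Q\<^esub> x" \<alpha>] comb_add[of "\<one>\<^bsub>Q\<^esub>" "\<one>\<^bsub>Q\<^esub>" \<alpha>] that by simp
  have comb1: "comb_character d p \<alpha> (i1 x) = comb_character d P \<alpha> (\<pi>1 x)" if "x \<in> carrier G1" for \<alpha> x
    unfolding comb \<kappa>_def i1_def using that by simp
  have comb2: "comb_character d p \<alpha> (i2 y) = - comb_character d P \<alpha> (\<pi>2 y)" if "y \<in> carrier G2" for \<alpha> y
    unfolding comb \<kappa>_def i2_def using that comb_inv by simp
  interpret lattice_words ?G "i1 ` X1" "i2 ` X2" L d p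
  proof unfold_locales
    show "finite (i1 ` X1)" "finite (i2 ` X2)" using X1 X2 by auto
    show "i1 ` X1 \<subseteq> carrier ?G" "i2 ` X2 \<subseteq> carrier ?G" by fact+
    show "\<forall>x\<in>i1 ` X1. inv\<^bsub>?G\<^esub> x \<in> i1 ` X1"
      using X1 by (auto simp flip: i1.hom_inv)
    show "\<forall>x\<in>i2 ` X2. inv\<^bsub>?G\<^esub> x \<in> i2 ` X2"
      using X2 by (auto simp flip: i2.hom_inv)
    show "x \<otimes>\<^bsub>?G\<^esub> y = y \<otimes>\<^bsub>?G\<^esub> x" if "x \<in> i1 ` X1" "y \<in> i2 ` X2" for x y
      using that X1(2) X2(2) by (auto simp: i1_def i2_def subset_iff)
    show "4 \<le> L" by (simp add: L_def)
    show "homot ?G (i1 ` X1) L (carrier ?G) \<one>\<^bsub>?G\<^esub> w []" if "set w \<subseteq> i1 ` X1" "wprod ?G w = \<one>\<^bsub>?G\<^esub>" for w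
      by (rule i1.trivial_words_image[OF wp1 _ inj(1) that]) (simp add: L_def)
    show "homot ?G (i2 ` X2) L (carrier ?G) \<one>\<^bsub>?G\<^esub> w []" if "set w \<subseteq> i2 ` X2" "wprod ?G w = \<one>\<^bsub>?G\<^esub>" for w
      by (rule i2.trivial_words_image[OF wp2 _ inj(2) that]) (simp add: L_def)
    show "wprod ?G u = \<one>\<^bsub>?G\<^esub> \<and> wprod ?G v = \<one>\<^bsub>?G\<^esub>"
      if "set u \<subseteq> i1 ` X1" "set v \<subseteq> i2 ` X2" "wprod ?G u \<otimes>\<^bsub>?G\<^esub> wprod ?G v = \<one>\<^bsub>?G\<^esub>" for u v
      using in1[OF that(1)] in2[OF that(2)] that(3) by (auto simp: i1_def i2_def)
    show "p j (x \<otimes>\<^bsub>?G\<^esub> y) = p j x + p j y" if "j < d" "x \<in> carrier ?G" "y \<in> carrier ?G" for j x y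
      unfolding p_def \<kappa>.hom_mult[OF that(2,3)] using that \<kappa>.hom_closed by (intro P_add)
    show "\<exists>w. set w \<subseteq> i1 ` X1 \<union> i2 ` X2 \<and> wprod ?G w = g" if g: "g \<in> carrier ?G" for g
    proof -
      obtain x y where xy: "g = (x, y)" "x \<in> carrier G1" "y \<in> carrier G2" using g by auto
      obtain u where u: "set u \<subseteq> X1" "wprod G1 u = x" using gen1 xy by blast
      obtain v where v: "set v \<subseteq> X2" "wprod G2 v = y" using gen2 xy by blast
      have c: "set u \<subseteq> carrier G1" "set v \<subseteq> carrier G2" using u v X1 X2 by auto
      have "wprod ?G (map i1 u @ map i2 v) = i1 x \<otimes>\<^bsub>?G\<^esub> i2 y"
        using c u v i1.wprod_map[OF c(1)] i2.wprod_map[OF c(2)] by (subst G.wprod_append[OF i1.set_map_closed[OF c(1)] i2.set_map_closed[OF c(2)]]) simp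
      also have "\<dots> = g" using xy by (simp add: i1_def i2_def)
      finally show ?thesis using u v by (intro exI[of _ "map i1 u @ map i2 v"]) auto
    qed
    fix \<alpha> :: "nat \<Rightarrow> real" assume \<alpha>: "(\<Sum>j<d. (\<alpha> j)\<^sup>2) = 1"
    let ?\<chi> = "comb_character d P \<alpha>"
    have "\<exists>j<d. \<alpha> j \<noteq> 0"
    proof (rule ccontr)
      assume "\<not> ?thesis"
      then have "(\<Sum>j<d. (\<alpha> j)\<^sup>2) = 0" by simp
      then show False using \<alpha> by simp
    qed
    then obtain q where q: "q \<in> carrier Q" "?\<chi> q \<noteq> 0" using P_sep by blast
    have add1: "?\<chi> (\<pi>1 (x \<otimes>\<^bsub>G1\<^esub> y)) = ?\<chi> (\<pi>1 x) + ?\<chi> (\<pi>1 y)" if "x \<in> carrier G1" "y \<in> carrier G1" for x y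
      using that by (simp add: comb_add)
    have add2: "- ?\<chi> (\<pi>2 (x \<otimes>\<^bsub>G2\<^esub> y)) = - ?\<chi> (\<pi>2 x) + - ?\<chi> (\<pi>2 y)" if "x \<in> carrier G2" "y \<in> carrier G2" for x y
      using that by (simp add: comb_add)
    have cong1: "half_space_connected G1 X1 (\<lambda>g. comb_character d p \<alpha> (i1 g))"
      if "fin_connected (character_monoid G1 (\<lambda>g. ?\<chi> (\<pi>1 g)))"
    proof (rule G1.half_space_connected_if_fin_connected[OF _ X1 gen1])
      have "character_monoid G1 (\<lambda>g. comb_character d p \<alpha> (i1 g)) = character_monoid G1 (\<lambda>g. ?\<chi> (\<pi>1 g))"
        unfolding character_monoid_def using comb1 by (intro arg_cong[of _ _ "\<lambda>A. G1\<lparr>carrier := A\<rparr>"]) auto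
      then show "fin_connected (character_monoid G1 (\<lambda>g. comb_character d p \<alpha> (i1 g)))" using that by simp
    qed (use comb1 add1 in \<open>auto simp del: i1.hom_mult \<pi>1.hom_mult\<close>)
    have cong2: "half_space_connected G2 X2 (\<lambda>g. comb_character d p \<alpha> (i2 g))"
      if "fin_connected (character_monoid G2 (\<lambda>g. - ?\<chi> (\<pi>2 g)))"
    proof (rule G2.half_space_connected_if_fin_connected[OF _ X2 gen2])
      have "character_monoid G2 (\<lambda>g. comb_character d p \<alpha> (i2 g)) = character_monoid G2 (\<lambda>g. - ?\<chi> (\<pi>2 g))"
        unfolding character_monoid_def using comb2 by (intro arg_cong[of _ _ "\<lambda>A. G2\<lparr>carrier := A\<rparr>"]) auto
      then show "fin_connected (character_monoid G2 (\<lambda>g. comb_character d p \<alpha> (i2 g)))" using that by simp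
    qed (use comb2 add2 in \<open>auto simp del: i2.hom_mult \<pi>2.hom_mult\<close>)
    have "fin_connected (character_monoid G1 (\<lambda>g. ?\<chi> (\<pi>1 g))) \<or> fin_connected (character_monoid G2 (\<lambda>g. - ?\<chi> (\<pi>2 g)))"
      using comb_add q by (intro cond) auto
    then have A: "half_space_connected ?G (i1 ` X1) (comb_character d p \<alpha>) \<or>
        half_space_connected ?G (i2 ` X2) (comb_character d p \<alpha>)"
      using cong1 cong2 i1.half_space_connected_image[OF _ X1(2)] i2.half_space_connected_image[OF _ X2(2)] by blast
    obtain x y where xy: "x \<in> carrier G1" "\<pi>1 x = q" "y \<in> carrier G2" "\<pi>2 y = q"
      using surj1[OF q(1)] surj2[OF q(1)] by blast
    have "\<exists>a\<in>X1. 0 < ?\<chi> (\<pi>1 a)"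
    proof (rule G1.positive_letter[where \<chi> = "\<lambda>x. ?\<chi> (\<pi>1 x)" and g = x and X = X1])
      show "?\<chi> (\<pi>1 x) \<noteq> 0" using q(2) by (simp only: xy(2) not_False_eq_True)
    qed (rule add1 X1 gen1 xy | assumption)+
    then obtain a where a: "a \<in> X1" "0 < ?\<chi> (\<pi>1 a)" by (rule bexE)
    then have "0 < comb_character d p \<alpha> (i1 a)" using X1(2) by (simp only: comb1 subsetD)
    from this imageI[OF a(1)] have B: "\<exists>a\<in>i1 ` X1. 0 < comb_character d p \<alpha> a" by (rule bexI)
    have "\<exists>b\<in>X2. 0 < - ?\<chi> (\<pi>2 b)"
    proof (rule G2.positive_letter[where \<chi> = "\<lambda>y. - ?\<chi> (\<pi>2 y)" and g = y and X = X2])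
      show "- ?\<chi> (\<pi>2 y) \<noteq> 0" using q(2) by (simp only: xy(4) neg_equal_0_iff_equal not_False_eq_True)
    qed (rule add2 X2 gen2 xy | assumption)+
    then obtain b where b: "b \<in> X2" "0 < - ?\<chi> (\<pi>2 b)" by (rule bexE)
    then have "0 < comb_character d p \<alpha> (i2 b)" using X2(2) by (simp only: comb2 subsetD)
    from this imageI[OF b(1)] have C: "\<exists>b\<in>i2 ` X2. 0 < comb_character d p \<alpha> b" by (rule bexI)
    show "(half_space_connected ?G (i1 ` X1) (comb_character d p \<alpha>) \<or>
        half_space_connected ?G (i2 ` X2) (comb_character d p \<alpha>)) \<and>
      (\<exists>a\<in>i1 ` X1. 0 < comb_character d p \<alpha> a) \<and> (\<exists>b\<in>i2 ` X2. 0 < comb_character d p \<alpha> b)"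
      using A B C by blast
  qed
  have H_iff: "g \<in> H \<longleftrightarrow> \<kappa> g = \<one>\<^bsub>Q\<^esub>" if "g \<in> carrier ?G" for g
  proof -
    obtain x y where xy: "g = (x, y)" "x \<in> carrier G1" "y \<in> carrier G2" using \<open>g \<in> carrier ?G\<close> by auto
    have "\<pi>1 x = \<pi>2 y \<longleftrightarrow> \<pi>1 x \<otimes>\<^bsub>Q\<^esub> inv\<^bsub>Q\<^esub> \<pi>2 y = \<one>\<^bsub>Q\<^esub>"
      using xy(2,3) by (metis Q.inv_solve_right' Q.l_one Q.one_closed \<pi>1.hom_closed \<pi>2.hom_closed)
    then show ?thesis unfolding H(2) \<kappa>_def using xy by auto
  qed
  show ?thesis
  proof (rule kernel_word_presented[OF H(1)])
    fix g g' assume g: "g \<in> carrier ?G" "g' \<in> carrier ?G"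
    have "\<kappa> g = \<kappa> g' \<longleftrightarrow> \<kappa> g \<otimes>\<^bsub>Q\<^esub> inv\<^bsub>Q\<^esub> \<kappa> g' = \<one>\<^bsub>Q\<^esub>"
      using g by (metis Q.inv_solve_right' Q.l_one Q.one_closed \<kappa>.hom_closed)
    moreover have "\<kappa> (g \<otimes>\<^bsub>?G\<^esub> inv\<^bsub>?G\<^esub> g') = \<kappa> g \<otimes>\<^bsub>Q\<^esub> inv\<^bsub>Q\<^esub> \<kappa> g'"
      unfolding \<kappa>.hom_mult[OF g(1) G.inv_closed[OF g(2)]] \<kappa>.hom_inv[OF g(2)] ..
    ultimately show "\<kappa> g = \<kappa> g' \<longleftrightarrow> g \<otimes>\<^bsub>?G\<^esub> inv\<^bsub>?G\<^esub> g' \<in> H"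
      using H_iff[OF G.m_closed[OF g(1) G.inv_closed[OF g(2)]]] by simp
  next
    fix r
    have "\<kappa> ` sublevel r \<subseteq> {x \<in> carrier Q. sq_norm d P x \<le> r}"
      unfolding sublevel_def sq_norm_def p_def using \<kappa>.hom_closed by auto
    then show "finite (\<kappa> ` sublevel r)" using P_fin by (rule finite_subset)
  next
    fix j h assume "j < d" "h \<in> H"
    then have "\<kappa> h = \<one>\<^bsub>Q\<^esub>" using H_iff[of h] H(1) by (auto dest: subgroup.mem_carrier)
    then show "p j h = 0" unfolding p_def using P_add[OF \<open>j < d\<close>, of "\<one>\<^bsub>Q\<^esub>" "\<one>\<^bsub>Q\<^esub>"] by simp
  qed
qed

section \<open>Character spheres\<close>

lemma characters_add:
  "\<lbrakk>\<chi> \<in> characters G; x \<in> carrier G; y \<in> carrier G\<rbrakk> \<Longrightarrow> \<chi> (x \<otimes>\<^bsub>G\<^esub> y) = \<chi> x + \<chi> y"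
  by (auto simp: characters_def hom_def real_group_def)

lemma restrict_characters:
  assumes "group G" "\<And>x y. x \<in> carrier G \<Longrightarrow> y \<in> carrier G \<Longrightarrow> \<chi> (x \<otimes>\<^bsub>G\<^esub> y) = \<chi> x + \<chi> y"
  shows "restrict \<chi> (carrier G) \<in> characters G"
proof -
  interpret group G by fact
  show ?thesis using assms(2) by (auto simp: characters_def hom_def real_group_def)
qed

lemma nonzero_characters_iff:
  "\<chi> \<in> nonzero_characters G \<longleftrightarrow> \<chi> \<in> characters G \<and> (\<exists>g\<in>carrier G. \<chi> g \<noteq> 0)"
proof -
  have "\<chi> = (\<lambda>g\<in>carrier G. 0) \<longleftrightarrow> (\<forall>g\<in>carrier G. \<chi> g = 0)" if "\<chi> \<in> characters G"
    using that by (auto simp: characters_def fun_eq_iff extensional_def)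
  then show ?thesis by (auto simp: nonzero_characters_def)
qed

lemma character_monoid_cong:
  assumes "\<And>g. g \<in> carrier G \<Longrightarrow> 0 \<le> \<chi> g \<longleftrightarrow> 0 \<le> \<chi>' g"
  shows "character_monoid G \<chi> = character_monoid G \<chi>'"
proof -
  have "{g \<in> carrier G. 0 \<le> \<chi> g} = {g \<in> carrier G. 0 \<le> \<chi>' g}" using assms by auto
  then show ?thesis by (simp add: character_monoid_def)
qed

lemma ray_eqE:
  assumes "\<chi> \<in> characters G" "ray G \<chi> = ray G \<chi>'"
  obtains t where "0 < t" "\<And>g. g \<in> carrier G \<Longrightarrow> \<chi> g = t * \<chi>' g"
proof -
  have "\<chi> = (\<lambda>g\<in>carrier G. 1 * \<chi> g)"
    using assms(1) by (auto simp: characters_def fun_eq_iff extensional_def)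
  then have "\<chi> \<in> ray G \<chi>" unfolding ray_def by (intro CollectI exI[of _ 1]) simp
  then obtain t where t: "0 < t" "\<chi> = (\<lambda>g\<in>carrier G. t * \<chi>' g)"
    unfolding assms(2) unfolding ray_def by blast
  then have "\<chi> g = t * \<chi>' g" if "g \<in> carrier G" for g using that by simp
  then show ?thesis using t(1) that by blast
qed

text \<open>Characters on the same ray differ by a positive factor, so they have the same half space
  and connectivity can be tested on any representative.\<close>

lemma (in group) Sigma1_iff:
  assumes \<chi>: "\<chi> \<in> nonzero_characters G"
  shows "ray G \<chi> \<in> Sigma1 G \<longleftrightarrow> fin_connected (character_monoid G \<chi>)"
proof -
  have FP: "FP_monoid 1 (character_monoid G \<chi>) \<longleftrightarrow> fin_connected (character_monoid G \<chi>)"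
    if "\<chi> \<in> nonzero_characters G" for \<chi>
    using that by (intro FP_monoid_1_iff_fin_connected monoid_character_monoid) (simp add: nonzero_characters_iff)
  show ?thesis
  proof
    assume "ray G \<chi> \<in> Sigma1 G"
    then obtain \<chi>' where \<chi>': "ray G \<chi> = ray G \<chi>'" "\<chi>' \<in> nonzero_characters G"
      "fin_connected (character_monoid G \<chi>')"
      unfolding Sigma1_def using FP by auto
    obtain t where t: "0 < t" "\<And>g. g \<in> carrier G \<Longrightarrow> \<chi> g = t * \<chi>' g"
      using ray_eqE[OF _ \<chi>'(1)] \<chi> unfolding nonzero_characters_iff by blast
    have "character_monoid G \<chi> = character_monoid G \<chi>'"
      using t by (intro character_monoid_cong) (simp add: zero_le_mult_iff)
    then show "fin_connected (character_monoid G \<chi>)" using \<chi>'(3) by simp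
  next
    assume "fin_connected (character_monoid G \<chi>)"
    then show "ray G \<chi> \<in> Sigma1 G" unfolding Sigma1_def using \<chi> FP[OF \<chi>] by blast
  qed
qed

lemma character_subsphere_iff:
  assumes \<chi>: "\<chi> \<in> nonzero_characters G" and N: "N \<subseteq> carrier G"
  shows "ray G \<chi> \<in> character_subsphere G N \<longleftrightarrow> (\<forall>g\<in>N. \<chi> g = 0)"
proof
  assume "ray G \<chi> \<in> character_subsphere G N"
  then obtain \<chi>' where \<chi>': "ray G \<chi> = ray G \<chi>'" "\<forall>g\<in>N. \<chi>' g = 0"
    unfolding character_subsphere_def by blast
  obtain t where t: "0 < t" "\<And>g. g \<in> carrier G \<Longrightarrow> \<chi> g = t * \<chi>' g"
    using ray_eqE[OF _ \<chi>'(1)] \<chi> unfolding nonzero_characters_iff by blast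
  show "\<forall>g\<in>N. \<chi> g = 0" using t(2) \<chi>'(2) N by auto
qed (use \<chi> in \<open>auto simp: character_subsphere_def\<close>)

lemma (in group) uminus_nonzero_characters:
  assumes "\<chi> \<in> nonzero_characters G"
  shows "(\<lambda>g\<in>carrier G. - \<chi> g) \<in> nonzero_characters G"
proof -
  have "restrict (\<lambda>g. - \<chi> g) (carrier G) \<in> characters G"
    using assms characters_add[of \<chi> G] unfolding nonzero_characters_iff
    by (intro restrict_characters is_group) auto
  then show ?thesis using assms unfolding nonzero_characters_iff by auto
qed

lemma (in group) antipodal_Sigma1_iff:
  assumes \<chi>: "\<chi> \<in> nonzero_characters G"
  shows "ray G \<chi> \<in> antipodal G (Sigma1 G) \<longleftrightarrow> fin_connected (character_monoid G (\<lambda>g. - \<chi> g))"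
proof
  assume "ray G \<chi> \<in> antipodal G (Sigma1 G)"
  then obtain \<chi>' where \<chi>': "ray G \<chi> = ray G (\<lambda>g\<in>carrier G. - \<chi>' g)" "\<chi>' \<in> nonzero_characters G"
    "ray G \<chi>' \<in> Sigma1 G"
    unfolding antipodal_def by blast
  obtain t where t: "0 < t" "\<And>g. g \<in> carrier G \<Longrightarrow> \<chi> g = t * (\<lambda>g\<in>carrier G. - \<chi>' g) g"
    using ray_eqE[OF _ \<chi>'(1)] \<chi> unfolding nonzero_characters_iff by blast
  have "character_monoid G (\<lambda>g. - \<chi> g) = character_monoid G \<chi>'"
    using t by (intro character_monoid_cong) (simp add: zero_le_mult_iff mult_le_0_iff)
  then show "fin_connected (character_monoid G (\<lambda>g. - \<chi> g))" using \<chi>' Sigma1_iff by simp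
next
  assume conn: "fin_connected (character_monoid G (\<lambda>g. - \<chi> g))"
  let ?\<chi> = "\<lambda>g\<in>carrier G. - \<chi> g"
  have "character_monoid G ?\<chi> = character_monoid G (\<lambda>g. - \<chi> g)"
    by (rule character_monoid_cong) simp
  then have S: "ray G ?\<chi> \<in> Sigma1 G"
    using conn Sigma1_iff[OF uminus_nonzero_characters[OF \<chi>]] by simp
  have "(\<lambda>g\<in>carrier G. - ?\<chi> g) = \<chi>"
    using \<chi> unfolding nonzero_characters_iff by (auto simp: characters_def extensional_def fun_eq_iff)
  then show "ray G \<chi> \<in> antipodal G (Sigma1 G)"
    unfolding antipodal_def using S uminus_nonzero_characters[OF \<chi>] by (intro CollectI exI[of _ ?\<chi>]) simp
qed

lemma comm_group_quotient:
  fixes G (structure)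
  assumes "N \<lhd> G" "derived G (carrier G) \<subseteq> N"
  shows "comm_group (G Mod N)"
proof -
  interpret normal N G by fact
  interpret Q: group "G Mod N" by (rule factorgroup_is_group)
  have coset: "\<exists>x\<in>carrier G. C = N #> x" if "C \<in> carrier (G Mod N)" for C
    using that by (auto simp: FactGroup_def RCOSETS_def)
  show ?thesis
  proof (rule Q.group_comm_groupI)
    fix C D assume "C \<in> carrier (G Mod N)" "D \<in> carrier (G Mod N)"
    then obtain x y where xy: "x \<in> carrier G" "C = N #> x" "y \<in> carrier G" "D = N #> y"
      using coset by blast
    have "x \<otimes> y \<otimes> inv x \<otimes> inv y \<in> derived_set G (carrier G)" using xy by blast
    then have "x \<otimes> y \<otimes> inv x \<otimes> inv y \<in> N"
      using assms(2) unfolding derived_def by (blast intro: generate.incl)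
    moreover have "x \<otimes> y = (x \<otimes> y \<otimes> inv x \<otimes> inv y) \<otimes> (y \<otimes> x)"
    proof -
      have "(x \<otimes> y \<otimes> inv x \<otimes> inv y) \<otimes> (y \<otimes> x) = x \<otimes> y \<otimes> (inv x \<otimes> ((inv y \<otimes> y) \<otimes> x))"
        using xy by (simp only: m_assoc m_closed inv_closed)
      also have "\<dots> = x \<otimes> y" using xy by simp
      finally show ?thesis by simp
    qed
    ultimately have "x \<otimes> y \<in> N #> (y \<otimes> x)" unfolding r_coset_def by blast
    then have "N #> (y \<otimes> x) = N #> (x \<otimes> y)"
      using xy by (intro repr_independence subgroup_axioms) auto
    then show "C \<otimes>\<^bsub>G Mod N\<^esub> D = D \<otimes>\<^bsub>G Mod N\<^esub> C"
      using xy by (simp add: FactGroup_def rcos_sum)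
  qed
qed

theorem theoremC:
  fixes G1 :: "('a, 'm) monoid_scheme" and G2 :: "('b, 'n) monoid_scheme"
    and N1 :: "'a set" and N2 :: "'b set" and \<mu> :: "'a set \<Rightarrow> 'b set"
  assumes "group G1" and "group G2"
    and "finitely_presented G1" and "finitely_presented G2"
    and "N1 \<lhd> G1" and "N2 \<lhd> G2"
    and "derived G1 (carrier G1) \<subseteq> N1" and "derived G2 (carrier G2) \<subseteq> N2"
    and "\<mu> \<in> iso (G1 Mod N1) (G2 Mod N2)"
  shows "finitely_presented (fibre_product G1 N1 G2 N2 \<mu>) \<longleftrightarrow>
    dual_image G1 N1 G2 N2 \<mu> ((character_sphere G2 - Sigma1 G2) \<inter> character_subsphere G2 N2)
      \<subseteq> antipodal G1 (Sigma1 G1) \<inter> character_subsphere G1 N1"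
proof -
  interpret N1: normal N1 G1 by fact
  interpret N2: normal N2 G2 by fact
  let ?Q = "G2 Mod N2"
  have \<mu>: "\<mu> \<in> hom (G1 Mod N1) ?Q" "\<mu> ` carrier (G1 Mod N1) = carrier ?Q"
    using assms(9) by (auto simp: iso_def bij_betw_def)
  interpret Q: comm_group ?Q by (rule comm_group_quotient) fact+
  interpret Q1: group "G1 Mod N1" by (rule N1.factorgroup_is_group)
  define \<pi>1 where "\<pi>1 g = \<mu> (g <#\<^bsub>G1\<^esub> N1)" for g
  define \<pi>2 where "\<pi>2 g = g <#\<^bsub>G2\<^esub> N2" for g
  have c1: "carrier (G1 Mod N1) = (\<lambda>g. g <#\<^bsub>G1\<^esub> N1) ` carrier G1"
    using N1.coset_eq by (auto simp: FactGroup_def RCOSETS_def)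
  have c2: "carrier ?Q = \<pi>2 ` carrier G2"
    unfolding \<pi>2_def using N2.coset_eq by (auto simp: FactGroup_def RCOSETS_def)
  have h1: "(\<lambda>g. g <#\<^bsub>G1\<^esub> N1) \<in> hom G1 (G1 Mod N1)"
    using N1.r_coset_hom_Mod N1.coset_eq by (auto simp: hom_def Pi_iff)
  have \<pi>1: "\<pi>1 \<in> hom G1 ?Q" "\<pi>1 ` carrier G1 = carrier ?Q"
  proof -
    show "\<pi>1 \<in> hom G1 ?Q"
      using hom_compose[OF h1 \<mu>(1)] by (simp add: \<pi>1_def[abs_def] comp_def)
    show "\<pi>1 ` carrier G1 = carrier ?Q"
      unfolding \<mu>(2)[symmetric] c1 image_image \<pi>1_def ..
  qed
  have \<pi>2: "\<pi>2 \<in> hom G2 ?Q" "\<pi>2 ` carrier G2 = carrier ?Q"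
    using N2.r_coset_hom_Mod N2.coset_eq c2 by (auto simp: \<pi>2_def hom_def Pi_iff)
  interpret \<pi>1: group_hom G1 ?Q \<pi>1 by unfold_locales (rule \<pi>1)
  interpret \<pi>2: group_hom G2 ?Q \<pi>2 by unfold_locales (rule \<pi>2)
  have one: "\<one>\<^bsub>?Q\<^esub> = N2" "\<one>\<^bsub>G1 Mod N1\<^esub> = N1" by (simp_all add: FactGroup_def)
  have ker2: "\<pi>2 n = \<one>\<^bsub>?Q\<^esub>" if "n \<in> N2" for n
    unfolding \<pi>2_def one using that N2.coset_eq N2.coset_join2[of n N2] N2.subset N2.subgroup_axioms by auto
  have ker1: "\<pi>1 n = \<one>\<^bsub>?Q\<^esub>" if "n \<in> N1" for n
  proof -
    have "n <#\<^bsub>G1\<^esub> N1 = \<one>\<^bsub>G1 Mod N1\<^esub>"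
      unfolding one using that N1.coset_eq N1.coset_join2[of n N1] N1.subset N1.subgroup_axioms by auto
    then show ?thesis unfolding \<pi>1_def using hom_one[OF \<mu>(1) Q1.is_group Q.is_group] by simp
  qed
  have surj1: "\<exists>x\<in>carrier G1. \<pi>1 x = q" if "q \<in> carrier ?Q" for q
    using that unfolding \<pi>1(2)[symmetric] by force
  have surj2: "\<exists>x\<in>carrier G2. \<pi>2 x = q" if "q \<in> carrier ?Q" for q
    using that unfolding \<pi>2(2)[symmetric] by force
  let ?H = "fibre_product_set G1 N1 G2 N2 \<mu>"
  let ?K = "fibre_product G1 N1 G2 N2 \<mu>"
  have H_eq: "?H = {(x, y) \<in> carrier G1 \<times> carrier G2. \<pi>1 x = \<pi>2 y}"
    by (simp add: fibre_product_set_def \<pi>1_def \<pi>2_def)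
  interpret D: group "G1 \<times>\<times> G2" by (rule DirProd_group) fact+
  have H: "subgroup ?H (G1 \<times>\<times> G2)"
    by (rule subgroup_fibre_product_set[OF assms(5,6) \<mu>(1)])
  interpret K: group ?K
    unfolding fibre_product_def by (rule subgroup.subgroup_is_group[OF H D.is_group])

  \<comment> \<open>The character of \<open>G1\<close> that corresponds to \<chi> through the common
    quotient. By \<open>pull_val\<close> it takes at one component of a point of the fibre product
    the value of \<chi> at the other component.\<close>
  define pull where "pull \<chi> = inflate_character G1 N1 (dual_map (G1 Mod N1) \<mu> (descend_character G2 N2 \<chi>))" for \<chi>
  have pull_val: "pull \<chi> x = \<chi> y"
    if \<chi>: "\<chi> \<in> characters G2" "\<forall>n\<in>N2. \<chi> n = 0" and xy: "x \<in> carrier G1" "y \<in> carrier G2" "\<pi>1 x = \<pi>2 y" for \<chi> x y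
  proof -
    have "x <#\<^bsub>G1\<^esub> N1 \<in> carrier (G1 Mod N1)" using xy(1) c1 by blast
    then have "pull \<chi> x = descend_character G2 N2 \<chi> (\<pi>1 x)"
      using xy(1) by (simp add: pull_def inflate_character_def dual_map_def compose_def \<pi>1_def)
    also have "\<dots> = \<chi> y"
      unfolding xy(3) \<pi>2_def using \<chi> xy(2) by (intro N2.descend_character_apply) auto
    finally show ?thesis .
  qed
  have pull_char: "pull \<chi> \<in> nonzero_characters G1 \<and> (\<forall>n\<in>N1. pull \<chi> n = 0)"
    if \<chi>: "\<chi> \<in> nonzero_characters G2" "\<forall>n\<in>N2. \<chi> n = 0" for \<chi>
  proof -
    have \<chi>c: "\<chi> \<in> characters G2" using \<chi>(1) by (simp add: nonzero_characters_iff)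
    obtain y where y: "y \<in> carrier G2" "\<chi> y \<noteq> 0" using \<chi>(1) by (auto simp: nonzero_characters_iff)
    obtain x where x: "x \<in> carrier G1" "\<pi>1 x = \<pi>2 y" using surj1[OF \<pi>2.hom_closed[OF y(1)]] by blast
    have add: "pull \<chi> (a \<otimes>\<^bsub>G1\<^esub> b) = pull \<chi> a + pull \<chi> b" if ab: "a \<in> carrier G1" "b \<in> carrier G1" for a b
    proof -
      obtain a' where a': "a' \<in> carrier G2" "\<pi>2 a' = \<pi>1 a" using surj2[OF \<pi>1.hom_closed[OF ab(1)]] by blast
      obtain b' where b': "b' \<in> carrier G2" "\<pi>2 b' = \<pi>1 b" using surj2[OF \<pi>1.hom_closed[OF ab(2)]] by blast
      have "pull \<chi> (a \<otimes>\<^bsub>G1\<^esub> b) = \<chi> (a' \<otimes>\<^bsub>G2\<^esub> b')"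
        using ab a' b' by (intro pull_val[OF \<chi>c \<chi>(2)]) auto
      also have "\<dots> = \<chi> a' + \<chi> b'" using characters_add[OF \<chi>c] a' b' by simp
      also have "\<dots> = pull \<chi> a + pull \<chi> b"
        using pull_val[OF \<chi>c \<chi>(2) ab(1) a'(1)] pull_val[OF \<chi>c \<chi>(2) ab(2) b'(1)] a' b' by simp
      finally show ?thesis .
    qed
    have "restrict (pull \<chi>) (carrier G1) \<in> characters G1"
      using add by (intro restrict_characters N1.is_group)
    moreover have "restrict (pull \<chi>) (carrier G1) = pull \<chi>"
      by (simp add: pull_def inflate_character_def)
    ultimately have "pull \<chi> \<in> characters G1" by simp
    moreover have "pull \<chi> x \<noteq> 0" using pull_val[OF \<chi>c \<chi>(2) x(1) y(1) x(2)] y(2) by simp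
    moreover have "pull \<chi> n = 0" if n: "n \<in> N1" for n
    proof -
      have "n \<in> carrier G1" using n N1.subset by blast
      moreover have "\<pi>1 n = \<pi>2 \<one>\<^bsub>G2\<^esub>" using ker1[OF n] by simp
      ultimately have "pull \<chi> n = \<chi> \<one>\<^bsub>G2\<^esub>" by (intro pull_val[OF \<chi>c \<chi>(2)]) auto
      also have "\<dots> = 0" using \<chi>(2) subgroup.one_closed[OF N2.subgroup_axioms] by blast
      finally show ?thesis .
    qed
    ultimately show ?thesis using x(1) unfolding nonzero_characters_iff by blast
  qed
  \<comment> \<open>The inclusion between subsets of spheres becomes a statement about characters:
    for each of them one of two half spaces is connected. Membership in the subsphere of
    \<open>N1\<close> is supplied by \<open>pull_char\<close>.\<close>
  have cond: "dual_image G1 N1 G2 N2 \<mu> ((character_sphere G2 - Sigma1 G2) \<inter> character_subsphere G2 N2)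
      \<subseteq> antipodal G1 (Sigma1 G1) \<inter> character_subsphere G1 N1 \<longleftrightarrow>
    (\<forall>\<chi>\<in>nonzero_characters G2. (\<forall>n\<in>N2. \<chi> n = 0) \<longrightarrow>
      fin_connected (character_monoid G2 \<chi>) \<or> fin_connected (character_monoid G1 (\<lambda>g. - pull \<chi> g)))"
    (is "?A \<subseteq> ?B \<longleftrightarrow> ?C")
  proof -
    have mem: "ray G2 \<chi> \<in> (character_sphere G2 - Sigma1 G2) \<inter> character_subsphere G2 N2 \<longleftrightarrow>
        \<not> fin_connected (character_monoid G2 \<chi>) \<and> (\<forall>n\<in>N2. \<chi> n = 0)" if "\<chi> \<in> nonzero_characters G2" for \<chi>
      using N2.Sigma1_iff[OF that] character_subsphere_iff[OF that N2.subset] that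
      by (auto simp: character_sphere_def)
    have memB: "ray G1 (pull \<chi>) \<in> ?B \<longleftrightarrow> fin_connected (character_monoid G1 (\<lambda>g. - pull \<chi> g))"
      if "\<chi> \<in> nonzero_characters G2" "\<forall>n\<in>N2. \<chi> n = 0" for \<chi>
      using pull_char[OF that] N1.antipodal_Sigma1_iff character_subsphere_iff[OF _ N1.subset] by blast
    have A: "X \<in> ?A \<longleftrightarrow> (\<exists>\<chi>. X = ray G1 (pull \<chi>) \<and> \<chi> \<in> nonzero_characters G2 \<and>
        \<not> fin_connected (character_monoid G2 \<chi>) \<and> (\<forall>n\<in>N2. \<chi> n = 0))" for X
      unfolding dual_image_def pull_def[symmetric] mem_Collect_eq
      by (intro ex_cong1 conj_cong HOL.refl) (rule mem)
    show ?thesis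
    proof
      assume sub: "?A \<subseteq> ?B"
      show ?C
      proof (intro ballI impI disjCI)
        fix \<chi> assume \<chi>: "\<chi> \<in> nonzero_characters G2" "\<forall>n\<in>N2. \<chi> n = 0"
          "\<not> fin_connected (character_monoid G1 (\<lambda>g. - pull \<chi> g))"
        have "ray G1 (pull \<chi>) \<notin> ?A" using sub memB[OF \<chi>(1,2)] \<chi>(3) by (meson subsetD)
        then show "fin_connected (character_monoid G2 \<chi>)" unfolding A using \<chi>(1,2) by metis
      qed
    next
      assume C: ?C
      show "?A \<subseteq> ?B"
      proof
        fix X assume "X \<in> ?A"
        then obtain \<chi> where \<chi>: "X = ray G1 (pull \<chi>)" "\<chi> \<in> nonzero_characters G2"
            "\<not> fin_connected (character_monoid G2 \<chi>)" "\<forall>n\<in>N2. \<chi> n = 0"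
          unfolding A by (elim exE conjE)
        then show "X \<in> ?B" using memB[OF \<chi>(2,4)] C[rule_format, OF \<chi>(2)] by metis
      qed
    qed
  qed
  show ?thesis
    unfolding cond
  proof (intro iffI ballI impI)
    fix \<chi> assume fp: "finitely_presented ?K"
      and \<chi>: "\<chi> \<in> nonzero_characters G2" "\<forall>n\<in>N2. \<chi> n = 0"
    obtain Y L where Y: "word_presented ?K Y L"
      using finitely_presentedE[OF K.is_group fp] .
    have carK: "carrier ?K = ?H" by (simp add: fibre_product_def)
    have \<chi>c: "\<chi> \<in> characters G2" using \<chi>(1) by (simp add: nonzero_characters_iff)
    have pull: "pull \<chi> \<in> characters G1" "\<exists>g\<in>carrier G1. pull \<chi> g \<noteq> 0"
      using pull_char[OF \<chi>] by (auto simp: nonzero_characters_iff)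
    have "fin_connected (character_monoid G1 (\<lambda>g. - pull \<chi> g)) \<or> fin_connected (character_monoid G2 \<chi>)"
    proof (rule word_presented_imp_fin_connected[OF K.is_group assms(1,2) Y])
      show "fst \<in> hom ?K G1" "snd \<in> hom ?K G2"
        unfolding hom_def carK H_eq by (auto simp: fibre_product_def)
      show "fst ` carrier ?K = carrier G1"
      proof (intro equalityI subsetI)
        fix x assume x: "x \<in> carrier G1"
        obtain y where "y \<in> carrier G2" "\<pi>2 y = \<pi>1 x" using surj2[OF \<pi>1.hom_closed[OF x]] by blast
        then have "(x, y) \<in> carrier ?K" unfolding carK H_eq using x by simp
        then show "x \<in> fst ` carrier ?K" by force
      qed (auto simp: carK H_eq)
      show "snd ` carrier ?K = carrier G2"
      proof (intro equalityI subsetI)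
        fix y assume y: "y \<in> carrier G2"
        obtain x where "x \<in> carrier G1" "\<pi>1 x = \<pi>2 y" using surj1[OF \<pi>2.hom_closed[OF y]] by blast
        then have "(x, y) \<in> carrier ?K" unfolding carK H_eq using y by simp
        then show "y \<in> snd ` carrier ?K" by force
      qed (auto simp: carK H_eq)
      show "h = \<one>\<^bsub>?K\<^esub>" if "h \<in> carrier ?K" "fst h = \<one>\<^bsub>G1\<^esub>" "snd h = \<one>\<^bsub>G2\<^esub>" for h
        using that by (simp add: fibre_product_def prod_eq_iff)
      show "\<exists>h\<in>carrier ?K. fst h = n \<and> snd h = \<one>\<^bsub>G2\<^esub>" if n: "n \<in> N1" for n
        unfolding carK H_eq using ker1[OF n] subsetD[OF N1.subset n] by (intro bexI[of _ "(n, \<one>\<^bsub>G2\<^esub>)"]) auto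
      show "\<exists>h\<in>carrier ?K. fst h = \<one>\<^bsub>G1\<^esub> \<and> snd h = n" if n: "n \<in> N2" for n
        unfolding carK H_eq using ker2[OF n] subsetD[OF N2.subset n] by (intro bexI[of _ "(\<one>\<^bsub>G1\<^esub>, n)"]) auto
      show "- pull \<chi> (x \<otimes>\<^bsub>G1\<^esub> y) = - pull \<chi> x + - pull \<chi> y" if "x \<in> carrier G1" "y \<in> carrier G1" for x y
        using characters_add[OF pull(1) that] by simp
      show "\<chi> (snd h) = - (- pull \<chi> (fst h))" if "h \<in> carrier ?K" for h
        using that pull_val[OF \<chi>c \<chi>(2)] unfolding carK H_eq by auto
      show "\<exists>g\<in>carrier G1. - pull \<chi> g \<noteq> 0" using pull(2) by simp
    qed (use assms characters_add[OF \<chi>c] in auto)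
    then show "fin_connected (character_monoid G2 \<chi>) \<or> fin_connected (character_monoid G1 (\<lambda>g. - pull \<chi> g))"
      by blast
  next
    assume C: ?C
    obtain X1 L1 where wp1: "word_presented G1 X1 L1" using finitely_presentedE[OF assms(1,3)] .
    obtain X2 L2 where wp2: "word_presented G2 X2 L2" using finitely_presentedE[OF assms(2,4)] .
    have "\<exists>Z M. word_presented ((G1 \<times>\<times> G2)\<lparr>carrier := ?H\<rparr>) Z M"
    proof (rule fin_connected_imp_word_presented[OF assms(1,2) Q.comm_group_axioms wp1 wp2 \<pi>1 \<pi>2 _ H H_eq])
      fix \<psi> assume \<psi>: "\<And>x y. x \<in> carrier ?Q \<Longrightarrow> y \<in> carrier ?Q \<Longrightarrow> \<psi> (x \<otimes>\<^bsub>?Q\<^esub> y) = \<psi> x + (\<psi> y :: real)"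
        and nz: "\<exists>x\<in>carrier ?Q. \<psi> x \<noteq> 0"
      \<comment> \<open>With this sign \<open>- pull \<chi>\<close> agrees with
        \<open>\<psi> \<circ> \<pi>1\<close> on \<open>G1\<close>, so the assumed alternative for
        \<chi> is exactly the required one for \<psi>.\<close>
      define \<chi> where "\<chi> = restrict (\<lambda>g. - \<psi> (\<pi>2 g)) (carrier G2)"
      have \<chi>c: "\<chi> \<in> characters G2"
        unfolding \<chi>_def using \<psi> by (intro restrict_characters N2.is_group) simp
      obtain q where q: "q \<in> carrier ?Q" "\<psi> q \<noteq> 0" using nz by blast
      obtain y where "y \<in> carrier G2" "\<pi>2 y = q" using surj2[OF q(1)] by blast
      then have \<chi>nz: "\<chi> \<in> nonzero_characters G2"
        unfolding nonzero_characters_iff using \<chi>c q by (auto simp: \<chi>_def)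
      have \<psi>1: "\<psi> \<one>\<^bsub>?Q\<^esub> = 0" using \<psi>[OF Q.one_closed Q.one_closed] Q.l_one[OF Q.one_closed] by simp
      have \<chi>N: "\<forall>n\<in>N2. \<chi> n = 0" using ker2 \<psi>1 N2.subset by (auto simp: \<chi>_def)
      have "- pull \<chi> g = \<psi> (\<pi>1 g)" if g: "g \<in> carrier G1" for g
      proof -
        obtain y where y: "y \<in> carrier G2" "\<pi>2 y = \<pi>1 g" using surj2[OF \<pi>1.hom_closed[OF g]] by blast
        have "\<chi> y = - \<psi> (\<pi>1 g)" using y by (simp add: \<chi>_def)
        then show ?thesis using pull_val[OF \<chi>c \<chi>N g y(1)] y(2) by simp
      qed
      then have "character_monoid G1 (\<lambda>g. - pull \<chi> g) = character_monoid G1 (\<lambda>g. \<psi> (\<pi>1 g))"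
        by (intro character_monoid_cong) simp
      moreover have "character_monoid G2 \<chi> = character_monoid G2 (\<lambda>g. - \<psi> (\<pi>2 g))"
        by (intro character_monoid_cong) (simp add: \<chi>_def)
      ultimately show "fin_connected (character_monoid G1 (\<lambda>g. \<psi> (\<pi>1 g))) \<or>
          fin_connected (character_monoid G2 (\<lambda>g. - \<psi> (\<pi>2 g)))"
        using C[rule_format, OF \<chi>nz] \<chi>N by auto
    qed
    then show "finitely_presented ?K"
      unfolding fibre_product_def[symmetric]
      using word_presented_imp_finitely_presented[OF K.is_group] by blast
  qed
qed

end
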